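(* The quantization functor $Q_W:\mathbf{LinClass}\to\mathbf{LinQuant}$ and the classical limit functor $L_W:\mathbf{LinQuant}\to\mathbf{LinClass}$ (both defined in the context) provide a categorical equivalence between $\mathbf{LinClass}$ and $\mathbf{LinQuant}$; that is, there are natural isomorphisms $1_{\mathbf{LinClass}}\Rightarrow L_W\circ Q_W$ and $1_{\mathbf{LinQuant}}\Rightarrow Q_W\circ L_W$.
   Context: **Classical algebras.** A symplectic topological vector space $(V,\sigma)$ is a topological vector space $V$ with a symplectic form $\sigma$, i.e. a non-degenerate, bilinear, antisymmetric map $\sigma:V\times V\to\mathbb{R}$. $V'$ is the space of continuous linear functionals on $V$. For $f\in V$ let $W_0(f):V'\to\mathbb{C}$, $W_0(f)(F)=e^{iF(f)}$. $\Delta(V,0)$ is the *-algebra of linear combinations of the $W_0(f)$ (pointwise operations), with Poisson bracket the linear extension of $\{W_0(f),W_0(g)\}=\sigma(f,g)W_0(f+g)$. $AP(V')$ is the C*-algebra of continuous almost periodic functions on $V'$, in which $\Delta(V,0)$ is norm dense. **Quantum algebras.** For $\hbar>0$, $\Delta(V,\hbar\sigma)$ is the *-algebra generated freely by linearly independent elements $W_\hbar(f)$, $f\in V$, with $W_\hbar(f)W_\hbar(g)=e^{-\frac{i}{2}\hbar\sigma(f,g)}W_\hbar(f+g)$, $W_\hbar(f)^*=W_\hbar(-f)$. The C*-Weyl algebra $\mathcal{W}(V,\hbar\sigma)$ is its completion in the unique maximal C*-norm. The quantization maps $\mathcal{Q}_\hbar:\Delta(V,0)\to\mathcal{W}(V,\hbar\sigma)$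 are the linear extensions of $\mathcal{Q}_\hbar(W_0(f))=W_\hbar(f)$. **Smooth and scaling.** Let $(V,\sigma)$, $(U,\sigma')$ be symplectic topological vector spaces with quantization maps $\mathcal{Q}_\hbar$, $\mathcal{Q}'_\hbar$, $\hbar\in(0,1]$. A *-homomorphism $\alpha_1:\mathcal{W}(V,\sigma)\to\mathcal{W}(U,\sigma')$ is *smooth* if $\alpha_1[\Delta(V,\sigma)]\subseteq\Delta(U,\sigma')$. It is *scaling* if for every $\hbar'\in(0,1]$ the map $\alpha_{\hbar'}=\mathcal{Q}'_{\hbar'}\circ(\mathcal{Q}'_1)^{-1}\circ\alpha_1\circ\mathcal{Q}_1\circ(\mathcal{Q}_{\hbar'})^{-1}$ on $\Delta(V,\hbar'\sigma)$ extends continuously to a *-homomorphism $\alpha_{\hbar'}:\mathcal{W}(V,\hbar'\sigma)\to\mathcal{W}(U,\hbar'\sigma')$. **Category $\mathbf{LinClass}$.** Objects: pairs $(AP(V'),\Delta(V,0))$, with $V$ a topological vector space and the Poisson bracket on $\Delta(V,0)$ given by a symplectic form $\sigma$ on $V$. Arrows: *-homomorphisms $\alpha_0:AP(V')\to AP(U')$ that are smooth, $\alpha_0[\Delta(V,0)]\subseteq\Delta(U,0)$, and Poisson, $\alpha_0(\{A,B\}_V)=\{\alpha_0(A),\alpha_0(B)\}_U$ for all $A,B\in\Delta(V,0)$. **Category $\mathbf{LinQuant}$.** Objects: the strict quantizations $(\mathcal{W}(V,\hbar\sigma),\Delta(V,\hbar\sigma),\mathcal{Q}_\hbar)_{\hbar\in(0,1]}$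 of $\Delta(V,0)$ just described. Arrows: smooth, scaling *-homomorphisms $\alpha_1:\mathcal{W}(V,\sigma)\to\mathcal{W}(U,\sigma')$ between the algebras at $\hbar=1$. **Functor $Q_W$.** On objects, $(AP(V'),\Delta(V,0))\mapsto(\mathcal{W}(V,\hbar\sigma),\Delta(V,\hbar\sigma),\mathcal{Q}_\hbar)_{\hbar\in(0,1]}$. On arrows: each arrow $\alpha_0:AP(V')\to AP(U')$ of $\mathbf{LinClass}$ has the form $\alpha_0(W_0(f))=\chi(f)W_0(Tf)$ with $\chi:V\to\mathbb{C}$ a character on the additive group $V$ and $T:V\to U$ additive, symplectic ($\sigma'(Tf,Tg)=\sigma(f,g)$) and origin-preserving ($T(0)=0$); $Q_W(\alpha_0)=\alpha_1$ is the continuous linear extension of $W_1(f)\mapsto\chi(f)W_1(Tf)$. **Functor $L_W$.** For $(V,\sigma)$ let $\mathcal{W}(V,(0,1]\sigma)$ be the C*-algebra of continuous sections of the continuous bundle of C*-algebras over $(0,1]$ defined by the strict quantization: the C*-algebra of bounded sections $a$ of $(\mathcal{W}(V,\hbar\sigma))_{\hbar\in(0,1]}$, with norm $\sup_\hbar\|\phi_\hbar(a)\|_\hbar$ ($\phi_\hbar$ = evaluation at $\hbar$), generated by the sections $[\hbar\mapsto W_\hbar(f)]$, $f\in V$, and closed under multiplication by uniformly continuous bounded functions of $\hbar\in(0,1]$. Let $\Delta(V,(0,1]\sigma)$ be the subalgebra generated by the sections $[\hbar\mapsto W_\hbar(f)]$, and $K_0(V)$ the closed two-sided ideal $\{a:\lim_{\hbar\to0}\|\phi_\hbar(a)\|_\hbar=0\}$.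 On objects, $L_W$ sends $(\mathcal{W}(V,\hbar\sigma),\Delta(V,\hbar\sigma),\mathcal{Q}_\hbar)_{\hbar\in(0,1]}$ to $(\mathcal{W}(V,(0,1]\sigma)/K_0(V),\ \Delta(V,(0,1]\sigma)/K_0(V))$, where the second entry is the image in the quotient, and where $\mathcal{W}(V,(0,1]\sigma)/K_0(V)\cong AP(V')$ by the *-isomorphism determined by $[\hbar\mapsto W_\hbar(f)]+K_0(V)\mapsto W_0(f)$. On arrows: a smooth scaling $\alpha_1$ determines the family $(\alpha_\hbar)_{\hbar\in(0,1]}$ above, which lifts to the *-homomorphism $\alpha:\mathcal{W}(V,(0,1]\sigma)\to\mathcal{W}(U,(0,1]\sigma')$ with $\phi_\hbar(\alpha(a))=\alpha_\hbar(\phi_\hbar(a))$ for all $\hbar$; $L_W(\alpha_1)=\alpha_0$ is the induced map of the quotients by $K_0(V)$ and $K_0(U)$. *)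

theory Defs
  imports
    "HOL-Analysis.Analysis"
    "HOL-Algebra.QuotRing"
    "HOL-Algebra.Algebraic_Closure_Type"
begin

section \<open>Categories, functors, natural transformations\<close>

record ('o, 'm) category =
  Obj :: "'o set"
  Hom :: "'o \<Rightarrow> 'o \<Rightarrow> 'm set"
  Id :: "'o \<Rightarrow> 'm"
  Comp :: "'o \<Rightarrow> 'o \<Rightarrow> 'o \<Rightarrow> 'm \<Rightarrow> 'm \<Rightarrow> 'm"

text \<open>\<open>Comp C x y z g f\<close> is the composite of \<open>f : x \<rightarrow> y\<close> and \<open>g : y \<rightarrow> z\<close>.\<close>

definition is_category :: "('o, 'm) category \<Rightarrow> bool" where
  "is_category C \<longleftrightarrow>
     (\<forall>x\<in>Obj C. Id C x \<in> Hom C x x) \<and>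
     (\<forall>x\<in>Obj C. \<forall>y\<in>Obj C. \<forall>z\<in>Obj C. \<forall>f\<in>Hom C x y. \<forall>g\<in>Hom C y z.
        Comp C x y z g f \<in> Hom C x z) \<and>
     (\<forall>x\<in>Obj C. \<forall>y\<in>Obj C. \<forall>f\<in>Hom C x y.
        Comp C x x y f (Id C x) = f \<and> Comp C x y y (Id C y) f = f) \<and>
     (\<forall>w\<in>Obj C. \<forall>x\<in>Obj C. \<forall>y\<in>Obj C. \<forall>z\<in>Obj C.
        \<forall>f\<in>Hom C w x. \<forall>g\<in>Hom C x y. \<forall>h\<in>Hom C y z.
        Comp C w y z h (Comp C w x y g f) = Comp C w x z (Comp C x y z h g) f)"

record ('o, 'm, 'p, 'n) cat_functor =
  omap :: "'o \<Rightarrow> 'p"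
  amap :: "'o \<Rightarrow> 'o \<Rightarrow> 'm \<Rightarrow> 'n"

definition is_functor ::
  "('o, 'm) category \<Rightarrow> ('p, 'n) category \<Rightarrow> ('o, 'm, 'p, 'n) cat_functor \<Rightarrow> bool" where
  "is_functor C D F \<longleftrightarrow>
     (\<forall>x\<in>Obj C. omap F x \<in> Obj D) \<and>
     (\<forall>x\<in>Obj C. \<forall>y\<in>Obj C. \<forall>f\<in>Hom C x y.
        amap F x y f \<in> Hom D (omap F x) (omap F y)) \<and>
     (\<forall>x\<in>Obj C. amap F x x (Id C x) = Id D (omap F x)) \<and>
     (\<forall>x\<in>Obj C. \<forall>y\<in>Obj C. \<forall>z\<in>Obj C. \<forall>f\<in>Hom C x y. \<forall>g\<in>Hom C y z.
        amap F x z (Comp C x y z g f) =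
        Comp D (omap F x) (omap F y) (omap F z) (amap F y z g) (amap F x y f))"

definition id_functor :: "('o, 'm, 'o, 'm) cat_functor" where
  "id_functor = \<lparr>omap = \<lambda>x. x, amap = \<lambda>x y f. f\<rparr>"

definition comp_functor ::
  "('p, 'n, 'q, 'k) cat_functor \<Rightarrow> ('o, 'm, 'p, 'n) cat_functor \<Rightarrow> ('o, 'm, 'q, 'k) cat_functor"
  where
  "comp_functor G F =
     \<lparr>omap = \<lambda>x. omap G (omap F x),
      amap = \<lambda>x y f. amap G (omap F x) (omap F y) (amap F x y f)\<rparr>"

definition natural_transformation ::
  "('o, 'm) category \<Rightarrow> ('p, 'n) category \<Rightarrow> ('o, 'm, 'p, 'n) cat_functor \<Rightarrow>
   ('o, 'm, 'p, 'n) cat_functor \<Rightarrow> ('o \<Rightarrow> 'n) \<Rightarrow> bool" where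
  "natural_transformation C D F G \<eta> \<longleftrightarrow>
     (\<forall>x\<in>Obj C. \<eta> x \<in> Hom D (omap F x) (omap G x)) \<and>
     (\<forall>x\<in>Obj C. \<forall>y\<in>Obj C. \<forall>f\<in>Hom C x y.
        Comp D (omap F x) (omap F y) (omap G y) (\<eta> y) (amap F x y f) =
        Comp D (omap F x) (omap G x) (omap G y) (amap G x y f) (\<eta> x))"

definition is_iso_arrow :: "('o, 'm) category \<Rightarrow> 'o \<Rightarrow> 'o \<Rightarrow> 'm \<Rightarrow> bool" where
  "is_iso_arrow C x y f \<longleftrightarrow>
     f \<in> Hom C x y \<and>
     (\<exists>g\<in>Hom C y x. Comp C x y x g f = Id C x \<and> Comp C y x y f g = Id C y)"

definition natural_isomorphism ::
  "('o, 'm) category \<Rightarrow> ('p, 'n) category \<Rightarrow> ('o, 'm, 'p, 'n) cat_functor \<Rightarrow>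
   ('o, 'm, 'p, 'n) cat_functor \<Rightarrow> ('o \<Rightarrow> 'n) \<Rightarrow> bool" where
  "natural_isomorphism C D F G \<eta> \<longleftrightarrow>
     natural_transformation C D F G \<eta> \<and>
     (\<forall>x\<in>Obj C. is_iso_arrow D (omap F x) (omap G x) (\<eta> x))"


section \<open>Complex *-algebras\<close>

record 'a star_algebra = "(complex, 'a) module" +
  star :: "'a \<Rightarrow> 'a"

record 'a cstar_algebra = "'a star_algebra" +
  cnorm :: "'a \<Rightarrow> real"

text \<open>Maps between algebras are extensional, so that arrows are determined by their values on
  the carrier. Homomorphisms are unital, since \<^const>\<open>ring_hom\<close> preserves the unit.\<close>

definition star_hom ::
  "('a, 'x) star_algebra_scheme \<Rightarrow> ('b, 'y) star_algebra_scheme \<Rightarrow> ('a \<Rightarrow> 'b) set" where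
  "star_hom A B = {h \<in> ring_hom A B \<inter> extensional (carrier A).
     (\<forall>c. \<forall>a\<in>carrier A. h (c \<odot>\<^bsub>A\<^esub> a) = c \<odot>\<^bsub>B\<^esub> h a) \<and>
     (\<forall>a\<in>carrier A. h (star A a) = star B (h a))}"

definition star_iso ::
  "('a, 'x) star_algebra_scheme \<Rightarrow> ('b, 'y) star_algebra_scheme \<Rightarrow> ('a \<Rightarrow> 'b) set" where
  "star_iso A B = {h \<in> star_hom A B. bij_betw h (carrier A) (carrier B)}"

definition cont_linear ::
  "('a, 'x) cstar_algebra_scheme \<Rightarrow> ('b, 'y) cstar_algebra_scheme \<Rightarrow> ('a \<Rightarrow> 'b) set" where
  "cont_linear A B = {h \<in> carrier A \<rightarrow>\<^sub>E carrier B.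
     (\<forall>a\<in>carrier A. \<forall>b\<in>carrier A. h (a \<oplus>\<^bsub>A\<^esub> b) = h a \<oplus>\<^bsub>B\<^esub> h b) \<and>
     (\<forall>c. \<forall>a\<in>carrier A. h (c \<odot>\<^bsub>A\<^esub> a) = c \<odot>\<^bsub>B\<^esub> h a) \<and>
     (\<exists>K. \<forall>a\<in>carrier A. cnorm B (h a) \<le> K * cnorm A a)}"

definition star_subalgebra :: "('a, 'x) star_algebra_scheme \<Rightarrow> 'a set \<Rightarrow> bool" where
  "star_subalgebra A S \<longleftrightarrow>
     S \<subseteq> carrier A \<and> \<zero>\<^bsub>A\<^esub> \<in> S \<and>
     (\<forall>a\<in>S. \<forall>b\<in>S. a \<oplus>\<^bsub>A\<^esub> b \<in> S \<and> a \<otimes>\<^bsub>A\<^esub> b \<in> S) \<and>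
     (\<forall>c. \<forall>a\<in>S. c \<odot>\<^bsub>A\<^esub> a \<in> S) \<and>
     (\<forall>a\<in>S. star A a \<in> S)"

definition norm_closed :: "('a, 'x) cstar_algebra_scheme \<Rightarrow> 'a set \<Rightarrow> bool" where
  "norm_closed A S \<longleftrightarrow>
     (\<forall>s a. (\<forall>n::nat. s n \<in> S) \<and> a \<in> carrier A \<and>
        (\<lambda>n. cnorm A (s n \<ominus>\<^bsub>A\<^esub> a)) \<longlonglongrightarrow> 0 \<longrightarrow> a \<in> S)"

definition cstar_norm :: "('a, 'x) star_algebra_scheme \<Rightarrow> ('a \<Rightarrow> real) \<Rightarrow> bool" where
  "cstar_norm A p \<longleftrightarrow>
     (\<forall>a\<in>carrier A. 0 \<le> p a \<and> (p a = 0 \<longleftrightarrow> a = \<zero>\<^bsub>A\<^esub>)) \<and>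
     (\<forall>c. \<forall>a\<in>carrier A. p (c \<odot>\<^bsub>A\<^esub> a) = cmod c * p a) \<and>
     (\<forall>a\<in>carrier A. \<forall>b\<in>carrier A. p (a \<oplus>\<^bsub>A\<^esub> b) \<le> p a + p b) \<and>
     (\<forall>a\<in>carrier A. \<forall>b\<in>carrier A. p (a \<otimes>\<^bsub>A\<^esub> b) \<le> p a * p b) \<and>
     (\<forall>a\<in>carrier A. p (star A a \<otimes>\<^bsub>A\<^esub> a) = (p a)\<^sup>2)"

text \<open>The pointwise supremum of all C*-norms. Whenever it is finite and there is a C*-norm at all,
  this is itself a C*-norm, hence the unique maximal one.\<close>

definition max_cstar_norm :: "('a, 'x) star_algebra_scheme \<Rightarrow> 'a \<Rightarrow> real" where
  "max_cstar_norm A a = (SUP p\<in>{p. cstar_norm A p}. p a)"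


subsection \<open>Completion by Cauchy sequences\<close>

definition cauchy_seqs :: "('a, 'x) star_algebra_scheme \<Rightarrow> ('a \<Rightarrow> real) \<Rightarrow> (nat \<Rightarrow> 'a) set" where
  "cauchy_seqs A p = {s. (\<forall>n. s n \<in> carrier A) \<and>
     (\<forall>e>0. \<exists>N. \<forall>m\<ge>N. \<forall>n\<ge>N. p (s m \<ominus>\<^bsub>A\<^esub> s n) < e)}"

definition cauchy_class ::
  "('a, 'x) star_algebra_scheme \<Rightarrow> ('a \<Rightarrow> real) \<Rightarrow> (nat \<Rightarrow> 'a) \<Rightarrow> (nat \<Rightarrow> 'a) set" where
  "cauchy_class A p s = {t \<in> cauchy_seqs A p. (\<lambda>n. p (s n \<ominus>\<^bsub>A\<^esub> t n)) \<longlonglongrightarrow> 0}"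

definition cauchy_rep :: "(nat \<Rightarrow> 'a) set \<Rightarrow> nat \<Rightarrow> 'a" where
  "cauchy_rep P = (SOME s. s \<in> P)"

definition completion ::
  "('a, 'x) star_algebra_scheme \<Rightarrow> ('a \<Rightarrow> real) \<Rightarrow> (nat \<Rightarrow> 'a) set cstar_algebra" where
  "completion A p =
     \<lparr>carrier = cauchy_class A p ` cauchy_seqs A p,
      monoid.mult = \<lambda>P Q. cauchy_class A p (\<lambda>n. cauchy_rep P n \<otimes>\<^bsub>A\<^esub> cauchy_rep Q n),
      one = cauchy_class A p (\<lambda>_. \<one>\<^bsub>A\<^esub>),
      zero = cauchy_class A p (\<lambda>_. \<zero>\<^bsub>A\<^esub>),
      add = \<lambda>P Q. cauchy_class A p (\<lambda>n. cauchy_rep P n \<oplus>\<^bsub>A\<^esub> cauchy_rep Q n),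
      smult = \<lambda>c P. cauchy_class A p (\<lambda>n. c \<odot>\<^bsub>A\<^esub> cauchy_rep P n),
      star = \<lambda>P. cauchy_class A p (\<lambda>n. star A (cauchy_rep P n)),
      cnorm = \<lambda>P. lim (\<lambda>n. p (cauchy_rep P n))\<rparr>"

definition completion_embed ::
  "('a, 'x) star_algebra_scheme \<Rightarrow> ('a \<Rightarrow> real) \<Rightarrow> 'a \<Rightarrow> (nat \<Rightarrow> 'a) set" where
  "completion_embed A p a = cauchy_class A p (\<lambda>_. a)"


subsection \<open>Quotient by an ideal\<close>

definition quotient_algebra ::
  "('a, 'x) star_algebra_scheme \<Rightarrow> 'a set \<Rightarrow> 'a set star_algebra" where
  "quotient_algebra A I =
     \<lparr>carrier = carrier (A Quot I),
      monoid.mult = monoid.mult (A Quot I),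
      one = \<one>\<^bsub>A Quot I\<^esub>,
      zero = \<zero>\<^bsub>A Quot I\<^esub>,
      add = add (A Quot I),
      smult = \<lambda>c P. \<Union>a\<in>P. I +>\<^bsub>A\<^esub> (c \<odot>\<^bsub>A\<^esub> a),
      star = \<lambda>P. \<Union>a\<in>P. I +>\<^bsub>A\<^esub> (star A a)\<rparr>"


section \<open>Symplectic topological vector spaces\<close>

text \<open>A real vector space is a \<^const>\<open>Module.module\<close> over the field of reals; the fields
  \<^const>\<open>monoid.mult\<close> and \<^const>\<open>one\<close> that the record type inherits play no role. The underlying
  sets are subsets of an arbitrary type. The form is not required to be continuous.\<close>

record 'v symplectic_tvs = "(real, 'v) module" +
  vtop :: "'v topology"
  sform :: "'v \<Rightarrow> 'v \<Rightarrow> real"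

definition real_vector_space :: "(real, 'v, 'x) module_scheme \<Rightarrow> bool" where
  "real_vector_space V \<longleftrightarrow> Module.module (ring_of_type_algebra :: real ring) V"

definition topological_vector_space :: "'v symplectic_tvs \<Rightarrow> bool" where
  "topological_vector_space V \<longleftrightarrow>
     real_vector_space V \<and> topspace (vtop V) = carrier V \<and>
     continuous_map (prod_topology (vtop V) (vtop V)) (vtop V) (\<lambda>(f, g). f \<oplus>\<^bsub>V\<^esub> g) \<and>
     continuous_map (prod_topology euclideanreal (vtop V)) (vtop V) (\<lambda>(r, f). r \<odot>\<^bsub>V\<^esub> f)"

definition symplectic_form :: "'v symplectic_tvs \<Rightarrow> bool" where
  "symplectic_form V \<longleftrightarrow>
     (\<forall>f\<in>carrier V. \<forall>g\<in>carrier V. \<forall>h\<in>carrier V.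
        sform V (f \<oplus>\<^bsub>V\<^esub> g) h = sform V f h + sform V g h \<and>
        sform V h (f \<oplus>\<^bsub>V\<^esub> g) = sform V h f + sform V h g) \<and>
     (\<forall>r. \<forall>f\<in>carrier V. \<forall>g\<in>carrier V.
        sform V (r \<odot>\<^bsub>V\<^esub> f) g = r * sform V f g \<and>
        sform V f (r \<odot>\<^bsub>V\<^esub> g) = r * sform V f g) \<and>
     (\<forall>f\<in>carrier V. \<forall>g\<in>carrier V. sform V f g = - sform V g f) \<and>
     (\<forall>f\<in>carrier V. (\<forall>g\<in>carrier V. sform V f g = 0) \<longrightarrow> f = \<zero>\<^bsub>V\<^esub>)"

definition is_symplectic_tvs :: "'v symplectic_tvs \<Rightarrow> bool" where
  "is_symplectic_tvs V \<longleftrightarrow> topological_vector_space V \<and> symplectic_form V"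

definition dual :: "'v symplectic_tvs \<Rightarrow> ('v \<Rightarrow> real) set" where
  "dual V = {F \<in> extensional (carrier V).
     (\<forall>f\<in>carrier V. \<forall>g\<in>carrier V. F (f \<oplus>\<^bsub>V\<^esub> g) = F f + F g) \<and>
     (\<forall>r. \<forall>f\<in>carrier V. F (r \<odot>\<^bsub>V\<^esub> f) = r * F f) \<and>
     continuous_map (vtop V) euclideanreal F}"

definition dual_add :: "'v symplectic_tvs \<Rightarrow> ('v \<Rightarrow> real) \<Rightarrow> ('v \<Rightarrow> real) \<Rightarrow> 'v \<Rightarrow> real" where
  "dual_add V F G = (\<lambda>f\<in>carrier V. F f + G f)"

text \<open>The topology of pointwise convergence (weak* topology).\<close>

definition dual_topology :: "'v symplectic_tvs \<Rightarrow> ('v \<Rightarrow> real) topology" where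
  "dual_topology V = subtopology (product_topology (\<lambda>_. euclideanreal) (carrier V)) (dual V)"


section \<open>Classical algebras\<close>

type_synonym 'v dual_fun = "('v \<Rightarrow> real) \<Rightarrow> complex"

definition dual_fun_algebra :: "'v symplectic_tvs \<Rightarrow> 'v dual_fun set \<Rightarrow> 'v dual_fun cstar_algebra"
  where
  "dual_fun_algebra V S =
     \<lparr>carrier = S,
      monoid.mult = \<lambda>a b. \<lambda>F\<in>dual V. a F * b F,
      one = \<lambda>F\<in>dual V. 1,
      zero = \<lambda>F\<in>dual V. 0,
      add = \<lambda>a b. \<lambda>F\<in>dual V. a F + b F,
      smult = \<lambda>c a. \<lambda>F\<in>dual V. c * a F,
      star = \<lambda>a. \<lambda>F\<in>dual V. cnj (a F),
      cnorm = \<lambda>a. SUP F\<in>dual V. cmod (a F)\<rparr>"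

text \<open>Almost periodicity in the sense of Bochner: the set of translates is totally bounded, that is,
  relatively compact, in the supremum norm. This forces boundedness.\<close>

definition almost_periodic :: "'v symplectic_tvs \<Rightarrow> 'v dual_fun \<Rightarrow> bool" where
  "almost_periodic V a \<longleftrightarrow>
     (\<forall>e>0. \<exists>N. finite N \<and> N \<subseteq> dual V \<and>
        (\<forall>F\<in>dual V. \<exists>K\<in>N. \<forall>G\<in>dual V.
           cmod (a (dual_add V G F) - a (dual_add V G K)) \<le> e))"

definition AP :: "'v symplectic_tvs \<Rightarrow> 'v dual_fun cstar_algebra" where
  "AP V = dual_fun_algebra V
     {a \<in> extensional (dual V). continuous_map (dual_topology V) euclidean a \<and> almost_periodic V a}"

definition W0 :: "'v symplectic_tvs \<Rightarrow> 'v \<Rightarrow> 'v dual_fun" where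
  "W0 V f = (\<lambda>F\<in>dual V. exp (\<i> * complex_of_real (F f)))"

definition fin_coeffs :: "'v symplectic_tvs \<Rightarrow> ('v \<Rightarrow> complex) set" where
  "fin_coeffs V = {c. finite {f. c f \<noteq> 0} \<and> {f. c f \<noteq> 0} \<subseteq> carrier V}"

definition W0_combination :: "'v symplectic_tvs \<Rightarrow> ('v \<Rightarrow> complex) \<Rightarrow> 'v dual_fun" where
  "W0_combination V c = (\<lambda>F\<in>dual V. \<Sum>f\<in>{f. c f \<noteq> 0}. c f * W0 V f F)"

definition Delta0 :: "'v symplectic_tvs \<Rightarrow> 'v dual_fun set" where
  "Delta0 V = W0_combination V ` fin_coeffs V"

type_synonym 'v bracket = "'v dual_fun \<Rightarrow> 'v dual_fun \<Rightarrow> 'v dual_fun"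

definition is_poisson_bracket :: "'v symplectic_tvs \<Rightarrow> 'v bracket \<Rightarrow> bool" where
  "is_poisson_bracket V B \<longleftrightarrow>
     B \<in> Delta0 V \<rightarrow>\<^sub>E (Delta0 V \<rightarrow>\<^sub>E Delta0 V) \<and>
     (\<forall>a\<in>Delta0 V. \<forall>b\<in>Delta0 V. \<forall>d\<in>Delta0 V.
        B (a \<oplus>\<^bsub>AP V\<^esub> b) d = B a d \<oplus>\<^bsub>AP V\<^esub> B b d \<and>
        B d (a \<oplus>\<^bsub>AP V\<^esub> b) = B d a \<oplus>\<^bsub>AP V\<^esub> B d b) \<and>
     (\<forall>c. \<forall>a\<in>Delta0 V. \<forall>b\<in>Delta0 V.
        B (c \<odot>\<^bsub>AP V\<^esub> a) b = c \<odot>\<^bsub>AP V\<^esub> B a b \<and>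
        B a (c \<odot>\<^bsub>AP V\<^esub> b) = c \<odot>\<^bsub>AP V\<^esub> B a b) \<and>
     (\<forall>f\<in>carrier V. \<forall>g\<in>carrier V.
        B (W0 V f) (W0 V g) = complex_of_real (sform V f g) \<odot>\<^bsub>AP V\<^esub> W0 V (f \<oplus>\<^bsub>V\<^esub> g))"

definition poisson_bracket :: "'v symplectic_tvs \<Rightarrow> 'v bracket" where
  "poisson_bracket V = (THE B. is_poisson_bracket V B)"

text \<open>The linear extension that defines the bracket (and the one that defines the quantization
  maps) is meaningful only if the \<open>W0 V f\<close> are linearly independent, i.e. if the dual separates
  points. For a symplectic space this is equivalent to the existence of the bracket:
  if \<open>W0 V h = W0 V \<zero>\<close> then \<open>sform V h g = 0\<close> for all \<open>g\<close>.\<close>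

definition has_poisson_bracket :: "'v symplectic_tvs \<Rightarrow> bool" where
  "has_poisson_bracket V \<longleftrightarrow> (\<exists>B. is_poisson_bracket V B)"


section \<open>Weyl algebras and quantization maps\<close>

text \<open>The free vector space on symbols \<open>W\<^sub>h(f)\<close> is the space of finitely supported coefficient
  functions. On these the relations
  \<open>W\<^sub>h(f) W\<^sub>h(g) = exp (-(\<i>/2) h \<sigma>(f,g)) W\<^sub>h(f+g)\<close> and \<open>W\<^sub>h(f)\<^sup>* = W\<^sub>h(-f)\<close> amount to a twisted
  convolution and a reflected conjugation.\<close>

definition weyl_poly :: "'v symplectic_tvs \<Rightarrow> real \<Rightarrow> ('v \<Rightarrow> complex) star_algebra" where
  "weyl_poly V h =
     \<lparr>carrier = fin_coeffs V,
      monoid.mult = \<lambda>a b. \<lambda>k. \<Sum>(f, g)\<in>{(f, g). a f \<noteq> 0 \<and> b g \<noteq> 0 \<and> f \<oplus>\<^bsub>V\<^esub> g = k}.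
        a f * b g * exp (- (\<i> / 2) * complex_of_real (h * sform V f g)),
      one = \<lambda>f. if f = \<zero>\<^bsub>V\<^esub> then 1 else 0,
      zero = \<lambda>_. 0,
      add = \<lambda>a b f. a f + b f,
      smult = \<lambda>c a f. c * a f,
      star = \<lambda>a f. if f \<in> carrier V then cnj (a (\<ominus>\<^bsub>V\<^esub> f)) else 0\<rparr>"

definition weyl_symbol :: "'v \<Rightarrow> 'v \<Rightarrow> complex" where
  "weyl_symbol f = (\<lambda>g. if g = f then 1 else 0)"

type_synonym 'v weyl_elem = "(nat \<Rightarrow> 'v \<Rightarrow> complex) set"

definition weyl_algebra :: "'v symplectic_tvs \<Rightarrow> real \<Rightarrow> 'v weyl_elem cstar_algebra" where
  "weyl_algebra V h = completion (weyl_poly V h) (max_cstar_norm (weyl_poly V h))"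

definition weyl_embed :: "'v symplectic_tvs \<Rightarrow> real \<Rightarrow> ('v \<Rightarrow> complex) \<Rightarrow> 'v weyl_elem" where
  "weyl_embed V h = completion_embed (weyl_poly V h) (max_cstar_norm (weyl_poly V h))"

definition W :: "'v symplectic_tvs \<Rightarrow> real \<Rightarrow> 'v \<Rightarrow> 'v weyl_elem" where
  "W V h f = weyl_embed V h (weyl_symbol f)"

definition Delta :: "'v symplectic_tvs \<Rightarrow> real \<Rightarrow> 'v weyl_elem set" where
  "Delta V h = weyl_embed V h ` fin_coeffs V"

text \<open>The linear extension of \<open>W0 V f \<mapsto> W V h f\<close>: an element of \<open>Delta0 V\<close> has unique
  coefficients under \<^const>\<open>has_poisson_bracket\<close>.\<close>

definition quantization_map :: "'v symplectic_tvs \<Rightarrow> real \<Rightarrow> 'v dual_fun \<Rightarrow> 'v weyl_elem" where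
  "quantization_map V h =
     (\<lambda>a\<in>Delta0 V. weyl_embed V h (inv_into (fin_coeffs V) (W0_combination V) a))"


section \<open>The category LinClass\<close>

record 'v classical_obj =
  cspace :: "'v symplectic_tvs"
  calg :: "'v dual_fun cstar_algebra"
  csmooth :: "'v dual_fun set"
  cbracket :: "'v bracket"

type_synonym 'v classical_map = "'v dual_fun \<Rightarrow> 'v dual_fun"

definition classical_system :: "'v symplectic_tvs \<Rightarrow> 'v classical_obj" where
  "classical_system V =
     \<lparr>cspace = V, calg = AP V, csmooth = Delta0 V, cbracket = poisson_bracket V\<rparr>"

definition LinClass :: "('v classical_obj, 'v classical_map) category" where
  "LinClass =
     \<lparr>Obj = {classical_system V | V. is_symplectic_tvs V \<and> has_poisson_bracket V},
      Hom = \<lambda>x y. {\<alpha> \<in> star_hom (calg x) (calg y).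
        \<alpha> ` csmooth x \<subseteq> csmooth y \<and>
        (\<forall>a\<in>csmooth x. \<forall>b\<in>csmooth x. \<alpha> (cbracket x a b) = cbracket y (\<alpha> a) (\<alpha> b))},
      Id = \<lambda>x. \<lambda>a\<in>carrier (calg x). a,
      Comp = \<lambda>x y z \<beta> \<alpha>. compose (carrier (calg x)) \<beta> \<alpha>\<rparr>"


section \<open>The category LinQuant\<close>

record 'v quantum_obj =
  qspace :: "'v symplectic_tvs"
  qalg :: "real \<Rightarrow> 'v weyl_elem cstar_algebra"
  qsmooth :: "real \<Rightarrow> 'v weyl_elem set"
  qmap :: "real \<Rightarrow> 'v dual_fun \<Rightarrow> 'v weyl_elem"

type_synonym 'v quantum_map = "'v weyl_elem \<Rightarrow> 'v weyl_elem"

definition quantum_system :: "'v symplectic_tvs \<Rightarrow> 'v quantum_obj" where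
  "quantum_system V =
     \<lparr>qspace = V,
      qalg = \<lambda>h\<in>{0<..1}. weyl_algebra V h,
      qsmooth = \<lambda>h\<in>{0<..1}. Delta V h,
      qmap = \<lambda>h\<in>{0<..1}. quantization_map V h\<rparr>"

definition smooth_map :: "'v quantum_obj \<Rightarrow> 'v quantum_obj \<Rightarrow> 'v quantum_map \<Rightarrow> bool" where
  "smooth_map x y \<alpha> \<longleftrightarrow> \<alpha> ` qsmooth x 1 \<subseteq> qsmooth y 1"

definition rescaled_map ::
  "'v quantum_obj \<Rightarrow> 'v quantum_obj \<Rightarrow> 'v quantum_map \<Rightarrow> real \<Rightarrow> 'v quantum_map" where
  "rescaled_map x y \<alpha> h =
     qmap y h \<circ> inv_into (Delta0 (qspace y)) (qmap y 1) \<circ> \<alpha> \<circ>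
     qmap x 1 \<circ> inv_into (Delta0 (qspace x)) (qmap x h)"

definition rescaled_extension ::
  "'v quantum_obj \<Rightarrow> 'v quantum_obj \<Rightarrow> 'v quantum_map \<Rightarrow> real \<Rightarrow> 'v quantum_map \<Rightarrow> bool" where
  "rescaled_extension x y \<alpha> h \<beta> \<longleftrightarrow>
     \<beta> \<in> star_hom (qalg x h) (qalg y h) \<inter> cont_linear (qalg x h) (qalg y h) \<and>
     (\<forall>a\<in>qsmooth x h. \<beta> a = rescaled_map x y \<alpha> h a)"

definition scaling_map :: "'v quantum_obj \<Rightarrow> 'v quantum_obj \<Rightarrow> 'v quantum_map \<Rightarrow> bool" where
  "scaling_map x y \<alpha> \<longleftrightarrow> (\<forall>h\<in>{0<..1}. \<exists>\<beta>. rescaled_extension x y \<alpha> h \<beta>)"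

definition LinQuant :: "('v quantum_obj, 'v quantum_map) category" where
  "LinQuant =
     \<lparr>Obj = {quantum_system V | V. is_symplectic_tvs V \<and> has_poisson_bracket V},
      Hom = \<lambda>x y. {\<alpha> \<in> star_hom (qalg x 1) (qalg y 1). smooth_map x y \<alpha> \<and> scaling_map x y \<alpha>},
      Id = \<lambda>x. \<lambda>a\<in>carrier (qalg x 1). a,
      Comp = \<lambda>x y z \<beta> \<alpha>. compose (carrier (qalg x 1)) \<beta> \<alpha>\<rparr>"


section \<open>The quantization functor\<close>

definition additive_character :: "'v symplectic_tvs \<Rightarrow> ('v \<Rightarrow> complex) \<Rightarrow> bool" where
  "additive_character V \<omega> \<longleftrightarrow>
     (\<forall>f\<in>carrier V. cmod (\<omega> f) = 1) \<and>
     (\<forall>f\<in>carrier V. \<forall>g\<in>carrier V. \<omega> (f \<oplus>\<^bsub>V\<^esub> g) = \<omega> f * \<omega> g)"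

definition additive_symplectic ::
  "'v symplectic_tvs \<Rightarrow> 'v symplectic_tvs \<Rightarrow> ('v \<Rightarrow> 'v) \<Rightarrow> bool" where
  "additive_symplectic V U T \<longleftrightarrow>
     T \<in> carrier V \<rightarrow> carrier U \<and>
     (\<forall>f\<in>carrier V. \<forall>g\<in>carrier V. T (f \<oplus>\<^bsub>V\<^esub> g) = T f \<oplus>\<^bsub>U\<^esub> T g) \<and>
     (\<forall>f\<in>carrier V. \<forall>g\<in>carrier V. sform U (T f) (T g) = sform V f g) \<and>
     T \<zero>\<^bsub>V\<^esub> = \<zero>\<^bsub>U\<^esub>"

definition quantized_arrow ::
  "'v symplectic_tvs \<Rightarrow> 'v symplectic_tvs \<Rightarrow> 'v classical_map \<Rightarrow> 'v quantum_map" where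
  "quantized_arrow V U \<alpha> =
     (THE \<beta>. \<beta> \<in> cont_linear (weyl_algebra V 1) (weyl_algebra U 1) \<and>
        (\<exists>\<omega> T. additive_character V \<omega> \<and> additive_symplectic V U T \<and>
           (\<forall>f\<in>carrier V. \<alpha> (W0 V f) = \<omega> f \<odot>\<^bsub>AP U\<^esub> W0 U (T f)) \<and>
           (\<forall>f\<in>carrier V. \<beta> (W V 1 f) = \<omega> f \<odot>\<^bsub>weyl_algebra U 1\<^esub> W U 1 (T f))))"

definition Q_W :: "('v classical_obj, 'v classical_map, 'v quantum_obj, 'v quantum_map) cat_functor"
  where
  "Q_W = \<lparr>omap = \<lambda>x. quantum_system (cspace x),
          amap = \<lambda>x y \<alpha>. quantized_arrow (cspace x) (cspace y) \<alpha>\<rparr>"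


section \<open>The classical limit functor\<close>

type_synonym 'v weyl_section = "real \<Rightarrow> 'v weyl_elem"

definition bounded_sections :: "'v symplectic_tvs \<Rightarrow> 'v weyl_section cstar_algebra" where
  "bounded_sections V =
     \<lparr>carrier = {a \<in> (\<Pi>\<^sub>E h\<in>{0<..1}. carrier (weyl_algebra V h)).
        bdd_above ((\<lambda>h. cnorm (weyl_algebra V h) (a h)) ` {0<..1})},
      monoid.mult = \<lambda>a b. \<lambda>h\<in>{0<..1}. a h \<otimes>\<^bsub>weyl_algebra V h\<^esub> b h,
      one = \<lambda>h\<in>{0<..1}. \<one>\<^bsub>weyl_algebra V h\<^esub>,
      zero = \<lambda>h\<in>{0<..1}. \<zero>\<^bsub>weyl_algebra V h\<^esub>,
      add = \<lambda>a b. \<lambda>h\<in>{0<..1}. a h \<oplus>\<^bsub>weyl_algebra V h\<^esub> b h,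
      smult = \<lambda>c a. \<lambda>h\<in>{0<..1}. c \<odot>\<^bsub>weyl_algebra V h\<^esub> a h,
      star = \<lambda>a. \<lambda>h\<in>{0<..1}. star (weyl_algebra V h) (a h),
      cnorm = \<lambda>a. SUP h\<in>{0<..1}. cnorm (weyl_algebra V h) (a h)\<rparr>"

definition W_section :: "'v symplectic_tvs \<Rightarrow> 'v \<Rightarrow> 'v weyl_section" where
  "W_section V f = (\<lambda>h\<in>{0<..1}. W V h f)"

definition closed_under_uc_functions :: "'v symplectic_tvs \<Rightarrow> 'v weyl_section set \<Rightarrow> bool" where
  "closed_under_uc_functions V S \<longleftrightarrow>
     (\<forall>c :: real \<Rightarrow> complex. uniformly_continuous_on {0<..1} c \<and> bounded (c ` {0<..1}) \<longrightarrow>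
        (\<forall>a\<in>S. (\<lambda>h\<in>{0<..1}. c h \<odot>\<^bsub>weyl_algebra V h\<^esub> a h) \<in> S))"

definition continuous_sections :: "'v symplectic_tvs \<Rightarrow> 'v weyl_section cstar_algebra" where
  "continuous_sections V = (bounded_sections V)
     \<lparr>carrier := \<Inter>{S. star_subalgebra (bounded_sections V) S \<and>
                       norm_closed (bounded_sections V) S \<and>
                       closed_under_uc_functions V S \<and>
                       W_section V ` carrier V \<subseteq> S}\<rparr>"

definition smooth_sections :: "'v symplectic_tvs \<Rightarrow> 'v weyl_section set" where
  "smooth_sections V =
     \<Inter>{S. star_subalgebra (bounded_sections V) S \<and> W_section V ` carrier V \<subseteq> S}"

definition K0 :: "'v symplectic_tvs \<Rightarrow> 'v weyl_section set" where
  "K0 V = {a \<in> carrier (continuous_sections V).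
     ((\<lambda>h. cnorm (weyl_algebra V h) (a h)) \<longlongrightarrow> 0) (at_right 0)}"

definition limit_algebra :: "'v symplectic_tvs \<Rightarrow> 'v weyl_section set star_algebra" where
  "limit_algebra V = quotient_algebra (continuous_sections V) (K0 V)"

definition limit_smooth :: "'v symplectic_tvs \<Rightarrow> 'v weyl_section set set" where
  "limit_smooth V = (\<lambda>a. K0 V +>\<^bsub>continuous_sections V\<^esub> a) ` smooth_sections V"

definition limit_iso :: "'v symplectic_tvs \<Rightarrow> 'v weyl_section set \<Rightarrow> 'v dual_fun" where
  "limit_iso V = (THE \<Phi>. \<Phi> \<in> star_iso (limit_algebra V) (AP V) \<and>
     (\<forall>f\<in>carrier V. \<Phi> (K0 V +>\<^bsub>continuous_sections V\<^esub> W_section V f) = W0 V f))"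

text \<open>The quotient is a pair of LinClass only through its identification by \<^const>\<open>limit_iso\<close>:
  both its elements and its distinguished subalgebra are transported along this map.\<close>

definition classical_limit_obj :: "'v symplectic_tvs \<Rightarrow> 'v classical_obj" where
  "classical_limit_obj V =
     \<lparr>cspace = V,
      calg = dual_fun_algebra V (limit_iso V ` carrier (limit_algebra V)),
      csmooth = limit_iso V ` limit_smooth V,
      cbracket = poisson_bracket V\<rparr>"

definition rescaled_arrow ::
  "'v quantum_obj \<Rightarrow> 'v quantum_obj \<Rightarrow> 'v quantum_map \<Rightarrow> real \<Rightarrow> 'v quantum_map" where
  "rescaled_arrow x y \<alpha> h = (THE \<beta>. rescaled_extension x y \<alpha> h \<beta>)"

definition lifted_arrow ::
  "'v quantum_obj \<Rightarrow> 'v quantum_obj \<Rightarrow> 'v quantum_map \<Rightarrow> 'v weyl_section \<Rightarrow> 'v weyl_section" where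
  "lifted_arrow x y \<alpha> =
     (\<lambda>a\<in>carrier (continuous_sections (qspace x)). \<lambda>h\<in>{0<..1}. rescaled_arrow x y \<alpha> h (a h))"

definition quotient_arrow ::
  "'v quantum_obj \<Rightarrow> 'v quantum_obj \<Rightarrow> 'v quantum_map \<Rightarrow>
   'v weyl_section set \<Rightarrow> 'v weyl_section set" where
  "quotient_arrow x y \<alpha> P =
     (\<Union>a\<in>P. K0 (qspace y) +>\<^bsub>continuous_sections (qspace y)\<^esub> lifted_arrow x y \<alpha> a)"

definition classical_limit_arrow ::
  "'v quantum_obj \<Rightarrow> 'v quantum_obj \<Rightarrow> 'v quantum_map \<Rightarrow> 'v classical_map" where
  "classical_limit_arrow x y \<alpha> =
     (\<lambda>a\<in>limit_iso (qspace x) ` carrier (limit_algebra (qspace x)).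
        limit_iso (qspace y) (quotient_arrow x y \<alpha>
          (inv_into (carrier (limit_algebra (qspace x))) (limit_iso (qspace x)) a)))"

definition L_W :: "('v quantum_obj, 'v quantum_map, 'v classical_obj, 'v classical_map) cat_functor"
  where
  "L_W = \<lparr>omap = \<lambda>x. classical_limit_obj (qspace x),
          amap = \<lambda>x y \<alpha>. classical_limit_arrow x y \<alpha>\<rparr>"

end

theory Submission
  imports Defs "HOL-Library.Real_Mod"
begin

text \<open>Both functors turn out to be mutually inverse, so identities serve as natural isomorphisms. A unitary
with finitely many Weyl coefficients is a multiple of a single symbol, because some functional
\<open>sform V \<cdot> g\<close> is injective on its support. Hence an arrow of either category maps symbols to multiples of
symbols, which gives a character and an additive symplectic map; conversely such data act on the
polynomials over all values of the parameter at once and extend to the completions by maximality of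
the norms.

The classical limit rests on the convergence of the maximal norm to the supremum norm on coefficients
of finite support: all norms in question lie between the square-sum and the sum norm of the
coefficients, which differ on the iterates of \<open>a \<mapsto> a\<^sup>* a\<close> by a polynomial factor only. So every continuous section
has a limit in the almost periodic functions. That each almost periodic function is such a limit needs
the density of trigonometric polynomials, obtained for the weak* topology from Bogolyubov's theorem on
the reals.\<close>

text \<open>The map \<open>T\<close> of an arrow is additive and preserves the form, but it may be
  neither linear nor continuous. It then does not act on dual spaces, and a classical arrow cannot
  be written as composition with a transpose. The classical arrow with parameters \<omega> and
  \<open>T\<close> is therefore derived from the quantum one by passing to the limit on sections;
  homomorphisms being automatically contractive, values on symbols identify it. Both kinds of arrows
  are indexed by the same pairs, and functoriality becomes composition of pairs. Scaling ties the
  form to a quantum arrow: at one parameter value only a phase is visible, mixed with the character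
  and fixing the form modulo a period; the phases at all values fix it. Coefficients in the
  classical algebra are unique because the dual separates points, which is extracted from the
  existence of the bracket. The dual with its weak* topology is in general not locally compact, so
  there is no Haar measure for averaging in the proof that trigonometric polynomials are dense.
  Continuity confines attention to finitely many directions, and on each line a counting argument
  replaces harmonic analysis.\<close>

abbreviation "cr \<equiv> complex_of_real"
abbreviation "ws \<equiv> weyl_symbol"
abbreviation "qs \<equiv> quantum_system"
abbreviation "cs \<equiv> classical_system"

section \<open>Abstract star algebras and C*-norms\<close>

locale star_alg = ring A for A :: "('a,'x) star_algebra_scheme" (structure) +
 assumes smult_closed [simp, intro]: "a : carrier A ==> c \<odot> a : carrier A"
  and smult_l_distr: "a : carrier A ==> (c + d) \<odot> a = c \<odot> a \<oplus> d \<odot> a"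
  and smult_r_distr: "a : carrier A ==> b : carrier A ==> c \<odot> (a \<oplus> b) = c \<odot> a \<oplus> c \<odot> b"
  and smult_smult: "a : carrier A ==> (c * d) \<odot> a = c \<odot> (d \<odot> a)"
  and smult_one [simp]: "a : carrier A ==> 1 \<odot> a = a"
  and smult_mult_l: "a : carrier A ==> b : carrier A ==> (c \<odot> a) \<otimes> b = c \<odot> (a \<otimes> b)"
  and smult_mult_r: "a : carrier A ==> b : carrier A ==> a \<otimes> (c \<odot> b) = c \<odot> (a \<otimes> b)"
  and star_closed [simp, intro]: "a : carrier A ==> star A a : carrier A"
  and star_star [simp]: "a : carrier A ==> star A (star A a) = a"
  and star_add: "a : carrier A ==> b : carrier A ==> star A (a \<oplus> b) = star A a \<oplus> star A b"
  and star_mult: "a : carrier A ==> b : carrier A ==> star A (a \<otimes> b) = star A b \<otimes> star A a"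
  and star_smult: "a : carrier A ==> star A (c \<odot> a) = cnj c \<odot> star A a"
begin

lemma smult_0_left [simp]: "a : carrier A ==> 0 \<odot> a = \<zero>"
 using smult_l_distr[of a 0 0] by (simp add: local.add.l_cancel_one')

lemma smult_0_right [simp]: "c \<odot> \<zero> = \<zero>"
 using smult_r_distr[of \<zero> \<zero> c] by (simp add: local.add.l_cancel_one')

lemma a_inv_smult: "a : carrier A ==> \<ominus> a = (-1) \<odot> a"
 using smult_l_distr[of a 1 "-1"] by (simp add: local.minus_equality local.a_comm)

lemma a_minus_smult: "a : carrier A ==> b : carrier A ==> a \<ominus> b = a \<oplus> (-1) \<odot> b"
 by (simp add: a_minus_def a_inv_smult)

lemma smult_minus: "a : carrier A ==> b : carrier A ==> c \<odot> (a \<ominus> b) = c \<odot> a \<ominus> c \<odot> b"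
 by (simp add: a_minus_smult smult_r_distr smult_smult[symmetric] mult.commute)

lemma star_zero [simp]: "star A \<zero> = \<zero>"
 using star_smult[of \<zero> 0] by simp

lemma star_minus: "a : carrier A ==> b : carrier A ==> star A (a \<ominus> b) = star A a \<ominus> star A b"
 by (simp add: a_minus_smult star_add star_smult)

lemma star_one [simp]: "star A \<one> = \<one>"
 by (metis local.l_one local.one_closed local.r_one star_closed star_mult star_star)

end

lemma star_homD:
 assumes "h : star_hom A B"
 shows "!!a. a : carrier A ==> h a : carrier B"
  "!!a b. a : carrier A ==> b : carrier A ==> h (a \<oplus>\<^bsub>A\<^esub> b) = h a \<oplus>\<^bsub>B\<^esub> h b"
  "!!a b. a : carrier A ==> b : carrier A ==> h (a \<otimes>\<^bsub>A\<^esub> b) = h a \<otimes>\<^bsub>B\<^esub> h b"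
  "h \<one>\<^bsub>A\<^esub> = \<one>\<^bsub>B\<^esub>"
  "!!a c. a : carrier A ==> h (c \<odot>\<^bsub>A\<^esub> a) = c \<odot>\<^bsub>B\<^esub> h a"
  "!!a. a : carrier A ==> h (star A a) = star B (h a)"
  "h : extensional (carrier A)"
 using assms unfolding star_hom_def ring_hom_def by auto

lemma star_homI:
 assumes "!!a. a : carrier A ==> h a : carrier B"
  "!!a b. a : carrier A ==> b : carrier A ==> h (a \<oplus>\<^bsub>A\<^esub> b) = h a \<oplus>\<^bsub>B\<^esub> h b"
  "!!a b. a : carrier A ==> b : carrier A ==> h (a \<otimes>\<^bsub>A\<^esub> b) = h a \<otimes>\<^bsub>B\<^esub> h b"
  "h \<one>\<^bsub>A\<^esub> = \<one>\<^bsub>B\<^esub>"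
  "!!a c. a : carrier A ==> h (c \<odot>\<^bsub>A\<^esub> a) = c \<odot>\<^bsub>B\<^esub> h a"
  "!!a. a : carrier A ==> h (star A a) = star B (h a)"
  "h : extensional (carrier A)"
 shows "h : star_hom A B"
 using assms unfolding star_hom_def ring_hom_def by auto

lemma star_hom_compose:
 assumes "star_alg A" "g : star_hom A B" "h : star_hom B C"
 shows "compose (carrier A) h g : star_hom A C"
proof -
 interpret star_alg A by fact
 show ?thesis
  by (rule star_homI) (auto simp: compose_def star_homD[OF assms(2)] star_homD[OF assms(3)])
qed

lemma star_hom_id:
 assumes "star_alg A" shows "(\<lambda>a\<in>carrier A. a) : star_hom A A"
proof -
 interpret star_alg A by fact
 show ?thesis by (rule star_homI) auto
qed

locale cstar_pre = star_alg A for A :: "('a,'x) star_algebra_scheme" (structure) +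
 fixes p :: "'a => real"
 assumes is_cstar_norm: "cstar_norm A p"
begin

lemma p_nonneg [simp]: "a : carrier A ==> 0 <= p a"
 and p_eq_0_iff: "a : carrier A ==> p a = 0 \<longleftrightarrow> a = \<zero>"
 and p_smult: "a : carrier A ==> p (c \<odot> a) = cmod c * p a"
 and p_add: "a : carrier A ==> b : carrier A ==> p (a \<oplus> b) <= p a + p b"
 and p_mult: "a : carrier A ==> b : carrier A ==> p (a \<otimes> b) <= p a * p b"
 and p_cstar: "a : carrier A ==> p (star A a \<otimes> a) = (p a)\<^sup>2"
 using is_cstar_norm unfolding cstar_norm_def by auto

lemma p_zero [simp]: "p \<zero> = 0"
 using p_eq_0_iff by blast

lemma p_neg: "a : carrier A ==> p (\<ominus> a) = p a"
 by (simp add: a_inv_smult p_smult)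

lemma p_commute: "a : carrier A ==> b : carrier A ==> p (a \<ominus> b) = p (b \<ominus> a)"
proof -
 assume [simp]: "a : carrier A" "b : carrier A"
 have "a \<ominus> b = \<ominus> (b \<ominus> a)" using \<open>a : carrier A\<close> \<open>b : carrier A\<close> by algebra
 then show ?thesis by (simp add: p_neg)
qed

lemma p_tri: "a : carrier A ==> b : carrier A ==> c : carrier A ==> p (a \<ominus> c) <= p (a \<ominus> b) + p (b \<ominus> c)"
proof -
 assume [simp]: "a : carrier A" "b : carrier A" "c : carrier A"
 have "a \<ominus> c = (a \<ominus> b) \<oplus> (b \<ominus> c)"
  using \<open>a : carrier A\<close> \<open>b : carrier A\<close> \<open>c : carrier A\<close> by algebra
 then show ?thesis by (simp add: p_add)
qed

lemma p_le_diff: "a : carrier A ==> b : carrier A ==> p a <= p (a \<ominus> b) + p b"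
proof -
 assume [simp]: "a : carrier A" "b : carrier A"
 have "a = (a \<ominus> b) \<oplus> b" using \<open>a : carrier A\<close> \<open>b : carrier A\<close> by algebra
 then show ?thesis using p_add[of "a \<ominus> b" b] by simp
qed

lemma p_abs_diff: "a : carrier A ==> b : carrier A ==> \<bar>p a - p b\<bar> <= p (a \<ominus> b)"
 using p_le_diff[of a b] p_le_diff[of b a] p_commute[of a b] by auto

text \<open>The C*-identity and submultiplicativity give
  \<open>(p a)\<^sup>2 <= p (star A a) * p a\<close>; one factor cancels, and the same argument
  applies to the adjoint.\<close>

lemma p_star [simp]: "a : carrier A ==> p (star A a) = p a"
proof -
 have le: "p a <= p (star A a)" if [simp]: "a : carrier A" for a
 proof (cases "p a = 0")
  case False
  then have "0 < p a" by (simp add: less_le)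
  moreover have "p a * p a <= p (star A a) * p a"
   using p_cstar[of a] p_mult[of "star A a" a] by (simp add: power2_eq_square)
  ultimately show ?thesis by (rule mult_right_le_imp_le[rotated])
 qed simp
 assume "a : carrier A"
 then show ?thesis using le[of a] le[of "star A a"] by simp
qed

lemma p_one_le: "p \<one> <= 1"
proof -
 have "p \<one> = (p \<one>)\<^sup>2" using p_cstar[of \<one>] by simp
 then have "p \<one> = 0 \<or> p \<one> = 1" by (simp add: power2_eq_square)
 then show ?thesis by linarith
qed

lemma diff_eq_zeroD: "a : carrier A ==> b : carrier A ==> p (a \<ominus> b) = 0 ==> a = b"
 by (simp add: p_eq_0_iff local.r_right_minus_eq)

lemma p_mult_diff:
 "a : carrier A ==> b : carrier A ==> a' : carrier A ==> b' : carrier A ==>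
 p (a \<otimes> b \<ominus> a' \<otimes> b') <= p a * p (b \<ominus> b') + p (a \<ominus> a') * p b'"
proof -
 assume [simp]: "a : carrier A" "b : carrier A" "a' : carrier A" "b' : carrier A"
 have "a \<otimes> b \<ominus> a' \<otimes> b' = a \<otimes> (b \<ominus> b') \<oplus> (a \<ominus> a') \<otimes> b'"
  using \<open>a : carrier A\<close> \<open>b : carrier A\<close> \<open>a' : carrier A\<close> \<open>b' : carrier A\<close> by algebra
 then have "p (a \<otimes> b \<ominus> a' \<otimes> b') <= p (a \<otimes> (b \<ominus> b')) + p ((a \<ominus> a') \<otimes> b')" by (simp add: p_add)
 then show ?thesis using p_mult[of a "b \<ominus> b'"] p_mult[of "a \<ominus> a'" b'] by simp
qed

text \<open>Membership in the carrier is part of the notion, so that the rules for sums and products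
  below apply without side conditions.\<close>

definition conv :: "(nat => 'a) => 'a => bool" where
 "conv s a \<longleftrightarrow> (ALL n. s n : carrier A) & a : carrier A & (%n. p (s n \<ominus> a)) \<longlonglongrightarrow> 0"

lemma convD: "conv s a ==> s n : carrier A" "conv s a ==> a : carrier A"
  "conv s a ==> (%n. p (s n \<ominus> a)) \<longlonglongrightarrow> 0"
 by (auto simp: conv_def)

lemma conv_const: "a : carrier A ==> conv (%_. a) a"
 by (simp add: conv_def a_minus_def local.r_neg)

lemma conv_norm: "conv s a ==> (%n. p (s n)) \<longlonglongrightarrow> p a"
proof -
 assume a: "conv s a"
 have "(%n. p (s n) - p a) \<longlonglongrightarrow> 0"
  by (rule Lim_null_comparison[OF _ convD(3)[OF a]]) (use convD(1,2)[OF a] p_abs_diff in simp)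
 then show ?thesis by (simp add: LIM_zero_iff)
qed

lemma conv_unique: "conv s a ==> conv s b ==> a = b"
proof -
 assume 1: "conv s a" and 2: "conv s b"
 note [simp] = convD[OF 1] convD[OF 2]
 have "(%n. p (s n \<ominus> a) + p (s n \<ominus> b)) \<longlonglongrightarrow> 0 + 0"
  using 1 2 by (intro tendsto_add) (auto simp: conv_def)
 moreover have "p (a \<ominus> b) <= p (s n \<ominus> a) + p (s n \<ominus> b)" for n
  using p_tri[of a "s n" b] p_commute[of a "s n"] by simp
 ultimately have "p (a \<ominus> b) <= 0" using tendsto_lowerbound[of _ 0 sequentially "p (a \<ominus> b)"] by fastforce
 then show ?thesis using diff_eq_zeroD[of a b] p_nonneg[of "a \<ominus> b"] convD(2)[OF 1] convD(2)[OF 2]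
  by (metis local.minus_closed order_antisym)
qed

lemma conv_sandwich:
 assumes "!!n. s n : carrier A" "a : carrier A" "g \<longlonglongrightarrow> 0" "!!n. p (s n \<ominus> a) <= g n"
 shows "conv s a"
 unfolding conv_def using assms
 by (auto intro!: tendsto_sandwich[of "%_. 0" "%n. p (s n \<ominus> a)" sequentially g 0])

lemma conv_add: assumes "conv s a" "conv t b" shows "conv (%n. s n \<oplus> t n) (a \<oplus> b)"
proof (rule conv_sandwich)
 note [simp] = convD[OF assms(1)] convD[OF assms(2)]
 show "p (s n \<oplus> t n \<ominus> (a \<oplus> b)) <= p (s n \<ominus> a) + p (t n \<ominus> b)" for n
 proof -
  have "s n \<oplus> t n \<ominus> (a \<oplus> b) = (s n \<ominus> a) \<oplus> (t n \<ominus> b)"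
   using convD(1)[OF assms(1), of n] convD(1)[OF assms(2), of n] convD(2)[OF assms(1)] convD(2)[OF assms(2)]
   by algebra
  then show ?thesis by (simp add: p_add)
 qed
 show "(%n. p (s n \<ominus> a) + p (t n \<ominus> b)) \<longlonglongrightarrow> 0"
  using tendsto_add[OF convD(3)[OF assms(1)] convD(3)[OF assms(2)]] by simp
qed (use assms in \<open>auto simp: conv_def\<close>)

lemma conv_smult: assumes "conv s a" shows "conv (%n. c \<odot> s n) (c \<odot> a)"
proof (rule conv_sandwich)
 show "p (c \<odot> s n \<ominus> c \<odot> a) <= cmod c * p (s n \<ominus> a)" for n
  using convD[OF assms] by (simp add: smult_minus[symmetric] p_smult)
 show "(%n. cmod c * p (s n \<ominus> a)) \<longlonglongrightarrow> 0"
  using tendsto_mult_left[OF convD(3)[OF assms], of "cmod c"] by simp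
qed (use assms in \<open>auto simp: conv_def\<close>)

lemma conv_star: assumes "conv s a" shows "conv (%n. star A (s n)) (star A a)"
 using assms by (simp add: conv_def star_minus[symmetric])

lemma conv_mult: assumes "conv s a" "conv t b" shows "conv (%n. s n \<otimes> t n) (a \<otimes> b)"
proof (rule conv_sandwich)
 note [simp] = convD[OF assms(1)] convD[OF assms(2)]
 show "p (s n \<otimes> t n \<ominus> a \<otimes> b) <= p (s n) * p (t n \<ominus> b) + p (s n \<ominus> a) * p b" for n
  by (simp add: p_mult_diff)
 show "(%n. p (s n) * p (t n \<ominus> b) + p (s n \<ominus> a) * p b) \<longlonglongrightarrow> 0"
  using tendsto_add[OF tendsto_mult[OF conv_norm[OF assms(1)] convD(3)[OF assms(2)]]
    tendsto_mult_right[OF convD(3)[OF assms(1)], of "p b"]] by simp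
qed (use assms in \<open>auto simp: conv_def\<close>)

lemma conv_Suc: "conv s a ==> conv (%n. s (Suc n)) a"
 unfolding conv_def by (auto intro: LIMSEQ_Suc)

lemma dense_conv:
 assumes "!!e. e > 0 ==> EX d:D. p (a \<ominus> d) < e" "D \<subseteq> carrier A" "a : carrier A"
 obtains s where "!!n. s n : D" "conv s a"
proof -
 have "ALL n. EX d:D. p (a \<ominus> d) < inverse (real (Suc n))" using assms(1) by simp
 then obtain s where s: "!!n. s n : D" "!!n. p (a \<ominus> s n) < inverse (real (Suc n))" by metis
 have "conv s a"
  by (rule conv_sandwich[OF _ assms(3) LIMSEQ_inverse_real_of_nat])
   (use s assms in \<open>auto simp: p_commute less_imp_le subset_iff\<close>)
 with s(1) that show ?thesis by blast
qed

end

section \<open>Completeness, square roots and automatic continuity\<close>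

locale cstar = cstar_pre A p for A :: "('a,'x) star_algebra_scheme" (structure) and p +
 assumes complete: "s : cauchy_seqs A p ==> EX a:carrier A. (%n. p (s n \<ominus> a)) \<longlonglongrightarrow> 0"
begin

lemma complete': "s : cauchy_seqs A p ==> EX a. conv s a"
 using complete[of s] by (auto simp: conv_def cauchy_seqs_def)

lemma geometric_cauchy:
 assumes "!!n. s n : carrier A" "!!n. p (s (Suc n) \<ominus> s n) <= C * r ^ n" "0 <= r" "r < 1"
 shows "s : cauchy_seqs A p"
proof -
 note [simp] = assms(1)
 have C: "C >= 0"
  using order_trans[OF p_nonneg[OF local.minus_closed, OF assms(1) assms(1), of "Suc 0" 0] assms(2)[of 0]] by simp
 have tail: "p (s (n + k) \<ominus> s n) <= C * (\<Sum>i<k. r ^ (n + i))" for n k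
 proof (induction k)
  case (Suc k)
  have "p (s (n + Suc k) \<ominus> s n) <= p (s (Suc (n + k)) \<ominus> s (n + k)) + p (s (n + k) \<ominus> s n)"
   using p_tri[of "s (Suc (n+k))" "s (n + k)" "s n"] by simp
  then show ?case using Suc assms(2)[of "n + k"] by (simp add: algebra_simps)
 qed (simp add: a_minus_def local.r_neg)
 have tail2: "p (s (n + k) \<ominus> s n) <= C / (1 - r) * r ^ n" for n k
 proof -
  have "(\<Sum>i<k. r ^ (n + i)) = r ^ n * (\<Sum>i<k. r ^ i)" by (simp add: power_add sum_distrib_left)
  also have "... <= r ^ n * (1 / (1 - r))"
   using assms(3,4) by (intro mult_left_mono) (auto simp: sum_gp_strict intro!: divide_right_mono)
  finally have "C * (\<Sum>i<k. r ^ (n + i)) <= C * (r ^ n * (1 / (1 - r)))" using C by (rule mult_left_mono)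
  with tail[of n k] show ?thesis by (simp add: field_simps)
 qed
 have lim: "(%n. C / (1 - r) * r ^ n) \<longlonglongrightarrow> 0"
  using tendsto_mult_left[OF LIMSEQ_realpow_zero[OF assms(3,4)], of "C / (1 - r)"] by simp
 show ?thesis unfolding cauchy_seqs_def
 proof (intro CollectI conjI allI impI)
  fix e :: real assume "e > 0"
  then obtain N where N: "C / (1 - r) * r ^ N < e / 2"
   using order_tendstoD(2)[OF lim, of "e/2"] by (auto simp: eventually_sequentially)
  have "p (s m \<ominus> s n) < e" if "m >= N" "n >= N" for m n
  proof -
   have "p (s m \<ominus> s N) < e / 2" using order.strict_trans1[OF tail2[of N "m - N"] N] that by simp
   moreover have "p (s n \<ominus> s N) < e / 2" using order.strict_trans1[OF tail2[of N "n - N"] N] that by simp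
   ultimately show ?thesis using p_tri[of "s m" "s N" "s n"] p_commute[of "s n" "s N"] by simp
  qed
  then show "EX N. ALL m>=N. ALL n>=N. p (s m \<ominus> s n) < e" by blast
 qed simp
qed

text \<open>The element \<open>\<one> \<ominus> y\<close> is the square root of \<open>\<one> \<ominus> b\<close>.\<close>
lemma sqrt_exists:
 assumes b: "b : carrier A" "star A b = b" "p b < 1"
 obtains y where "y : carrier A" "star A y = y" "y \<oplus> y = b \<oplus> y \<otimes> y"
  "!!a. a : carrier A ==> a \<otimes> b = b \<otimes> a ==> a \<otimes> y = y \<otimes> a"
proof -
 \<comment> \<open>A fixed point of \<open>t\<close> solves
   \<open>(\<one> - y)^2 = \<one> - b\<close> after expansion. The iterates from
   \<open>\<zero>\<close> are polynomials in \<open>b\<close> with real coefficients, which is why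
   the limit is self-adjoint and commutes with whatever commutes with \<open>b\<close>.\<close>
 define t where "t = (%y. (1/2) \<odot> (b \<oplus> y \<otimes> y))"
 define s where "s = (%n. (t ^^ n) \<zero>)"
 have s0: "s 0 = \<zero>" and sS: "s (Suc n) = t (s n)" for n by (auto simp: s_def)
 have s [simp]: "s n : carrier A" for n
  by (induction n) (use b in \<open>auto simp: s0 sS t_def\<close>)
 \<comment> \<open>The smaller root of \<open>r^2 - 2 r + p b = 0\<close>, that is, the fixed point
   of the scalar iteration \<open>r \<mapsto> (p b + r^2) / 2\<close>. It bounds all iterates and
   serves as the contraction factor.\<close>
 define r where "r = 1 - sqrt (1 - p b)"
 have pb: "0 <= p b" using b by simp
 have r: "0 <= r" "r < 1" using b(3) pb by (auto simp: r_def)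
 have r2: "p b + r\<^sup>2 = 2 * r"
  using b(3) by (simp add: r_def power2_eq_square algebra_simps)
 have bound: "p (s n) <= r" for n
 proof (induction n)
  case (Suc n)
  have "p (s (Suc n)) <= (1/2) * (p b + p (s n) * p (s n))"
   using p_add[of b "s n \<otimes> s n"] p_mult[of "s n" "s n"] b by (simp add: sS t_def p_smult norm_divide)
  also have "... <= (1/2) * (p b + r * r)" using Suc r by (intro mult_left_mono add_left_mono mult_mono) auto
  also have "... = r" using r2 by (simp add: power2_eq_square)
  finally show ?case .
 qed (use r in \<open>simp add: s0\<close>)
 have step: "p (s (Suc n) \<ominus> s n) <= p (s 1 \<ominus> s 0) * r ^ n" for n
 proof (induction n)
  case (Suc n)
  have "s (Suc (Suc n)) \<ominus> s (Suc n) = (1/2) \<odot> (s (Suc n) \<otimes> s (Suc n) \<ominus> s n \<otimes> s n)"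
  proof -
   have "(b \<oplus> s (Suc n) \<otimes> s (Suc n)) \<ominus> (b \<oplus> s n \<otimes> s n) = s (Suc n) \<otimes> s (Suc n) \<ominus> s n \<otimes> s n"
    using b(1) s[of n] s[of "Suc n"] by algebra
   then show ?thesis using b by (simp only: sS[of "Suc n"] sS[of n] t_def)
     (simp add: smult_minus[symmetric] t_def)
  qed
  then have "p (s (Suc (Suc n)) \<ominus> s (Suc n)) = (1/2) * p (s (Suc n) \<otimes> s (Suc n) \<ominus> s n \<otimes> s n)"
   by (simp add: p_smult norm_divide)
  also have "... <= (1/2) * (p (s (Suc n)) * p (s (Suc n) \<ominus> s n) + p (s (Suc n) \<ominus> s n) * p (s n))"
   by (intro mult_left_mono p_mult_diff) auto
  also have "... <= (1/2) * (r * p (s (Suc n) \<ominus> s n) + p (s (Suc n) \<ominus> s n) * r)"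
   by (intro mult_left_mono add_mono mult_right_mono bound) auto
  also have "... = p (s (Suc n) \<ominus> s n) * r" by simp
  also have "... <= (p (s 1 \<ominus> s 0) * r ^ n) * r" using Suc r by (intro mult_right_mono)
  finally show ?case by (simp add: mult.assoc mult.commute mult.left_commute)
 qed simp
 obtain y where y: "conv s y" using complete'[OF geometric_cauchy[OF s step r]] by blast
 have y_in [simp]: "y : carrier A" using y by (auto simp: conv_def)
 have "conv (%n. s (Suc n)) ((1/2) \<odot> (b \<oplus> y \<otimes> y))"
  unfolding sS t_def by (intro conv_smult conv_add conv_mult conv_const y b(1))
 then have y_fix: "y = (1/2) \<odot> (b \<oplus> y \<otimes> y)" using conv_unique conv_Suc[OF y] by blast
 have "y \<oplus> y = b \<oplus> y \<otimes> y"
 proof -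
  let ?z = "b \<oplus> y \<otimes> y"
  have "(1/2) \<odot> ?z \<oplus> (1/2) \<odot> ?z = ?z" using b by (simp add: smult_l_distr[symmetric])
  then show ?thesis using y_fix by metis
 qed
 moreover have "star A y = y"
 proof -
  have "star A (s n) = s n" for n
   by (induction n) (use b in \<open>auto simp: s0 sS t_def star_smult star_add star_mult\<close>)
  then have "conv s (star A y)" using conv_star[OF y] by simp
  then show ?thesis using conv_unique y by metis
 qed
 moreover have "a \<otimes> y = y \<otimes> a" if a: "a : carrier A" "a \<otimes> b = b \<otimes> a" for a
 proof -
  have "a \<otimes> s n = s n \<otimes> a" for n
  proof (induction n)
   case (Suc n)
   have "a \<otimes> (s n \<otimes> s n) = (s n \<otimes> s n) \<otimes> a"
    using a(1) s Suc by (metis local.m_assoc)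
   then show ?case using a b by (simp add: sS t_def smult_mult_r smult_mult_l local.r_distr local.l_distr)
  qed (use a in \<open>simp add: s0\<close>)
  then have "conv (%n. s n \<otimes> a) (a \<otimes> y)" using conv_mult[OF conv_const[OF a(1)] y] by simp
  then show ?thesis using conv_mult[OF y conv_const[OF a(1)]] conv_unique by blast
 qed
 ultimately show thesis using that y_in by blast
qed

end

text \<open>A self-adjoint element of norm below 1 is the mean of two unitaries
  \<open>a \<plusminus> \<i> s\<close> with \<open>s\<close> a square root of
  \<open>\<one> - a\<^sup>2\<close>, and a unital homomorphism sends unitaries to unitaries, whose
  C*-norm is at most 1. Scaling covers all self-adjoint elements and the C*-identity the rest. This
  replaces the usual argument by spectral radii.\<close>

theorem star_hom_contractive:
 assumes "cstar A p" "cstar_pre B q" and h: "h : star_hom A B" and a: "a : carrier A"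
 shows "q (h a) <= p a"
proof -
 interpret A: cstar A p by fact
 interpret B: cstar_pre B q by fact
 note hs = star_homD[OF h]
 have unit: "q (h a) <= 1" if a: "a : carrier A" "star A a = a" "p a < 1" for a
 proof -
  note [simp] = a(1)
  have "p (a \<otimes>\<^bsub>A\<^esub> a) < 1" using A.p_cstar[OF a(1)] a(2,3) by (simp add: power_less_one_iff)
  moreover have "star A (a \<otimes>\<^bsub>A\<^esub> a) = a \<otimes>\<^bsub>A\<^esub> a" using a by (simp add: A.star_mult)
  ultimately obtain y where y [simp]: "y : carrier A" and y1: "star A y = y"
   "y \<oplus>\<^bsub>A\<^esub> y = a \<otimes>\<^bsub>A\<^esub> a \<oplus>\<^bsub>A\<^esub> y \<otimes>\<^bsub>A\<^esub> y"
   and comm: "!!x. x : carrier A ==> x \<otimes>\<^bsub>A\<^esub> (a \<otimes>\<^bsub>A\<^esub> a) = (a \<otimes>\<^bsub>A\<^esub> a) \<otimes>\<^bsub>A\<^esub> x ==> x \<otimes>\<^bsub>A\<^esub> y = y \<otimes>\<^bsub>A\<^esub> x"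
   using A.sqrt_exists[of "a \<otimes>\<^bsub>A\<^esub> a"] by (metis A.m_closed a(1))
  have ay: "a \<otimes>\<^bsub>A\<^esub> y = y \<otimes>\<^bsub>A\<^esub> a" using comm[of a] by (simp add: A.m_assoc)
  \<comment> \<open>By the equation for \<open>y\<close> the square of \<open>s\<close> is
    \<open>\<one> - a\<^sup>2\<close>, and \<open>s\<close> commutes with \<open>a\<close> because
    \<open>y\<close> does.\<close>
  define s where "s = \<one>\<^bsub>A\<^esub> \<ominus>\<^bsub>A\<^esub> y"
  have s [simp]: "s : carrier A" by (simp add: s_def)
  have ss: "star A s = s" by (simp add: s_def A.star_minus y1)
  have as: "a \<otimes>\<^bsub>A\<^esub> s = s \<otimes>\<^bsub>A\<^esub> a"
  proof -
   have "a \<otimes>\<^bsub>A\<^esub> s = a \<ominus>\<^bsub>A\<^esub> a \<otimes>\<^bsub>A\<^esub> y" unfolding s_def using a(1) y A.one_closed by (simp add: A.r_distr a_minus_def A.r_minus)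
   moreover have "s \<otimes>\<^bsub>A\<^esub> a = a \<ominus>\<^bsub>A\<^esub> y \<otimes>\<^bsub>A\<^esub> a" unfolding s_def using a(1) y A.one_closed by (simp add: A.l_distr a_minus_def A.l_minus)
   ultimately show ?thesis using ay by simp
  qed
  have sq: "a \<otimes>\<^bsub>A\<^esub> a \<oplus>\<^bsub>A\<^esub> s \<otimes>\<^bsub>A\<^esub> s = \<one>\<^bsub>A\<^esub>"
  proof -
   have "a \<otimes>\<^bsub>A\<^esub> a \<oplus>\<^bsub>A\<^esub> s \<otimes>\<^bsub>A\<^esub> s = \<one>\<^bsub>A\<^esub> \<oplus>\<^bsub>A\<^esub> (a \<otimes>\<^bsub>A\<^esub> a \<oplus>\<^bsub>A\<^esub> y \<otimes>\<^bsub>A\<^esub> y) \<ominus>\<^bsub>A\<^esub> (y \<oplus>\<^bsub>A\<^esub> y)"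
    unfolding s_def using a(1) y A.one_closed
    by (simp add: A.l_distr A.r_distr a_minus_def A.l_minus A.r_minus A.minus_add A.a_ac)
   also have "... = \<one>\<^bsub>A\<^esub>" unfolding y1(2)[symmetric] using y A.one_closed
    by (metis A.a_assoc A.a_closed A.r_neg A.r_zero A.a_inv_closed a_minus_def)
   finally show ?thesis .
  qed
  have norm1: "q (h u) <= 1" if u: "u : carrier A" "star A u \<otimes>\<^bsub>A\<^esub> u = \<one>\<^bsub>A\<^esub>" for u
  proof -
   have "(q (h u))\<^sup>2 = q (h (star A u \<otimes>\<^bsub>A\<^esub> u))" using u(1) hs by (simp add: B.p_cstar)
   also have "... <= 1" using u hs(4) B.p_one_le by simp
   finally show ?thesis using B.p_nonneg[of "h u"] hs(1)[OF u(1)] by (simp add: power_le_one_iff)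
  qed
  define u where "u = (%c::complex. a \<oplus>\<^bsub>A\<^esub> c \<odot>\<^bsub>A\<^esub> s)"
  have u [simp]: "u c : carrier A" for c by (simp add: u_def)
  have "star A (u c) \<otimes>\<^bsub>A\<^esub> u c = \<one>\<^bsub>A\<^esub>" if c: "cnj c = - c" "c * c = -1" for c
  proof -
   have "star A (u c) = a \<oplus>\<^bsub>A\<^esub> (-c) \<odot>\<^bsub>A\<^esub> s" by (simp add: u_def A.star_add A.star_smult a ss c)
   then have "star A (u c) \<otimes>\<^bsub>A\<^esub> u c = a \<otimes>\<^bsub>A\<^esub> a \<oplus>\<^bsub>A\<^esub> c \<odot>\<^bsub>A\<^esub> (a \<otimes>\<^bsub>A\<^esub> s) \<oplus>\<^bsub>A\<^esub> ((-c) \<odot>\<^bsub>A\<^esub> (a \<otimes>\<^bsub>A\<^esub> s) \<oplus>\<^bsub>A\<^esub> (- (c * c)) \<odot>\<^bsub>A\<^esub> (s \<otimes>\<^bsub>A\<^esub> s))"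
    by (simp add: u_def A.l_distr A.r_distr A.smult_mult_l A.smult_mult_r as A.smult_smult[symmetric] A.smult_r_distr A.a_ac)
   also have "... = a \<otimes>\<^bsub>A\<^esub> a \<oplus>\<^bsub>A\<^esub> (c \<odot>\<^bsub>A\<^esub> (a \<otimes>\<^bsub>A\<^esub> s) \<oplus>\<^bsub>A\<^esub> (-c) \<odot>\<^bsub>A\<^esub> (a \<otimes>\<^bsub>A\<^esub> s)) \<oplus>\<^bsub>A\<^esub> s \<otimes>\<^bsub>A\<^esub> s"
    using c by (simp add: A.a_assoc)
   also have "c \<odot>\<^bsub>A\<^esub> (a \<otimes>\<^bsub>A\<^esub> s) \<oplus>\<^bsub>A\<^esub> (-c) \<odot>\<^bsub>A\<^esub> (a \<otimes>\<^bsub>A\<^esub> s) = \<zero>\<^bsub>A\<^esub>"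
    using A.smult_l_distr[of "a \<otimes>\<^bsub>A\<^esub> s" c "-c"] by simp
   finally show ?thesis using sq by simp
  qed
  then have u1: "q (h (u \<i>)) <= 1" "q (h (u (-\<i>))) <= 1" using norm1 by auto
  have "u \<i> \<oplus>\<^bsub>A\<^esub> u (-\<i>) = a \<oplus>\<^bsub>A\<^esub> a \<oplus>\<^bsub>A\<^esub> (\<i> \<odot>\<^bsub>A\<^esub> s \<oplus>\<^bsub>A\<^esub> (-\<i>) \<odot>\<^bsub>A\<^esub> s)"
   by (simp add: u_def A.a_ac)
  also have "\<i> \<odot>\<^bsub>A\<^esub> s \<oplus>\<^bsub>A\<^esub> (-\<i>) \<odot>\<^bsub>A\<^esub> s = \<zero>\<^bsub>A\<^esub>" using A.smult_l_distr[of s "\<i>" "-\<i>"] by simp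
  finally have "u \<i> \<oplus>\<^bsub>A\<^esub> u (-\<i>) = 2 \<odot>\<^bsub>A\<^esub> a" using A.smult_l_distr[of a 1 1] by simp
  then have "2 * q (h a) = q (h (u \<i>) \<oplus>\<^bsub>B\<^esub> h (u (-\<i>)))"
   using hs by (metis B.p_smult a(1) norm_numeral u)
  also have "... <= 2" using B.p_add[of "h (u \<i>)" "h (u (-\<i>))"] u1 hs(1) by fastforce
  finally show ?thesis by simp
 qed
 have sa: "q (h a) <= p a" if a: "a : carrier A" "star A a = a" for a
 proof (rule field_le_epsilon)
  fix e :: real assume e: "e > 0"
  \<comment> \<open>The slack \<open>e\<close> makes the norm of the rescaled element strictly
    smaller than 1, as \<open>unit\<close> demands, and keeps the denominator positive when
    \<open>a\<close> is zero.\<close>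
  let ?c = "1 / (p a + e)"
  have pos: "0 < p a + e" using e a by (simp add: add_nonneg_pos)
  have cmod: "cmod (cr ?c) = ?c" using pos by (simp only: norm_of_real) simp
  have "p (cr ?c \<odot>\<^bsub>A\<^esub> a) < 1"
   unfolding A.p_smult[OF a(1)] cmod using pos e by (simp add: field_simps)
  moreover have "star A (cr ?c \<odot>\<^bsub>A\<^esub> a) = cr ?c \<odot>\<^bsub>A\<^esub> a" using a by (simp add: A.star_smult)
  ultimately have "q (h (cr ?c \<odot>\<^bsub>A\<^esub> a)) <= 1" using unit a by blast
  then have "cmod (cr ?c) * q (h a) <= 1"
   using hs(1,5) a B.p_smult by metis
  then show "q (h a) <= p a + e" unfolding cmod using pos by (simp add: field_simps)
 qed
 have "(q (h a))\<^sup>2 = q (h (star A a \<otimes>\<^bsub>A\<^esub> a))" using a hs by (simp add: B.p_cstar)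
 also have "... <= p (star A a \<otimes>\<^bsub>A\<^esub> a)" using a by (intro sa) (auto simp: A.star_mult)
 also have "... = (p a)\<^sup>2" using a by (simp add: A.p_cstar)
 finally show ?thesis by (rule power2_le_imp_le) (use a in simp)
qed

text \<open>Contractivity makes both maps continuous, so it is enough to approximate by elements of
  \<open>D\<close>.\<close>

lemma star_hom_eq_on_dense:
 assumes "cstar A p" "cstar_pre B q" and h: "h : star_hom A B" and g: "g : star_hom A B"
  and D: "D \<subseteq> carrier A" "!!a e. a : carrier A ==> e > 0 ==> EX d:D. p (a \<ominus>\<^bsub>A\<^esub> d) < e"
  and eq: "!!d. d : D ==> h d = g d"
 shows "h = g"
proof (rule extensionalityI[of _ "carrier A"])
 interpret A: cstar A p by fact
 interpret B: cstar_pre B q by fact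
 note hs = star_homD[OF h] note gs = star_homD[OF g]
 show "h : extensional (carrier A)" "g : extensional (carrier A)" by (fact hs gs)+
 fix a assume a: "a : carrier A"
 obtain s where s: "!!n. s n : D" "A.conv s a" using A.dense_conv[of D a] D a by metis
 have "B.conv (%n. k (s n)) (k a)" if k: "k : star_hom A B" for k
 proof (rule B.conv_sandwich[OF _ _ A.convD(3)[OF s(2)]])
  note ks = star_homD[OF k]
  show "q (k (s n) \<ominus>\<^bsub>B\<^esub> k a) <= p (s n \<ominus>\<^bsub>A\<^esub> a)" for n
   using star_hom_contractive[OF assms(1,2) k, of "s n \<ominus>\<^bsub>A\<^esub> a"] A.convD(1)[OF s(2), of n] a
   by (simp add: A.a_minus_smult B.a_minus_smult ks)
 qed (use A.convD[OF s(2)] star_homD[OF k] in auto)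
 from this[OF h] this[OF g] have "B.conv (%n. g (s n)) (h a)" "B.conv (%n. g (s n)) (g a)"
  by (simp_all add: eq s(1))
 then show "h a = g a" by (rule B.conv_unique)
qed

section \<open>The completion by Cauchy sequences\<close>

context cstar_pre begin

lemma cauchy_in: "s : cauchy_seqs A p ==> s n : carrier A"
 by (simp add: cauchy_seqs_def)

lemma cauchyD: "s : cauchy_seqs A p ==> e > 0 ==> EX N. ALL m>=N. ALL n>=N. p (s m \<ominus> s n) < e"
 by (simp add: cauchy_seqs_def)

lemma cauchyI:
 "(!!n. s n : carrier A) ==> (!!e. e > 0 ==> EX N. ALL m>=N. ALL n>=N. p (s m \<ominus> s n) < e) ==> s : cauchy_seqs A p"
 by (simp add: cauchy_seqs_def)

declare cauchy_in [simp]

lemma cauchy_const [simp]: "a : carrier A ==> (%_. a) : cauchy_seqs A p"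
 by (rule cauchyI) (auto simp: a_minus_def local.r_neg)

lemma norm_convergent:
 assumes "s : cauchy_seqs A p" shows "(%n. p (s n)) \<longlonglongrightarrow> lim (%n. p (s n))"
proof -
 have "Cauchy (%n. p (s n))"
  unfolding Cauchy_def dist_real_def
 proof (intro allI impI)
  fix e :: real assume "e > 0"
  then obtain N where "ALL m>=N. ALL n>=N. p (s m \<ominus> s n) < e" using cauchyD[OF assms] by blast
  then have "ALL m>=N. ALL n>=N. \<bar>p (s m) - p (s n)\<bar> < e"
   using p_abs_diff[OF cauchy_in[OF assms] cauchy_in[OF assms]] order.strict_trans1 by blast
  then show "EX N. ALL m>=N. ALL n>=N. \<bar>p (s m) - p (s n)\<bar> < e" by blast
 qed
 then show ?thesis by (simp add: Cauchy_convergent_iff convergent_LIMSEQ_iff)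
qed

lemma cauchy_bounded:
 assumes "s : cauchy_seqs A p" obtains K where "K > 0" "!!n. p (s n) <= K"
proof -
 have "Bseq (%n. p (s n))" using norm_convergent[OF assms]
  by (intro convergent_imp_Bseq) (auto simp: convergent_def)
 then obtain K where "K > 0" "ALL n. norm (p (s n)) <= K" by (rule BseqE)
 then show ?thesis using that[of K] by (auto simp: abs_le_iff)
qed

lemma cauchy_add [simp]:
 assumes "s : cauchy_seqs A p" "t : cauchy_seqs A p" shows "(%n. s n \<oplus> t n) : cauchy_seqs A p"
proof (rule cauchyI)
 fix e :: real assume "e > 0"
 then obtain N M where N: "ALL m>=N. ALL n>=N. p (s m \<ominus> s n) < e/2" and M: "ALL m>=M. ALL n>=M. p (t m \<ominus> t n) < e/2"
  using cauchyD[OF assms(1), of "e/2"] cauchyD[OF assms(2), of "e/2"] by auto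
 have "p (s m \<oplus> t m \<ominus> (s n \<oplus> t n)) < e" if "m >= max N M" "n >= max N M" for m n
 proof -
  have "s m \<oplus> t m \<ominus> (s n \<oplus> t n) = (s m \<ominus> s n) \<oplus> (t m \<ominus> t n)"
   using cauchy_in[OF assms(1), of m] cauchy_in[OF assms(1), of n]
    cauchy_in[OF assms(2), of m] cauchy_in[OF assms(2), of n] by algebra
  moreover have "p (s m \<ominus> s n) < e/2" "p (t m \<ominus> t n) < e/2" using N M that by auto
  ultimately show ?thesis using p_add[of "s m \<ominus> s n" "t m \<ominus> t n"] assms by simp
 qed
 then show "EX N. ALL m>=N. ALL n>=N. p (s m \<oplus> t m \<ominus> (s n \<oplus> t n)) < e" by blast
qed (use assms in simp)

lemma cauchy_smult [simp]:
 assumes "s : cauchy_seqs A p" shows "(%n. c \<odot> s n) : cauchy_seqs A p"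
proof (rule cauchyI)
 fix e :: real assume "e > 0"
 then have "e / (cmod c + 1) > 0" by (simp add: add_nonneg_pos)
 then obtain N where N: "ALL m>=N. ALL n>=N. p (s m \<ominus> s n) < e / (cmod c + 1)"
  using cauchyD[OF assms] by blast
 have "p (c \<odot> s m \<ominus> c \<odot> s n) < e" if "m >= N" "n >= N" for m n
 proof -
  have "p (c \<odot> s m \<ominus> c \<odot> s n) = cmod c * p (s m \<ominus> s n)"
   using assms by (simp add: smult_minus[symmetric] p_smult)
  also have "... <= (cmod c + 1) * p (s m \<ominus> s n)" using assms by (intro mult_right_mono) auto
  also have "... < (cmod c + 1) * (e / (cmod c + 1))"
   using N that by (intro mult_strict_left_mono) (auto simp: add_nonneg_pos)
  also have "... = e" by (simp add: add_nonneg_eq_0_iff)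
  finally show ?thesis .
 qed
 then show "EX N. ALL m>=N. ALL n>=N. p (c \<odot> s m \<ominus> c \<odot> s n) < e" by blast
qed (use assms in simp)

lemma cauchy_star [simp]:
 assumes "s : cauchy_seqs A p" shows "(%n. star A (s n)) : cauchy_seqs A p"
proof (rule cauchyI)
 fix e :: real assume "e > 0"
 moreover have "p (star A (s m) \<ominus> star A (s n)) = p (s m \<ominus> s n)" for m n
  using assms by (simp add: star_minus[symmetric])
 ultimately show "EX N. ALL m>=N. ALL n>=N. p (star A (s m) \<ominus> star A (s n)) < e"
  using cauchyD[OF assms] by simp
qed (use assms in simp)

lemma cauchy_mult [simp]:
 assumes "s : cauchy_seqs A p" "t : cauchy_seqs A p" shows "(%n. s n \<otimes> t n) : cauchy_seqs A p"
proof (rule cauchyI)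
 obtain K where K: "K > 0" "!!n. p (s n) <= K" using cauchy_bounded[OF assms(1)] by blast
 obtain L where L: "L > 0" "!!n. p (t n) <= L" using cauchy_bounded[OF assms(2)] by blast
 fix e :: real assume "e > 0"
 then have "e / (2 * K) > 0" "e / (2 * L) > 0" using K L by auto
 then obtain N M where N: "ALL m>=N. ALL n>=N. p (s m \<ominus> s n) < e / (2 * L)" and M: "ALL m>=M. ALL n>=M. p (t m \<ominus> t n) < e / (2 * K)"
  using cauchyD[OF assms(1), of "e / (2 * L)"] cauchyD[OF assms(2), of "e / (2 * K)"] by auto
 have "p (s m \<otimes> t m \<ominus> s n \<otimes> t n) < e" if "m >= max N M" "n >= max N M" for m n
 proof -
  have "p (s m \<otimes> t m \<ominus> s n \<otimes> t n) <= p (s m) * p (t m \<ominus> t n) + p (s m \<ominus> s n) * p (t n)"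
   using assms by (intro p_mult_diff) auto
  also have "... <= K * p (t m \<ominus> t n) + p (s m \<ominus> s n) * L"
   using K L assms by (intro add_mono mult_right_mono mult_left_mono) auto
  also have "... < K * (e / (2 * K)) + (e / (2 * L)) * L"
   using K L N M that by (intro add_strict_mono mult_strict_left_mono mult_strict_right_mono) auto
  also have "... = e" using K L by simp
  finally show ?thesis .
 qed
 then show "EX N. ALL m>=N. ALL n>=N. p (s m \<otimes> t m \<ominus> s n \<otimes> t n) < e" by blast
qed (use assms in simp)

lemma cauchy_minus [simp]:
 "s : cauchy_seqs A p ==> t : cauchy_seqs A p ==> (%n. s n \<ominus> t n) : cauchy_seqs A p"
 by (simp add: a_minus_smult)

abbreviation Cl :: "(nat => 'a) => (nat => 'a) set" where "Cl \<equiv> cauchy_class A p"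
abbreviation Compl :: "(nat => 'a) set cstar_algebra" where "Compl \<equiv> completion A p"

text \<open>Independence of the representative chosen by \<open>cauchy_rep\<close> is derived from
  this criterion for every operation of the completion.\<close>

lemma class_eq_iff:
 assumes "s : cauchy_seqs A p" "t : cauchy_seqs A p"
 shows "Cl s = Cl t \<longleftrightarrow> (%n. p (s n \<ominus> t n)) \<longlonglongrightarrow> 0"
proof
 assume "Cl s = Cl t"
 moreover have "t : Cl t" using assms by (simp add: cauchy_class_def a_minus_def local.r_neg)
 ultimately show "(%n. p (s n \<ominus> t n)) \<longlonglongrightarrow> 0" by (auto simp: cauchy_class_def)
next
 have sub: "Cl t' \<subseteq> Cl s'" if "(%n. p (s' n \<ominus> t' n)) \<longlonglongrightarrow> 0" "s' : cauchy_seqs A p" "t' : cauchy_seqs A p" for s' t'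
 proof
  fix u assume "u : Cl t'"
  then have u: "u : cauchy_seqs A p" "(%n. p (t' n \<ominus> u n)) \<longlonglongrightarrow> 0" by (auto simp: cauchy_class_def)
  have "(%n. p (s' n \<ominus> u n)) \<longlonglongrightarrow> 0"
   by (rule tendsto_sandwich[of "%_. 0" _ _ "%n. p (s' n \<ominus> t' n) + p (t' n \<ominus> u n)"])
    (use that u p_tri tendsto_add[OF that(1) u(2)] in auto)
  then show "u : Cl s'" using u by (simp add: cauchy_class_def)
 qed
 assume "(%n. p (s n \<ominus> t n)) \<longlonglongrightarrow> 0"
 moreover from this have "(%n. p (t n \<ominus> s n)) \<longlonglongrightarrow> 0" using assms by (simp add: p_commute)
 ultimately show "Cl s = Cl t" using sub assms by blast
qed

lemma rep_class:
 assumes "s : cauchy_seqs A p"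
 shows "cauchy_rep (Cl s) : cauchy_seqs A p" "(%n. p (s n \<ominus> cauchy_rep (Cl s) n)) \<longlonglongrightarrow> 0"
proof -
 have "s : Cl s" using assms by (simp add: cauchy_class_def a_minus_def local.r_neg)
 then have "cauchy_rep (Cl s) : Cl s" unfolding cauchy_rep_def by (rule someI[of "%x. x : Cl s" s])
 then show "cauchy_rep (Cl s) : cauchy_seqs A p" "(%n. p (s n \<ominus> cauchy_rep (Cl s) n)) \<longlonglongrightarrow> 0"
  by (auto simp: cauchy_class_def)
qed

lemma Compl_carrier: "carrier Compl = Cl ` cauchy_seqs A p"
 and Compl_one: "\<one>\<^bsub>Compl\<^esub> = Cl (%_. \<one>)"
 and Compl_zero: "\<zero>\<^bsub>Compl\<^esub> = Cl (%_. \<zero>)"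
 by (simp_all add: completion_def)

text \<open>\<open>completion\<close> computes with the representatives picked by
  \<open>cauchy_rep\<close>. This and the analogous rules below allow arbitrary representatives,
  after which the laws of the algebra hold termwise.\<close>

lemma Compl_add:
 assumes "s : cauchy_seqs A p" "t : cauchy_seqs A p"
 shows "Cl s \<oplus>\<^bsub>Compl\<^esub> Cl t = Cl (%n. s n \<oplus> t n)"
proof -
 let ?s = "cauchy_rep (Cl s)" and ?t = "cauchy_rep (Cl t)"
 note rs = rep_class[OF assms(1)] and rt = rep_class[OF assms(2)]
 have "(%n. p (s n \<oplus> t n \<ominus> (?s n \<oplus> ?t n))) \<longlonglongrightarrow> 0"
 proof (rule tendsto_sandwich[of "%_. 0" _ _ "%n. p (s n \<ominus> ?s n) + p (t n \<ominus> ?t n)"])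
  have "p (s n \<oplus> t n \<ominus> (?s n \<oplus> ?t n)) <= p (s n \<ominus> ?s n) + p (t n \<ominus> ?t n)" for n
  proof -
   have "s n \<oplus> t n \<ominus> (?s n \<oplus> ?t n) = (s n \<ominus> ?s n) \<oplus> (t n \<ominus> ?t n)"
    using cauchy_in[OF assms(1), of n] cauchy_in[OF assms(2), of n] cauchy_in[OF rs(1), of n] cauchy_in[OF rt(1), of n]
    by algebra
   then show ?thesis using assms rs rt by (simp add: p_add)
  qed
  then show "\<forall>\<^sub>F n in sequentially. p (s n \<oplus> t n \<ominus> (?s n \<oplus> ?t n)) <= p (s n \<ominus> ?s n) + p (t n \<ominus> ?t n)" by simp
 qed (use assms rs rt tendsto_add[OF rs(2) rt(2)] in auto)
 then have "Cl (%n. s n \<oplus> t n) = Cl (%n. ?s n \<oplus> ?t n)" using assms rs rt by (subst class_eq_iff) auto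
 then show ?thesis by (simp add: completion_def)
qed

lemma Compl_mult:
 assumes "s : cauchy_seqs A p" "t : cauchy_seqs A p"
 shows "Cl s \<otimes>\<^bsub>Compl\<^esub> Cl t = Cl (%n. s n \<otimes> t n)"
proof -
 let ?s = "cauchy_rep (Cl s)" and ?t = "cauchy_rep (Cl t)"
 note rs = rep_class[OF assms(1)] and rt = rep_class[OF assms(2)]
 have "(%n. p (s n \<otimes> t n \<ominus> (?s n \<otimes> ?t n))) \<longlonglongrightarrow> 0"
 proof (rule tendsto_sandwich[of "%_. 0" _ _ "%n. p (s n) * p (t n \<ominus> ?t n) + p (s n \<ominus> ?s n) * p (?t n)"])
  show "(%n. p (s n) * p (t n \<ominus> ?t n) + p (s n \<ominus> ?s n) * p (?t n)) \<longlonglongrightarrow> 0"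
   using tendsto_add[OF tendsto_mult[OF norm_convergent[OF assms(1)] rt(2)] tendsto_mult[OF rs(2) norm_convergent[OF rt(1)]]]
   by simp
 qed (use assms rs rt p_mult_diff in auto)
 then have "Cl (%n. s n \<otimes> t n) = Cl (%n. ?s n \<otimes> ?t n)" using assms rs rt by (subst class_eq_iff) auto
 then show ?thesis by (simp add: completion_def)
qed

lemma Compl_smult:
 assumes "s : cauchy_seqs A p"
 shows "c \<odot>\<^bsub>Compl\<^esub> Cl s = Cl (%n. c \<odot> s n)"
proof -
 let ?s = "cauchy_rep (Cl s)"
 note rs = rep_class[OF assms(1)]
 have "(%n. p (c \<odot> s n \<ominus> c \<odot> ?s n)) \<longlonglongrightarrow> 0"
  using tendsto_mult_left[OF rs(2), of "cmod c"] assms rs by (simp add: smult_minus[symmetric] p_smult)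
 then have "Cl (%n. c \<odot> s n) = Cl (%n. c \<odot> ?s n)" using assms rs by (subst class_eq_iff) auto
 then show ?thesis by (simp add: completion_def)
qed

lemma Compl_star:
 assumes "s : cauchy_seqs A p"
 shows "star Compl (Cl s) = Cl (%n. star A (s n))"
proof -
 let ?s = "cauchy_rep (Cl s)"
 note rs = rep_class[OF assms(1)]
 have "(%n. p (star A (s n) \<ominus> star A (?s n))) \<longlonglongrightarrow> 0"
  using rs assms by (simp add: star_minus[symmetric])
 then have "Cl (%n. star A (s n)) = Cl (%n. star A (?s n))" using assms rs by (subst class_eq_iff) auto
 then show ?thesis by (simp add: completion_def)
qed

lemma Compl_norm:
 assumes "s : cauchy_seqs A p"
 shows "(%n. p (s n)) \<longlonglongrightarrow> cnorm Compl (Cl s)"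
proof -
 let ?s = "cauchy_rep (Cl s)"
 note rs = rep_class[OF assms(1)]
 have "(%n. p (s n) - p (?s n)) \<longlonglongrightarrow> 0"
  by (rule Lim_null_comparison[OF _ rs(2)]) (use assms rs p_abs_diff in simp)
 from tendsto_add[OF this norm_convergent[OF rs(1)]] show ?thesis by (simp add: completion_def)
qed

lemmas Compl_simps = Compl_carrier Compl_one Compl_zero Compl_add Compl_mult Compl_smult Compl_star

lemma Compl_star_alg: "star_alg Compl"
proof -
 have ag: "abelian_group Compl"
 proof (rule abelian_groupI)
  fix x assume "x : carrier Compl"
  then obtain s where s: "s : cauchy_seqs A p" "x = Cl s" by (auto simp: Compl_carrier)
  have "(-1) \<odot> s n \<oplus> s n = \<zero>" for n using s by (simp add: a_inv_smult[symmetric] local.l_neg)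
  then show "EX y:carrier Compl. y \<oplus>\<^bsub>Compl\<^esub> x = \<zero>\<^bsub>Compl\<^esub>"
   by (intro bexI[of _ "Cl (%n. (-1) \<odot> s n)"]) (use s in \<open>simp_all add: Compl_simps\<close>)
 qed (auto simp: Compl_simps local.a_ac)
 have mon: "Group.monoid Compl"
  by (rule monoidI) (auto simp: Compl_simps local.m_assoc)
 have "ring Compl"
  by (rule ringI[OF ag mon]) (auto simp: Compl_simps local.l_distr local.r_distr)
 then show ?thesis
  by (intro star_alg.intro star_alg_axioms.intro)
   (auto simp: Compl_simps smult_l_distr smult_r_distr smult_smult smult_mult_l smult_mult_r star_add star_mult star_smult)
qed

lemma Compl_cstar_norm: "cstar_norm Compl (cnorm Compl)"
 unfolding cstar_norm_def
proof (intro conjI ballI allI)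
 fix a assume "a : carrier Compl"
 then obtain s where s: "s : cauchy_seqs A p" and a: "a = Cl s" by (auto simp: Compl_carrier)
 note sn = Compl_norm[OF s]
 show "0 <= cnorm Compl a" unfolding a by (rule LIMSEQ_le_const[OF sn]) (use s in auto)
 show "cnorm Compl a = 0 \<longleftrightarrow> a = \<zero>\<^bsub>Compl\<^esub>"
 proof -
  have "a = \<zero>\<^bsub>Compl\<^esub> \<longleftrightarrow> (%n. p (s n \<ominus> \<zero>)) \<longlonglongrightarrow> 0"
   unfolding a Compl_zero using s by (subst class_eq_iff) auto
  also have "... \<longleftrightarrow> (%n. p (s n)) \<longlonglongrightarrow> 0" using s by (simp add: a_minus_def)
  also have "... \<longleftrightarrow> cnorm Compl a = 0" using sn LIMSEQ_unique unfolding a by metis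
  finally show ?thesis by simp
 qed
 show "cnorm Compl (c \<odot>\<^bsub>Compl\<^esub> a) = cmod c * cnorm Compl a" for c
 proof -
  have "(%n. p (c \<odot> s n)) \<longlonglongrightarrow> cnorm Compl (c \<odot>\<^bsub>Compl\<^esub> a)"
   using Compl_norm[OF cauchy_smult[OF s]] by (simp add: a s Compl_smult)
  moreover have "(%n. p (c \<odot> s n)) \<longlonglongrightarrow> cmod c * cnorm Compl a"
   using tendsto_mult_left[OF sn] s by (simp add: a p_smult)
  ultimately show ?thesis by (rule LIMSEQ_unique)
 qed
 show "cnorm Compl (star Compl a \<otimes>\<^bsub>Compl\<^esub> a) = (cnorm Compl a)\<^sup>2"
 proof -
  have "(%n. p (star A (s n) \<otimes> s n)) \<longlonglongrightarrow> cnorm Compl (star Compl a \<otimes>\<^bsub>Compl\<^esub> a)"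
   using Compl_norm[OF cauchy_mult[OF cauchy_star[OF s] s]] by (simp add: a s Compl_star Compl_mult)
  moreover have "(%n. p (star A (s n) \<otimes> s n)) \<longlonglongrightarrow> (cnorm Compl a)\<^sup>2"
   using tendsto_power[OF sn, of 2] s by (simp add: a p_cstar)
  ultimately show ?thesis by (rule LIMSEQ_unique)
 qed
 fix b assume "b : carrier Compl"
 then obtain t where t: "t : cauchy_seqs A p" and b: "b = Cl t" by (auto simp: Compl_carrier)
 note tn = Compl_norm[OF t]
 show "cnorm Compl (a \<oplus>\<^bsub>Compl\<^esub> b) <= cnorm Compl a + cnorm Compl b"
  using LIMSEQ_le[OF Compl_norm[OF cauchy_add[OF s t]] tendsto_add[OF sn tn]] s t p_add
  by (auto simp: a b Compl_add)
 show "cnorm Compl (a \<otimes>\<^bsub>Compl\<^esub> b) <= cnorm Compl a * cnorm Compl b"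
  using LIMSEQ_le[OF Compl_norm[OF cauchy_mult[OF s t]] tendsto_mult[OF sn tn]] s t p_mult
  by (auto simp: a b Compl_mult)
qed

lemma Compl_cstar_pre: "cstar_pre Compl (cnorm Compl)"
 by (intro cstar_pre.intro cstar_pre_axioms.intro Compl_star_alg Compl_cstar_norm)

lemma Compl_minus:
 assumes "s : cauchy_seqs A p" "t : cauchy_seqs A p"
 shows "Cl s \<ominus>\<^bsub>Compl\<^esub> Cl t = Cl (%n. s n \<ominus> t n)"
proof -
 interpret K: star_alg Compl by (rule Compl_star_alg)
 show ?thesis using assms by (subst K.a_minus_smult) (auto simp: Compl_simps a_minus_smult)
qed

abbreviation E :: "'a => (nat => 'a) set" where "E \<equiv> completion_embed A p"

lemma E_simps:
 assumes "a : carrier A" "b : carrier A"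
 shows "E a : carrier Compl" "E (a \<oplus> b) = E a \<oplus>\<^bsub>Compl\<^esub> E b" "E (a \<otimes> b) = E a \<otimes>\<^bsub>Compl\<^esub> E b"
  "E (c \<odot> a) = c \<odot>\<^bsub>Compl\<^esub> E a" "E (star A a) = star Compl (E a)" "E \<one> = \<one>\<^bsub>Compl\<^esub>" "E \<zero> = \<zero>\<^bsub>Compl\<^esub>"
  "E (a \<ominus> b) = E a \<ominus>\<^bsub>Compl\<^esub> E b" "cnorm Compl (E a) = p a"
 using assms LIMSEQ_unique[OF Compl_norm[of "%_. a"] tendsto_const]
 by (auto simp: completion_embed_def Compl_simps Compl_minus)

lemma E_inj: "inj_on E (carrier A)"
proof (rule inj_onI)
 fix a b assume ab: "a : carrier A" "b : carrier A" "E a = E b"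
 then have "(%n::nat. p (a \<ominus> b)) \<longlonglongrightarrow> 0" unfolding completion_embed_def by (subst (asm) class_eq_iff) auto
 then show "a = b" using ab diff_eq_zeroD LIMSEQ_unique tendsto_const by metis
qed

lemma E_conv:
 assumes s: "s : cauchy_seqs A p" shows "cstar_pre.conv Compl (cnorm Compl) (%n. E (s n)) (Cl s)"
proof -
 interpret K: cstar_pre Compl "cnorm Compl" by (rule Compl_cstar_pre)
 have "(%n. cnorm Compl (E (s n) \<ominus>\<^bsub>Compl\<^esub> Cl s)) \<longlonglongrightarrow> 0"
 proof (rule LIMSEQ_I)
  fix e :: real assume e: "e > 0"
  then obtain N where N: "!!m n. m >= N ==> n >= N ==> p (s m \<ominus> s n) < e/2" using cauchyD[OF s, of "e/2"] by auto
  have "norm (cnorm Compl (E (s n) \<ominus>\<^bsub>Compl\<^esub> Cl s) - 0) < e" if n: "n >= N" for n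
  proof -
   have eq: "E (s n) \<ominus>\<^bsub>Compl\<^esub> Cl s = Cl (%m. s n \<ominus> s m)"
    unfolding completion_embed_def using s by (simp add: Compl_minus)
   have cs: "(%m. s n \<ominus> s m) : cauchy_seqs A p" using s by simp
   have "cnorm Compl (Cl (%m. s n \<ominus> s m)) <= e/2"
    by (rule LIMSEQ_le_const2[OF Compl_norm[OF cs]]) (use N n less_imp_le in blast)
   moreover have "0 <= cnorm Compl (Cl (%m. s n \<ominus> s m))" using cs K.p_nonneg Compl_carrier by blast
   ultimately show ?thesis using eq e by simp
  qed
  then show "EX N. ALL n>=N. norm (cnorm Compl (E (s n) \<ominus>\<^bsub>Compl\<^esub> Cl s) - 0) < e" by blast
 qed
 then show ?thesis unfolding K.conv_def using s E_simps(1) by (auto simp: Compl_carrier completion_embed_def)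
qed

lemma E_dense:
 assumes "P : carrier Compl" "e > 0"
 shows "EX d:E ` carrier A. cnorm Compl (P \<ominus>\<^bsub>Compl\<^esub> d) < e"
proof -
 interpret K: cstar_pre Compl "cnorm Compl" by (rule Compl_cstar_pre)
 obtain s where s: "s : cauchy_seqs A p" "P = Cl s" using assms by (auto simp: Compl_carrier)
 note c = E_conv[OF s(1)]
 obtain n where "\<bar>cnorm Compl (E (s n) \<ominus>\<^bsub>Compl\<^esub> P)\<bar> < e"
  using LIMSEQ_D[OF K.convD(3)[OF c] assms(2)] unfolding s(2) by (auto simp only: diff_zero real_norm_def)
 then have "cnorm Compl (P \<ominus>\<^bsub>Compl\<^esub> E (s n)) < e"
  using K.p_commute[OF K.convD(1)[OF c, of n] assms(1)] by linarith
 then show ?thesis using cauchy_in[OF s(1)] by blast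
qed

text \<open>Diagonal argument: the \<open>m\<close>-th class is approximated up to
  \<open>1 / (m + 1)\<close> by an embedded element \<open>t m\<close>. The sequence
  \<open>t\<close> is Cauchy in \<open>A\<close>, and its class is the limit.\<close>

lemma Compl_cstar: "cstar Compl (cnorm Compl)"
proof -
 interpret K: cstar_pre Compl "cnorm Compl" by (rule Compl_cstar_pre)
 show ?thesis
 proof (intro cstar.intro cstar_axioms.intro Compl_cstar_pre)
  fix S assume S: "S : cauchy_seqs Compl (cnorm Compl)"
  note [simp] = K.cauchy_in[OF S]
  have "ALL m. EX a:carrier A. cnorm Compl (S m \<ominus>\<^bsub>Compl\<^esub> E a) < inverse (real (Suc m))"
   using E_dense by auto
  then obtain t where t [simp]: "!!m. t m : carrier A"
   and tS: "!!m. cnorm Compl (S m \<ominus>\<^bsub>Compl\<^esub> E (t m)) < inverse (real (Suc m))" by metis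
  note [simp] = E_simps(1)[OF t t]
  have null: "(%m. cnorm Compl (S m \<ominus>\<^bsub>Compl\<^esub> E (t m))) \<longlonglongrightarrow> 0"
   by (rule tendsto_sandwich[OF _ _ tendsto_const LIMSEQ_inverse_real_of_nat]) (use less_imp_le[OF tS] in auto)
  have "t : cauchy_seqs A p"
  proof (rule cauchyI)
   fix e :: real assume e: "e > 0"
   obtain N where N: "!!m n. m >= N ==> n >= N ==> cnorm Compl (S m \<ominus>\<^bsub>Compl\<^esub> S n) < e/3"
    using K.cauchyD[OF S, of "e/3"] e by auto
   obtain M where M: "!!m. m >= M ==> cnorm Compl (S m \<ominus>\<^bsub>Compl\<^esub> E (t m)) < e/3"
    using order_tendstoD(2)[OF null, of "e/3"] e by (auto simp: eventually_sequentially)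
   have "p (t m \<ominus> t n) < e" if "m >= max M N" "n >= max M N" for m n
   proof -
    have "p (t m \<ominus> t n) = cnorm Compl (E (t m) \<ominus>\<^bsub>Compl\<^esub> E (t n))"
     using E_simps(8)[OF t t] E_simps(9)[of "t m \<ominus> t n" "t m"] by simp
    also have "... <= cnorm Compl (E (t m) \<ominus>\<^bsub>Compl\<^esub> S m) + cnorm Compl (S m \<ominus>\<^bsub>Compl\<^esub> E (t n))"
     by (rule K.p_tri) auto
    also have "cnorm Compl (S m \<ominus>\<^bsub>Compl\<^esub> E (t n)) <= cnorm Compl (S m \<ominus>\<^bsub>Compl\<^esub> S n) + cnorm Compl (S n \<ominus>\<^bsub>Compl\<^esub> E (t n))"
     by (rule K.p_tri) auto
    finally show ?thesis using M[of m] M[of n] N[of m n] that K.p_commute[of "E (t m)" "S m"] by simp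
   qed
   then show "EX N. ALL m>=N. ALL n>=N. p (t m \<ominus> t n) < e" by blast
  qed simp
  note c = E_conv[OF this]
  have "K.conv S (Cl t)"
  proof (rule K.conv_sandwich)
   show "(%m. cnorm Compl (S m \<ominus>\<^bsub>Compl\<^esub> E (t m)) + cnorm Compl (E (t m) \<ominus>\<^bsub>Compl\<^esub> Cl t)) \<longlonglongrightarrow> 0"
    using tendsto_add[OF null K.convD(3)[OF c]] by simp
  qed (use K.p_tri K.convD[OF c] in auto)
  then show "EX a:carrier Compl. (%n. cnorm Compl (S n \<ominus>\<^bsub>Compl\<^esub> a)) \<longlonglongrightarrow> 0"
   using K.convD(2,3) by blast
 qed
qed

text \<open>The bound turns Cauchy sequences into Cauchy sequences, and completeness of
  \<open>B\<close> provides values. These are picked along \<open>cauchy_rep\<close> and then shown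
  to be limits along every representative (\<open>kc\<close>), which yields the homomorphism laws by
  uniqueness of limits.\<close>

theorem completion_extend:
 assumes "cstar B q" and h: "h : star_hom A B" and le: "!!a. a : carrier A ==> q (h a) <= p a"
 obtains k where "k : star_hom Compl B" "!!a. a : carrier A ==> k (E a) = h a"
proof -
 interpret B: cstar B q by fact
 interpret K: cstar_pre Compl "cnorm Compl" by (rule Compl_cstar_pre)
 note hs = star_homD[OF h]
 have hm: "h (a \<ominus> b) = h a \<ominus>\<^bsub>B\<^esub> h b" if "a : carrier A" "b : carrier A" for a b
  using that by (simp add: a_minus_smult B.a_minus_smult hs)
 have hc: "(%n. h (s n)) : cauchy_seqs B q" if s: "s : cauchy_seqs A p" for s
 proof (rule B.cauchyI)
  fix e :: real assume "e > 0"
  then obtain N where N: "ALL m>=N. ALL n>=N. p (s m \<ominus> s n) < e" using cauchyD[OF s] by blast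
  have "q (h (s m) \<ominus>\<^bsub>B\<^esub> h (s n)) < e" if "m >= N" "n >= N" for m n
   using N le[of "s m \<ominus> s n"] hm[of "s m" "s n"] s that by fastforce
  then show "EX N. ALL m>=N. ALL n>=N. q (h (s m) \<ominus>\<^bsub>B\<^esub> h (s n)) < e" by blast
 qed (use s hs in simp)
 define k where "k = (\<lambda>P\<in>carrier Compl. SOME b. B.conv (%n. h (cauchy_rep P n)) b)"
 have kc: "B.conv (%n. h (s n)) (k (Cl s))" if s: "s : cauchy_seqs A p" for s
 proof -
  let ?r = "cauchy_rep (Cl s)"
  note r = rep_class[OF s]
  have "EX b. B.conv (%n. h (?r n)) b" by (rule B.complete'[OF hc[OF r(1)]])
  then have c: "B.conv (%n. h (?r n)) (k (Cl s))"
   using s by (simp add: k_def Compl_carrier someI_ex)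
  show ?thesis
  proof (rule B.conv_sandwich)
   show "(%n. p (s n \<ominus> ?r n) + q (h (?r n) \<ominus>\<^bsub>B\<^esub> k (Cl s))) \<longlonglongrightarrow> 0"
    using tendsto_add[OF r(2) B.convD(3)[OF c]] by simp
   show "q (h (s n) \<ominus>\<^bsub>B\<^esub> k (Cl s)) <= p (s n \<ominus> ?r n) + q (h (?r n) \<ominus>\<^bsub>B\<^esub> k (Cl s))" for n
    using B.p_tri[of "h (s n)" "h (?r n)" "k (Cl s)"] le[of "s n \<ominus> ?r n"] hm[of "s n" "?r n"]
     B.convD(2)[OF c] s r(1) hs(1) by simp
  qed (use s hs B.convD[OF c] in auto)
 qed
 have uniq: "k (Cl s) = b" if "s : cauchy_seqs A p" "B.conv (%n. h (s n)) b" for s b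
  using kc[OF that(1)] that(2) by (rule B.conv_unique)
 have "k : star_hom Compl B"
 proof (rule star_homI)
  fix P assume "P : carrier Compl"
  then obtain s where s: "s : cauchy_seqs A p" and P: "P = Cl s" by (auto simp: Compl_carrier)
  show "k P : carrier B" using B.convD(2)[OF kc[OF s]] P by simp
  show "k (c \<odot>\<^bsub>Compl\<^esub> P) = c \<odot>\<^bsub>B\<^esub> k P" for c
   unfolding P Compl_smult[OF s] by (rule uniq) (use s hs B.conv_smult[OF kc[OF s]] in simp_all)
  show "k (star Compl P) = star B (k P)"
   unfolding P Compl_star[OF s] by (rule uniq) (use s hs B.conv_star[OF kc[OF s]] in simp_all)
  fix Q assume "Q : carrier Compl"
  then obtain t where t: "t : cauchy_seqs A p" and Q: "Q = Cl t" by (auto simp: Compl_carrier)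
  show "k (P \<oplus>\<^bsub>Compl\<^esub> Q) = k P \<oplus>\<^bsub>B\<^esub> k Q"
   unfolding P Q Compl_add[OF s t] by (rule uniq) (use s t hs B.conv_add[OF kc[OF s] kc[OF t]] in simp_all)
  show "k (P \<otimes>\<^bsub>Compl\<^esub> Q) = k P \<otimes>\<^bsub>B\<^esub> k Q"
   unfolding P Q Compl_mult[OF s t] by (rule uniq) (use s t hs B.conv_mult[OF kc[OF s] kc[OF t]] in simp_all)
 next
  show "k \<one>\<^bsub>Compl\<^esub> = \<one>\<^bsub>B\<^esub>" unfolding Compl_one by (rule uniq) (simp_all add: hs B.conv_const)
  show "k : extensional (carrier Compl)" by (simp add: k_def)
 qed
 moreover have "k (E a) = h a" if "a : carrier A" for a
  unfolding completion_embed_def by (rule uniq) (use that hs B.conv_const in simp_all)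
 ultimately show thesis using that by blast
qed

end

lemma star_hom_cont_linear:
 assumes "cstar A (cnorm A)" "cstar_pre B (cnorm B)" and h: "h : star_hom A B"
 shows "h : cont_linear A B"
 unfolding cont_linear_def
proof (intro CollectI conjI ballI allI exI[of _ 1])
 show "h : carrier A \<rightarrow>\<^sub>E carrier B"
  using star_homD(1,7)[OF h] by (intro PiE_I) (auto simp: extensional_def)
 show "cnorm B (h a) <= 1 * cnorm A a" if "a : carrier A" for a
  using star_hom_contractive[OF assms that] by simp
qed (rule star_homD[OF h]; assumption)+

text \<open>A companion to the version for homomorphisms: \<open>quantized_arrow\<close> is a
  description over continuous linear maps, for which multiplicativity is not at hand.\<close>

lemma cont_linear_eq_on_dense:
 assumes "cstar_pre A (cnorm A)" "cstar_pre B (cnorm B)" and h: "h : cont_linear A B" and g: "g : cont_linear A B"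
  and D: "D \<subseteq> carrier A" "!!a e. a : carrier A ==> e > 0 ==> EX d:D. cnorm A (a \<ominus>\<^bsub>A\<^esub> d) < e"
  and eq: "!!d. d : D ==> h d = g d"
 shows "h = g"
proof (rule extensionalityI[of _ "carrier A"])
 interpret A: cstar_pre A "cnorm A" by fact
 interpret B: cstar_pre B "cnorm B" by fact
 show "h : extensional (carrier A)" "g : extensional (carrier A)"
  using h g by (auto simp: cont_linear_def PiE_def)
 fix a assume a: "a : carrier A"
 obtain s where s: "!!n. s n : D" "A.conv s a" using A.dense_conv[of D a] D a by metis
 have "B.conv (%n. k (s n)) (k a)" if k: "k : cont_linear A B" for k
 proof -
  have ks: "!!x. x : carrier A ==> k x : carrier B"
   "!!x y. x : carrier A ==> y : carrier A ==> k (x \<oplus>\<^bsub>A\<^esub> y) = k x \<oplus>\<^bsub>B\<^esub> k y"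
   "!!x c. x : carrier A ==> k (c \<odot>\<^bsub>A\<^esub> x) = c \<odot>\<^bsub>B\<^esub> k x"
   using k by (auto simp: cont_linear_def)
  have "EX K. ALL x:carrier A. cnorm B (k x) <= K * cnorm A x" using k by (simp add: cont_linear_def)
  then obtain K where K: "!!x. x : carrier A ==> cnorm B (k x) <= K * cnorm A x" by blast
  show ?thesis
  proof (rule B.conv_sandwich)
   show "(%n. K * cnorm A (s n \<ominus>\<^bsub>A\<^esub> a)) \<longlonglongrightarrow> 0"
    using tendsto_mult_left[OF A.convD(3)[OF s(2)], of K] by simp
   show "cnorm B (k (s n) \<ominus>\<^bsub>B\<^esub> k a) <= K * cnorm A (s n \<ominus>\<^bsub>A\<^esub> a)" for n
    using K[of "s n \<ominus>\<^bsub>A\<^esub> a"] A.convD(1)[OF s(2), of n] a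
    by (simp add: A.a_minus_smult B.a_minus_smult ks)
  qed (use A.convD[OF s(2)] ks in auto)
 qed
 from this[OF h] this[OF g] have "B.conv (%n. g (s n)) (h a)" "B.conv (%n. g (s n)) (g a)"
  by (simp_all add: eq s(1))
 then show "h a = g a" by (rule B.conv_unique)
qed

section \<open>Finitely supported coefficient functions\<close>

definition supp :: "('v => complex) => 'v set" where "supp a = {f. a f ~= 0}"
definition l1 :: "('v => complex) => real" where "l1 a = (\<Sum>f\<in>supp a. cmod (a f))"
definition l2 :: "('v => complex) => real" where "l2 a = L2_set (%f. cmod (a f)) (supp a)"

lemma supp_iff: "f : supp a \<longleftrightarrow> a f ~= 0" by (simp add: supp_def)

lemma fin_coeffs_iff: "a : fin_coeffs V \<longleftrightarrow> finite (supp a) & supp a \<subseteq> carrier V"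
 by (simp add: fin_coeffs_def supp_def)

lemma l1_superset: "finite S ==> supp a \<subseteq> S ==> l1 a = (\<Sum>f\<in>S. cmod (a f))"
 unfolding l1_def by (rule sum.mono_neutral_left) (auto simp: supp_def)

lemma l2_superset: "finite S ==> supp a \<subseteq> S ==> l2 a = L2_set (%f. cmod (a f)) S"
 unfolding l2_def L2_set_def by (rule arg_cong[of _ _ sqrt], rule sum.mono_neutral_left) (auto simp: supp_def)

lemma l1_nonneg: "0 <= l1 a" by (simp add: l1_def sum_nonneg)
lemma l2_nonneg: "0 <= l2 a" by (simp add: l2_def L2_set_nonneg)

lemma l2_eq_0D: "finite (supp a) ==> l2 a = 0 ==> a = (%_. 0)"
 by (auto simp: l2_def L2_set_eq_0_iff supp_def fun_eq_iff)

text \<open>Cauchy-Schwarz against the constant 1. The factor \<open>sqrt (card S)\<close> is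
  harmless wherever the supports grow only polynomially while norms are raised to powers.\<close>

lemma l1_le_l2:
 assumes "finite S" "supp a \<subseteq> S" shows "l1 a <= sqrt (card S) * l2 a"
 using L2_set_mult_ineq[of "%_. 1" "%f. cmod (a f)" S]
 by (simp add: l1_superset[OF assms] l2_superset[OF assms] L2_set_def)

lemma ws_fin [simp]: "f : carrier V ==> ws f : fin_coeffs V"
 by (auto simp: fin_coeffs_def weyl_symbol_def)

text \<open>Peels one point off the support at a time. The condition \<open>r f = 0\<close> keeps
  the two summands disjoint, so that their \<open>l1\<close> norms add up exactly.\<close>

lemma fin_coeffs_induct [consumes 1, case_names zero add]:
 assumes "a : fin_coeffs V" and z: "Q (%_. 0)"
  and step: "!!c f r. f : carrier V ==> c ~= 0 ==> r : fin_coeffs V ==> r f = 0 ==> Q r ==>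
   Q (%g. c * ws f g + r g)"
 shows "Q a"
proof -
 have "finite S ==> S \<subseteq> carrier V ==> supp a = S ==> Q a" for S a
 proof (induction S arbitrary: a rule: finite_induct)
  case empty
  then have "a = (%_. 0)" by (auto simp: supp_def)
  then show ?case using z by simp
 next
  case (insert f S)
  define r where "r = a(f := 0)"
  have r: "supp r = S" using insert by (auto simp: supp_def r_def split: if_splits)
  have "a f ~= 0" using insert.prems by (auto simp: supp_def)
  moreover have "r : fin_coeffs V" "Q r" "r f = 0"
   using insert r by (auto simp: fin_coeffs_iff) (simp add: r_def)
  ultimately have "Q (%g. a f * ws f g + r g)"
   using insert.prems by (intro step) auto
  moreover have "(%g. a f * ws f g + r g) = a" by (auto simp: weyl_symbol_def r_def)
  ultimately show ?case by simp
 qed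
 then show ?thesis using assms(1) by (auto simp: fin_coeffs_iff)
qed

text \<open>The triangle inequality along the support. It serves both for C*-norms, with
  \<open>K = 1\<close>, and for the \<open>l2\<close> norm of a product with fixed right factor
  \<open>x\<close>, with \<open>K = l2 x\<close>.\<close>

lemma le_l1:
 assumes "a : fin_coeffs V" "q (%_. 0) <= 0"
  and "!!x y. x : fin_coeffs V ==> y : fin_coeffs V ==> q (%f. x f + y f) <= q x + q y"
  and "!!c f. f : carrier V ==> q (%g. c * ws f g) <= cmod c * K"
 shows "q a <= l1 a * K"
 using assms(1)
proof (induction rule: fin_coeffs_induct)
 case (add c f r)
 have fin: "(%g. c * ws f g) : fin_coeffs V"
  using add by (auto simp: fin_coeffs_def weyl_symbol_def)
 have "l1 (%g. c * ws f g + r g) = (\<Sum>g\<in>insert f (supp r). cmod (c * ws f g + r g))"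
  using add by (intro l1_superset) (auto simp: fin_coeffs_iff supp_def weyl_symbol_def)
 also have "... = cmod c + (\<Sum>g\<in>supp r. cmod (c * ws f g + r g))"
  using add by (subst sum.insert) (auto simp: fin_coeffs_iff supp_def weyl_symbol_def)
 also have "(\<Sum>g\<in>supp r. cmod (c * ws f g + r g)) = l1 r"
  unfolding l1_def using add by (intro sum.cong) (auto simp: supp_def weyl_symbol_def)
 finally show ?case
  using assms(3)[OF fin, of r] assms(4)[of f c] add by (simp add: algebra_simps)
qed (use assms(2) in \<open>simp add: l1_def supp_def\<close>)

section \<open>The twisted convolution algebra of Weyl polynomials\<close>

locale symp =
 fixes V :: "'v symplectic_tvs" (structure)
 assumes is_symplectic: "is_symplectic_tvs V"
begin

lemma vector_space: "Module.module (ring_of_type_algebra :: real ring) V"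
 using is_symplectic by (auto simp: is_symplectic_tvs_def topological_vector_space_def real_vector_space_def)

end

sublocale symp \<subseteq> V: abelian_group V
 using vector_space by (simp add: Module.module_def)

context symp
begin

abbreviation "FC \<equiv> fin_coeffs V"
abbreviation "WC \<equiv> W0_combination V"
abbreviation "apn \<equiv> cnorm (AP V)"
abbreviation "adj h \<equiv> star (weyl_poly V h)"
abbreviation weyl_times ("_ \<star>[_] _" [70, 0, 71] 70) where "a \<star>[h] b \<equiv> a \<otimes>\<^bsub>weyl_poly V h\<^esub> b"

lemma rsmult:
 shows "f : carrier V ==> r \<odot> f : carrier V"
  "f : carrier V ==> (r + s) \<odot> f = r \<odot> f \<oplus> s \<odot> f"
  "f : carrier V ==> g : carrier V ==> r \<odot> (f \<oplus> g) = r \<odot> f \<oplus> r \<odot> g"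
  "f : carrier V ==> (r * s) \<odot> f = r \<odot> (s \<odot> f)"
  "f : carrier V ==> 1 \<odot> f = f"
 using module.smult_closed[OF vector_space, of r f] module.smult_l_distr[OF vector_space, of r s f]
  module.smult_r_distr[OF vector_space, of r f g] module.smult_assoc1[OF vector_space, of r s f]
  module.smult_one[OF vector_space, of f]
 by (auto simp: ring_of_type_algebra_def)

lemma sform_add:
 "f : carrier V ==> g : carrier V ==> k : carrier V ==> sform V (f \<oplus> g) k = sform V f k + sform V g k"
 "f : carrier V ==> g : carrier V ==> k : carrier V ==> sform V k (f \<oplus> g) = sform V k f + sform V k g"
 and sform_smult:
 "f : carrier V ==> g : carrier V ==> sform V (r \<odot> f) g = r * sform V f g"
 "f : carrier V ==> g : carrier V ==> sform V f (r \<odot> g) = r * sform V f g"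
 and sform_anti: "f : carrier V ==> g : carrier V ==> sform V f g = - sform V g f"
 and sform_nondeg: "f : carrier V ==> (!!g. g : carrier V ==> sform V f g = 0) ==> f = \<zero>"
 using is_symplectic unfolding is_symplectic_tvs_def symplectic_form_def by blast+

lemma sform_self [simp]: "f : carrier V ==> sform V f f = 0"
 using sform_anti[of f f] by simp

lemma sform_zero [simp]: "f : carrier V ==> sform V \<zero> f = 0" "f : carrier V ==> sform V f \<zero> = 0"
 using sform_add[of \<zero> \<zero> f] by auto

lemma sform_neg [simp]:
 assumes "f : carrier V" "g : carrier V"
 shows "sform V (\<ominus> f) g = - sform V f g" "sform V g (\<ominus> f) = - sform V g f"
 using sform_add[of f "\<ominus> f" g] assms by (auto simp: V.r_neg)

definition ph :: "real => 'v => 'v => complex" where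
 "ph h f g = exp (- (\<i> / 2) * cr (h * sform V f g))"

lemma ph_norm [simp]: "cmod (ph h f g) = 1"
 by (simp add: ph_def norm_exp_eq_Re)

lemma ph_nz [simp]: "ph h f g ~= 0" by (simp add: ph_def)

lemma ph_0 [simp]: "ph 0 f g = 1" by (simp add: ph_def)

lemma ph_zero [simp]: "f : carrier V ==> ph h \<zero> f = 1" "f : carrier V ==> ph h f \<zero> = 1"
 "f : carrier V ==> ph h f f = 1" "f : carrier V ==> ph h (\<ominus> f) f = 1"
 by (simp_all add: ph_def)

text \<open>Bilinearity of the form makes the phase a 2-cocycle of the additive group; associativity
  of the twisted convolution rests on this.\<close>

lemma ph_cocycle:
 assumes "f : carrier V" "g : carrier V" "k : carrier V"
 shows "ph h f g * ph h (f \<oplus> g) k = ph h g k * ph h f (g \<oplus> k)"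
 using assms by (simp add: ph_def exp_add[symmetric] sform_add algebra_simps)

lemma ph_cnj: "f : carrier V ==> g : carrier V ==> cnj (ph h f g) = ph h g f"
 by (simp add: ph_def exp_cnj sform_anti[of f g])

lemma ph_neg: "f : carrier V ==> g : carrier V ==> ph h (\<ominus> f) (\<ominus> g) = ph h f g"
 by (simp add: ph_def)

lemma finC: "a : FC ==> finite (supp a)" "a : FC ==> supp a \<subseteq> carrier V"
 by (auto simp: fin_coeffs_iff)

text \<open>Trades the sum over pairs in \<open>weyl_poly\<close> for a double sum over arbitrary
  finite supersets of the supports, so that several products can be expanded over common index
  sets.\<close>

lemma weyl_mult:
 assumes "finite S" "finite T" "supp a \<subseteq> S" "supp b \<subseteq> T"
 shows "(a \<star>[h] b) k = (\<Sum>f\<in>S. \<Sum>g\<in>T. if f \<oplus> g = k then a f * b g * ph h f g else 0)"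
proof -
 have "(\<Sum>f\<in>S. \<Sum>g\<in>T. if f \<oplus> g = k then a f * b g * ph h f g else 0) =
   (\<Sum>x\<in>S \<times> T. case x of (f, g) => if f \<oplus> g = k then a f * b g * ph h f g else 0)"
  by (rule sum.cartesian_product)
 also have "... = (\<Sum>x\<in>{(f, g). a f ~= 0 & b g ~= 0 & f \<oplus> g = k}. case x of (f, g) => if f \<oplus> g = k then a f * b g * ph h f g else 0)"
  by (rule sum.mono_neutral_right) (use assms in \<open>auto simp: supp_def split: if_splits\<close>)
 also have "... = (a \<star>[h] b) k"
  unfolding weyl_poly_def ph_def by (auto intro!: sum.cong)
 finally show ?thesis by simp
qed

text \<open>Pairing a product with a test function \<phi> eliminates the variable \<open>k\<close>.
  Associativity, evaluation at functionals and transport along an additive map are all obtained from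
  it by a choice of \<phi>.\<close>

lemma weyl_pairing:
 assumes "finite S" "finite T" "supp a \<subseteq> S" "supp b \<subseteq> T" "finite U" "!!f g. f : S ==> g : T ==> f \<oplus> g : U"
 shows "(\<Sum>k\<in>U. (a \<star>[h] b) k * \<phi> k) = (\<Sum>f\<in>S. \<Sum>g\<in>T. a f * b g * ph h f g * \<phi> (f \<oplus> g))"
proof -
 have "(\<Sum>k\<in>U. (a \<star>[h] b) k * \<phi> k) =
   (\<Sum>k\<in>U. \<Sum>f\<in>S. \<Sum>g\<in>T. if f \<oplus> g = k then a f * b g * ph h f g * \<phi> k else 0)"
  unfolding weyl_mult[OF assms(1-4)] sum_distrib_right by (intro sum.cong) auto
 also have "... = (\<Sum>f\<in>S. \<Sum>g\<in>T. \<Sum>k\<in>U. if f \<oplus> g = k then a f * b g * ph h f g * \<phi> k else 0)"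
  by (subst sum.swap, rule sum.cong[OF refl], rule sum.swap)
 also have "... = (\<Sum>f\<in>S. \<Sum>g\<in>T. a f * b g * ph h f g * \<phi> (f \<oplus> g))"
  using assms by (intro sum.cong refl) simp
 finally show ?thesis .
qed

lemma supp_mult: "supp (a \<star>[h] b) \<subseteq> (%(f, g). f \<oplus> g) ` (supp a \<times> supp b)"
proof
 fix k assume "k : supp (a \<star>[h] b)"
 have "{(f, g). a f ~= 0 & b g ~= 0 & f \<oplus> g = k} ~= {}"
 proof
  assume e: "{(f, g). a f ~= 0 & b g ~= 0 & f \<oplus> g = k} = {}"
  have "(a \<star>[h] b) k = 0" unfolding weyl_poly_def by (simp add: e)
  then show False using \<open>k : supp _\<close> by (simp add: supp_iff)
 qed
 then show "k : (%(f, g). f \<oplus> g) ` (supp a \<times> supp b)" by (auto simp: supp_def)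
qed

lemma weyl_poly_simps [simp]:
 "carrier (weyl_poly V h) = FC"
 "\<one>\<^bsub>weyl_poly V h\<^esub> = ws \<zero>"
 "\<zero>\<^bsub>weyl_poly V h\<^esub> = (%_. 0)"
 "a \<oplus>\<^bsub>weyl_poly V h\<^esub> b = (%f. a f + b f)"
 "c \<odot>\<^bsub>weyl_poly V h\<^esub> a = (%f. c * a f)"
 by (auto simp: weyl_poly_def weyl_symbol_def)

lemma weyl_star: "adj h a = (%f. if f : carrier V then cnj (a (\<ominus> f)) else 0)"
 by (simp add: weyl_poly_def)

lemma supp_star: "a : FC ==> supp (adj h a) = a_inv V ` supp a"
proof -
 assume a: "a : FC"
 show ?thesis
 proof (intro equalityI subsetI)
  fix f assume "f : supp (adj h a)"
  then have "f : carrier V" "a (\<ominus> f) ~= 0" by (auto simp: supp_def weyl_star split: if_splits)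
  then show "f : a_inv V ` supp a" by (intro image_eqI[of _ _ "\<ominus> f"]) (auto simp: supp_def)
 next
  fix f assume "f : a_inv V ` supp a"
  then show "f : supp (adj h a)" using finC(2)[OF a] by (auto simp: supp_def weyl_star)
 qed
qed

lemma fin_closed [simp, intro]:
 "a : FC ==> b : FC ==> (%f. a f + b f) : FC"
 "a : FC ==> (%f. c * a f) : FC"
 "(%_. 0) : FC"
 "a : FC ==> b : FC ==> a \<star>[h] b : FC"
 "a : FC ==> adj h a : FC"
proof -
 assume a: "a : FC"
 show "(%f. c * a f) : FC" using a unfolding fin_coeffs_def by (auto intro: finite_subset)
 show "adj h a : FC"
  using supp_star[OF a] finC[OF a] by (auto simp: fin_coeffs_iff)
 assume b: "b : FC"
 have "supp (%f. a f + b f) \<subseteq> supp a \<union> supp b" by (auto simp: supp_def)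
 then show "(%f. a f + b f) : FC" using finC[OF a] finC[OF b]
  unfolding fin_coeffs_iff by (meson finite_Un finite_subset le_sup_iff order_trans)
 have "finite (supp (a \<star>[h] b))"
  using finite_subset[OF supp_mult] finC(1)[OF a] finC(1)[OF b] by blast
 moreover have "supp (a \<star>[h] b) \<subseteq> carrier V"
  using supp_mult[of h a b] finC(2)[OF a] finC(2)[OF b] by fastforce
 ultimately show "a \<star>[h] b : FC" by (simp add: fin_coeffs_iff)
qed (auto simp: fin_coeffs_def)

text \<open>Both triple products are expanded by pairing with test functions, \<phi> on one side and
  \<open>\<psi> f\<close> on the other; the cocycle identity matches the terms.\<close>

lemma weyl_assoc:
 assumes a: "a : FC" and b: "b : FC" and c: "c : FC"
 shows "(a \<star>[h] b) \<star>[h] c = a \<star>[h] (b \<star>[h] c)"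
proof
 fix k
 define AB where "AB = (%(f, g). f \<oplus> g) ` (supp a \<times> supp b)"
 define BC where "BC = (%(f, g). f \<oplus> g) ` (supp b \<times> supp c)"
 have fin: "finite AB" "finite BC" using finC a b c by (auto simp: AB_def BC_def)
 have sub: "supp (a \<star>[h] b) \<subseteq> AB" "supp (b \<star>[h] c) \<subseteq> BC"
  unfolding AB_def BC_def by (rule supp_mult)+
 have inAB: "f \<oplus> g : AB" if "f : supp a" "g : supp b" for f g using that by (auto simp: AB_def)
 have inBC: "f \<oplus> g : BC" if "f : supp b" "g : supp c" for f g using that by (auto simp: BC_def)
 let ?ab = "a \<star>[h] b" and ?bc = "b \<star>[h] c"
 define \<phi> where "\<phi> m = (\<Sum>g\<in>supp c. if m \<oplus> g = k then c g * ph h m g else 0)" for m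
 define \<psi> where "\<psi> f m = (if f \<oplus> m = k then a f * ph h f m else 0)" for f m
 have "(?ab \<star>[h] c) k = (\<Sum>m\<in>AB. \<Sum>g\<in>supp c. if m \<oplus> g = k then ?ab m * c g * ph h m g else 0)"
  by (rule weyl_mult) (use fin sub finC c in auto)
 also have "... = (\<Sum>m\<in>AB. ?ab m * \<phi> m)"
  unfolding \<phi>_def sum_distrib_left by (intro sum.cong refl) (auto simp: mult.assoc)
 also have "... = (\<Sum>f\<in>supp a. \<Sum>g\<in>supp b. a f * b g * ph h f g * \<phi> (f \<oplus> g))"
  by (rule weyl_pairing) (use fin inAB finC a b in auto)
 also have "... = (\<Sum>f\<in>supp a. \<Sum>g\<in>supp b. \<Sum>l\<in>supp c. b g * c l * ph h g l * \<psi> f (g \<oplus> l))"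
 proof (intro sum.cong refl)
  fix f g assume fg: "f : supp a" "g : supp b"
  then have cr: "f : carrier V" "g : carrier V" using finC a b by auto
  show "a f * b g * ph h f g * \<phi> (f \<oplus> g) = (\<Sum>l\<in>supp c. b g * c l * ph h g l * \<psi> f (g \<oplus> l))"
   unfolding \<phi>_def sum_distrib_left
  proof (intro sum.cong refl)
   fix l assume "l : supp c"
   then have l: "l : carrier V" using finC c by auto
   show "a f * b g * ph h f g * (if f \<oplus> g \<oplus> l = k then c l * ph h (f \<oplus> g) l else 0) =
     b g * c l * ph h g l * \<psi> f (g \<oplus> l)"
    using cr l ph_cocycle[OF cr l] by (auto simp: \<psi>_def V.a_assoc)
  qed
 qed
 also have "... = (\<Sum>f\<in>supp a. \<Sum>m\<in>BC. ?bc m * \<psi> f m)"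
  by (intro sum.cong refl weyl_pairing[symmetric]) (use fin inBC finC b c in auto)
 also have "... = (\<Sum>f\<in>supp a. \<Sum>m\<in>BC. if f \<oplus> m = k then a f * ?bc m * ph h f m else 0)"
  unfolding \<psi>_def by (intro sum.cong refl) (auto simp: ac_simps)
 also have "... = (a \<star>[h] ?bc) k"
  by (rule weyl_mult[symmetric]) (use fin sub finC a in auto)
 finally show "(?ab \<star>[h] c) k = (a \<star>[h] ?bc) k" .
qed

lemma inj_neg: "S \<subseteq> carrier V ==> inj_on (a_inv V) S"
 by (rule inj_onI) (metis V.minus_minus subsetD)

lemma weyl_star_mult:
 assumes a: "a : FC" and T: "finite T" "supp b \<subseteq> T"
 shows "(adj h a \<star>[h] b) k =
  (\<Sum>f\<in>supp a. \<Sum>g\<in>T. if \<ominus> f \<oplus> g = k then cnj (a f) * b g * ph h (\<ominus> f) g else 0)"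
proof -
 have "(adj h a \<star>[h] b) k =
  (\<Sum>f\<in>a_inv V ` supp a. \<Sum>g\<in>T. if f \<oplus> g = k then adj h a f * b g * ph h f g else 0)"
  by (rule weyl_mult) (use finC[OF a] supp_star[OF a] T in auto)
 also have "... = (\<Sum>f\<in>supp a. \<Sum>g\<in>T. if \<ominus> f \<oplus> g = k then adj h a (\<ominus> f) * b g * ph h (\<ominus> f) g else 0)"
  by (subst sum.reindex[OF inj_neg[OF finC(2)[OF a]]]) simp
 also have "... = (\<Sum>f\<in>supp a. \<Sum>g\<in>T. if \<ominus> f \<oplus> g = k then cnj (a f) * b g * ph h (\<ominus> f) g else 0)"
  using finC(2)[OF a] by (intro sum.cong refl) (auto simp: weyl_star subset_iff)
 finally show ?thesis .
qed

lemma weyl_star_product: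
 assumes a: "a : FC" and b: "b : FC"
 shows "adj h (a \<star>[h] b) = adj h b \<star>[h] adj h a"
proof
 fix k
 let ?s = "adj h"
 note fa = finC[OF a] and fb = finC[OF b]
 have "(?s b \<star>[h] ?s a) k =
  (\<Sum>g\<in>supp b. \<Sum>f\<in>a_inv V ` supp a. if \<ominus> g \<oplus> f = k then cnj (b g) * ?s a f * ph h (\<ominus> g) f else 0)"
  by (rule weyl_star_mult) (use b fa supp_star[OF a] in auto)
 also have "... = (\<Sum>g\<in>supp b. \<Sum>f\<in>supp a. if \<ominus> g \<oplus> \<ominus> f = k then cnj (b g) * cnj (a f) * ph h g f else 0)"
 proof (rule sum.cong[OF refl])
  fix g assume "g : supp b"
  then have g: "g : carrier V" using fb by auto
  show "(\<Sum>f\<in>a_inv V ` supp a. if \<ominus> g \<oplus> f = k then cnj (b g) * ?s a f * ph h (\<ominus> g) f else 0) =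
   (\<Sum>f\<in>supp a. if \<ominus> g \<oplus> \<ominus> f = k then cnj (b g) * cnj (a f) * ph h g f else 0)"
   unfolding sum.reindex[OF inj_neg[OF fa(2)]]
   using fa g by (intro sum.cong refl) (auto simp: weyl_star subset_iff ph_neg)
 qed
 also have "... = (\<Sum>f\<in>supp a. \<Sum>g\<in>supp b. if \<ominus> g \<oplus> \<ominus> f = k then cnj (b g) * cnj (a f) * ph h g f else 0)"
  by (rule sum.swap)
 also have "... = ?s (a \<star>[h] b) k"
 \<comment> \<open>\<open>star\<close> is 0 outside the carrier by definition, while the convolution
   vanishes there because sums of carrier elements stay in the carrier.\<close>
 proof (cases "k : carrier V")
  case True
  have iff: "\<ominus> g \<oplus> \<ominus> f = k \<longleftrightarrow> f \<oplus> g = \<ominus> k" if "f : carrier V" "g : carrier V" for f g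
   using that True by (metis V.add.inv_closed V.minus_add V.minus_minus V.a_comm)
  have "?s (a \<star>[h] b) k = cnj (\<Sum>f\<in>supp a. \<Sum>g\<in>supp b. if f \<oplus> g = \<ominus> k then a f * b g * ph h f g else 0)"
   using True fa fb by (simp add: weyl_star weyl_mult[of "supp a" "supp b"])
  also have "... = (\<Sum>f\<in>supp a. \<Sum>g\<in>supp b. if \<ominus> g \<oplus> \<ominus> f = k then cnj (b g) * cnj (a f) * ph h g f else 0)"
   unfolding cnj_sum using fa fb by (intro sum.cong refl) (auto simp: subset_iff iff ph_cnj)
  finally show ?thesis by simp
 next
  case False
  have "\<ominus> g \<oplus> \<ominus> f ~= k" if "f : supp a" "g : supp b" for f g
   using that fa(2) fb(2) False by (auto simp: subset_iff)
  then have "(\<Sum>f\<in>supp a. \<Sum>g\<in>supp b. if \<ominus> g \<oplus> \<ominus> f = k then cnj (b g) * cnj (a f) * ph h g f else 0) = 0"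
   by (intro sum.neutral ballI) simp
  then show ?thesis using False by (simp add: weyl_star)
 qed
 finally show "?s (a \<star>[h] b) k = (?s b \<star>[h] ?s a) k" by simp
qed

lemma weyl_distr:
 assumes a: "a : FC" and b: "b : FC" and c: "c : FC"
 shows "(%f. a f + b f) \<star>[h] c = (%k. (a \<star>[h] c) k + (b \<star>[h] c) k)"
  "c \<star>[h] (%f. a f + b f) = (%k. (c \<star>[h] a) k + (c \<star>[h] b) k)"
proof -
 let ?S = "supp a \<union> supp b"
 have S: "finite ?S" "supp a \<subseteq> ?S" "supp b \<subseteq> ?S" "supp (%f. a f + b f) \<subseteq> ?S" "finite (supp c)"
  using finC a b c by (auto simp: supp_def)
 show "(%f. a f + b f) \<star>[h] c = (%k. (a \<star>[h] c) k + (b \<star>[h] c) k)"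
  unfolding weyl_mult[OF S(1,5,2) order_refl] weyl_mult[OF S(1,5,3) order_refl] sum.distrib[symmetric]
  by (rule ext, subst weyl_mult[OF S(1,5,4) order_refl], intro sum.cong refl) (simp add: algebra_simps)
 show "c \<star>[h] (%f. a f + b f) = (%k. (c \<star>[h] a) k + (c \<star>[h] b) k)"
  unfolding weyl_mult[OF S(5,1) order_refl S(2)] weyl_mult[OF S(5,1) order_refl S(3)] sum.distrib[symmetric]
  by (rule ext, subst weyl_mult[OF S(5,1) order_refl S(4)], intro sum.cong refl) (simp add: algebra_simps)
qed

lemma weyl_smult:
 assumes a: "a : FC" and b: "b : FC"
 shows "(%f. z * a f) \<star>[h] b = (%k. z * (a \<star>[h] b) k)"
  "a \<star>[h] (%f. z * b f) = (%k. z * (a \<star>[h] b) k)"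
proof -
 have S: "finite (supp a)" "finite (supp b)" "supp (%f. z * a f) \<subseteq> supp a" "supp (%f. z * b f) \<subseteq> supp b"
  using finC a b by (auto simp: supp_def)
 show "(%f. z * a f) \<star>[h] b = (%k. z * (a \<star>[h] b) k)"
  unfolding weyl_mult[OF S(1,2) order_refl order_refl] sum_distrib_left
  by (rule ext, subst weyl_mult[OF S(1,2,3) order_refl], intro sum.cong refl) (simp add: algebra_simps)
 show "a \<star>[h] (%f. z * b f) = (%k. z * (a \<star>[h] b) k)"
  unfolding weyl_mult[OF S(1,2) order_refl order_refl] sum_distrib_left
  by (rule ext, subst weyl_mult[OF S(1,2) order_refl S(4)], intro sum.cong refl) (simp add: algebra_simps)
qed

lemma supp_symbol [simp]: "supp (ws f) = {f}"
 by (auto simp: supp_def weyl_symbol_def)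

lemma symbol_mult:
 "f : carrier V ==> g : carrier V ==>
  ws f \<star>[h] ws g = (%k. ph h f g * ws (f \<oplus> g) k)"
 by (rule ext, subst weyl_mult[of "{f}" "{g}"], simp_all) (auto simp: weyl_symbol_def)

lemma symbol_star:
 "f : carrier V ==> adj h (ws f) = ws (\<ominus> f)"
 by (rule ext) (auto simp: weyl_star weyl_symbol_def)

lemma weyl_one:
 assumes a: "a : FC"
 shows "ws \<zero> \<star>[h] a = a" "a \<star>[h] ws \<zero> = a"
proof -
 note fa = finC[OF a]
 have out: "a k = 0" if "k ~: carrier V" for k using fa that by (auto simp: supp_def)
 show "ws \<zero> \<star>[h] a = a"
 proof
  fix k
  have "(ws \<zero> \<star>[h] a) k = (\<Sum>g\<in>supp a. if g = k then a g else 0)"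
   using fa by (subst weyl_mult[of "{\<zero>}" "supp a"], simp_all) (auto simp: weyl_symbol_def subset_iff intro!: sum.cong)
  also have "... = a k" using fa by (simp add: supp_iff)
  finally show "(ws \<zero> \<star>[h] a) k = a k" .
 qed
 show "a \<star>[h] ws \<zero> = a"
 proof
  fix k
  have "(a \<star>[h] ws \<zero>) k = (\<Sum>g\<in>supp a. if g = k then a g else 0)"
   using fa by (subst weyl_mult[of "supp a" "{\<zero>}"], simp_all) (auto simp: weyl_symbol_def subset_iff intro!: sum.cong)
  also have "... = a k" using fa by (simp add: supp_iff)
  finally show "(a \<star>[h] ws \<zero>) k = a k" .
 qed
qed

theorem weyl_star_alg: "star_alg (weyl_poly V h)"
proof -
 have ag: "abelian_group (weyl_poly V h)"
 proof (rule abelian_groupI)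
  fix x assume "x : carrier (weyl_poly V h)"
  then show "EX y:carrier (weyl_poly V h). y \<oplus>\<^bsub>weyl_poly V h\<^esub> x = \<zero>\<^bsub>weyl_poly V h\<^esub>"
   using fin_closed(2)[of x "-1"] by (intro bexI[of _ "%f. (-1) * x f"]) auto
 qed (auto simp: algebra_simps)
 have mon: "Group.monoid (weyl_poly V h)"
  by (rule monoidI) (auto simp: weyl_assoc weyl_one)
 have "ring (weyl_poly V h)"
  by (rule ringI[OF ag mon]) (auto simp: weyl_distr)
 moreover have "adj h (adj h a) = a" if "a : FC" for a
  using that by (auto simp: weyl_star fun_eq_iff fin_coeffs_def)
 moreover have "adj h (%f. a f + b f) = (%f. adj h a f + adj h b f)"
  "adj h (%f. c * a f) = (%f. cnj c * adj h a f)" for a b c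
  by (auto simp: weyl_star fun_eq_iff)
 ultimately show ?thesis
  by (intro star_alg.intro star_alg_axioms.intro)
   (auto simp: weyl_smult weyl_star_product algebra_simps)
qed

end

section \<open>The regular representation and the maximal C*-norm\<close>

lemma l2_smult: "l2 (%f. c * a f) = cmod c * l2 a"
proof (cases "c = 0")
 case True
 then show ?thesis by (simp add: l2_def supp_def)
next
 case False
 then have "supp (%f. c * a f) = supp a" by (auto simp: supp_def)
 then show ?thesis by (simp add: l2_def norm_mult L2_set_right_distrib)
qed

lemma l2_add:
 assumes "finite (supp a)" "finite (supp b)" shows "l2 (%f. a f + b f) <= l2 a + l2 b"
proof -
 let ?S = "supp a \<union> supp b"
 have S: "finite ?S" "supp a \<subseteq> ?S" "supp b \<subseteq> ?S" "supp (%f. a f + b f) \<subseteq> ?S"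
  using assms by (auto simp: supp_def)
 have "l2 (%f. a f + b f) <= L2_set (%f. cmod (a f) + cmod (b f)) ?S"
  unfolding l2_superset[OF S(1,4)] by (intro L2_set_mono norm_triangle_ineq) auto
 also have "... <= l2 a + l2 b"
  unfolding l2_superset[OF S(1,2)] l2_superset[OF S(1,3)] by (rule L2_set_triangle_ineq)
 finally show ?thesis .
qed

context symp
begin

text \<open>The GNS inner product of the trace \<open>a \<mapsto> a \<zero>\<close>. By
  \<open>ip_eq\<close> it is the ordinary inner product of square-summable functions, whatever
  \<open>h\<close> is; in this form, moving a factor to the other side is mere associativity
  (\<open>ip_adj\<close>).\<close>

definition ip :: "real => ('v => complex) => ('v => complex) => complex" where
 "ip h x y = (adj h x \<star>[h] y) \<zero>"

lemma ip_eq: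
 assumes x: "x : FC" and y: "y : FC"
 shows "ip h x y = (\<Sum>f\<in>supp x. cnj (x f) * y f)"
proof -
 let ?S = "supp x \<union> supp y"
 have S: "finite ?S" "supp y \<subseteq> ?S" and c: "?S \<subseteq> carrier V" using finC[OF x] finC[OF y] by auto
 have "ip h x y = (\<Sum>f\<in>supp x. \<Sum>g\<in>?S. if \<ominus> f \<oplus> g = \<zero> then cnj (x f) * y g * ph h (\<ominus> f) g else 0)"
  unfolding ip_def by (rule weyl_star_mult[OF x S])
 also have "... = (\<Sum>f\<in>supp x. \<Sum>g\<in>?S. if f = g then cnj (x f) * y f else 0)"
 proof (intro sum.cong refl)
  fix f g assume "f : supp x" "g : ?S"
  then have fg: "f : carrier V" "g : carrier V" using c by auto
  have "\<ominus> f \<oplus> g = \<zero> \<longleftrightarrow> f = g"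
   using fg by (metis V.add.inv_closed V.l_neg V.minus_equality V.minus_minus V.a_comm)
  then show "(if \<ominus> f \<oplus> g = \<zero> then cnj (x f) * y g * ph h (\<ominus> f) g else 0) = (if f = g then cnj (x f) * y f else 0)"
   using fg by auto
 qed
 also have "... = (\<Sum>f\<in>supp x. cnj (x f) * y f)"
  using S by (intro sum.cong refl) (subst sum.delta', auto)
 finally show ?thesis .
qed

lemma ip_self: "x : FC ==> ip h x x = cr ((l2 x)\<^sup>2)"
 by (simp add: ip_eq l2_def L2_set_def sum_nonneg complex_norm_square[symmetric] mult.commute
   del: of_real_power)

lemma ip_le:
 assumes x: "x : FC" and y: "y : FC"
 shows "cmod (ip h x y) <= l2 x * l2 y"
proof -
 let ?S = "supp x \<union> supp y"
 have S: "finite ?S" "supp x \<subseteq> ?S" "supp y \<subseteq> ?S" using finC[OF x] finC[OF y] by auto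
 have "cmod (ip h x y) <= (\<Sum>f\<in>supp x. cmod (x f) * cmod (y f))"
  unfolding ip_eq[OF x y] by (rule order_trans[OF norm_sum]) (simp add: norm_mult)
 also have "... <= (\<Sum>f\<in>?S. \<bar>cmod (x f)\<bar> * \<bar>cmod (y f)\<bar>)"
  using S by (simp, intro sum_mono2) auto
 also have "... <= l2 x * l2 y"
  unfolding l2_superset[OF S(1,2)] l2_superset[OF S(1,3)] by (rule L2_set_mult_ineq)
 finally show ?thesis .
qed

lemma ip_adj:
 assumes "a : FC" "x : FC" "y : FC"
 shows "ip h (a \<star>[h] x) y = ip h x (adj h a \<star>[h] y)"
 using assms by (simp add: ip_def weyl_star_product weyl_assoc)

lemma weyl_zero_mult [simp]: "x : FC ==> (%_. 0) \<star>[h] x = (%_. 0)"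
 "x : FC ==> x \<star>[h] (%_. 0) = (%_. 0)"
 using weyl_smult(1)[where z=0 and a="%_. 0" and b=x and h=h] weyl_smult(2)[where z=0 and a=x and b="%_. 0" and h=h]
 by simp_all

lemma symbol_unitary:
 "f : carrier V ==> adj h (ws f) \<star>[h] ws f = ws \<zero>"
 by (simp add: symbol_star symbol_mult V.l_neg)

lemma l2_symbol_mult:
 assumes f: "f : carrier V" and x: "x : FC"
 shows "l2 (ws f \<star>[h] x) = l2 x"
proof -
 have "cr ((l2 (ws f \<star>[h] x))\<^sup>2) =
   ip h (ws f \<star>[h] x) (ws f \<star>[h] x)"
  using f x by (subst ip_self) auto
 also have "... = ip h x (adj h (ws f) \<star>[h] (ws f \<star>[h] x))"
  using f x by (subst ip_adj) auto
 also have "... = ip h x x"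
  using f x by (subst weyl_assoc[symmetric]) (auto simp: symbol_unitary weyl_one)
 also have "... = cr ((l2 x)\<^sup>2)" using x by (rule ip_self)
 finally have "(l2 (ws f \<star>[h] x))\<^sup>2 = (l2 x)\<^sup>2" by (simp only: of_real_eq_iff)
 then show ?thesis using l2_nonneg power2_eq_imp_eq by blast
qed

lemma l2_mult_le:
 assumes "a : FC" and x: "x : FC"
 shows "l2 (a \<star>[h] x) <= l1 a * l2 x"
proof (rule le_l1[OF assms(1)])
 show "l2 ((%_. 0) \<star>[h] x) <= 0" using x by (simp add: l2_def supp_def)
 show "l2 ((%f. a f + b f) \<star>[h] x) <= l2 (a \<star>[h] x) + l2 (b \<star>[h] x)"
  if "a : FC" "b : FC" for a b
  using that x by (simp add: weyl_distr l2_add finC)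
 show "l2 ((%g. c * ws f g) \<star>[h] x) <= cmod c * l2 x" if "f : carrier V" for c f
  using that x by (simp add: weyl_smult l2_smult l2_symbol_mult)
qed

text \<open>The norm of the left regular representation on the square-summable functions.\<close>
definition reg :: "real => ('v => complex) => real" where
 "reg h a = (SUP x\<in>{x\<in>FC. l2 x <= 1}. l2 (a \<star>[h] x))"

lemma reg_le:
 assumes "0 <= C" "!!x. x : FC ==> l2 (a \<star>[h] x) <= C * l2 x"
 shows "reg h a <= C"
 unfolding reg_def
proof (rule cSUP_least)
 show "{x : FC. l2 x <= 1} ~= {}" using fin_closed(3) by (auto simp: l2_def supp_def)
 fix x assume "x : {x : FC. l2 x <= 1}"
 then show "l2 (a \<star>[h] x) <= C"
  using assms(2)[of x] mult_left_mono[of "l2 x" 1 C] assms(1) by simp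
qed

lemma reg_bound:
 assumes a: "a : FC" and x: "x : FC"
 shows "l2 (a \<star>[h] x) <= reg h a * l2 x"
proof (cases "l2 x = 0")
 case True
 then have "x = (%_. 0)" using l2_eq_0D finC(1)[OF x] by blast
 then show ?thesis using a True by (simp add: l2_def supp_def)
next
 case False
 then have pos: "l2 x > 0" using l2_nonneg[of x] by simp
 let ?y = "%f. cr (1 / l2 x) * x f"
 have y: "?y : FC" using x by (rule fin_closed)
 have y1: "l2 ?y <= 1" unfolding l2_smult using pos by (simp add: norm_divide)
 have bdd: "bdd_above ((%x. l2 (a \<star>[h] x)) ` {x\<in>FC. l2 x <= 1})"
 proof (rule bdd_aboveI2)
  fix z assume "z : {x\<in>FC. l2 x <= 1}"
  then show "l2 (a \<star>[h] z) <= l1 a"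
   using l2_mult_le[OF a, of z h] mult_left_mono[of "l2 z" 1 "l1 a"] l1_nonneg[of a] by simp
 qed
 have "l2 (a \<star>[h] ?y) <= reg h a"
  unfolding reg_def using y y1 by (intro cSUP_upper[OF _ bdd]) simp
 moreover have "l2 (a \<star>[h] ?y) = (1 / l2 x) * l2 (a \<star>[h] x)"
  unfolding weyl_smult(2)[OF a x] l2_smult using pos by (simp add: norm_divide)
 ultimately have "(1 / l2 x) * l2 (a \<star>[h] x) <= reg h a" by simp
 then show ?thesis using pos by (simp add: pos_divide_le_eq)
qed

lemma l2_one: "l2 (ws f) = 1"
 by (simp add: l2_def) (simp add: weyl_symbol_def)

lemma l2_le_reg: "a : FC ==> l2 a <= reg h a"
 using reg_bound[of a "ws \<zero>" h] by (simp add: weyl_one l2_one)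

lemma reg_nonneg: "a : FC ==> 0 <= reg h a"
 using l2_le_reg[of a h] l2_nonneg[of a] by linarith

lemma l2_sq_le:
 assumes a: "a : FC" and x: "x : FC"
 shows "(l2 (a \<star>[h] x))\<^sup>2 <= l2 x * l2 (adj h a \<star>[h] (a \<star>[h] x))"
proof -
 have "(l2 (a \<star>[h] x))\<^sup>2 = cmod (ip h (a \<star>[h] x) (a \<star>[h] x))"
  using a x by (subst ip_self) (auto simp del: of_real_power)
 also have "... = cmod (ip h x (adj h a \<star>[h] (a \<star>[h] x)))"
  using a x by (subst ip_adj) auto
 also have "... <= l2 x * l2 (adj h a \<star>[h] (a \<star>[h] x))"
  using a x by (intro ip_le) auto
 finally show ?thesis .
qed

text \<open>Cauchy-Schwarz bounds the square of \<open>l2 ?y\<close> by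
  \<open>l2 x * reg h a * l2 ?y\<close>, and one factor cancels.\<close>

lemma reg_star_le: assumes a: "a : FC" shows "reg h (adj h a) <= reg h a"
proof (rule reg_le[OF reg_nonneg[OF a]])
 interpret P: star_alg "weyl_poly V h" by (rule weyl_star_alg)
 fix x assume x: "x : FC"
 let ?b = "adj h a"
 let ?y = "?b \<star>[h] x"
 have b: "?b : FC" "?y : FC" using a x by auto
 have bb: "adj h ?b = a" using a by (metis P.star_star weyl_poly_simps(1))
 have "(l2 ?y)\<^sup>2 <= l2 x * l2 (a \<star>[h] ?y)" using l2_sq_le[OF b(1) x, of h] unfolding bb .
 also have "... <= l2 x * (reg h a * l2 ?y)"
  by (intro mult_left_mono reg_bound a b l2_nonneg)
 finally have "l2 ?y * l2 ?y <= (reg h a * l2 x) * l2 ?y" by (simp add: power2_eq_square ac_simps)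
 then show "l2 ?y <= reg h a * l2 x"
  using l2_nonneg[of ?y] reg_nonneg[OF a, of h] l2_nonneg[of x]
  by (cases "l2 ?y = 0") (auto intro: mult_right_le_imp_le)
qed

text \<open>An operator norm on an inner product space on which \<open>adj h a\<close> acts as the
  adjoint of \<open>a\<close>; it is definite because it dominates \<open>l2\<close>. Its existence
  makes the supremum in \<open>max_cstar_norm\<close> range over a nonempty set and bounds that
  supremum from below.\<close>

theorem reg_cstar_norm: "cstar_norm (weyl_poly V h) (reg h)"
 unfolding cstar_norm_def weyl_poly_simps
proof (intro conjI ballI allI)
 interpret P: star_alg "weyl_poly V h" by (rule weyl_star_alg)
 fix a assume a: "a : FC"
 let ?s = "adj h a"
 have s: "?s : FC" using a by simp
 show "0 <= reg h a" by (rule reg_nonneg[OF a])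
 show "reg h a = 0 \<longleftrightarrow> a = (%_. 0)"
 proof
  assume "reg h a = 0"
  then have "l2 a = 0" using l2_le_reg[OF a, of h] l2_nonneg[of a] by simp
  then show "a = (%_. 0)" using l2_eq_0D finC(1)[OF a] by blast
 next
  assume "a = (%_. 0)"
  then have "reg h a <= 0" by (intro reg_le) (auto simp: l2_def supp_def)
  then show "reg h a = 0" using reg_nonneg[OF a, of h] by simp
 qed
 have sm: "reg h (%f. c * b f) <= cmod c * reg h b" if b: "b : FC" for c b
  by (rule reg_le)
   (use b reg_bound[OF b, of _ h] reg_nonneg[OF b, of h] in \<open>auto simp: weyl_smult l2_smult mult.assoc intro: mult_left_mono\<close>)
 show "reg h (%f. c * a f) = cmod c * reg h a" for c
 proof (cases "c = 0")
  case True
  have "reg h (%_. 0) <= 0" by (intro reg_le) (auto simp: l2_def supp_def)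
  then show ?thesis using True reg_nonneg[of "%_. 0" h] by simp
 next
  case False
  have "reg h (%f. inverse c * (c * a f)) <= cmod (inverse c) * reg h (%f. c * a f)" using a by (intro sm) auto
  then have "reg h a <= inverse (cmod c) * reg h (%f. c * a f)"
   using False by (simp add: mult.assoc[symmetric] norm_inverse)
  then have "cmod c * reg h a <= reg h (%f. c * a f)" using False by (simp add: field_simps)
  then show ?thesis using sm[OF a, of c] by simp
 qed
 show "reg h (?s \<star>[h] a) = (reg h a)\<^sup>2"
 proof (rule antisym)
  have "reg h (?s \<star>[h] a) <= reg h a * reg h a"
  proof (rule reg_le)
   fix x assume x: "x : FC"
   have "l2 (?s \<star>[h] a \<star>[h] x) = l2 (?s \<star>[h] (a \<star>[h] x))"
    using a s x by (simp add: weyl_assoc)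
   also have "... <= reg h ?s * l2 (a \<star>[h] x)" using a s x by (intro reg_bound) auto
   also have "... <= reg h a * (reg h a * l2 x)"
    by (intro mult_mono reg_star_le reg_bound a x reg_nonneg l2_nonneg)
   finally show "l2 (?s \<star>[h] a \<star>[h] x) <= reg h a * reg h a * l2 x" by (simp add: ac_simps)
  qed (use reg_nonneg[OF a] in simp)
  then show "reg h (?s \<star>[h] a) <= (reg h a)\<^sup>2" by (simp add: power2_eq_square)
  have sa: "?s \<star>[h] a : FC" using a s by simp
  have "reg h a <= sqrt (reg h (?s \<star>[h] a))"
  proof (rule reg_le)
   fix x assume x: "x : FC"
   have "(l2 (a \<star>[h] x))\<^sup>2 <= l2 x * l2 (?s \<star>[h] a \<star>[h] x)"
    using l2_sq_le[OF a x] a s x by (simp add: weyl_assoc)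
   also have "... <= l2 x * (reg h (?s \<star>[h] a) * l2 x)"
    by (intro mult_left_mono reg_bound sa x l2_nonneg)
   finally have "(l2 (a \<star>[h] x))\<^sup>2 <= reg h (?s \<star>[h] a) * (l2 x)\<^sup>2"
    by (simp add: power2_eq_square ac_simps)
   then have "l2 (a \<star>[h] x) <= sqrt (reg h (?s \<star>[h] a) * (l2 x)\<^sup>2)"
    by (rule real_le_rsqrt)
   then show "l2 (a \<star>[h] x) <= sqrt (reg h (?s \<star>[h] a)) * l2 x"
    by (simp add: real_sqrt_mult l2_nonneg)
  qed (use reg_nonneg[OF sa] in simp)
  then show "(reg h a)\<^sup>2 <= reg h (?s \<star>[h] a)"
   using reg_nonneg[OF sa, of h] reg_nonneg[OF a, of h] by (metis real_sqrt_le_iff real_sqrt_pow2 power_mono)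
 qed
 fix b assume b: "b : FC"
 show "reg h (%f. a f + b f) <= reg h a + reg h b"
 proof (rule reg_le)
  fix x assume x: "x : FC"
  have "l2 ((%f. a f + b f) \<star>[h] x) <= l2 (a \<star>[h] x) + l2 (b \<star>[h] x)"
   using a b x by (simp add: weyl_distr l2_add finC)
  also have "... <= reg h a * l2 x + reg h b * l2 x" by (intro add_mono reg_bound a b x)
  finally show "l2 ((%f. a f + b f) \<star>[h] x) <= (reg h a + reg h b) * l2 x" by (simp add: algebra_simps)
 qed (use reg_nonneg[OF a, of h] reg_nonneg[OF b, of h] in simp)
 show "reg h (a \<star>[h] b) <= reg h a * reg h b"
 proof (rule reg_le)
  fix x assume x: "x : FC"
  have "l2 (a \<star>[h] b \<star>[h] x) <= reg h a * l2 (b \<star>[h] x)"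
   using a b x by (simp add: weyl_assoc reg_bound)
  also have "... <= reg h a * (reg h b * l2 x)" by (intro mult_left_mono reg_bound b x reg_nonneg a)
  finally show "l2 (a \<star>[h] b \<star>[h] x) <= reg h a * reg h b * l2 x" by (simp add: ac_simps)
 qed (use reg_nonneg[OF a, of h] reg_nonneg[OF b, of h] in simp)
qed

abbreviation mx :: "real => ('v => complex) => real" where
 "mx h \<equiv> max_cstar_norm (weyl_poly V h)"

text \<open>Symbols are unitary, so each C*-norm is at most 1 on them. The bound does not depend on
  the norm, which makes the supremum in \<open>max_cstar_norm\<close> finite.\<close>

lemma cstar_norm_le_l1:
 assumes "cstar_norm (weyl_poly V h) q" "a : FC" shows "q a <= l1 a"
proof -
 interpret P: cstar_pre "weyl_poly V h" q
  by (intro cstar_pre.intro cstar_pre_axioms.intro weyl_star_alg assms(1))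
 have "q a <= l1 a * 1"
 proof (rule le_l1[OF assms(2)])
  show "q (%_. 0) <= 0" using P.p_zero by simp
  show "q (%f. x f + y f) <= q x + q y" if "x : FC" "y : FC" for x y
   using P.p_add[of x y] that by simp
  fix c f assume f: "f : carrier V"
  have "(q (ws f))\<^sup>2 = q (ws \<zero>)"
   using P.p_cstar[of "ws f"] f by (simp add: symbol_unitary)
  also have "... <= 1" using P.p_one_le by simp
  finally have "q (ws f) <= 1" using P.p_nonneg[of "ws f"] f by (simp add: power_le_one_iff)
  then show "q (%g. c * ws f g) <= cmod c * 1"
   using P.p_smult[of "ws f" c] f by (simp add: mult_left_le)
 qed
 then show ?thesis by simp
qed

lemma mx_bdd: "a : FC ==> bdd_above ((%q. q a) ` {q. cstar_norm (weyl_poly V h) q})"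
 using cstar_norm_le_l1 by (intro bdd_aboveI2[of _ _ "l1 a"]) auto

lemma cstar_norm_le_mx: "cstar_norm (weyl_poly V h) q ==> a : FC ==> q a <= mx h a"
 unfolding max_cstar_norm_def by (rule cSUP_upper[OF _ mx_bdd]) auto

lemma mx_le: "(!!q. cstar_norm (weyl_poly V h) q ==> q a <= C) ==> mx h a <= C"
 unfolding max_cstar_norm_def using reg_cstar_norm by (intro cSUP_least) auto

lemma mx_le_l1: "a : FC ==> mx h a <= l1 a"
 by (rule mx_le) (rule cstar_norm_le_l1)

lemma l2_le_mx: "a : FC ==> l2 a <= mx h a"
 using l2_le_reg cstar_norm_le_mx[OF reg_cstar_norm] by (rule order_trans)

text \<open>Each axiom passes to a finite pointwise supremum. Definiteness comes from
  \<open>l2_le_mx\<close>; the C*-identity follows in one direction by squaring bounds, in the other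
  by taking square roots.\<close>

theorem mx_cstar_norm: "cstar_norm (weyl_poly V h) (mx h)"
 unfolding cstar_norm_def weyl_poly_simps
proof (intro conjI ballI allI)
 have pre: "cstar_pre (weyl_poly V h) q" if "cstar_norm (weyl_poly V h) q" for q
  by (intro cstar_pre.intro cstar_pre_axioms.intro weyl_star_alg that)
 fix a assume a: "a : FC"
 show nn: "0 <= mx h a" using l2_le_mx[OF a, of h] l2_nonneg[of a] by simp
 show "mx h a = 0 \<longleftrightarrow> a = (%_. 0)"
 proof
  assume "mx h a = 0"
  then have "l2 a = 0" using l2_le_mx[OF a, of h] l2_nonneg[of a] by simp
  then show "a = (%_. 0)" using l2_eq_0D finC(1)[OF a] by blast
 next
  assume "a = (%_. 0)"
  then have "mx h a <= 0" using mx_le_l1[OF a, of h] by (simp add: l1_def supp_def)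
  then show "mx h a = 0" using nn by simp
 qed
 have sm: "mx h (%f. c * b f) <= cmod c * mx h b" if b: "b : FC" for c b
 proof (rule mx_le)
  fix q assume q: "cstar_norm (weyl_poly V h) q"
  interpret P: cstar_pre "weyl_poly V h" q by (rule pre[OF q])
  show "q (%f. c * b f) <= cmod c * mx h b"
   using P.p_smult[of b c] b cstar_norm_le_mx[OF q b] by (simp add: mult_left_mono)
 qed
 show "mx h (%f. c * a f) = cmod c * mx h a" for c
 proof (cases "c = 0")
  case True
  have "mx h (%_. 0) <= 0" using mx_le_l1[of "%_. 0" h] by (simp add: l1_def supp_def)
  moreover have "0 <= mx h (%_. 0)" using order_trans[OF l2_nonneg l2_le_mx] by simp
  ultimately show ?thesis using True by simp
 next
  case False
  have "mx h (%f. inverse c * (c * a f)) <= cmod (inverse c) * mx h (%f. c * a f)" using a by (intro sm) auto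
  then have "mx h a <= inverse (cmod c) * mx h (%f. c * a f)"
   using False by (simp add: mult.assoc[symmetric] norm_inverse)
  then have "cmod c * mx h a <= mx h (%f. c * a f)" using False by (simp add: field_simps)
  then show ?thesis using sm[OF a, of c] by simp
 qed
 let ?s = "adj h a"
 have sa: "?s \<star>[h] a : FC" using a by simp
 show "mx h (?s \<star>[h] a) = (mx h a)\<^sup>2"
 proof (rule antisym)
  show "mx h (?s \<star>[h] a) <= (mx h a)\<^sup>2"
  proof (rule mx_le)
   fix q assume q: "cstar_norm (weyl_poly V h) q"
   interpret P: cstar_pre "weyl_poly V h" q by (rule pre[OF q])
   show "q (?s \<star>[h] a) <= (mx h a)\<^sup>2"
    using P.p_cstar[of a] a cstar_norm_le_mx[OF q a] P.p_nonneg[of a] by (simp add: power_mono)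
  qed
  have nn2: "0 <= mx h (?s \<star>[h] a)" using l2_le_mx[OF sa, of h] l2_nonneg by (meson order_trans)
  have "mx h a <= sqrt (mx h (?s \<star>[h] a))"
  proof (rule mx_le)
   fix q assume q: "cstar_norm (weyl_poly V h) q"
   interpret P: cstar_pre "weyl_poly V h" q by (rule pre[OF q])
   have "(q a)\<^sup>2 <= mx h (?s \<star>[h] a)" using P.p_cstar[of a] a cstar_norm_le_mx[OF q sa] by simp
   then show "q a <= sqrt (mx h (?s \<star>[h] a))" by (rule real_le_rsqrt)
  qed
  then show "(mx h a)\<^sup>2 <= mx h (?s \<star>[h] a)"
   using nn nn2 by (metis real_sqrt_pow2 power_mono)
 qed
 fix b assume b: "b : FC"
 show "mx h (%f. a f + b f) <= mx h a + mx h b"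
 proof (rule mx_le)
  fix q assume q: "cstar_norm (weyl_poly V h) q"
  interpret P: cstar_pre "weyl_poly V h" q by (rule pre[OF q])
  show "q (%f. a f + b f) <= mx h a + mx h b"
   using P.p_add[of a b] a b cstar_norm_le_mx[OF q a] cstar_norm_le_mx[OF q b] by simp
 qed
 show "mx h (a \<star>[h] b) <= mx h a * mx h b"
 proof (rule mx_le)
  fix q assume q: "cstar_norm (weyl_poly V h) q"
  interpret P: cstar_pre "weyl_poly V h" q by (rule pre[OF q])
  have "q (a \<star>[h] b) <= q a * q b" using P.p_mult a b by simp
  also have "... <= mx h a * mx h b"
   using cstar_norm_le_mx[OF q a] cstar_norm_le_mx[OF q b] nn P.p_nonneg a b by (intro mult_mono) auto
  finally show "q (a \<star>[h] b) <= mx h a * mx h b" .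
 qed
qed

lemma weyl_cstar_pre: "cstar_pre (weyl_poly V h) (mx h)"
 by (intro cstar_pre.intro cstar_pre_axioms.intro weyl_star_alg mx_cstar_norm)

end

section \<open>Separating functionals and unitary polynomials\<close>

text \<open>A real vector space is not covered by finitely many hyperplanes: on the line
  \<open>F + t G\<close> each point \<open>d\<close> spoils at most one value of \<open>t\<close>,
  and \<open>G\<close> is chosen to take care of the new point.\<close>

lemma exists_nonvanishing:
 assumes "finite D" and nz: "!!d. d : D ==> EX F:\<Phi>. F d ~= (0::real)"
  and comb: "!!F G t. F : \<Phi> ==> G : \<Phi> ==> EX H:\<Phi>. ALL d:D. H d = F d + t * G d" and "\<Phi> ~= {}"
 shows "EX F:\<Phi>. ALL d:D. F d ~= 0"
proof -
 have "finite E ==> E \<subseteq> D ==> EX F:\<Phi>. ALL d:E. F d ~= 0" for E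
 proof (induction E rule: finite_induct)
  case empty
  then show ?case using assms(4) by auto
 next
  case (insert x E)
  then obtain F where F: "F : \<Phi>" "ALL d:E. F d ~= 0" by auto
  obtain G where G: "G : \<Phi>" "G x ~= 0" using nz insert by blast
  let ?bad = "(%d. - F d / G d) ` (insert x E)"
  have "finite ?bad" using insert by simp
  then obtain t where t: "t ~: insert 0 ?bad" using ex_new_if_finite[OF infinite_UNIV_char_0] by (metis finite.insertI)
  obtain H where H: "H : \<Phi>" "ALL d:D. H d = F d + t * G d" using comb[OF F(1) G(1)] by blast
  have "H d ~= 0" if d: "d : insert x E" for d
  proof
   assume "H d = 0"
   then have eq: "F d + t * G d = 0" using H d insert.prems by auto
   show False
   proof (cases "G d = 0")
    case True
    then show False using eq d F(2) G(2) by auto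
   next
    case False
    then have "t = - F d / G d" using eq by (simp add: field_simps)
    then show False using t d by blast
   qed
  qed
  then show ?case using H(1) by blast
 qed
 then show ?thesis using assms(1) by blast
qed

context symp
begin

lemma diff_eq_0D:
 assumes "f : carrier V" "g : carrier V" "f \<ominus> g = \<zero>" shows "f = g"
 using assms V.minus_equality[of f "\<ominus> g"] by (simp add: a_minus_def)

lemma sform_separates:
 assumes "finite D" "D \<subseteq> carrier V - {\<zero>}"
 obtains g where "g : carrier V" "ALL d:D. sform V d g ~= 0"
proof -
 have "EX F:(%g d. sform V d g) ` carrier V. ALL d:D. F d ~= 0"
 proof (rule exists_nonvanishing[OF assms(1)])
  fix d assume "d : D"
  then have d: "d : carrier V" "d ~= \<zero>" using assms(2) by auto
  then obtain g where "g : carrier V" "sform V d g ~= 0" using sform_nondeg[OF d(1)] by metis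
  then show "EX F:(%g d. sform V d g) ` carrier V. F d ~= 0"
   by (intro bexI[of _ "%d. sform V d g"]) auto
 next
  fix F G t assume "F : (%g d. sform V d g) ` carrier V" "G : (%g d. sform V d g) ` carrier V"
  then obtain g k where gk: "g : carrier V" "k : carrier V" "F = (%d. sform V d g)" "G = (%d. sform V d k)" by auto
  have "ALL d:D. sform V d (g \<oplus> t \<odot> k) = F d + t * G d"
  proof
   fix d assume "d : D"
   then have "d : carrier V" using assms(2) by auto
   then show "sform V d (g \<oplus> t \<odot> k) = F d + t * G d"
    using gk(1,2) rsmult(1)[OF gk(2)] by (simp add: gk(3,4) sform_add sform_smult)
  qed
  then show "EX H:(%g d. sform V d g) ` carrier V. ALL d:D. H d = F d + t * G d"
   using gk(1) rsmult(1)[OF gk(2)] by (intro bexI[of _ "%d. sform V d (g \<oplus> t \<odot> k)"] imageI) auto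
 qed (use V.zero_closed in blast)
 then show thesis using that by auto
qed

text \<open>A functional \<open>\<sigma>(\<cdot>, g)\<close> that is injective on the support of \<open>a\<close> has its extreme values there
 at two points whose difference occurs only once among all differences.\<close>
theorem weyl_unitary_trivial:
 assumes a: "a : FC"
  and u: "adj h a \<star>[h] a = ws \<zero>"
 obtains c f where "cmod c = 1" "f : carrier V" "a = (%g. c * ws f g)"
proof -
 note fa = finC[OF a]
 have prod: "(\<Sum>f\<in>supp a. \<Sum>g\<in>supp a. if \<ominus> f \<oplus> g = k then cnj (a f) * a g * ph h (\<ominus> f) g else 0) = ws \<zero> k" for k
  using weyl_star_mult[OF a fa(1) order_refl, of h k] u by simp
 have ne: "supp a ~= {}"
 proof
  assume "supp a = {}"
  then show False using prod[of \<zero>] by (simp add: weyl_symbol_def)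
 qed
 let ?D = "(%(f, g). f \<ominus> g) ` {(f, g) : supp a \<times> supp a. f ~= g}"
 have "finite ?D" using fa by (auto intro: finite_subset[of _ "supp a \<times> supp a"])
 moreover have "?D \<subseteq> carrier V - {\<zero>}"
 proof
  fix d assume "d : ?D"
  then obtain f g where fg: "f : supp a" "g : supp a" "f ~= g" "d = f \<ominus> g" by auto
  then have "f : carrier V" "g : carrier V" using fa by auto
  then show "d : carrier V - {\<zero>}" using fg diff_eq_0D[of f g] by auto
 qed
 ultimately obtain v where v: "v : carrier V" "ALL d:?D. sform V d v ~= 0"
  by (rule sform_separates)
 define L where "L = (%f. sform V f v)"
 have Ldiff: "L (\<ominus> f \<oplus> g) = L g - L f" if "f : carrier V" "g : carrier V" for f g
  using that v(1) by (simp add: L_def sform_add)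
 have inj: "f = g" if "f : supp a" "g : supp a" "L f = L g" for f g
 proof (rule ccontr)
  assume "f ~= g"
  then have "f \<ominus> g : ?D" using that by auto
  then have "sform V (f \<ominus> g) v ~= 0" using v(2) by blast
  moreover have "f : carrier V" "g : carrier V" using that fa by auto
  ultimately show False using that(3) v(1) by (simp add: a_minus_def sform_add L_def)
 qed
 have "Max (L ` supp a) : L ` supp a" "Min (L ` supp a) : L ` supp a"
  using ne fa(1) by (auto intro!: Max_in Min_in simp del: Max_in Min_in)
 then obtain M m where M0: "M : supp a" "Max (L ` supp a) = L M" and m0: "m : supp a" "Min (L ` supp a) = L m"
  by (elim imageE) blast
 have M: "M : supp a" "L f <= L M" if "f : supp a" for f
  using M0 Max_ge[of "L ` supp a" "L f"] fa(1) that by auto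
 have m: "m : supp a" "L m <= L f" if "f : supp a" for f
  using m0 Min_le[of "L ` supp a" "L f"] fa(1) that by auto
 note M = M0(1) M(2) and m = m0(1) m(2)
 have cM: "M : carrier V" and cm: "m : carrier V" using M m fa by auto
 \<comment> \<open>The coefficient of the product at \<open>?k\<close> is a single nonzero term, and
   the unit vanishes away from \<open>\<zero>\<close>. So \<open>m = M\<close>, \<open>L\<close> is
   constant on the support, and injectivity leaves one point.\<close>
 let ?k = "\<ominus> m \<oplus> M"
 have uniq: "f = m & g = M" if "f : supp a" "g : supp a" "\<ominus> f \<oplus> g = ?k" for f g
 proof -
  have "L g - L f = L M - L m" using Ldiff[of f g] Ldiff[of m M] that cM cm subsetD[OF fa(2)] by metis
  then have "L g = L M" "L f = L m" using M(2)[OF that(2)] m(2)[OF that(1)] by linarith+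
  then show ?thesis using inj that M m by blast
 qed
 have "(\<Sum>f\<in>supp a. \<Sum>g\<in>supp a. if \<ominus> f \<oplus> g = ?k then cnj (a f) * a g * ph h (\<ominus> f) g else 0) =
  (\<Sum>f\<in>supp a. if m = f then \<Sum>g\<in>supp a. if M = g then cnj (a f) * a g * ph h (\<ominus> f) g else 0 else 0)"
 proof (intro sum.cong refl)
  fix f assume f: "f : supp a"
  show "(\<Sum>g\<in>supp a. if \<ominus> f \<oplus> g = ?k then cnj (a f) * a g * ph h (\<ominus> f) g else 0) =
   (if m = f then \<Sum>g\<in>supp a. if M = g then cnj (a f) * a g * ph h (\<ominus> f) g else 0 else 0)"
  proof (cases "m = f")
   case True
   have "(\<ominus> f \<oplus> g = ?k) = (M = g)" if "g : supp a" for g using uniq[OF f that] True by auto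
   then show ?thesis using True by (simp cong: sum.cong)
  next
   case False
   have "\<ominus> f \<oplus> g ~= ?k" if "g : supp a" for g using uniq[OF f that] False by auto
   then show ?thesis using False by (simp cong: sum.cong)
  qed
 qed
 also have "... = cnj (a m) * a M * ph h (\<ominus> m) M" using fa(1) m(1) M(1) by simp
 finally have val: "cnj (a m) * a M * ph h (\<ominus> m) M = ws \<zero> ?k" using prod by simp
 have "cnj (a m) * a M * ph h (\<ominus> m) M ~= 0" using m M by (simp add: supp_iff)
 then have "?k = \<zero>" using val by (auto simp: weyl_symbol_def split: if_splits)
 then have "M \<ominus> m = \<zero>" using V.a_comm[of M "\<ominus> m"] cm cM by (simp add: a_minus_def)
 then have mM: "m = M" using diff_eq_0D[OF cM cm] by simp
 have supp: "supp a = {m}"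
 proof (intro equalityI subsetI)
  fix f assume f: "f : supp a"
  have "L f = L m" using M(2)[OF f] m(2)[OF f] unfolding mM by (rule order_antisym)
  then show "f : {m}" using inj[OF f m(1)] by blast
 qed (use m(1) in blast)
 have "cnj (a m) * a m = 1" using val[unfolded \<open>?k = \<zero>\<close>] cm unfolding mM[symmetric] by (simp add: weyl_symbol_def)
 then have "(cmod (a m))\<^sup>2 = 1" by (metis complex_norm_square mult.commute of_real_eq_1_iff)
 then have "cmod (a m) = 1" using norm_ge_zero[of "a m"] by (simp add: power2_eq_1_iff)
 moreover have "a = (%g. a m * ws m g)"
  using supp by (auto simp: fun_eq_iff weyl_symbol_def supp_def)
 ultimately show thesis using that cm by blast
qed

end

text \<open>The supports of iterated products vary with \<open>h\<close>. Fixed supersets give sums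
  over one index set, in which the limit in \<open>h\<close> can be taken termwise.\<close>

lemma fin_mult_star_superset:
 assumes "symp V" "a : fin_coeffs V" "finite S" "supp a \<subseteq> S" "finite T" "supp b \<subseteq> T"
 shows "(star (weyl_poly V h) a \<otimes>\<^bsub>weyl_poly V h\<^esub> b) k =
  (\<Sum>f\<in>S. \<Sum>g\<in>T. if \<ominus>\<^bsub>V\<^esub> f \<oplus>\<^bsub>V\<^esub> g = k then cnj (a f) * b g * symp.ph V h (\<ominus>\<^bsub>V\<^esub> f) g else 0)"
proof -
 interpret symp V by fact
 have "(star (weyl_poly V h) a \<otimes>\<^bsub>weyl_poly V h\<^esub> b) k =
  (\<Sum>f\<in>supp a. \<Sum>g\<in>T. if \<ominus>\<^bsub>V\<^esub> f \<oplus>\<^bsub>V\<^esub> g = k then cnj (a f) * b g * ph h (\<ominus>\<^bsub>V\<^esub> f) g else 0)"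
  using assms by (intro weyl_star_mult)
 also have "... = (\<Sum>f\<in>S. \<Sum>g\<in>T. if \<ominus>\<^bsub>V\<^esub> f \<oplus>\<^bsub>V\<^esub> g = k then cnj (a f) * b g * ph h (\<ominus>\<^bsub>V\<^esub> f) g else 0)"
  using assms by (intro sum.mono_neutral_left) (auto simp: supp_def intro!: sum.neutral split: if_splits)
 finally show ?thesis .
qed

section \<open>The dual space and trigonometric polynomials\<close>

context symp
begin

lemma dualD:
 assumes "F : dual V"
 shows "f : carrier V ==> g : carrier V ==> F (f \<oplus> g) = F f + F g"
  "f : carrier V ==> F (r \<odot> f) = r * F f" "F \<zero> = 0" "f : carrier V ==> F (\<ominus> f) = - F f"
  "F : extensional (carrier V)" "continuous_map (vtop V) euclideanreal F"
proof -
 show 1: "F (f \<oplus> g) = F f + F g" if "f : carrier V" "g : carrier V" for f g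
  using assms that by (auto simp: dual_def)
 show "F (r \<odot> f) = r * F f" if "f : carrier V" using assms that by (auto simp: dual_def)
 show z: "F \<zero> = 0" using 1[of \<zero> \<zero>] by simp
 show "F (\<ominus> f) = - F f" if "f : carrier V" using 1[of f "\<ominus> f"] that z by (simp add: V.r_neg)
 show "F : extensional (carrier V)" "continuous_map (vtop V) euclideanreal F" using assms by (auto simp: dual_def)
qed

lemma topspace_vtop: "topspace (vtop V) = carrier V"
 using is_symplectic by (auto simp: is_symplectic_tvs_def topological_vector_space_def)

lemma dual_comb:
 assumes F: "F : dual V" and G: "G : dual V"
 shows "(\<lambda>f\<in>carrier V. F f + t * G f) : dual V"
proof -
 have "continuous_map (vtop V) euclideanreal (%f. F f + t * G f)"
  by (intro continuous_map_add continuous_map_real_mult_left dualD(6)[OF F] dualD(6)[OF G])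
 then have "continuous_map (vtop V) euclideanreal (\<lambda>f\<in>carrier V. F f + t * G f)"
  by (rule continuous_map_eq) (simp add: topspace_vtop)
 then show ?thesis
  unfolding dual_def by (auto simp: dualD[OF F] dualD[OF G] rsmult algebra_simps)
qed

lemma dual_zero: "(\<lambda>f\<in>carrier V. 0) : dual V"
proof -
 have "continuous_map (vtop V) euclideanreal (\<lambda>f\<in>carrier V. 0)"
  by (rule continuous_map_eq[of _ _ "%_. 0"]) (auto simp: topspace_vtop)
 then show ?thesis unfolding dual_def by (auto simp: rsmult)
qed

lemma dual_nonempty: "dual V ~= {}" using dual_zero by blast

lemma dual_add_closed: "F : dual V ==> G : dual V ==> dual_add V F G : dual V"
 using dual_comb[of F G 1] by (simp add: dual_add_def)

lemma dual_scale: "F : dual V ==> (\<lambda>f\<in>carrier V. t * F f) : dual V"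
 using dual_comb[OF dual_zero, of F t] by (simp cong: restrict_cong)

lemma W0_eq: "F : dual V ==> W0 V f F = cis (F f)"
 by (simp add: W0_def cis_conv_exp)

lemma W0_comb_eq: "F : dual V ==> WC c F = (\<Sum>f\<in>supp c. c f * cis (F f))"
 by (simp add: W0_combination_def W0_eq supp_def)

lemma W0_comb_superset:
 "F : dual V ==> finite S ==> supp c \<subseteq> S ==> WC c F = (\<Sum>f\<in>S. c f * cis (F f))"
 unfolding W0_comb_eq by (rule sum.mono_neutral_left) (auto simp: supp_def)

lemma W0_comb_symbol: "WC (ws f) = W0 V f"
 unfolding W0_combination_def W0_def by (rule restrict_ext) (simp add: weyl_symbol_def)

text \<open>At parameter 0 all phases are 1, and the twisted convolution is the coefficient form of
  the pointwise product. So \<open>weyl_poly V 0\<close> is the coefficient algebra of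
  \<open>Delta0 V\<close>; the involution is the same for every parameter.\<close>

lemma W0_comb_star_mult:
 assumes a: "a : FC" and b: "b : FC" and F: "F : dual V"
 shows "WC (a \<star>[0] b) F = WC a F * WC b F"
  "WC (adj h a) F = cnj (WC a F)"
proof -
 let ?U = "(%(f, g). f \<oplus> g) ` (supp a \<times> supp b)"
 note fa = finC[OF a] and fb = finC[OF b]
 have "WC (a \<star>[0] b) F = (\<Sum>k\<in>?U. (a \<star>[0] b) k * cis (F k))"
  using F fa fb by (intro W0_comb_superset supp_mult) auto
 also have "... = (\<Sum>f\<in>supp a. \<Sum>g\<in>supp b. a f * b g * ph 0 f g * cis (F (f \<oplus> g)))"
  by (rule weyl_pairing) (use fa fb in auto)
 also have "... = (\<Sum>f\<in>supp a. \<Sum>g\<in>supp b. (a f * cis (F f)) * (b g * cis (F g)))"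
 proof (intro sum.cong refl)
  fix f g assume "f : supp a" "g : supp b"
  then have "f : carrier V" "g : carrier V" using fa fb by auto
  then show "a f * b g * ph 0 f g * cis (F (f \<oplus> g)) = (a f * cis (F f)) * (b g * cis (F g))"
   by (simp add: dualD[OF F] cis_mult[symmetric])
 qed
 also have "... = WC a F * WC b F"
  by (simp only: W0_comb_eq[OF F] sum_product)
 finally show "WC (a \<star>[0] b) F = WC a F * WC b F" .
 have "WC (adj h a) F = (\<Sum>f\<in>a_inv V ` supp a. adj h a f * cis (F f))"
  by (simp only: W0_comb_eq[OF F] supp_star[OF a])
 also have "... = (\<Sum>f\<in>supp a. adj h a (\<ominus> f) * cis (F (\<ominus> f)))"
  by (subst sum.reindex[OF inj_neg[OF fa(2)]]) simp
 also have "... = (\<Sum>f\<in>supp a. cnj (a f * cis (F f)))"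
 proof (intro sum.cong refl)
  fix f assume "f : supp a"
  then have "f : carrier V" using fa by auto
  then show "adj h a (\<ominus> f) * cis (F (\<ominus> f)) = cnj (a f * cis (F f))"
   by (simp add: weyl_star dualD[OF F] cis_cnj)
 qed
 finally show "WC (adj h a) F = cnj (WC a F)"
  by (simp only: W0_comb_eq[OF F] cnj_sum)
qed

lemma W0_comb_linear:
 assumes a: "a : FC" and b: "b : FC" and F: "F : dual V"
 shows "WC (%f. a f + b f) F = WC a F + WC b F"
  "WC (%f. z * a f) F = z * WC a F"
proof -
 let ?S = "supp a \<union> supp b"
 have S: "finite ?S" "supp a \<subseteq> ?S" "supp b \<subseteq> ?S" "supp (%f. a f + b f) \<subseteq> ?S" "supp (%f. z * a f) \<subseteq> ?S"
  using finC[OF a] finC[OF b] by (auto simp: supp_def)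
 show "WC (%f. a f + b f) F = WC a F + WC b F"
  unfolding W0_comb_superset[OF F S(1,2)] W0_comb_superset[OF F S(1,3)] W0_comb_superset[OF F S(1,4)]
  by (simp add: sum.distrib algebra_simps)
 show "WC (%f. z * a f) F = z * WC a F"
  unfolding W0_comb_superset[OF F S(1,2)] W0_comb_superset[OF F S(1,5)]
  by (simp add: sum_distrib_left algebra_simps)
qed

lemma W0_comb_le_l1: "a : FC ==> F : dual V ==> cmod (WC a F) <= l1 a"
 unfolding W0_comb_eq l1_def by (rule order_trans[OF norm_sum]) (simp add: norm_mult)

definition supn :: "('v => complex) => real" where
 "supn a = (SUP F\<in>dual V. cmod (WC a F))"

lemma supn_upper: "a : FC ==> F : dual V ==> cmod (WC a F) <= supn a"
 unfolding supn_def by (intro cSUP_upper bdd_aboveI2[of _ _ "l1 a"]) (auto intro: W0_comb_le_l1)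

lemma supn_least: "(!!F. F : dual V ==> cmod (WC a F) <= C) ==> supn a <= C"
 unfolding supn_def by (rule cSUP_least[OF dual_nonempty])

lemma supn_nonneg: "a : FC ==> 0 <= supn a"
 using supn_upper[OF _ dual_zero] norm_ge_zero order_trans by blast

end

locale psymp = symp + assumes has_bracket: "has_poisson_bracket V"
begin

text \<open>If all functionals vanish at \<open>f\<close>, then
  \<open>W0 V f = W0 V \<zero>\<close>, and comparing the brackets of both with
  \<open>W0 V g\<close> at the zero functional gives \<open>sform V f g = 0\<close> for every
  \<open>g\<close>. Nondegeneracy excludes this.\<close>

lemma dual_separates:
 assumes f: "f : carrier V" and nz: "f ~= \<zero>"
 shows "EX F:dual V. F f ~= 0"
proof (rule ccontr)
 assume no: "\<not> ?thesis"
 obtain B where B: "is_poisson_bracket V B" using has_bracket by (auto simp: has_poisson_bracket_def)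
 let ?Z = "\<lambda>f\<in>carrier V. 0 :: real"
 have eq: "W0 V f = W0 V \<zero>"
  unfolding W0_def
 proof (rule restrict_ext)
  fix F assume F: "F : dual V"
  then have "F f = 0" using no by blast
  then show "exp (\<i> * cr (F f)) = exp (\<i> * cr (F \<zero>))" using dualD(3)[OF F] by simp
 qed
 have BW: "B (W0 V f) (W0 V g) = cr (sform V f g) \<odot>\<^bsub>AP V\<^esub> W0 V (f \<oplus> g)"
  if "f : carrier V" "g : carrier V" for f g
  using B that by (simp add: is_poisson_bracket_def)
 have AP: "(c \<odot>\<^bsub>AP V\<^esub> a) ?Z = c * a ?Z" for c a
  using dual_zero by (simp add: AP_def dual_fun_algebra_def)
 have WZ: "W0 V g ?Z = 1" if "g : carrier V" for g using that dual_zero by (simp add: W0_eq)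
 have "sform V f g = 0" if g: "g : carrier V" for g
 proof -
  have "cr (sform V f g) \<odot>\<^bsub>AP V\<^esub> W0 V (f \<oplus> g) = cr (sform V \<zero> g) \<odot>\<^bsub>AP V\<^esub> W0 V (\<zero> \<oplus> g)"
   using BW[OF f g] BW[OF V.zero_closed g] eq by simp
  then have "(cr (sform V f g) \<odot>\<^bsub>AP V\<^esub> W0 V (f \<oplus> g)) ?Z = (cr (sform V \<zero> g) \<odot>\<^bsub>AP V\<^esub> W0 V (\<zero> \<oplus> g)) ?Z"
   by simp
  then show ?thesis using f g by (simp add: AP WZ)
 qed
 then show False using sform_nondeg[OF f] nz by blast
qed

lemma dual_separates_finite:
 assumes "finite D" "D \<subseteq> carrier V - {\<zero>}"
 obtains F where "F : dual V" "ALL d:D. F d ~= 0"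
proof -
 have "EX F:dual V. ALL d:D. F d ~= 0"
 proof (rule exists_nonvanishing[OF assms(1) _ _ dual_nonempty])
  show "EX F:dual V. F d ~= 0" if "d : D" for d using dual_separates that assms(2) by blast
  show "EX H:dual V. ALL d:D. H d = F d + t * G d" if "F : dual V" "G : dual V" for F G t
   by (rule bexI[OF _ dual_comb[OF that, of t]]) (use assms(2) in auto)
 qed
 then show thesis using that by blast
qed

text \<open>The geometric sum stays bounded by \<open>2 / cmod (cis u - 1)\<close>, so the means
  decay like \<open>1 / N\<close>.\<close>

lemma avg_cis_null:
 assumes "cis u ~= 1" shows "(%N. (\<Sum>j<N. cis (real j * u)) / of_nat N) \<longlonglongrightarrow> 0"
proof (rule Lim_null_comparison)
 have "cmod ((\<Sum>j<N. cis (real j * u)) / of_nat N) <= (2 / cmod (cis u - 1)) * (1 / real N)" for N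
 proof -
  have "(\<Sum>j<N. cis (real j * u)) = (\<Sum>j<N. cis u ^ j)" by (simp add: Complex.DeMoivre)
  also have "... = (cis u ^ N - 1) / (cis u - 1)" by (rule geometric_sum[OF assms])
  finally have "(\<Sum>j<N. cis (real j * u)) = (cis u ^ N - 1) / (cis u - 1)" .
  then have "cmod (\<Sum>j<N. cis (real j * u)) = cmod (cis u ^ N - 1) / cmod (cis u - 1)" by (simp add: norm_divide)
  also have "... <= 2 / cmod (cis u - 1)"
   using norm_triangle_ineq4[of "cis u ^ N" 1] by (intro divide_right_mono) (auto simp: norm_power)
  finally have "cmod (\<Sum>j<N. cis (real j * u)) * (1 / real N) <= (2 / cmod (cis u - 1)) * (1 / real N)"
   by (rule mult_right_mono) simp
  then show ?thesis by (simp add: norm_divide)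
 qed
 then show "\<forall>\<^sub>F N in sequentially. cmod ((\<Sum>j<N. cis (real j * u)) / of_nat N) <= (2 / cmod (cis u - 1)) * (1 / real N)" by simp
 show "(%N. (2 / cmod (cis u - 1)) * (1 / real N)) \<longlonglongrightarrow> 0"
  using tendsto_mult_left[OF lim_1_over_n, of "2 / cmod (cis u - 1)"] by simp
qed

text \<open>Parseval along the multiples of a functional that separates the support.\<close>
lemma l2_le_supn:
 assumes a: "a : FC" shows "l2 a <= supn a"
proof -
 note fa = finC[OF a]
 let ?D = "(%(f, g). f \<ominus> g) ` {(f, g) : supp a \<times> supp a. f ~= g}"
 have finD: "finite ?D" using fa by (auto intro: finite_subset[of _ "supp a \<times> supp a"])
 have "?D \<subseteq> carrier V - {\<zero>}"
 proof
  fix d assume "d : ?D"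
  then obtain f g where fg: "f : supp a" "g : supp a" "f ~= g" "d = f \<ominus> g" by auto
  then have "f : carrier V" "g : carrier V" using fa by auto
  then show "d : carrier V - {\<zero>}" using fg diff_eq_0D[of f g] by auto
 qed
 then obtain F0 where F0: "F0 : dual V" "ALL d:?D. F0 d ~= 0" by (rule dual_separates_finite[OF finD])
 \<comment> \<open>Shrinks all differences \<open>F0 f - F0 g\<close> below 1 in modulus, hence
   below \<open>2 * pi\<close>, so that none of the nonzero ones is mapped to 1 by
   \<open>cis\<close>.\<close>
 define s where "s = 1 / (1 + (\<Sum>d\<in>?D. \<bar>F0 d\<bar>))"
 have B0: "0 <= (\<Sum>d\<in>?D. \<bar>F0 d\<bar>)" by (rule sum_nonneg) simp
 have B1: "0 < 1 + (\<Sum>d\<in>?D. \<bar>F0 d\<bar>)" by (rule add_pos_nonneg[OF zero_less_one B0])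
 then have s: "s > 0" unfolding s_def by (rule divide_pos_pos[OF zero_less_one])
 have ne1: "cis (s * (F0 f - F0 g)) ~= 1" if "f : supp a" "g : supp a" "f ~= g" for f g
 proof
  have cf: "f : carrier V" "g : carrier V" using that fa by auto
  have d: "f \<ominus> g : ?D" using that by auto
  have Fd: "F0 (f \<ominus> g) = F0 f - F0 g" using cf by (simp add: a_minus_def dualD[OF F0(1)])
  assume "cis (s * (F0 f - F0 g)) = 1"
  then have "cos (s * (F0 f - F0 g)) = 1" by (metis cis.simps(1) one_complex.simps(1))
  then obtain n :: int where n: "s * (F0 f - F0 g) = of_int n * 2 * pi" by (auto simp: cos_one_2pi_int)
  have "\<bar>F0 f - F0 g\<bar> <= (\<Sum>d\<in>?D. \<bar>F0 d\<bar>)"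
   using member_le_sum[OF d, of "%d. \<bar>F0 d\<bar>"] finD Fd by simp
  then have "s * \<bar>F0 f - F0 g\<bar> < 1" unfolding s_def using B1 by (simp only: times_divide_eq_left mult_1 divide_less_eq_1_pos)
  moreover have "s * \<bar>F0 f - F0 g\<bar> = \<bar>real_of_int n\<bar> * (2 * pi)"
   using arg_cong[OF n, of abs] s by (simp add: abs_mult)
  moreover have "\<bar>real_of_int n\<bar> * 1 <= \<bar>real_of_int n\<bar> * (2 * pi)"
   using pi_ge_two by (intro mult_left_mono) auto
  ultimately have "\<bar>real_of_int n\<bar> < 1" by linarith
  then have "n = 0" by linarith
  then have "F0 (f \<ominus> g) = 0" using n s Fd by simp
  then show False using F0(2) d by blast
 qed
 define Fj where "Fj j = (\<lambda>f\<in>carrier V. (real j * s) * F0 f)" for j :: nat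
 have Fj: "Fj j : dual V" for j unfolding Fj_def by (rule dual_scale[OF F0(1)])
 let ?w = "%j. WC a (Fj j)"
 have sq: "cr ((cmod (?w j))\<^sup>2) = (\<Sum>f\<in>supp a. \<Sum>g\<in>supp a. a f * cnj (a g) * cis (real j * (s * (F0 f - F0 g))))" for j
 proof -
  have "cr ((cmod (?w j))\<^sup>2) = ?w j * cnj (?w j)" by (rule complex_norm_square)
  also have "... = (\<Sum>f\<in>supp a. \<Sum>g\<in>supp a. (a f * cis (Fj j f)) * cnj (a g * cis (Fj j g)))"
   unfolding W0_comb_eq[OF Fj] cnj_sum by (rule sum_product)
  also have "... = (\<Sum>f\<in>supp a. \<Sum>g\<in>supp a. a f * cnj (a g) * cis (real j * (s * (F0 f - F0 g))))"
  proof (intro sum.cong refl)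
   fix f g assume "f : supp a" "g : supp a"
   then have "f : carrier V" "g : carrier V" using fa by auto
   then have "cis (Fj j f) * cnj (cis (Fj j g)) = cis (real j * (s * (F0 f - F0 g)))"
    by (simp add: Fj_def cis_cnj cis_mult algebra_simps)
   then show "(a f * cis (Fj j f)) * cnj (a g * cis (Fj j g)) = a f * cnj (a g) * cis (real j * (s * (F0 f - F0 g)))"
    by (simp add: mult_ac)
  qed
  finally show ?thesis .
 qed
 have avg: "cr ((\<Sum>j<N. (cmod (?w j))\<^sup>2) / real N) =
  (\<Sum>f\<in>supp a. \<Sum>g\<in>supp a. a f * cnj (a g) * ((\<Sum>j<N. cis (real j * (s * (F0 f - F0 g)))) / of_nat N))" for N
 proof -
  have "cr (\<Sum>j<N. (cmod (?w j))\<^sup>2) = (\<Sum>j<N. \<Sum>f\<in>supp a. \<Sum>g\<in>supp a. a f * cnj (a g) * cis (real j * (s * (F0 f - F0 g))))"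
   by (simp only: of_real_sum sq)
  also have "... = (\<Sum>f\<in>supp a. \<Sum>g\<in>supp a. \<Sum>j<N. a f * cnj (a g) * cis (real j * (s * (F0 f - F0 g))))"
   by (subst sum.swap, rule sum.cong[OF refl], rule sum.swap)
  finally have "cr ((\<Sum>j<N. (cmod (?w j))\<^sup>2) / real N) =
    (\<Sum>f\<in>supp a. \<Sum>g\<in>supp a. \<Sum>j<N. a f * cnj (a g) * cis (real j * (s * (F0 f - F0 g)))) / of_nat N"
   by (simp only: of_real_divide of_real_of_nat_eq)
  then show ?thesis by (simp only: sum_divide_distrib sum_distrib_left times_divide_eq_right)
 qed
 \<comment> \<open>Off the diagonal the means vanish in the limit by \<open>avg_cis_null\<close>.
   The diagonal leaves the square of \<open>l2 a\<close>, while every mean is at most the square of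
   \<open>supn a\<close>.\<close>
 have "(%N. cr ((\<Sum>j<N. (cmod (?w j))\<^sup>2) / real N)) \<longlonglongrightarrow>
  (\<Sum>f\<in>supp a. \<Sum>g\<in>supp a. a f * cnj (a g) * (if f = g then 1 else 0))"
  unfolding avg
 proof (intro tendsto_sum tendsto_mult tendsto_const)
  fix f g assume fg: "f : supp a" "g : supp a"
  show "(%N. (\<Sum>j<N. cis (real j * (s * (F0 f - F0 g)))) / of_nat N) \<longlonglongrightarrow> (if f = g then 1 else 0)"
  proof (cases "f = g")
   case True
   have "\<forall>\<^sub>F N in sequentially. (\<Sum>j<N. cis (real j * (s * (F0 f - F0 g)))) / of_nat N = 1"
    using True by (intro eventually_sequentiallyI[of 1]) simp
   then show ?thesis using True by (simp add: tendsto_eventually)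
  next
   case False
   then show ?thesis using avg_cis_null[OF ne1[OF fg]] by simp
  qed
 qed
 also have "(\<Sum>f\<in>supp a. \<Sum>g\<in>supp a. a f * cnj (a g) * (if f = g then 1 else 0)) = cr ((l2 a)\<^sup>2)"
 proof -
  have "(\<Sum>f\<in>supp a. \<Sum>g\<in>supp a. a f * cnj (a g) * (if f = g then 1 else 0)) = (\<Sum>f\<in>supp a. a f * cnj (a f))"
   using fa by (intro sum.cong refl) (simp add: if_distrib cong: if_cong)
  also have "... = (\<Sum>f\<in>supp a. cr ((cmod (a f))\<^sup>2))" by (simp only: complex_norm_square)
  also have "... = cr ((l2 a)\<^sup>2)" unfolding l2_def L2_set_def of_real_sum[symmetric] by (simp add: sum_nonneg del: of_real_sum of_real_power)
  finally show ?thesis .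
 qed
 finally have "(%N. (\<Sum>j<N. (cmod (?w j))\<^sup>2) / real N) \<longlonglongrightarrow> (l2 a)\<^sup>2" by (simp only: tendsto_of_real_iff)
 moreover have "\<forall>\<^sub>F N in sequentially. (\<Sum>j<N. (cmod (?w j))\<^sup>2) / real N <= (supn a)\<^sup>2"
 proof (rule eventually_sequentiallyI[of 1])
  fix N :: nat assume "1 <= N"
  have "(\<Sum>j<N. (cmod (?w j))\<^sup>2) <= (\<Sum>j<N. (supn a)\<^sup>2)"
   by (intro sum_mono power_mono supn_upper a Fj) auto
  then show "(\<Sum>j<N. (cmod (?w j))\<^sup>2) / real N <= (supn a)\<^sup>2" using \<open>1 <= N\<close> by (simp add: field_simps)
 qed
 ultimately have "(l2 a)\<^sup>2 <= (supn a)\<^sup>2" by (intro tendsto_upperbound[where F = sequentially]) auto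
 then show ?thesis using supn_nonneg[OF a] by (rule power2_le_imp_le)
qed

end

section \<open>Iterated squares and the limit of the maximal norms\<close>

context symp
begin

text \<open>Each application squares the maximal norm, so \<open>k\<close> of them raise it to the
  power \<open>2 ^ k\<close>, while the support is controlled by \<open>dset\<close>.\<close>

definition sq :: "real => ('v => complex) => 'v => complex" where
 "sq h a = adj h a \<star>[h] a"

lemma sq_closed: "a : FC ==> (sq h ^^ k) a : FC"
 by (induction k) (auto simp: sq_def)

lemma mx_sq: "a : FC ==> mx h ((sq h ^^ k) a) = mx h a ^ (2 ^ k)"
proof (induction k)
 case (Suc k)
 interpret P: cstar_pre "weyl_poly V h" "mx h" by (rule weyl_cstar_pre)
 have "mx h ((sq h ^^ Suc k) a) = (mx h ((sq h ^^ k) a))\<^sup>2"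
  using P.p_cstar[of "(sq h ^^ k) a"] sq_closed[OF Suc.prems] by (simp add: sq_def)
 then show ?case using Suc by (simp add: power_mult[symmetric] mult.commute)
qed simp

lemma W0_comb_sq:
 "a : FC ==> F : dual V ==>
  cmod (WC ((sq 0 ^^ k) a) F) = cmod (WC a F) ^ (2 ^ k)"
proof (induction k)
 case (Suc k)
 let ?x = "(sq 0 ^^ k) a"
 have x: "?x : FC" using sq_closed Suc.prems by blast
 have "WC ((sq 0 ^^ Suc k) a) F = cnj (WC ?x F) * WC ?x F"
  using W0_comb_star_mult[OF fin_closed(5)[OF x] x Suc.prems(2)] W0_comb_star_mult(2)[OF x x Suc.prems(2)]
  by (simp add: sq_def)
 then show ?case using Suc by (simp add: norm_mult power_mult[symmetric] mult.commute flip: power2_eq_square)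
qed simp

text \<open>Contains the supports of the iterated squares for all values of \<open>h\<close> at
  once.\<close>

fun dset :: "'v set => nat => 'v set" where
 "dset S 0 = S" |
 "dset S (Suc k) = (%(f, g). \<ominus> f \<oplus> g) ` (dset S k \<times> dset S k)"

lemma dset_finite: "finite S ==> finite (dset S k)"
 by (induction k) auto

lemma supp_sq: "a : FC ==> supp ((sq h ^^ k) a) \<subseteq> dset (supp a) k"
proof (induction k)
 case (Suc k)
 let ?x = "(sq h ^^ k) a"
 have x: "?x : FC" using sq_closed Suc.prems by blast
 have "supp ((sq h ^^ Suc k) a) \<subseteq> (%(f, g). f \<oplus> g) ` ((a_inv V ` supp ?x) \<times> supp ?x)"
  using supp_mult[of h "adj h ?x" ?x] by (simp add: sq_def supp_star[OF x])
 also have "... \<subseteq> dset (supp a) (Suc k)" using Suc by force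
 finally show ?case .
qed simp

text \<open>The iterated difference sets consist of integer combinations with coefficients bounded by
 \<open>2 ^ k\<close>, so their size is polynomial in \<open>2 ^ k\<close>.\<close>
lemma card_dset:
 assumes S: "finite S" "S \<subseteq> carrier V"
 shows "card (dset S k) <= (2 * 2 ^ k + 1) ^ card S"
proof -
 define cb where "cb n = finsum V (%s. real_of_int (n s) \<odot> s) S" for n :: "'v => int"
 have tm: "(%s. real_of_int (n s) \<odot> s) : S \<rightarrow> carrier V" for n :: "'v => int"
  using S(2) rsmult(1) by auto
 have cb_in: "cb n : carrier V" for n unfolding cb_def by (rule V.finsum_closed[OF tm])
 have cb_add: "cb (%s. m s + n s) = cb m \<oplus> cb n" for m n
 proof -
  have "cb (%s. m s + n s) = finsum V (%s. real_of_int (m s) \<odot> s \<oplus> real_of_int (n s) \<odot> s) S"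
   unfolding cb_def using S(2) tm by (intro V.finsum_cong') (auto simp: rsmult subset_iff)
  also have "... = cb m \<oplus> cb n" unfolding cb_def by (rule V.finsum_addf[OF tm tm])
  finally show ?thesis .
 qed
 have cb_diff: "cb (%s. n s - m s) = \<ominus> cb m \<oplus> cb n" for m n
 proof -
  have "cb m \<oplus> cb (%s. n s - m s) = cb n" using cb_add[of m "%s. n s - m s"] by simp
  then show ?thesis using cb_in V.r_neg1[of "cb m" "cb (%s. n s - m s)"] by metis
 qed
 \<comment> \<open>Functions vanishing outside \<open>S\<close> are determined by their restriction
   to \<open>S\<close>, so \<open>N k\<close> injects into a product of intervals, which gives the
   bound on the cardinality.\<close>
 define N where "N k = {n. (ALL s:S. \<bar>n s\<bar> <= (2::int) ^ k) & (ALL s. s ~: S --> n s = 0)}" for k :: nat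
 have sub: "dset S k \<subseteq> cb ` N k" for k
 proof (induction k)
  case 0
  show ?case
  proof
   fix s assume s: "s : dset S 0"
   let ?n = "%t. if t = s then 1 else 0 :: int"
   have "cb ?n = finsum V (%t. if s = t then t else \<zero>) S"
    unfolding cb_def
   proof (rule V.finsum_cong')
    fix t assume "t : S"
    then have t: "t : carrier V" using S by auto
    have "0 \<odot> t = \<zero>"
     using rsmult(2)[OF t, of 0 0] rsmult(1)[OF t, of 0] by (simp add: V.add.l_cancel_one')
    then show "real_of_int (?n t) \<odot> t = (if s = t then t else \<zero>)" using t rsmult(5) by simp
   qed (use S in auto)
   also have "... = s" using s S V.finsum_singleton[of s S "%t. t"] by auto
   finally have "cb ?n = s" .
   moreover have "?n : N 0" using s by (auto simp: N_def)
   ultimately show "s : cb ` N 0" by (metis image_eqI)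
  qed
 next
  case (Suc k)
  show ?case
  proof
   fix x assume "x : dset S (Suc k)"
   then obtain f g where fg: "f : dset S k" "g : dset S k" "x = \<ominus> f \<oplus> g" by auto
   then obtain m n where mn: "m : N k" "n : N k" "f = cb m" "g = cb n" using Suc by blast
   have "x = cb (%s. n s - m s)" using fg(3) mn(3,4) cb_diff by simp
   moreover have "(%s. n s - m s) : N (Suc k)"
   proof -
    have "\<bar>n s - m s\<bar> <= 2 ^ Suc k" if "s : S" for s
     using mn(1,2) that abs_triangle_ineq4[of "n s" "m s"] by (fastforce simp: N_def)
    then show ?thesis using mn by (simp add: N_def)
   qed
   ultimately show "x : cb ` N (Suc k)" by blast
  qed
 qed
 let ?P = "S \<rightarrow>\<^sub>E {-((2::int) ^ k)..2 ^ k}"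
 have inj: "inj_on (%n. restrict n S) (N k)"
  by (rule inj_onI) (auto simp: N_def fun_eq_iff restrict_def, metis)
 have im: "(%n. restrict n S) ` N k \<subseteq> ?P"
  by (auto simp: N_def abs_le_iff)
 have finP: "finite ?P" using S(1) by (intro finite_PiE) auto
 have finN: "finite (N k)" using finite_imageD[OF finite_subset[OF im finP] inj] .
 have "card (dset S k) <= card (N k)"
  using card_mono[OF finite_imageI[OF finN] sub] card_image_le[OF finN] by (rule order_trans)
 also have "card (N k) <= card ?P" using card_inj_on_le[OF inj im finP] .
 also have "... = (2 * 2 ^ k + 1) ^ card S"
  using S(1) by (simp add: card_PiE nat_add_distrib nat_mult_distrib nat_power_eq)
 finally show ?thesis .
qed

text \<open>Induction on \<open>k\<close>: the coefficient is a sum over a finite set that does not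
  involve \<open>h\<close>, and its terms are products of convergent coefficients with phases
  continuous in \<open>h\<close>.\<close>

lemma sq_coeff_tendsto:
 assumes a: "a : FC"
 shows "((%h. (sq h ^^ k) a f) \<longlongrightarrow> (sq 0 ^^ k) a f) (at_right 0)"
proof (induction k arbitrary: f)
 case (Suc k)
 let ?S = "dset (supp a) k"
 have S: "finite ?S" using finC[OF a] by (simp add: dset_finite)
 have expand: "(sq h ^^ Suc k) a f = (\<Sum>u\<in>?S. \<Sum>v\<in>?S. if \<ominus> u \<oplus> v = f then cnj ((sq h ^^ k) a u) * (sq h ^^ k) a v * ph h (\<ominus> u) v else 0)" for h
  using fin_mult_star_superset[OF symp_axioms sq_closed[OF a] S supp_sq[OF a] S supp_sq[OF a]] by (simp add: sq_def)
 have ph: "((%h. ph h u v) \<longlongrightarrow> ph 0 u v) (at_right 0)" for u v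
  unfolding ph_def by (intro tendsto_intros)
 show ?case unfolding expand
 proof (intro tendsto_sum)
  fix u v
  show "((%h. if \<ominus> u \<oplus> v = f then cnj ((sq h ^^ k) a u) * (sq h ^^ k) a v * ph h (\<ominus> u) v else 0) \<longlongrightarrow>
   (if \<ominus> u \<oplus> v = f then cnj ((sq 0 ^^ k) a u) * (sq 0 ^^ k) a v * ph 0 (\<ominus> u) v else 0)) (at_right 0)"
   by (cases "\<ominus> u \<oplus> v = f") (auto intro!: tendsto_mult tendsto_cnj Suc.IH ph simp del: ph_0)
 qed
qed simp

lemma l2_sq_tendsto:
 assumes a: "a : FC"
 shows "((%h. l2 ((sq h ^^ k) a)) \<longlongrightarrow> l2 ((sq 0 ^^ k) a)) (at_right 0)"
proof -
 have S: "finite (dset (supp a) k)" using finC[OF a] by (simp add: dset_finite)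
 show ?thesis
  unfolding l2_superset[OF S supp_sq[OF a]] L2_set_def
  by (intro tendsto_real_sqrt tendsto_sum tendsto_power tendsto_norm sq_coeff_tendsto[OF a])
qed

end

text \<open>The exponent is absorbed by \<open>x = root p r\<close>: the expression is the
  \<open>p\<close>-th power of \<open>(2 n + 1) * x ^ n\<close>, which tends to 0.\<close>

lemma poly_times_power_null:
 fixes r :: real assumes "0 <= r" "r < 1"
 shows "(%n. (2 * real n + 1) ^ p * r ^ n) \<longlonglongrightarrow> 0"
proof (cases "p = 0")
 case True
 then show ?thesis using LIMSEQ_realpow_zero[OF assms] by simp
next
 case False
 define x where "x = root p r"
 have x: "0 <= x" "x < 1" "x ^ p = r"
  using assms False by (auto simp: x_def)
 have "(%n. 2 * (real n * x ^ n) + x ^ n) \<longlonglongrightarrow> 2 * 0 + 0"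
  using x by (intro tendsto_intros powser_times_n_limit_0 LIMSEQ_realpow_zero) auto
 then have "(%n. (2 * (real n * x ^ n) + x ^ n) ^ p) \<longlonglongrightarrow> 0 ^ p" by (intro tendsto_power) simp
 moreover have "(2 * (real n * x ^ n) + x ^ n) ^ p = (2 * real n + 1) ^ p * r ^ n" for n
 proof -
  have "2 * (real n * x ^ n) + x ^ n = (2 * real n + 1) * x ^ n" by (simp add: algebra_simps)
  then show ?thesis using x(3) by (simp add: power_mult_distrib flip: power_mult) (metis mult.commute power_mult)
 qed
 ultimately show ?thesis using False by (simp add: power_0_left)
qed

text \<open>A strict gap between the bases wins over every polynomial factor; \<open>n\<close> is
  taken of the form \<open>2 ^ k\<close> to match the iterated squares.\<close>

lemma poly_times_power_less:
 fixes s t :: real assumes "0 <= s" "s < t"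
 obtains k :: nat where "(2 * 2 ^ k + 1) ^ p * s ^ (2 ^ k) < t ^ (2 ^ k)"
proof -
 have t: "t > 0" using assms by simp
 have "(%n. (2 * real n + 1) ^ p * (s / t) ^ n) \<longlonglongrightarrow> 0"
  using assms by (intro poly_times_power_null) auto
 then have "\<forall>\<^sub>F n in sequentially. (2 * real n + 1) ^ p * (s / t) ^ n < 1" by (rule order_tendstoD(2)) simp
 then obtain N where N: "!!n. n >= N ==> (2 * real n + 1) ^ p * (s / t) ^ n < 1" by (auto simp: eventually_sequentially)
 have "(2 * real (2 ^ N) + 1) ^ p * (s / t) ^ (2 ^ N) < 1" by (rule N) (simp add: less_imp_le)
 then have "(2 * 2 ^ N + 1) ^ p * s ^ (2 ^ N) < t ^ (2 ^ N)" using t by (simp add: power_divide field_simps)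
 then show thesis by (rule that)
qed

context psymp
begin

text \<open>Every one of the norms in question is squeezed between the \<open>l2\<close>- and the \<open>l1\<close>-norm, which on
 the iterated squares differ by a subexponential factor only.\<close>
theorem mx_tendsto_supn:
 assumes a: "a : FC"
 shows "((%h. mx h a) \<longlongrightarrow> supn a) (at_right 0)"
proof -
 note fa = finC[OF a]
 let ?D = "dset (supp a)"
 have finD: "finite (?D k)" for k using fa by (simp add: dset_finite)
 define p where "p = card (supp a)"
 have cardD: "sqrt (card (?D k)) <= (2 * 2 ^ k + 1) ^ p" for k
 proof -
  have "real (card (?D k)) <= real ((2 * 2 ^ k + 1) ^ p)" using card_dset[OF fa] unfolding p_def of_nat_le_iff .
  moreover have "sqrt (card (?D k)) <= card (?D k)"
  proof (cases "card (?D k) = 0")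
   case False
   then have "1 <= real (card (?D k))" by linarith
   then show ?thesis by (intro real_le_lsqrt) (auto simp: power2_eq_square)
  qed simp
  ultimately show ?thesis by (simp add: add.commute)
 qed
 have mxnn: "0 <= mx h a" for h using l2_le_mx[OF a, of h] l2_nonneg[of a] by linarith
 have upper: "\<forall>\<^sub>F h in at_right 0. mx h a < t" if t: "supn a < t" for t
 proof -
  have t0: "t > 0" using supn_nonneg[OF a] t by linarith
  \<comment> \<open>\<open>k\<close> is fixed at parameter 0, where the supremum norm dominates
    \<open>l2\<close>. Only afterwards \<open>h\<close> tends to 0, and the \<open>l2\<close> norm
    of the one fixed iterate is continuous there.\<close>
  obtain k where k: "(2 * 2 ^ k + 1) ^ p * supn a ^ (2 ^ k) < t ^ (2 ^ k)"
   using poly_times_power_less[OF supn_nonneg[OF a] t] by blast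
  let ?x = "%h. (sq h ^^ k) a"
  have "l2 (?x 0) <= supn (?x 0)" using l2_le_supn sq_closed[OF a] by blast
  also have "... <= supn a ^ (2 ^ k)"
   by (rule supn_least) (simp add: W0_comb_sq[OF a] power_mono supn_upper[OF a])
  finally have "(2 * 2 ^ k + 1) ^ p * l2 (?x 0) <= (2 * 2 ^ k + 1) ^ p * supn a ^ (2 ^ k)" by (rule mult_left_mono) simp
  then have lt: "(2 * 2 ^ k + 1) ^ p * l2 (?x 0) < t ^ (2 ^ k)" using k by linarith
  have "((%h. (2 * 2 ^ k + 1) ^ p * l2 (?x h)) \<longlongrightarrow> (2 * 2 ^ k + 1) ^ p * l2 (?x 0)) (at_right 0)"
   by (intro tendsto_mult_left l2_sq_tendsto[OF a])
  then have "\<forall>\<^sub>F h in at_right 0. (2 * 2 ^ k + 1) ^ p * l2 (?x h) < t ^ (2 ^ k)" using lt by (rule order_tendstoD(2))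
  then show ?thesis
  proof eventually_elim
   case (elim h)
   have "mx h a ^ (2 ^ k) = mx h (?x h)" using mx_sq[OF a] by simp
   also have "... <= l1 (?x h)" by (rule mx_le_l1[OF sq_closed[OF a]])
   also have "... <= sqrt (card (?D k)) * l2 (?x h)" by (rule l1_le_l2[OF finD supp_sq[OF a]])
   also have "... <= (2 * 2 ^ k + 1) ^ p * l2 (?x h)" by (rule mult_right_mono[OF cardD l2_nonneg])
   also have "... < t ^ (2 ^ k)" by (rule elim)
   finally show "mx h a < t" using t0 by (metis power_less_imp_less_base less_imp_le)
  qed
 qed
 have lower: "\<forall>\<^sub>F h in at_right 0. t < mx h a" if t: "t < supn a" for t
 proof (cases "t < 0")
  case True
  then show ?thesis using mxnn by (intro always_eventually) (auto intro: less_le_trans)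
 next
  case False
  obtain F where F: "F : dual V" "t < cmod (WC a F)"
   using t unfolding supn_def
   by (subst (asm) less_cSUP_iff[OF dual_nonempty bdd_aboveI2[of _ _ "l1 a"]]) (auto intro: W0_comb_le_l1[OF a])
  let ?s = "cmod (WC a F)"
  \<comment> \<open>The mirror image of the upper estimate: the value at a single functional
    \<open>F\<close> is at most the \<open>l1\<close> norm, and \<open>mx h\<close> is at least the
    \<open>l2\<close> norm.\<close>
  obtain k where k: "(2 * 2 ^ k + 1) ^ p * t ^ (2 ^ k) < ?s ^ (2 ^ k)"
   using poly_times_power_less[of t ?s] False F(2) by auto
  let ?x = "%h. (sq h ^^ k) a"
  have "?s ^ (2 ^ k) = cmod (WC (?x 0) F)" using W0_comb_sq[OF a F(1)] by simp
  also have "... <= l1 (?x 0)" by (rule W0_comb_le_l1[OF sq_closed[OF a] F(1)])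
  also have "... <= sqrt (card (?D k)) * l2 (?x 0)" by (rule l1_le_l2[OF finD supp_sq[OF a]])
  also have "... <= (2 * 2 ^ k + 1) ^ p * l2 (?x 0)" by (rule mult_right_mono[OF cardD l2_nonneg])
  finally have "(2 * 2 ^ k + 1) ^ p * t ^ (2 ^ k) < (2 * 2 ^ k + 1) ^ p * l2 (?x 0)" using k by linarith
  then have "t ^ (2 ^ k) < l2 (?x 0)" by (simp add: add_pos_pos)
  then have "\<forall>\<^sub>F h in at_right 0. t ^ (2 ^ k) < l2 (?x h)" using l2_sq_tendsto[OF a] order_tendstoD(1) by blast
  then show ?thesis
  proof eventually_elim
   case (elim h)
   have "t ^ (2 ^ k) < mx h (?x h)" using elim l2_le_mx[OF sq_closed[OF a, where h=h and k=k], where h=h] by linarith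
   then have "t ^ (2 ^ k) < mx h a ^ (2 ^ k)" using mx_sq[OF a] by simp
   then show "t < mx h a" using mxnn by (rule power_less_imp_less_base)
  qed
 qed
 show ?thesis by (rule order_tendstoI) (use upper lower in auto)
qed

end

section \<open>Homomorphisms induced by a character and an additive symplectic map\<close>

locale symp_hom = V: symp V + U: symp U for V U :: "'v symplectic_tvs" +
 fixes \<omega> :: "'v => complex" and T :: "'v => 'v"
 assumes char: "additive_character V \<omega>" and sympl: "additive_symplectic V U T"
begin

lemma \<omega>: "f : carrier V ==> cmod (\<omega> f) = 1"
 "f : carrier V ==> g : carrier V ==> \<omega> (f \<oplus>\<^bsub>V\<^esub> g) = \<omega> f * \<omega> g"
 using char by (auto simp: additive_character_def)

lemma T: "f : carrier V ==> T f : carrier U"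
 "f : carrier V ==> g : carrier V ==> T (f \<oplus>\<^bsub>V\<^esub> g) = T f \<oplus>\<^bsub>U\<^esub> T g"
 "f : carrier V ==> g : carrier V ==> sform U (T f) (T g) = sform V f g"
 "T \<zero>\<^bsub>V\<^esub> = \<zero>\<^bsub>U\<^esub>"
 using sympl by (auto simp: additive_symplectic_def)

lemma \<omega>_zero [simp]: "\<omega> \<zero>\<^bsub>V\<^esub> = 1"
 using \<omega>(2)[of "\<zero>\<^bsub>V\<^esub>" "\<zero>\<^bsub>V\<^esub>"] \<omega>(1)[of "\<zero>\<^bsub>V\<^esub>"] by (metis V.V.l_zero V.V.zero_closed mult_cancel_left1 norm_zero zero_neq_one)

lemma T_neg: "f : carrier V ==> T (\<ominus>\<^bsub>V\<^esub> f) = \<ominus>\<^bsub>U\<^esub> T f"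
proof -
 assume f: "f : carrier V"
 have "T (\<ominus>\<^bsub>V\<^esub> f) \<oplus>\<^bsub>U\<^esub> T f = \<zero>\<^bsub>U\<^esub>" using T(2)[of "\<ominus>\<^bsub>V\<^esub> f" f] f T(4) by (simp add: V.V.l_neg)
 then show ?thesis using U.V.minus_equality[of "T (\<ominus>\<^bsub>V\<^esub> f)" "T f"] T(1) f by (metis V.V.a_inv_closed)
qed

lemma \<omega>_neg: "f : carrier V ==> \<omega> (\<ominus>\<^bsub>V\<^esub> f) = cnj (\<omega> f)"
proof -
 assume f: "f : carrier V"
 have 1: "\<omega> (\<ominus>\<^bsub>V\<^esub> f) * \<omega> f = 1" using \<omega>(2)[of "\<ominus>\<^bsub>V\<^esub> f" f] f by (simp add: V.V.l_neg)
 have 2: "cnj (\<omega> f) * \<omega> f = 1" using \<omega>(1)[OF f] by (metis complex_norm_square mult.commute of_real_1 power_one)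
 have "\<omega> f ~= 0" using \<omega>(1)[OF f] by auto
 then show ?thesis using 1 2 by (metis mult_right_cancel)
qed

text \<open>A difference in the kernel would be orthogonal to everything, and the form of
  \<open>V\<close> is nondegenerate.\<close>

lemma T_inj: "inj_on T (carrier V)"
proof (rule inj_onI)
 fix f g assume fg: "f : carrier V" "g : carrier V" "T f = T g"
 have "sform V (f \<ominus>\<^bsub>V\<^esub> g) k = 0" if k: "k : carrier V" for k
 proof -
  have "sform V f k = sform V g k" using T(3)[OF fg(1) k] T(3)[OF fg(2) k] fg(3) by simp
  then show ?thesis using fg k by (simp add: a_minus_def V.sform_add)
 qed
 then have "f \<ominus>\<^bsub>V\<^esub> g = \<zero>\<^bsub>V\<^esub>" using V.sform_nondeg[of "f \<ominus>\<^bsub>V\<^esub> g"] fg by simp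
 then show "f = g" using V.diff_eq_0D fg by blast
qed

text \<open>The coefficient form of \<open>W(f) \<mapsto> \<omega>(f) W(T f)\<close>. It does not
  involve the parameter and is a homomorphism for each value of it, because \<open>T\<close>
  preserves the form and with it every phase.\<close>

definition push :: "('v => complex) => 'v => complex" where
 "push a = (%k. \<Sum>f\<in>supp a. if T f = k then \<omega> f * a f else 0)"

lemma push_superset:
 "finite S ==> supp a \<subseteq> S ==> push a k = (\<Sum>f\<in>S. if T f = k then \<omega> f * a f else 0)"
 unfolding push_def by (rule sum.mono_neutral_left) (auto simp: supp_def)

lemma push_T:
 assumes "a : fin_coeffs V" "f : carrier V" shows "push a (T f) = \<omega> f * a f"
proof -
 note fa = V.finC[OF assms(1)]
 have "push a (T f) = (\<Sum>g\<in>insert f (supp a). if T g = T f then \<omega> g * a g else 0)"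
  by (rule push_superset) (use fa in auto)
 also have "... = (\<Sum>g\<in>insert f (supp a). if g = f then \<omega> g * a g else 0)"
  using T_inj fa(2) assms(2) by (intro sum.cong refl) (auto dest: inj_onD)
 also have "... = \<omega> f * a f" using fa by simp
 finally show ?thesis .
qed

lemma supp_push: "supp (push a) \<subseteq> T ` supp a"
proof
 fix k assume "k : supp (push a)"
 then have "(\<Sum>f\<in>supp a. if T f = k then \<omega> f * a f else 0) ~= 0" by (simp add: supp_iff push_def)
 then obtain f where "f : supp a" "(if T f = k then \<omega> f * a f else 0) ~= 0" by (rule sum.not_neutral_contains_not_neutral)
 then show "k : T ` supp a" by (auto split: if_splits)
qed

lemma push_closed: "a : fin_coeffs V ==> push a : fin_coeffs U"
proof -
 assume a: "a : fin_coeffs V"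
 have "T ` supp a \<subseteq> carrier U" using T(1) V.finC(2)[OF a] by blast
 moreover have "finite (T ` supp a)" using V.finC(1)[OF a] by simp
 ultimately show ?thesis using supp_push[of a] finite_subset unfolding fin_coeffs_iff by blast
qed

lemma push_zero: "push (%_. 0) = (%_. 0)"
 by (simp add: push_def supp_def)

lemma push_eq_0D:
 assumes a: "a : fin_coeffs V" and z: "push a = (%_. 0)" shows "a = (%_. 0)"
proof
 fix f
 show "a f = 0"
 proof (cases "f : carrier V")
  case True
  then show ?thesis using push_T[OF a True] z \<omega>(1)[OF True] by auto
 next
  case False
  then show ?thesis using V.finC(2)[OF a] by (auto simp: supp_def)
 qed
qed

lemma push_symbol: "push (ws f) = (%k. \<omega> f * ws (T f) k)"
 unfolding push_def V.supp_symbol by (auto simp: weyl_symbol_def)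

lemma push_linear:
 assumes a: "a : fin_coeffs V" and b: "b : fin_coeffs V"
 shows "push (%f. a f + b f) = (%f. push a f + push b f)" "push (%f. c * a f) = (%f. c * push a f)"
proof -
 let ?S = "supp a \<union> supp b"
 have S: "finite ?S" "supp a \<subseteq> ?S" "supp b \<subseteq> ?S" "supp (%f. a f + b f) \<subseteq> ?S" "supp (%f. c * a f) \<subseteq> ?S"
  using V.finC[OF a] V.finC[OF b] by (auto simp: supp_def)
 show "push (%f. a f + b f) = (%f. push a f + push b f)"
  unfolding push_superset[OF S(1,2)] push_superset[OF S(1,3)] sum.distrib[symmetric]
  by (rule ext, subst push_superset[OF S(1,4)], intro sum.cong refl) (simp add: algebra_simps)
 show "push (%f. c * a f) = (%f. c * push a f)"
  unfolding push_superset[OF S(1,2)] sum_distrib_left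
  by (rule ext, subst push_superset[OF S(1,5)], intro sum.cong refl) (simp add: algebra_simps)
qed

lemma push_mult:
 assumes a: "a : fin_coeffs V" and b: "b : fin_coeffs V"
 shows "push (a \<otimes>\<^bsub>weyl_poly V h\<^esub> b) = push a \<otimes>\<^bsub>weyl_poly U h\<^esub> push b"
proof
 fix k
 note fa = V.finC[OF a] and fb = V.finC[OF b]
 let ?X = "(%(f, g). f \<oplus>\<^bsub>V\<^esub> g) ` (supp a \<times> supp b)"
 have injA: "inj_on T (supp a)" "inj_on T (supp b)" using T_inj fa fb inj_on_subset by blast+
 have "push (a \<otimes>\<^bsub>weyl_poly V h\<^esub> b) k = (\<Sum>m\<in>?X. (a \<otimes>\<^bsub>weyl_poly V h\<^esub> b) m * (if T m = k then \<omega> m else 0))"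
  using fa fb by (subst push_superset[OF _ V.supp_mult]) (auto intro!: sum.cong)
 also have "... = (\<Sum>f\<in>supp a. \<Sum>g\<in>supp b. a f * b g * V.ph h f g * (if T (f \<oplus>\<^bsub>V\<^esub> g) = k then \<omega> (f \<oplus>\<^bsub>V\<^esub> g) else 0))"
  by (rule V.weyl_pairing) (use fa fb in auto)
 also have "... = (\<Sum>f\<in>supp a. \<Sum>g\<in>supp b. if T f \<oplus>\<^bsub>U\<^esub> T g = k then push a (T f) * push b (T g) * U.ph h (T f) (T g) else 0)"
 proof (intro sum.cong refl)
  fix f g assume "f : supp a" "g : supp b"
  then have c: "f : carrier V" "g : carrier V" using fa fb by auto
  show "a f * b g * V.ph h f g * (if T (f \<oplus>\<^bsub>V\<^esub> g) = k then \<omega> (f \<oplus>\<^bsub>V\<^esub> g) else 0) =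
   (if T f \<oplus>\<^bsub>U\<^esub> T g = k then push a (T f) * push b (T g) * U.ph h (T f) (T g) else 0)"
   using c by (simp add: T \<omega> push_T[OF a] push_T[OF b] V.ph_def U.ph_def)
 qed
 also have "... = (\<Sum>x\<in>T ` supp a. \<Sum>y\<in>T ` supp b. if x \<oplus>\<^bsub>U\<^esub> y = k then push a x * push b y * U.ph h x y else 0)"
  by (simp add: sum.reindex[OF injA(1)] sum.reindex[OF injA(2)])
 also have "... = (push a \<otimes>\<^bsub>weyl_poly U h\<^esub> push b) k"
  by (rule U.weyl_mult[symmetric]) (use fa fb supp_push in auto)
 finally show "push (a \<otimes>\<^bsub>weyl_poly V h\<^esub> b) k = (push a \<otimes>\<^bsub>weyl_poly U h\<^esub> push b) k" .
qed

lemma push_star: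
 assumes a: "a : fin_coeffs V"
 shows "push (star (weyl_poly V h) a) = star (weyl_poly U h) (push a)"
proof
 fix k
 note fa = V.finC[OF a]
 have "push (star (weyl_poly V h) a) k = (\<Sum>f\<in>a_inv V ` supp a. if T f = k then \<omega> f * star (weyl_poly V h) a f else 0)"
  by (simp only: push_def V.supp_star[OF a])
 also have "... = (\<Sum>f\<in>supp a. if T (\<ominus>\<^bsub>V\<^esub> f) = k then \<omega> (\<ominus>\<^bsub>V\<^esub> f) * star (weyl_poly V h) a (\<ominus>\<^bsub>V\<^esub> f) else 0)"
  by (subst sum.reindex[OF V.inj_neg[OF fa(2)]]) simp
 also have "... = (\<Sum>f\<in>supp a. if \<ominus>\<^bsub>U\<^esub> T f = k then cnj (\<omega> f * a f) else 0)"
 proof (intro sum.cong refl)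
  fix f assume "f : supp a"
  then have "f : carrier V" using fa by auto
  then show "(if T (\<ominus>\<^bsub>V\<^esub> f) = k then \<omega> (\<ominus>\<^bsub>V\<^esub> f) * star (weyl_poly V h) a (\<ominus>\<^bsub>V\<^esub> f) else 0) =
    (if \<ominus>\<^bsub>U\<^esub> T f = k then cnj (\<omega> f * a f) else 0)"
   by (simp add: T_neg \<omega>_neg V.weyl_star)
 qed
 also have "... = star (weyl_poly U h) (push a) k"
 proof (cases "k : carrier U")
  case True
  have "star (weyl_poly U h) (push a) k = (\<Sum>f\<in>supp a. cnj (if T f = \<ominus>\<^bsub>U\<^esub> k then \<omega> f * a f else 0))"
   using True by (simp add: U.weyl_star push_def)
  also have "... = (\<Sum>f\<in>supp a. if \<ominus>\<^bsub>U\<^esub> T f = k then cnj (\<omega> f * a f) else 0)"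
  proof (intro sum.cong refl)
   fix f assume "f : supp a"
   then have "T f : carrier U" using fa T(1) by auto
   then have "T f = \<ominus>\<^bsub>U\<^esub> k \<longleftrightarrow> \<ominus>\<^bsub>U\<^esub> T f = k" using True by (metis U.V.minus_minus)
   then show "cnj (if T f = \<ominus>\<^bsub>U\<^esub> k then \<omega> f * a f else 0) = (if \<ominus>\<^bsub>U\<^esub> T f = k then cnj (\<omega> f * a f) else 0)" by simp
  qed
  finally show ?thesis by simp
 next
  case False
  have "(if \<ominus>\<^bsub>U\<^esub> T f = k then cnj (\<omega> f * a f) else 0) = 0" if "f : supp a" for f
   using False fa T(1) that by (metis U.V.a_inv_closed subsetD)
  then show ?thesis using False by (simp add: U.weyl_star sum.neutral)
 qed
 finally show "push (star (weyl_poly V h) a) k = star (weyl_poly U h) (push a) k" .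
qed

text \<open>Along the injective homomorphism \<open>push\<close> the maximal norm of
  \<open>U\<close> pulls back to a C*-norm on the polynomials over \<open>V\<close>, and this lies
  below the maximal one. Injectivity gives definiteness.\<close>

lemma push_contractive: "a : fin_coeffs V ==> U.mx h (push a) <= V.mx h a"
proof (rule V.cstar_norm_le_mx)
 interpret P: cstar_pre "weyl_poly U h" "U.mx h" by (rule U.weyl_cstar_pre)
 show "cstar_norm (weyl_poly V h) (%a. U.mx h (push a))"
  unfolding cstar_norm_def V.weyl_poly_simps
 proof (intro conjI ballI allI)
  fix a assume a: "a : fin_coeffs V"
  note pa = push_closed[OF a]
  show "0 <= U.mx h (push a)" using P.p_nonneg pa by simp
  show "U.mx h (push a) = 0 \<longleftrightarrow> a = (%_. 0)"
   using P.p_eq_0_iff[of "push a"] pa push_eq_0D[OF a] push_zero by auto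
  show "U.mx h (push (%f. c * a f)) = cmod c * U.mx h (push a)" for c
   using P.p_smult[of "push a" c] pa by (simp add: push_linear(2)[OF a a])
  show "U.mx h (push (star (weyl_poly V h) a \<otimes>\<^bsub>weyl_poly V h\<^esub> a)) = (U.mx h (push a))\<^sup>2"
   using P.p_cstar[of "push a"] pa a by (simp add: push_mult push_star)
  fix b assume b: "b : fin_coeffs V"
  note pb = push_closed[OF b]
  show "U.mx h (push (%f. a f + b f)) <= U.mx h (push a) + U.mx h (push b)"
   using P.p_add[of "push a" "push b"] pa pb by (simp add: push_linear(1)[OF a b])
  show "U.mx h (push (a \<otimes>\<^bsub>weyl_poly V h\<^esub> b)) <= U.mx h (push a) * U.mx h (push b)"
   using P.p_mult[of "push a" "push b"] pa pb by (simp add: push_mult[OF a b])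
 qed
qed

theorem weyl_hom_exists:
 obtains \<beta> where "\<beta> : star_hom (weyl_algebra V h) (weyl_algebra U h)"
  "!!a. a : fin_coeffs V ==> \<beta> (weyl_embed V h a) = weyl_embed U h (push a)"
proof -
 interpret P: cstar_pre "weyl_poly V h" "V.mx h" by (rule V.weyl_cstar_pre)
 interpret Q: cstar_pre "weyl_poly U h" "U.mx h" by (rule U.weyl_cstar_pre)
 let ?g = "\<lambda>a\<in>fin_coeffs V. weyl_embed U h (push a)"
 have E: "weyl_embed U h = Q.E" by (simp add: weyl_embed_def fun_eq_iff)
 have W: "weyl_algebra U h = Q.Compl" "weyl_algebra V h = P.Compl" by (simp_all add: weyl_algebra_def)
 have "?g : star_hom (weyl_poly V h) (weyl_algebra U h)"
 proof (rule star_homI)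
  fix a assume a: "a : carrier (weyl_poly V h)"
  then have a': "a : fin_coeffs V" "push a : carrier (weyl_poly U h)" by (simp_all add: push_closed)
  note Ea = Q.E_simps[OF a'(2) a'(2)]
  show "?g a : carrier (weyl_algebra U h)" using a' Ea by (simp add: E W)
  show "?g (c \<odot>\<^bsub>weyl_poly V h\<^esub> a) = c \<odot>\<^bsub>weyl_algebra U h\<^esub> ?g a" for c
   using a' Q.E_simps(4)[OF a'(2) a'(2), of c] by (simp add: E W push_linear(2)[OF a'(1) a'(1)])
  show "?g (star (weyl_poly V h) a) = star (weyl_algebra U h) (?g a)"
   using a' Ea(5) by (simp add: E W push_star)
  fix b assume b: "b : carrier (weyl_poly V h)"
  then have b': "b : fin_coeffs V" "push b : carrier (weyl_poly U h)" by (simp_all add: push_closed)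
  show "?g (a \<oplus>\<^bsub>weyl_poly V h\<^esub> b) = ?g a \<oplus>\<^bsub>weyl_algebra U h\<^esub> ?g b"
   using a' b' Q.E_simps(2)[OF a'(2) b'(2)] by (simp add: E W push_linear(1)[OF a'(1) b'(1)])
  show "?g (a \<otimes>\<^bsub>weyl_poly V h\<^esub> b) = ?g a \<otimes>\<^bsub>weyl_algebra U h\<^esub> ?g b"
   using a' b' Q.E_simps(3)[OF a'(2) b'(2)] by (simp add: E W push_mult[OF a'(1) b'(1)])
 next
  show "?g \<one>\<^bsub>weyl_poly V h\<^esub> = \<one>\<^bsub>weyl_algebra U h\<^esub>"
   using Q.E_simps(6)[OF Q.zero_closed Q.zero_closed] by (simp add: push_symbol T(4) E W)
  show "?g : extensional (carrier (weyl_poly V h))" by simp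
 qed
 note hom = this
 have le: "cnorm (weyl_algebra U h) (?g a) <= V.mx h a" if "a : carrier (weyl_poly V h)" for a
  using Q.E_simps(9)[of "push a" "push a"] push_closed[of a] push_contractive[of a h] that by (simp add: E W)
 have c: "cstar (weyl_algebra U h) (cnorm (weyl_algebra U h))" unfolding W by (rule Q.Compl_cstar)
 obtain k where k: "k : star_hom P.Compl (weyl_algebra U h)" "!!a. a : carrier (weyl_poly V h) ==> k (P.E a) = ?g a"
  using P.completion_extend[OF c hom le] by blast
 show thesis
 proof (rule that)
  show "k : star_hom (weyl_algebra V h) (weyl_algebra U h)" using k(1) by (simp only: W)
  show "k (weyl_embed V h a) = weyl_embed U h (push a)" if "a : fin_coeffs V" for a
   using k(2)[of a] that by (simp add: weyl_embed_def)
 qed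
qed

end

section \<open>Bogolyubov's theorem on the integers and the reals\<close>

lemma norm_cis_minus_1: "(cmod (cis x - 1))\<^sup>2 = 2 - 2 * cos x"
proof -
 have "(cmod (cis x - 1))\<^sup>2 = (cos x - 1)\<^sup>2 + (sin x)\<^sup>2" by (simp add: cmod_power2)
 also have "... = 2 - 2 * cos x" using sin_cos_squared_add[of x] by (simp add: power2_eq_square algebra_simps)
 finally show ?thesis .
qed

lemma norm_cis_minus_1_le: "cmod (cis x - 1) <= \<bar>x\<bar>"
proof (rule power2_le_imp_le)
 have "2 - 2 * cos x = 4 * (sin (x / 2))\<^sup>2" using cos_double_sin[of "x/2"] by simp
 also have "... <= 4 * (x / 2)\<^sup>2"
  using iffD1[OF abs_le_square_iff abs_sin_x_le_abs_x[of "x/2"]] by simp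
 also have "4 * (x / 2)\<^sup>2 = \<bar>x\<bar>\<^sup>2" by (simp add: power2_eq_square)
 finally show "(cmod (cis x - 1))\<^sup>2 <= \<bar>x\<bar>\<^sup>2" by (simp only: norm_cis_minus_1)
qed simp

lemma norm_cis_diff_mult: "cmod (cis (x + y) - 1) <= cmod (cis x - 1) + cmod (cis y - 1)"
proof -
 have "cis (x + y) - 1 = cis x * (cis y - 1) + (cis x - 1)" by (simp add: cis_mult[symmetric] algebra_simps)
 then have "cmod (cis (x + y) - 1) <= cmod (cis x * (cis y - 1)) + cmod (cis x - 1)"
  by (metis norm_triangle_ineq)
 then show ?thesis by (simp add: norm_mult)
qed

lemma sum_root_of_unity:
 fixes K :: nat and n :: int
 assumes "K > 0"
 shows "(\<Sum>r<K. cis (2 * pi * real r * of_int n / real K)) = (if int K dvd n then of_nat K else 0)"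
proof -
 let ?z = "cis (2 * pi * of_int n / real K)"
 have pow: "cis (2 * pi * real r * of_int n / real K) = ?z ^ r" for r
 proof -
  have "?z ^ r = cis (real r * (2 * pi * of_int n / real K))" by (rule Complex.DeMoivre)
  then show ?thesis by (simp add: mult_ac)
 qed
 show ?thesis
 proof (cases "int K dvd n")
  case True
  then obtain k where "n = int K * k" by blast
  then have "?z = 1" using assms by (auto simp: cis_eq_1_iff)
  then show ?thesis using True by (simp add: pow)
 next
  case False
  have "?z ~= 1"
  proof
   assume "?z = 1"
   then obtain m where "2 * pi * of_int n / real K = of_int m * (2 * pi)" by (auto simp: cis_eq_1_iff)
   then have "real_of_int n = of_int m * real K" using assms by (simp add: field_simps)
   then have "n = m * int K" by (metis of_int_eq_iff of_int_mult of_int_of_nat_eq)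
   then show False using False by simp
  qed
  moreover have "?z ^ K = 1"
   using assms by (simp add: pow[symmetric] cis_eq_1_iff)
  ultimately show ?thesis using False by (simp add: pow geometric_sum)
 qed
qed

text \<open>Bogolyubov's argument: the frequencies at which the exponential sum over \<open>A\<close> is large are few,
 and they control membership in \<open>A - A + A - A\<close>.\<close>
lemma bogolyubov_finite:
 fixes A :: "int set" and M :: nat and \<rho> :: real
 assumes A: "A \<subseteq> {0..<int M}" and M: "M > 0" and \<rho>: "\<rho> > 0" and card: "real (card A) >= \<rho> * real M"
 obtains R where "R \<subseteq> {..<3 * M}" "real (card R) <= 18 / \<rho> ^ 4"
  "ALL x. \<bar>x\<bar> < int M --> (ALL r:R. cmod (cis (2 * pi * real r * of_int x / real (3 * M)) - 1) < 1) -->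
   (EX a:A. EX b:A. EX c:A. EX d:A. x = a - b + c - d)"
proof -
 \<comment> \<open>With entries of \<open>A\<close> in \<open>{0..<M}\<close> and
   \<open>\<bar>x\<bar> < M\<close>, the number \<open>a - b + c - d - x\<close> is smaller than
   \<open>3 * M\<close> in modulus, so it is divisible by \<open>K\<close> only if it is 0.\<close>
 define K where "K = 3 * M"
 have K: "K > 0" using M by (simp add: K_def)
 have fin: "finite A" using A finite_subset by blast
 have cardA: "card A <= M" using card_mono[OF _ A] by simp
 define w where "w = (%r::nat. %n::int. cis (2 * pi * real r * of_int n / real K))"
 have w_add: "w r m * w r n = w r (m + n)" for r m n
  by (simp add: w_def cis_mult add_divide_distrib[symmetric] algebra_simps)
 have w_cnj: "cnj (w r n) = w r (- n)" for r n by (simp add: w_def cis_cnj)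
 have w_sum: "(\<Sum>r<K. w r n) = (if int K dvd n then of_nat K else 0)" for n
  unfolding w_def by (rule sum_root_of_unity[OF K])
 define S where "S = (%r. \<Sum>a\<in>A. w r a)"
 have SS: "cr ((cmod (S r))\<^sup>2) = (\<Sum>a\<in>A. \<Sum>b\<in>A. w r (a - b))" for r
 proof -
  have "cr ((cmod (S r))\<^sup>2) = S r * cnj (S r)" by (rule complex_norm_square)
  also have "... = (\<Sum>a\<in>A. \<Sum>b\<in>A. w r a * w r (- b))" by (simp add: S_def sum_product w_cnj)
  finally show ?thesis by (simp add: w_add)
 qed
 have small: "int K dvd n \<longleftrightarrow> n = 0" if "\<bar>n\<bar> < int K" for n
  using that zdvd_imp_le[of "int K" "\<bar>n\<bar>"] by (cases "n = 0") auto
 have A_range: "0 <= a" "a < int M" if "a : A" for a using A that by auto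
 have parseval: "(\<Sum>r<K. (cmod (S r))\<^sup>2) = real K * real (card A)"
 proof -
  have "cr (\<Sum>r<K. (cmod (S r))\<^sup>2) = (\<Sum>r<K. \<Sum>a\<in>A. \<Sum>b\<in>A. w r (a - b))" by (simp add: SS del: of_real_power)
  also have "... = (\<Sum>a\<in>A. \<Sum>b\<in>A. \<Sum>r<K. w r (a - b))"
   by (subst sum.swap, rule sum.cong[OF refl], rule sum.swap)
  also have "... = (\<Sum>a\<in>A. \<Sum>b\<in>A. if a = b then of_nat K else 0)"
  proof (intro sum.cong refl)
   fix a b assume "a : A" "b : A"
   then have "\<bar>a - b\<bar> < int K" using A_range[of a] A_range[of b] by (simp add: K_def)
   then show "(\<Sum>r<K. w r (a - b)) = (if a = b then of_nat K else 0)" by (simp add: w_sum small)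
  qed
  also have "... = cr (real K * real (card A))" using fin by simp
  finally show ?thesis by (simp only: of_real_eq_iff)
 qed
 \<comment> \<open>Frequencies below the threshold contribute at most
   \<open>\<kappa> M\<^sup>2 * 3 M\<^sup>2\<close>, which is half of \<open>(\<rho> M)^4\<close>,
   the lower bound for the term at frequency 0. Parseval then leaves at most
   \<open>3 / \<kappa>\<close> large frequencies.\<close>
 define \<kappa> where "\<kappa> = \<rho> ^ 4 / 6"
 have \<kappa>: "\<kappa> > 0" using \<rho> by (simp add: \<kappa>_def)
 define R where "R = {r\<in>{..<K}. (cmod (S r))\<^sup>2 >= \<kappa> * (real M)\<^sup>2}"
 have Rfin: "finite R" by (simp add: R_def)
 have S2: "(\<Sum>r<K. (cmod (S r))\<^sup>2) <= 3 * (real M)\<^sup>2"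
  unfolding parseval using cardA by (simp add: K_def power2_eq_square mult_left_mono)
 have "real (card R) * (\<kappa> * (real M)\<^sup>2) <= (\<Sum>r\<in>R. (cmod (S r))\<^sup>2)"
  using sum_mono[of R "%_. \<kappa> * (real M)\<^sup>2" "%r. (cmod (S r))\<^sup>2"] by (simp add: R_def)
 also have "... <= (\<Sum>r<K. (cmod (S r))\<^sup>2)" by (rule sum_mono2) (auto simp: R_def)
 also have "... <= 3 * (real M)\<^sup>2" by (rule S2)
 finally have "real (card R) * \<kappa> <= 3" using M by (simp add: mult.assoc[symmetric])
 then have cardR: "real (card R) <= 18 / \<rho> ^ 4" using \<rho> by (simp add: \<kappa>_def field_simps)
 have "EX a:A. EX b:A. EX c:A. EX d:A. x = a - b + c - d"
  if x: "\<bar>x\<bar> < int M" and near: "!!r. r : R ==> cmod (w r x - 1) < 1" for x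
 proof (rule ccontr)
  assume none: "\<not> ?thesis"
  \<comment> \<open>This is \<open>K\<close> times the number of representations of \<open>x\<close>
    as \<open>a - b + c - d\<close>. Without any representation it is 0, while the frequency 0 alone
    outweighs all negative contributions.\<close>
  define T where "T = (\<Sum>r<K. cr ((cmod (S r)) ^ 4) * w r (- x))"
  have "T = (\<Sum>r<K. \<Sum>a\<in>A. \<Sum>b\<in>A. \<Sum>c\<in>A. \<Sum>d\<in>A. w r (a - b + c - d - x))"
  proof -
   have "cr ((cmod (S r)) ^ 4) * w r (- x) = (\<Sum>a\<in>A. \<Sum>b\<in>A. \<Sum>c\<in>A. \<Sum>d\<in>A. w r (a - b + c - d - x))" for r
   proof -
    have "cr ((cmod (S r)) ^ 4) = cr ((cmod (S r))\<^sup>2) * cr ((cmod (S r))\<^sup>2)"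
     by (simp only: of_real_mult[symmetric] power_add[symmetric]) simp
    also have "... * w r (- x) = (\<Sum>a\<in>A. \<Sum>b\<in>A. w r (a - b) * (cr ((cmod (S r))\<^sup>2) * w r (- x)))"
     by (subst (1) SS) (simp only: sum_distrib_right mult.assoc)
    also have "... = (\<Sum>a\<in>A. \<Sum>b\<in>A. \<Sum>c\<in>A. \<Sum>d\<in>A. w r (a - b) * (w r (c - d) * w r (- x)))"
     unfolding SS by (simp only: sum_distrib_left sum_distrib_right)
    finally show ?thesis by (simp add: w_add algebra_simps)
   qed
   then show ?thesis by (simp add: T_def)
  qed
  also have "... = (\<Sum>a\<in>A. \<Sum>b\<in>A. \<Sum>c\<in>A. \<Sum>d\<in>A. \<Sum>r<K. w r (a - b + c - d - x))"
   by (subst sum.swap, rule sum.cong[OF refl], subst sum.swap, rule sum.cong[OF refl],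
     subst sum.swap, rule sum.cong[OF refl], rule sum.swap)
  also have "... = 0"
  proof (rule sum.neutral, rule ballI, rule sum.neutral, rule ballI, rule sum.neutral, rule ballI, rule sum.neutral, rule ballI)
   fix a b c d assume *: "a : A" "b : A" "c : A" "d : A"
   then have "\<bar>a - b + c - d - x\<bar> < int K"
    using A_range[of a] A_range[of b] A_range[of c] A_range[of d] x by (simp add: K_def)
   moreover have "a - b + c - d - x ~= 0" using none * by force
   ultimately show "(\<Sum>r<K. w r (a - b + c - d - x)) = 0" by (simp add: w_sum small)
  qed
  finally have T0: "T = 0" .
  have term_ge: "Re (cr ((cmod (S r)) ^ 4) * w r (- x)) >= - (\<kappa> * (real M)\<^sup>2) * (cmod (S r))\<^sup>2" if "r < K" for r
  proof (cases "r : R")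
   case True
   \<comment> \<open>Within distance 1 of 1 the real part is nonnegative, so the large frequencies
     contribute nothing negative.\<close>
   have "(cmod (w r x - 1))\<^sup>2 < 1" using near[OF True] by (simp only: abs_square_less_1 abs_norm_cancel)
   then have "Re (w r x) >= 0" unfolding w_def norm_cis_minus_1 by simp
   moreover have "Re (w r (- x)) = Re (w r x)" unfolding w_cnj[of r x, symmetric] by simp
   ultimately have "0 <= Re (cr ((cmod (S r)) ^ 4) * w r (- x))" by simp
   moreover have "- (\<kappa> * (real M)\<^sup>2) * (cmod (S r))\<^sup>2 <= 0" using \<kappa> by simp
   ultimately show ?thesis by linarith
  next
   case False
   then have s: "(cmod (S r))\<^sup>2 <= \<kappa> * (real M)\<^sup>2" using that by (simp add: R_def)
   have "\<bar>Re (w r (- x))\<bar> <= 1" using abs_Re_le_cmod[of "w r (- x)"] by (simp add: w_def)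
   then have "Re (w r (- x)) >= -1" by linarith
   then have "Re (cr ((cmod (S r)) ^ 4) * w r (- x)) >= - ((cmod (S r)) ^ 4)"
    using mult_left_mono[of "-1" "Re (w r (- x))" "(cmod (S r)) ^ 4"] by simp
   moreover have "(cmod (S r)) ^ 4 = (cmod (S r))\<^sup>2 * (cmod (S r))\<^sup>2" by (simp add: power_add[symmetric])
   moreover have "... <= \<kappa> * (real M)\<^sup>2 * (cmod (S r))\<^sup>2" using s by (intro mult_right_mono) auto
   moreover have "- (\<kappa> * (real M)\<^sup>2) * (cmod (S r))\<^sup>2 = - (\<kappa> * (real M)\<^sup>2 * (cmod (S r))\<^sup>2)" by simp
   ultimately show ?thesis by (smt (verit))
  qed
  have S0: "S 0 = of_nat (card A)" by (simp add: S_def w_def)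
  have "Re T = (\<Sum>r<K. Re (cr ((cmod (S r)) ^ 4) * w r (- x)))" by (simp add: T_def)
  also have "... = (real (card A)) ^ 4 + (\<Sum>r\<in>{..<K} - {0}. Re (cr ((cmod (S r)) ^ 4) * w r (- x)))"
   using K by (subst sum.remove[of _ 0]) (auto simp: S0 w_def)
  finally have ReT: "Re T = (real (card A)) ^ 4 + (\<Sum>r\<in>{..<K} - {0}. Re (cr ((cmod (S r)) ^ 4) * w r (- x)))" .
  have "(\<Sum>r\<in>{..<K} - {0}. - (\<kappa> * (real M)\<^sup>2) * (cmod (S r))\<^sup>2) \<le>
    (\<Sum>r\<in>{..<K} - {0}. Re (cr ((cmod (S r)) ^ 4) * w r (- x)))"
   by (rule sum_mono) (rule term_ge, simp)
  moreover have "(\<Sum>r\<in>{..<K} - {0}. - (\<kappa> * (real M)\<^sup>2) * (cmod (S r))\<^sup>2) = - ((\<kappa> * (real M)\<^sup>2) * (\<Sum>r\<in>{..<K} - {0}. (cmod (S r))\<^sup>2))"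
   by (simp only: mult_minus_left sum_negf sum_distrib_left)
  ultimately have T_ge: "Re T >= (real (card A)) ^ 4 - (\<kappa> * (real M)\<^sup>2) * (\<Sum>r\<in>{..<K} - {0}. (cmod (S r))\<^sup>2)"
   unfolding ReT by linarith
  have "(\<Sum>r\<in>{..<K} - {0}. (cmod (S r))\<^sup>2) <= (\<Sum>r<K. (cmod (S r))\<^sup>2)" by (rule sum_mono2) auto
  also have "... <= 3 * (real M)\<^sup>2" by (rule S2)
  finally have "(\<kappa> * (real M)\<^sup>2) * (\<Sum>r\<in>{..<K} - {0}. (cmod (S r))\<^sup>2) <= (\<kappa> * (real M)\<^sup>2) * (3 * (real M)\<^sup>2)"
   using \<kappa> by (intro mult_left_mono) auto
  also have "... = (\<rho> * real M) ^ 4 / 2"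
   by (simp add: \<kappa>_def power_mult_distrib power2_eq_square power4_eq_xxxx)
  finally have "Re T >= (real (card A)) ^ 4 - (\<rho> * real M) ^ 4 / 2" using T_ge by linarith
  moreover have "(\<rho> * real M) ^ 4 <= (real (card A)) ^ 4" using card \<rho> by (intro power_mono) auto
  moreover have "(\<rho> * real M) ^ 4 > 0" using \<rho> M by simp
  ultimately show False using T0 by simp
 qed
 then show thesis using that[of R] cardR by (auto simp: R_def K_def w_def)
qed

text \<open>Compactness of the circle, used once for each of the finitely many indices with
  successive subsequences.\<close>

lemma finite_family_convergent:
 fixes z :: "nat => nat => complex"
 assumes "!!n i. cmod (z n i) = 1"
 obtains \<sigma> \<zeta> where "strict_mono \<sigma>" "!!i. i < L ==> (%n. z (\<sigma> n) i) \<longlonglongrightarrow> \<zeta> i & cmod (\<zeta> i) = 1"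
proof -
 have "EX \<sigma> \<zeta>. strict_mono \<sigma> & (ALL i<L. (%n. z (\<sigma> n) i) \<longlonglongrightarrow> \<zeta> i & cmod (\<zeta> i) = 1)"
 proof (induction L)
  case 0
  show ?case by (intro exI[of _ id]) (simp add: strict_mono_def)
 next
  case (Suc L)
  then obtain \<sigma> \<zeta> where s: "strict_mono \<sigma>" "!!i. i < L ==> (%n. z (\<sigma> n) i) \<longlonglongrightarrow> \<zeta> i & cmod (\<zeta> i) = 1" by blast
  have "seq_compact (sphere 0 1 :: complex set)" by (rule compact_imp_seq_compact) simp
  then obtain l r where l: "l : sphere (0::complex) 1" "strict_mono r" "((%n. z (\<sigma> n) L) \<circ> r) \<longlonglongrightarrow> l"
   using assms unfolding seq_compact_def by (metis mem_sphere_0)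
  show ?case
  proof (intro exI conjI allI impI)
   show "strict_mono (\<sigma> \<circ> r)" using s(1) l(2) by (rule strict_mono_o)
   fix i assume "i < Suc L"
   show "(%n. z ((\<sigma> \<circ> r) n) i) \<longlonglongrightarrow> (\<zeta>(L := l)) i"
   proof (cases "i = L")
    case True
    then show ?thesis using l(3) by (simp add: comp_def)
   next
    case False
    then have "(%n. z (\<sigma> n) i) \<longlonglongrightarrow> \<zeta> i" using s(2) \<open>i < Suc L\<close> by simp
    from LIMSEQ_subseq_LIMSEQ[OF this l(2)] show ?thesis using False by (simp add: comp_def)
   qed
   show "cmod ((\<zeta>(L := l)) i) = 1" using l(1) s(2)[of i] \<open>i < Suc L\<close> by (cases "i = L") auto
  qed
 qed
 then show thesis using that by blast
qed

text \<open>On each window \<open>{0..M}\<close> some member of the cover has density at least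
  \<open>1 / card \<C>\<close>, and the finite theorem yields frequencies whose number is bounded
  independently of the window. Compactness makes them converge along a sequence of growing
  windows.\<close>

lemma bogolyubov_int:
 fixes q :: "int => real"
 assumes fin: "finite \<C>" and cover: "\<Union>\<C> = UNIV"
  and diff: "!!C x y. C : \<C> ==> x : C ==> y : C ==> q (x - y) <= e"
  and sub: "!!m n. q (m + n) <= q m + q n"
 obtains \<Theta> where "finite \<Theta>" "!!m. (!!\<theta>. \<theta> : \<Theta> ==> cmod (cis (of_int m * \<theta>) - 1) < 1/2) ==> q m <= 2 * e"
proof -
 define N where "N = card \<C>"
 have N: "N > 0" using fin cover by (auto simp: N_def card_gt_0_iff)
 define \<rho> where "\<rho> = 1 / real N"
 have \<rho>: "\<rho> > 0" using N by (simp add: \<rho>_def)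
 define L where "L = nat \<lceil>18 / \<rho> ^ 4\<rceil>"
 have ex: "EX \<theta>::nat => real. ALL x. \<bar>x\<bar> < int (Suc M) --> (ALL i<L. cmod (cis (of_int x * \<theta> i) - 1) < 1) --> q x <= 2 * e" for M
 proof -
  let ?M = "Suc M"
  have "EX C:\<C>. real (card (C \<inter> {0..<int ?M})) >= \<rho> * real ?M"
  proof (rule ccontr)
   assume "\<not> ?thesis"
   then have lt: "!!C. C : \<C> ==> real (card (C \<inter> {0..<int ?M})) < \<rho> * real ?M" by force
   have "{0..<int ?M} = (\<Union>C\<in>\<C>. C \<inter> {0..<int ?M})" using cover by blast
   then have "card {0..<int ?M} <= (\<Sum>C\<in>\<C>. card (C \<inter> {0..<int ?M}))" using card_UN_le[OF fin] by metis
   then have "real ?M <= (\<Sum>C\<in>\<C>. real (card (C \<inter> {0..<int ?M})))" by (simp flip: of_nat_sum)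
   also have "... < (\<Sum>C\<in>\<C>. \<rho> * real ?M)" using fin N lt by (intro sum_strict_mono) (auto simp: N_def)
   also have "... = real ?M" using N by (simp add: \<rho>_def N_def)
   finally show False by simp
  qed
  then obtain C where C: "C : \<C>" "real (card (C \<inter> {0..<int ?M})) >= \<rho> * real ?M" by blast
  obtain R where R: "R \<subseteq> {..<3 * ?M}" "real (card R) <= 18 / \<rho> ^ 4"
   and Rq: "ALL x. \<bar>x\<bar> < int ?M --> (ALL r:R. cmod (cis (2 * pi * real r * of_int x / real (3 * ?M)) - 1) < 1) -->
   (EX a:C \<inter> {0..<int ?M}. EX b:C \<inter> {0..<int ?M}. EX c:C \<inter> {0..<int ?M}. EX d:C \<inter> {0..<int ?M}. x = a - b + c - d)"
   by (rule bogolyubov_finite[OF Int_lower2 zero_less_Suc \<rho> C(2)])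
  have finR: "finite R" using R(1) finite_subset by blast
  have "card R <= L" unfolding L_def using R(2) by linarith
  obtain f where f: "bij_betw f {0..<card R} R" using ex_bij_betw_nat_finite[OF finR] by blast
  \<comment> \<open>Indices beyond \<open>card R\<close> get frequency 0, which imposes no
    condition; this gives every window the same number \<open>L\<close> of frequencies.\<close>
  define \<theta> where "\<theta> = (%i. if i < card R then 2 * pi * real (f i) / real (3 * ?M) else 0)"
  have "q x <= 2 * e" if x: "\<bar>x\<bar> < int ?M" and near: "ALL i<L. cmod (cis (of_int x * \<theta> i) - 1) < 1" for x
  proof -
   have "cmod (cis (2 * pi * real r * of_int x / real (3 * ?M)) - 1) < 1" if "r : R" for r
   proof -
    have "r : f ` {0..<card R}" using f that by (simp add: bij_betw_def)
    then obtain i where i: "i < card R" "f i = r" by auto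
    then have "i < L" using \<open>card R <= L\<close> by simp
    then have "cmod (cis (of_int x * \<theta> i) - 1) < 1" using near by blast
    moreover have "of_int x * \<theta> i = 2 * pi * real r * of_int x / real (3 * ?M)" using i by (simp add: \<theta>_def)
    ultimately show ?thesis by simp
   qed
   then obtain a b c d where abcd: "a : C" "b : C" "c : C" "d : C" "x = a - b + c - d"
    using Rq x by blast
   have "x = (a - b) + (c - d)" using abcd(5) by simp
   then have "q x <= q (a - b) + q (c - d)" using sub by simp
   then show ?thesis using diff[OF C(1) abcd(1,2)] diff[OF C(1) abcd(3,4)] by linarith
  qed
  then show ?thesis by blast
 qed
 then obtain \<theta> :: "nat => nat => real" where
  \<theta>: "!!M x. \<bar>x\<bar> < int (Suc M) ==> (!!i. i < L ==> cmod (cis (of_int x * \<theta> M i) - 1) < 1) ==> q x <= 2 * e"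
  by metis
 obtain \<sigma> \<zeta> where \<sigma>: "strict_mono \<sigma>"
  and \<zeta>: "!!i. i < L ==> (%n. cis (\<theta> (\<sigma> n) i)) \<longlonglongrightarrow> \<zeta> i & cmod (\<zeta> i) = 1"
  using finite_family_convergent[of "%n i. cis (\<theta> n i)" L] by auto
 define \<Theta> where "\<Theta> = (%i. Arg (\<zeta> i)) ` {..<L}"
 have "q m <= 2 * e" if m: "!!t. t : \<Theta> ==> cmod (cis (of_int m * t) - 1) < 1/2" for m
 proof -
  have ev: "\<forall>\<^sub>F n in sequentially. cmod (cis (of_int m * \<theta> (\<sigma> n) i) - 1) < 1" if i: "i < L" for i
  proof -
   have "cis (Arg (\<zeta> i)) = \<zeta> i" using \<zeta>[OF i] by (metis cis_Arg norm_zero sgn_div_norm sgn_eq scaleR_one inverse_1 zero_neq_one)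
   then have lim_eq: "\<zeta> i powi m = cis (of_int m * Arg (\<zeta> i))" by (metis cis_power_int)
   \<comment> \<open>What converges are the values of the frequencies under \<open>cis\<close>, not
     the frequencies themselves; integer powers carry this over to the multiples by
     \<open>m\<close>.\<close>
   have "(%n. cis (\<theta> (\<sigma> n) i) powi m) \<longlonglongrightarrow> \<zeta> i powi m"
    using \<zeta>[OF i] by (intro tendsto_power_int) auto
   then have "(%n. cmod (cis (of_int m * \<theta> (\<sigma> n) i) - 1)) \<longlonglongrightarrow> cmod (cis (of_int m * Arg (\<zeta> i)) - 1)"
    unfolding cis_power_int lim_eq by (rule tendsto_norm[OF tendsto_diff[OF _ tendsto_const]])
   moreover have "cmod (cis (of_int m * Arg (\<zeta> i)) - 1) < 1"
    using m[of "Arg (\<zeta> i)"] i by (force simp: \<Theta>_def)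
   ultimately show ?thesis by (rule order_tendstoD(2))
  qed
  then have "\<forall>\<^sub>F n in sequentially. ALL i:{..<L}. cmod (cis (of_int m * \<theta> (\<sigma> n) i) - 1) < 1"
   by (subst eventually_ball_finite_distrib) auto
  moreover have "\<forall>\<^sub>F n in sequentially. n >= nat \<bar>m\<bar>" by (rule eventually_ge_at_top)
  ultimately have "\<forall>\<^sub>F n in sequentially. (ALL i:{..<L}. cmod (cis (of_int m * \<theta> (\<sigma> n) i) - 1) < 1) & n >= nat \<bar>m\<bar>"
   by (rule eventually_conj)
  then obtain n where n: "ALL i:{..<L}. cmod (cis (of_int m * \<theta> (\<sigma> n) i) - 1) < 1" "n >= nat \<bar>m\<bar>"
   by (auto simp: eventually_sequentially)
  have "\<bar>m\<bar> < int (Suc (\<sigma> n))" using n(2) seq_suble[OF \<sigma>, of n] by linarith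
  then show ?thesis using \<theta>[of m "\<sigma> n"] n(1) by simp
 qed
 moreover have "finite \<Theta>" by (simp add: \<Theta>_def)
 ultimately show thesis using that by blast
qed

text \<open>The integer version is applied on the lattice of multiples of \<open>s\<close>, and a
  real number is treated as its nearest lattice point plus a remainder. The two parts cost
  \<open>2 * e\<close> and \<open>e\<close>.\<close>

lemma bogolyubov_real:
 fixes q :: "real => real"
 assumes fin: "finite \<C>" and cover: "\<Union>\<C> = UNIV"
  and diff: "!!C x y. C : \<C> ==> x : C ==> y : C ==> q (x - y) <= e"
  and sub: "!!s t. q (s + t) <= q s + q t"
  and s: "s > 0" and small: "!!t. \<bar>t\<bar> <= s ==> q t <= e"
 obtains \<Theta> \<delta> where "finite \<Theta>" "\<delta> > 0" "!!t. (!!\<theta>. \<theta> : \<Theta> ==> cmod (cis (t * \<theta>) - 1) < \<delta>) ==> q t <= 3 * e"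
proof -
 let ?\<C> = "(%C. (%m::int. of_int m * s) -` C) ` \<C>"
 obtain \<Theta> where \<Theta>: "finite \<Theta>"
  and q\<Theta>: "!!m. (!!\<theta>. \<theta> : \<Theta> ==> cmod (cis (of_int m * \<theta>) - 1) < 1/2) ==> q (of_int m * s) <= 2 * e"
 proof (rule bogolyubov_int[of ?\<C> "%m. q (of_int m * s)" e])
  show "\<Union>?\<C> = UNIV" using cover by auto
  show "q (of_int (x - y) * s) <= e" if "C : ?\<C>" "x : C" "y : C" for C x y
   using that diff by (auto simp: algebra_simps)
  show "q (of_int (m + n) * s) <= q (of_int m * s) + q (of_int n * s)" for m n
   using sub[of "of_int m * s" "of_int n * s"] by (simp add: algebra_simps)
 qed (use fin in auto)
 define B where "B = 1 + (\<Sum>\<theta>\<in>\<Theta>. \<bar>\<theta>\<bar>)"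
 have B: "B >= 1" by (simp add: B_def sum_nonneg)
 have B\<theta>: "\<bar>\<theta>\<bar> <= B" if "\<theta> : \<Theta>" for \<theta>
  using member_le_sum[OF that, of "%\<theta>. \<bar>\<theta>\<bar>"] \<Theta> by (simp add: B_def)
 \<comment> \<open>A relative remainder below \<epsilon> moves each character by at most
   \<open>\<epsilon> * B = 1/4\<close>; with the tolerance \<open>\<delta> <= 1/4\<close> the
   lattice point stays within the \<open>1/2\<close> of the integer version.\<close>
 define \<epsilon> where "\<epsilon> = 1 / (4 * B)"
 have \<epsilon>: "\<epsilon> > 0" "\<epsilon> <= 1/4" using B by (auto simp: \<epsilon>_def field_simps)
 \<comment> \<open>The squared distance of \<open>cis (2 * pi * \<epsilon>)\<close> from 1. Being
   closer to 1 than this forces the relative remainder below \<epsilon>, because the cosine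
   decreases between 0 and \<open>pi\<close>.\<close>
 define \<gamma> where "\<gamma> = 2 - 2 * cos (2 * pi * \<epsilon>)"
 have \<gamma>: "\<gamma> > 0"
 proof -
  have "cos (2 * pi * \<epsilon>) < cos 0" using \<epsilon> by (intro cos_monotone_0_pi) auto
  then show ?thesis by (simp add: \<gamma>_def)
 qed
 define \<delta> where "\<delta> = min (1/4) (sqrt \<gamma>)"
 have \<delta>: "\<delta> > 0" using \<gamma> by (simp add: \<delta>_def)
 \<comment> \<open>The additional frequency \<open>2 * pi / s\<close> is trivial on the lattice and
   so detects only the remainder.\<close>
 let ?\<Theta> = "insert (2 * pi / s) ((%\<theta>. \<theta> / s) ` \<Theta>)"
 have "q t <= 3 * e" if t: "!!\<theta>. \<theta> : ?\<Theta> ==> cmod (cis (t * \<theta>) - 1) < \<delta>" for t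
 proof -
  define u where "u = t / s"
  define m where "m = round u"
  define r where "r = u - of_int m"
  have r: "\<bar>r\<bar> <= 1/2" using of_int_round_abs_le[of u] by (simp add: r_def m_def abs_minus_commute)
  have "cis (t * (2 * pi / s)) = cis (2 * pi * r)"
  proof -
   have "t * (2 * pi / s) = 2 * pi * r + of_int m * (2 * pi)" using s by (simp add: r_def u_def field_simps)
   then have "cis (t * (2 * pi / s)) = cis (2 * pi * r) * cis (of_int m * (2 * pi))" by (simp add: cis_mult)
   then show ?thesis by (simp add: cis_eq_1_iff)
  qed
  then have "(cmod (cis (2 * pi * r) - 1))\<^sup>2 < \<delta>\<^sup>2" using t[of "2 * pi / s"] by (intro power_strict_mono) auto
  also have "... <= (sqrt \<gamma>)\<^sup>2" using \<delta> by (intro power_mono) (auto simp: \<delta>_def)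
  finally have "2 - 2 * cos (2 * pi * r) < \<gamma>" using \<gamma> by (simp add: norm_cis_minus_1)
  then have cos: "cos (2 * pi * \<bar>r\<bar>) > cos (2 * pi * \<epsilon>)" using cos_abs_real[of "2 * pi * r"] by (simp add: \<gamma>_def abs_mult)
  have r\<epsilon>: "\<bar>r\<bar> < \<epsilon>"
  proof (rule ccontr)
   assume "\<not> ?thesis"
   then have "cos (2 * pi * \<bar>r\<bar>) <= cos (2 * pi * \<epsilon>)" using \<epsilon> r by (intro cos_monotone_0_pi_le) auto
   then show False using cos by simp
  qed
  have "cmod (cis (of_int m * \<theta>) - 1) < 1/2" if \<theta>: "\<theta> : \<Theta>" for \<theta>
  proof -
   have eq: "of_int m * \<theta> = t * (\<theta> / s) + (- r * \<theta>)" using s by (simp add: r_def u_def field_simps)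
   have "cmod (cis (of_int m * \<theta>) - 1) <= cmod (cis (t * (\<theta> / s)) - 1) + cmod (cis (- r * \<theta>) - 1)"
    unfolding eq by (rule norm_cis_diff_mult)
   also have "cmod (cis (- r * \<theta>) - 1) <= \<bar>r\<bar> * \<bar>\<theta>\<bar>" using norm_cis_minus_1_le[of "- r * \<theta>"] by (simp add: abs_mult)
   also have "\<bar>r\<bar> * \<bar>\<theta>\<bar> <= \<epsilon> * B" using r\<epsilon> B\<theta>[OF \<theta>] B \<epsilon> by (intro mult_mono) auto
   also have "\<epsilon> * B = 1/4" using B by (simp add: \<epsilon>_def)
   also have "cmod (cis (t * (\<theta> / s)) - 1) < 1/4" using t[OF insertI2, OF imageI, OF \<theta>] by (simp add: \<delta>_def)
   finally show ?thesis by simp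
  qed
  then have "q (of_int m * s) <= 2 * e" by (rule q\<Theta>)
  moreover have "q (r * s) <= e"
  proof (rule small)
   have "\<bar>r * s\<bar> <= 1 * s" unfolding abs_mult using r s by (intro mult_mono) auto
   then show "\<bar>r * s\<bar> <= s" by simp
  qed
  moreover have "t = of_int m * s + r * s" using s by (simp add: r_def u_def field_simps)
  ultimately show ?thesis using sub[of "of_int m * s" "r * s"] by simp
 qed
 then show thesis using that[of ?\<Theta> \<delta>] \<Theta> \<delta> by blast
qed

section \<open>Total boundedness and the algebra of almost periodic functions\<close>

text \<open>Finite covers by small sets instead of finite nets: covers intersect without loss
  (\<open>tbd_conj\<close>), which suits sums and products. \<open>tbd_net\<close> and
  \<open>tbdI_net\<close> translate between the two.\<close>

definition tbd :: "'d set => ('d => 'd => bool) => bool" where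
 "tbd D R \<longleftrightarrow> (EX \<P>. finite \<P> & D \<subseteq> \<Union>\<P> & (ALL P:\<P>. ALL x:P \<inter> D. ALL y:P \<inter> D. R x y))"

lemma tbdE:
 assumes "tbd D R"
 obtains \<P> where "finite \<P>" "D \<subseteq> \<Union>\<P>" "ALL P:\<P>. ALL x:P \<inter> D. ALL y:P \<inter> D. R x y"
 using assms unfolding tbd_def by (elim exE conjE)

lemma tbd_conj:
 assumes "tbd D R" "tbd D Q" shows "tbd D (%x y. R x y & Q x y)"
proof -
 obtain \<P> where P: "finite \<P>" "D \<subseteq> \<Union>\<P>" "ALL P:\<P>. ALL x:P \<inter> D. ALL y:P \<inter> D. R x y"
  using assms(1) by (rule tbdE)
 obtain \<Q> where Q: "finite \<Q>" "D \<subseteq> \<Union>\<Q>" "ALL P:\<Q>. ALL x:P \<inter> D. ALL y:P \<inter> D. Q x y"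
  using assms(2) by (rule tbdE)
 let ?\<R> = "(%(P, Q). P \<inter> Q) ` (\<P> \<times> \<Q>)"
 have "D \<subseteq> \<Union>?\<R>"
 proof
  fix x assume "x : D"
  then obtain P P' where "P : \<P>" "P' : \<Q>" "x : P" "x : P'" using P(2) Q(2) by blast
  then show "x : \<Union>?\<R>" by (intro UnionI[of "P \<inter> P'"]) auto
 qed
 moreover have "finite ?\<R>" using P(1) Q(1) by simp
 moreover have "ALL S:?\<R>. ALL x:S \<inter> D. ALL y:S \<inter> D. R x y & Q x y"
 proof (intro ballI)
  fix S x y assume "S : ?\<R>" "x : S \<inter> D" "y : S \<inter> D"
  then obtain P P' where "P : \<P>" "P' : \<Q>" "x : P" "x : P'" "y : P" "y : P'" "x : D" "y : D" by auto
  then show "R x y & Q x y" using P(3) Q(3) by blast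
 qed
 ultimately show ?thesis unfolding tbd_def by blast
qed

lemma tbd_mono: "tbd D R ==> (!!x y. x : D ==> y : D ==> R x y ==> Q x y) ==> tbd D Q"
 unfolding tbd_def by (elim exE conjE, intro exI conjI ballI, assumption, assumption) (simp add: Ball_def)

lemma tbd_ball:
 assumes "finite C" "!!c. c : C ==> tbd D (R c)" shows "tbd D (%x y. ALL c:C. R c x y)"
 using assms
proof (induction C rule: finite_induct)
 case empty
 show ?case unfolding tbd_def by (rule exI[of _ "{D}"]) simp
next
 case (insert c C)
 then have "tbd D (%x y. R c x y & (ALL c:C. R c x y))" by (intro tbd_conj) auto
 then show ?case by (rule tbd_mono) simp
qed

lemma tbd_net:
 assumes "tbd D R" obtains N where "finite N" "N \<subseteq> D" "!!x. x : D ==> EX y:N. R x y"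
proof -
 obtain \<P> where P: "finite \<P>" "D \<subseteq> \<Union>\<P>" "ALL P:\<P>. ALL x:P \<inter> D. ALL y:P \<inter> D. R x y"
  using assms by (rule tbdE)
 define r where "r P = (SOME x. x : P \<inter> D)" for P
 have r: "r P : P \<inter> D" if "x : P" "x : D" for P x
  unfolding r_def by (rule someI[of "%x. x : P \<inter> D" x]) (use that in simp)
 let ?N = "r ` {P : \<P>. P \<inter> D ~= {}}"
 have "EX y:?N. R x y" if x: "x : D" for x
 proof -
  obtain P where "P : \<P>" "x : P" using P(2) x by blast
  moreover from this have "r P : P \<inter> D" using r[of x P] x by blast
  ultimately have "r P : ?N" "R x (r P)" using P(3) x by blast+
  then show ?thesis by blast
 qed
 moreover have "finite ?N" "?N \<subseteq> D" using P(1) r by auto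
 ultimately show thesis using that by blast
qed

lemma tbdI_net:
 assumes "finite N" "!!x. x : D ==> EX k:N. Q x k" "!!x y k. x : D ==> y : D ==> Q x k ==> Q y k ==> R x y"
 shows "tbd D R"
 unfolding tbd_def
 by (rule exI[of _ "(%k. {x. Q x k}) ` N"]) (use assms in auto)

lemma tbd_bounded:
 fixes u :: "'d => complex"
 assumes "!!x. x : D ==> cmod (u x) <= B" "e > 0"
 shows "tbd D (%x y. cmod (u x - u y) <= e)"
proof -
 have "compact (cball (0::complex) B)" by simp
 then obtain k where k: "finite k" "cball (0::complex) B \<subseteq> (\<Union>x\<in>k. ball x (e/2))"
  using assms(2) unfolding compact_eq_totally_bounded by (meson half_gt_zero)
 show ?thesis
 proof (rule tbdI_net[OF k(1), of _ "%x c. dist c (u x) < e/2"])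
  show "EX c:k. dist c (u x) < e/2" if "x : D" for x
   using k(2) assms(1)[OF that] by (auto simp: subset_iff)
  show "cmod (u x - u y) <= e" if "dist c (u x) < e/2" "dist c (u y) < e/2" for x y c
   using dist_triangle_half_r[OF that] by (simp add: dist_norm)
 qed
qed

lemma continuous_map_complex_binop:
 fixes k :: "complex => complex => complex"
 assumes "continuous_map Y euclidean f" "continuous_map Y euclidean g" "continuous_on UNIV (%(x, y). k x y)"
 shows "continuous_map Y euclidean (%x. k (f x) (g x))"
proof -
 have "continuous_map Y (prod_topology euclidean euclidean) (%x. (f x, g x))"
  by (rule continuous_map_pairedI[OF assms(1,2)])
 then have "continuous_map Y euclidean (%x. (f x, g x))" by (simp add: prod_topology_euclidean)
 moreover have "continuous_map euclidean euclidean (%(x, y). k x y)" using assms(3) by simp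
 ultimately have "continuous_map Y euclidean ((%(x, y). k x y) \<circ> (%x. (f x, g x)))" by (rule continuous_map_compose)
 then show ?thesis by (simp add: o_def)
qed

context symp
begin

abbreviation dadd :: "('v => real) => ('v => real) => 'v => real" where "dadd \<equiv> dual_add V"

definition sc :: "real => ('v => real) => 'v => real" where "sc t F = (\<lambda>f\<in>carrier V. t * F f)"

lemma sc_closed: "F : dual V ==> sc t F : dual V"
 unfolding sc_def by (rule dual_scale)

lemma dadd_assoc: "dadd (dadd F G) H = dadd F (dadd G H)"
 unfolding dual_add_def by (rule restrict_ext) simp

lemma dadd_sc: "dadd (sc s F) (sc t F) = sc (s + t) F"
 unfolding dual_add_def sc_def by (rule restrict_ext) (simp add: algebra_simps)

lemma dadd_zero:
 assumes "F : dual V" shows "dadd F (sc 0 G) = F" "dadd (sc 0 G) F = F"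
proof (rule_tac [!] extensionalityI[of _ "carrier V"])
 show "F : extensional (carrier V)" "F : extensional (carrier V)" using dualD(5)[OF assms] by auto
qed (auto simp: dual_add_def sc_def)

definition apc :: "'v dual_fun set" where
 "apc = {a : extensional (dual V). continuous_map (dual_topology V) euclidean a & almost_periodic V a}"

lemma AP_eq: "AP V = dual_fun_algebra V apc" by (simp add: AP_def apc_def)

definition trel :: "'v dual_fun => real => ('v => real) => ('v => real) => bool" where
 "trel a e F K \<longleftrightarrow> (ALL G:dual V. cmod (a (dadd G F) - a (dadd G K)) <= e)"

lemma ap_iff: "almost_periodic V a \<longleftrightarrow> (ALL e>0. tbd (dual V) (trel a e))"
proof (intro iffI allI impI)
 fix e :: real assume "almost_periodic V a" "e > 0"
 then obtain N where N: "finite N" "!!F. F : dual V ==> EX K:N. trel a (e/2) F K"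
  unfolding almost_periodic_def trel_def by (meson half_gt_zero)
 show "tbd (dual V) (trel a e)"
 proof (rule tbdI_net[OF N])
  fix F G K assume *: "trel a (e/2) F K" "trel a (e/2) G K"
  show "trel a e F G" unfolding trel_def
  proof
   fix Y assume Y: "Y : dual V"
   have "dist (a (dadd Y F)) (a (dadd Y K)) <= e/2" "dist (a (dadd Y G)) (a (dadd Y K)) <= e/2"
    using * Y by (auto simp: trel_def dist_norm)
   then show "cmod (a (dadd Y F) - a (dadd Y G)) <= e"
    using dist_triangle2[of "a (dadd Y F)" "a (dadd Y G)" "a (dadd Y K)"] by (simp add: dist_norm)
  qed
 qed
next
 assume t: "ALL e>0. tbd (dual V) (trel a e)"
 show "almost_periodic V a" unfolding almost_periodic_def
 proof (intro allI impI)
  fix e :: real assume "e > 0"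
  then obtain N where "finite N" "N \<subseteq> dual V" "!!F. F : dual V ==> EX K:N. trel a e F K"
   using t tbd_net[of "dual V" "trel a e"] by blast
  then show "EX N. finite N & N \<subseteq> dual V & (ALL F:dual V. EX K:N. ALL G:dual V. cmod (a (dadd G F) - a (dadd G K)) <= e)"
   unfolding trel_def by blast
 qed
qed

lemma topspace_dual: "topspace (dual_topology V) = dual V"
 unfolding dual_topology_def using dualD(5) by (auto simp: PiE_def)

lemma apcD:
 assumes "a : apc"
 shows "a : extensional (dual V)" "continuous_map (dual_topology V) euclidean a" "e > 0 ==> tbd (dual V) (trel a e)"
 using assms by (auto simp: apc_def ap_iff)

text \<open>Two functions occur, because members must be extensional, whereas continuity and total
  boundedness are easier for the formula without restriction.\<close>

lemma apcI:
 assumes "continuous_map (dual_topology V) euclidean b" "!!e. e > 0 ==> tbd (dual V) (trel b e)"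
  "!!F. F : dual V ==> a F = b F" "a : extensional (dual V)"
 shows "a : apc"
proof -
 have "continuous_map (dual_topology V) euclidean a"
  using assms(1) by (rule continuous_map_eq) (simp add: topspace_dual assms(3))
 moreover have "tbd (dual V) (trel a e)" if "e > 0" for e
  using assms(2)[OF that] by (rule tbd_mono) (simp add: trel_def assms(3) dual_add_closed)
 ultimately show ?thesis using assms by (simp add: apc_def ap_iff)
qed

text \<open>The values of \<open>a\<close> are the values of its translates at the zero functional,
  written \<open>sc 0 F\<close>; a finite net with tolerance 1 bounds them.\<close>

lemma apc_bounded:
 assumes "a : apc" obtains B where "B >= 0" "!!F. F : dual V ==> cmod (a F) <= B"
proof -
 obtain N where N: "finite N" "N \<subseteq> dual V" "!!F. F : dual V ==> EX K:N. trel a 1 F K"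
  using tbd_net[OF apcD(3)[OF assms, of 1]] by (metis zero_less_one)
 let ?B = "1 + (\<Sum>K\<in>N. cmod (a K))"
 have "cmod (a F) <= ?B" if F: "F : dual V" for F
 proof -
  obtain K where K: "K : N" "trel a 1 F K" using N(3)[OF F] by blast
  have "sc 0 F : dual V" using sc_closed[OF F] .
  then have "cmod (a (dadd (sc 0 F) F) - a (dadd (sc 0 F) K)) <= 1" using K(2) by (simp add: trel_def)
  then have "cmod (a F - a K) <= 1" using dadd_zero(2)[OF F, of F] dadd_zero(2)[of K F] K(1) N(2) by auto
  moreover have "cmod (a K) <= (\<Sum>K\<in>N. cmod (a K))" using member_le_sum[OF K(1), of "%K. cmod (a K)"] N(1) by simp
  ultimately show ?thesis using norm_triangle_sub[of "a F" "a K"] by linarith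
 qed
 moreover have "?B >= 0" by (simp add: sum_nonneg add_nonneg_nonneg)
 ultimately show thesis using that by blast
qed

lemma apc_add:
 assumes a: "a : apc" and b: "b : apc" shows "(\<lambda>F\<in>dual V. a F + b F) : apc"
proof (rule apcI)
 show "continuous_map (dual_topology V) euclidean (%F. a F + b F)"
  by (intro continuous_map_add apcD(2) a b)
 fix e :: real assume e: "e > 0"
 have "tbd (dual V) (%F K. trel a (e/2) F K & trel b (e/2) F K)"
  using e by (intro tbd_conj apcD(3) a b) auto
 then show "tbd (dual V) (trel (%F. a F + b F) e)"
 proof (rule tbd_mono)
  fix F K assume *: "trel a (e/2) F K & trel b (e/2) F K"
  show "trel (%F. a F + b F) e F K" unfolding trel_def
  proof
   fix G assume G: "G : dual V"
   have "cmod ((a (dadd G F) - a (dadd G K)) + (b (dadd G F) - b (dadd G K))) <= e/2 + e/2"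
    using * G by (intro norm_triangle_mono) (auto simp: trel_def)
   then show "cmod (a (dadd G F) + b (dadd G F) - (a (dadd G K) + b (dadd G K))) <= e" by (simp add: algebra_simps)
  qed
 qed
qed auto

lemma apc_mult:
 assumes a: "a : apc" and b: "b : apc" shows "(\<lambda>F\<in>dual V. a F * b F) : apc"
proof (rule apcI)
 show "continuous_map (dual_topology V) euclidean (%F. a F * b F)"
  by (rule continuous_map_complex_binop[OF apcD(2)[OF a] apcD(2)[OF b]])
   (auto simp: case_prod_beta intro!: continuous_intros)
 obtain A where A: "A >= 0" "!!F. F : dual V ==> cmod (a F) <= A" using apc_bounded[OF a] by blast
 obtain B where B: "B >= 0" "!!F. F : dual V ==> cmod (b F) <= B" using apc_bounded[OF b] by blast
 fix e :: real assume e: "e > 0"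
 define \<epsilon> where "\<epsilon> = e / (A + B + 1)"
 have \<epsilon>: "\<epsilon> > 0" using e A B by (simp add: \<epsilon>_def)
 have "tbd (dual V) (%F K. (trel a \<epsilon> F K & trel b \<epsilon> F K))"
  by (intro tbd_conj apcD(3) a b \<epsilon>)
 then show "tbd (dual V) (trel (%F. a F * b F) e)"
 proof (rule tbd_mono)
  fix F K assume FK: "F : dual V" "K : dual V" and *: "trel a \<epsilon> F K & trel b \<epsilon> F K"
  show "trel (%F. a F * b F) e F K" unfolding trel_def
  proof
   fix G assume G: "G : dual V"
   let ?x = "dadd G F" and ?y = "dadd G K"
   have xy: "?x : dual V" "?y : dual V" using G FK dual_add_closed by auto
   have "a ?x * b ?x - a ?y * b ?y = a ?x * (b ?x - b ?y) + (a ?x - a ?y) * b ?y" by (simp add: algebra_simps)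
   then have "cmod (a ?x * b ?x - a ?y * b ?y) <= cmod (a ?x) * cmod (b ?x - b ?y) + cmod (a ?x - a ?y) * cmod (b ?y)"
    by (metis norm_mult norm_triangle_ineq)
   also have "... <= A * \<epsilon> + \<epsilon> * B"
    using * G A B xy \<epsilon> by (intro add_mono mult_mono) (auto simp: trel_def)
   also have "... <= (A + B + 1) * \<epsilon>" using \<epsilon> by (simp add: algebra_simps)
   also have "... = e" using A B by (simp add: \<epsilon>_def)
   finally show "cmod (a ?x * b ?x - a ?y * b ?y) <= e" .
  qed
 qed
qed auto

lemma apc_const: "(\<lambda>F\<in>dual V. c) : apc"
proof (rule apcI[of "%_. c"])
 fix e :: real assume e: "e > 0"
 show "tbd (dual V) (trel (%_. c) e)"
  unfolding tbd_def trel_def by (rule exI[of _ "{dual V}"]) (use e in auto)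
qed auto

lemma apc_smult: "a : apc ==> (\<lambda>F\<in>dual V. c * a F) : apc"
 using apc_mult[OF apc_const[of c], of a] by (simp cong: restrict_cong)

lemma apc_cnj:
 assumes a: "a : apc" shows "(\<lambda>F\<in>dual V. cnj (a F)) : apc"
proof (rule apcI)
 show "continuous_map (dual_topology V) euclidean (%F. cnj (a F))"
  by (rule continuous_map_complex_binop[OF apcD(2)[OF a] apcD(2)[OF a], of "%x y. cnj x"])
   (auto simp: case_prod_beta intro!: continuous_intros)
 fix e :: real assume e: "e > 0"
 show "tbd (dual V) (trel (%F. cnj (a F)) e)"
  using apcD(3)[OF a e] by (rule tbd_mono) (simp add: trel_def flip: complex_cnj_diff)
qed auto

text \<open>Translation multiplies a symbol by a number of modulus 1, so total boundedness of the
  translates reduces to that of the circle.\<close>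

lemma apc_W0: assumes f: "f : carrier V" shows "W0 V f : apc"
proof (rule apcI)
 have "continuous_map (product_topology (%_. euclideanreal) (carrier V)) euclidean (%F. F f)"
  by (rule continuous_map_product_projection[OF f])
 then have "continuous_map (dual_topology V) euclidean (%F. F f)"
  unfolding dual_topology_def by (rule continuous_map_from_subtopology)
 moreover have "continuous_map euclidean euclidean cis" by (simp add: continuous_on_cis)
 ultimately have "continuous_map (dual_topology V) euclidean (cis \<circ> (%F. F f))" by (rule continuous_map_compose)
 then show "continuous_map (dual_topology V) euclidean (%F. cis (F f))" by (simp add: o_def)
 fix e :: real assume e: "e > 0"
 have "tbd (dual V) (%F K. cmod (cis (F f) - cis (K f)) <= e)" using e by (intro tbd_bounded[of _ _ 1]) auto
 then show "tbd (dual V) (trel (%F. cis (F f)) e)"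
 proof (rule tbd_mono)
  fix F K :: "'v => real" assume le: "cmod (cis (F f) - cis (K f)) <= e"
  show "trel (%F. cis (F f)) e F K" unfolding trel_def
  proof
   fix G assume "G : dual V"
   have "cis (dadd G F f) - cis (dadd G K f) = cis (G f) * (cis (F f) - cis (K f))"
    using f by (simp add: dual_add_def cis_mult[symmetric] algebra_simps)
   then show "cmod (cis (dadd G F f) - cis (dadd G K f)) <= e" using le by (simp add: norm_mult)
  qed
 qed
qed (auto simp: W0_eq, simp add: W0_def)

lemma apc_W0_comb: "c : FC ==> WC c : apc"
proof (induction rule: fin_coeffs_induct)
 case zero
 have "WC (%_. 0) = (\<lambda>F\<in>dual V. 0)"
  unfolding W0_combination_def by simp
 show ?case unfolding \<open>WC (%_. 0) = _\<close> by (rule apc_const)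
next
 case (add c f r)
 have fin: "ws f : FC" "(%g. c * ws f g) : FC" using add by auto
 have "WC (%g. c * ws f g + r g) = (\<lambda>F\<in>dual V. (\<lambda>F\<in>dual V. c * W0 V f F) F + WC r F)"
 proof (rule extensionalityI[of _ "dual V"])
  fix F assume F: "F : dual V"
  show "WC (%g. c * ws f g + r g) F = (\<lambda>F\<in>dual V. (\<lambda>F\<in>dual V. c * W0 V f F) F + WC r F) F"
   using W0_comb_linear(1)[OF fin(2) add(3) F] W0_comb_linear(2)[OF fin(1) fin(1) F, of c] F by (simp add: W0_comb_symbol)
 qed (auto simp: W0_combination_def)
 then show ?case using apc_add[OF apc_smult[OF apc_W0[OF add(1)], of c] add.IH] by (simp only:)
qed

lemma apc_uniform_limit:
 assumes ext: "a : extensional (dual V)" and lim: "!!e. e > 0 ==> EX b:apc. ALL F:dual V. cmod (a F - b F) <= e"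
 shows "a : apc"
proof (rule apcI[OF _ _ refl ext])
 have "ALL n. EX b:apc. ALL F:dual V. cmod (a F - b F) <= inverse (real (Suc n))" using lim by simp
 then obtain b where b: "!!n. b n : apc" "!!n F. F : dual V ==> cmod (a F - b n F) <= inverse (real (Suc n))" by metis
 have "continuous_map (dual_topology V) Met_TC.mtopology a"
 proof (rule Met_TC.continuous_map_uniform_limit[where F = sequentially and f = b])
  show "\<forall>\<^sub>F n in sequentially. continuous_map (dual_topology V) Met_TC.mtopology (b n)"
   using apcD(2)[OF b(1)] by (simp add: mtopology_is_euclidean)
  fix e :: real assume "e > 0"
  then have "\<forall>\<^sub>F n in sequentially. inverse (real (Suc n)) < e" using order_tendstoD(2)[OF LIMSEQ_inverse_real_of_nat] by blast
  then show "\<forall>\<^sub>F n in sequentially. ALL x:topspace (dual_topology V). a x : UNIV & dist (b n x) (a x) < e"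
  proof eventually_elim
   case (elim n)
   have "dist (b n x) (a x) < e" if "x : dual V" for x
    using b(2)[OF that, of n] elim by (simp add: dist_norm norm_minus_commute)
   then show ?case by (simp add: topspace_dual)
  qed
 qed simp
 then show "continuous_map (dual_topology V) euclidean a" by (simp add: mtopology_is_euclidean)
 fix e :: real assume e: "e > 0"
 obtain b where b: "b : apc" "ALL F:dual V. cmod (a F - b F) <= e/3" using lim[of "e/3"] e by auto
 have "tbd (dual V) (trel b (e/3))" using e by (intro apcD(3)[OF b(1)]) simp
 then show "tbd (dual V) (trel a e)"
 proof (rule tbd_mono)
  fix F K assume FK: "F : dual V" "K : dual V" and *: "trel b (e/3) F K"
  show "trel a e F K" unfolding trel_def
  proof
   fix G assume G: "G : dual V"
   let ?x = "dadd G F" and ?y = "dadd G K"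
   have xy: "?x : dual V" "?y : dual V" using G FK dual_add_closed by auto
   have "cmod (a ?x - a ?y) = cmod ((a ?x - b ?x) + (b ?x - b ?y) - (a ?y - b ?y))" by simp
   also have "... <= cmod (a ?x - b ?x) + cmod (b ?x - b ?y) + cmod (a ?y - b ?y)"
    by (rule order_trans[OF norm_triangle_ineq4 add_right_mono[OF norm_triangle_ineq]])
   finally have "cmod (a ?x - a ?y) <= cmod (a ?x - b ?x) + cmod (b ?x - b ?y) + cmod (a ?y - b ?y)" .
   moreover have "cmod (a ?x - b ?x) <= e/3" "cmod (a ?y - b ?y) <= e/3" using b(2) xy by blast+
   moreover have "cmod (b ?x - b ?y) <= e/3" using * G unfolding trel_def by blast
   ultimately show "cmod (a ?x - a ?y) <= e" by linarith
  qed
 qed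
qed

lemma AP_simps [simp]:
 "carrier (AP V) = apc" "a \<otimes>\<^bsub>AP V\<^esub> b = (\<lambda>F\<in>dual V. a F * b F)" "\<one>\<^bsub>AP V\<^esub> = (\<lambda>F\<in>dual V. 1)"
 "\<zero>\<^bsub>AP V\<^esub> = (\<lambda>F\<in>dual V. 0)" "a \<oplus>\<^bsub>AP V\<^esub> b = (\<lambda>F\<in>dual V. a F + b F)" "c \<odot>\<^bsub>AP V\<^esub> a = (\<lambda>F\<in>dual V. c * a F)"
 "star (AP V) a = (\<lambda>F\<in>dual V. cnj (a F))" "apn a = (SUP F\<in>dual V. cmod (a F))"
 by (simp_all add: AP_eq dual_fun_algebra_def)

lemma apc_restrict: "a : apc ==> (\<lambda>F\<in>dual V. a F) = a"
 using apcD(1) by (simp add: extensional_restrict)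

theorem AP_star_alg: "star_alg (AP V)"
proof -
 have ag: "abelian_group (AP V)"
 proof (rule abelian_groupI)
  fix x assume "x : carrier (AP V)"
  then have x: "x : apc" by simp
  show "EX y:carrier (AP V). y \<oplus>\<^bsub>AP V\<^esub> x = \<zero>\<^bsub>AP V\<^esub>"
   using apc_smult[OF x, of "-1"] by (intro bexI[of _ "\<lambda>F\<in>dual V. (-1) * x F"]) (simp_all cong: restrict_cong)
 qed (simp_all add: apc_add apc_const apc_restrict add_ac cong: restrict_cong)
 have mon: "Group.monoid (AP V)"
  by (rule monoidI) (simp_all add: apc_mult apc_const apc_restrict mult_ac cong: restrict_cong)
 have "ring (AP V)"
  by (rule ringI[OF ag mon]) (simp_all add: algebra_simps cong: restrict_cong)
 then show ?thesis
  by (intro star_alg.intro star_alg_axioms.intro)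
   (simp_all add: apc_smult apc_cnj apc_restrict algebra_simps cong: restrict_cong)
qed

lemma AP_norm_le: "(!!F. F : dual V ==> cmod (a F) <= C) ==> apn a <= C"
 unfolding AP_simps by (rule cSUP_least[OF dual_nonempty])

lemma AP_norm_upper: "a : apc ==> F : dual V ==> cmod (a F) <= apn a"
proof -
 assume a: "a : apc" and F: "F : dual V"
 obtain B where B: "!!F. F : dual V ==> cmod (a F) <= B" using apc_bounded[OF a] by metis
 show ?thesis unfolding AP_simps by (rule cSUP_upper[OF F bdd_aboveI2[OF B]])
qed

lemma AP_norm_nonneg: "a : apc ==> 0 <= apn a"
 using AP_norm_upper[OF _ dual_zero, of a] norm_ge_zero order_trans by blast

theorem AP_cstar_pre: "cstar_pre (AP V) (apn)"
proof (intro cstar_pre.intro cstar_pre_axioms.intro AP_star_alg)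
 show "cstar_norm (AP V) (apn)"
  unfolding cstar_norm_def
 proof (intro conjI ballI allI)
  fix a assume "a : carrier (AP V)"
  then have a: "a : apc" by simp
  note up = AP_norm_upper[OF a]
  show nn: "0 <= apn a" by (rule AP_norm_nonneg[OF a])
  show "apn a = 0 \<longleftrightarrow> a = \<zero>\<^bsub>AP V\<^esub>"
  proof
   assume "apn a = 0"
   then have "a F = 0" if "F : dual V" for F using up[OF that] by simp
   then have "(\<lambda>F\<in>dual V. a F) = (\<lambda>F\<in>dual V. 0)" by (intro restrict_ext)
   then show "a = \<zero>\<^bsub>AP V\<^esub>" using apc_restrict[OF a] by simp
  next
   assume "a = \<zero>\<^bsub>AP V\<^esub>"
   then have "apn a <= 0" by (intro AP_norm_le) simp
   then show "apn a = 0" using nn by simp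
  qed
  show "apn (c \<odot>\<^bsub>AP V\<^esub> a) = cmod c * apn a" for c
  proof (rule antisym)
   show "apn (c \<odot>\<^bsub>AP V\<^esub> a) <= cmod c * apn a"
    by (rule AP_norm_le) (simp only: AP_simps(6) restrict_apply' norm_mult mult_left_mono[OF up norm_ge_zero])
   show "cmod c * apn a <= apn (c \<odot>\<^bsub>AP V\<^esub> a)"
   proof (cases "c = 0")
    case True
    then show ?thesis using AP_norm_nonneg[OF apc_smult[OF a, of c]] by (simp only: AP_simps(6)) simp
   next
    case False
    have "apn a <= apn (c \<odot>\<^bsub>AP V\<^esub> a) / cmod c"
    proof (rule AP_norm_le)
     fix F assume F: "F : dual V"
     have "cmod c * cmod (a F) <= apn (c \<odot>\<^bsub>AP V\<^esub> a)"
      using AP_norm_upper[OF apc_smult[OF a, of c] F] F by (simp only: AP_simps(6) restrict_apply' norm_mult)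
     then show "cmod (a F) <= apn (c \<odot>\<^bsub>AP V\<^esub> a) / cmod c"
      using False by (metis mult.commute pos_le_divide_eq zero_less_norm_iff)
    qed
    then show ?thesis using False by (metis mult.commute pos_le_divide_eq zero_less_norm_iff)
   qed
  qed
  show "apn (star (AP V) a \<otimes>\<^bsub>AP V\<^esub> a) = (apn a)\<^sup>2"
  proof (rule antisym)
   have sq: "cmod ((star (AP V) a \<otimes>\<^bsub>AP V\<^esub> a) F) = (cmod (a F))\<^sup>2" if "F : dual V" for F
    using that by (simp add: norm_mult power2_eq_square)
   show "apn (star (AP V) a \<otimes>\<^bsub>AP V\<^esub> a) <= (apn a)\<^sup>2"
    by (rule AP_norm_le) (simp only: sq power_mono[OF up norm_ge_zero])
   have sa: "star (AP V) a \<otimes>\<^bsub>AP V\<^esub> a : apc" using apc_mult[OF apc_cnj[OF a] a] by (simp only: AP_simps)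
   have "apn a <= sqrt (apn (star (AP V) a \<otimes>\<^bsub>AP V\<^esub> a))"
   proof (rule AP_norm_le)
    fix F assume F: "F : dual V"
    have "(cmod (a F))\<^sup>2 <= apn (star (AP V) a \<otimes>\<^bsub>AP V\<^esub> a)" using AP_norm_upper[OF sa F] by (simp only: sq[OF F])
    then show "cmod (a F) <= sqrt (apn (star (AP V) a \<otimes>\<^bsub>AP V\<^esub> a))" by (rule real_le_rsqrt)
   qed
   then have "(apn a)\<^sup>2 <= (sqrt (apn (star (AP V) a \<otimes>\<^bsub>AP V\<^esub> a)))\<^sup>2" using nn by (rule power_mono)
   then show "(apn a)\<^sup>2 <= apn (star (AP V) a \<otimes>\<^bsub>AP V\<^esub> a)"
    using AP_norm_nonneg[OF sa] by (simp only: real_sqrt_pow2)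
  qed
  fix b assume "b : carrier (AP V)"
  then have b: "b : apc" by simp
  show "apn (a \<oplus>\<^bsub>AP V\<^esub> b) <= apn a + apn b"
  proof (rule AP_norm_le)
   fix F assume F: "F : dual V"
   show "cmod ((a \<oplus>\<^bsub>AP V\<^esub> b) F) <= apn a + apn b"
    using norm_triangle_mono[OF up[OF F] AP_norm_upper[OF b F]] F by (simp only: AP_simps(5) restrict_apply')
  qed
  show "apn (a \<otimes>\<^bsub>AP V\<^esub> b) <= apn a * apn b"
  proof (rule AP_norm_le)
   fix F assume F: "F : dual V"
   show "cmod ((a \<otimes>\<^bsub>AP V\<^esub> b) F) <= apn a * apn b"
    using mult_mono[OF up[OF F] AP_norm_upper[OF b F] nn norm_ge_zero] F by (simp only: AP_simps(2) restrict_apply' norm_mult)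
  qed
 qed
qed

lemma AP_minus: "a : apc ==> b : apc ==> F : dual V ==> (a \<ominus>\<^bsub>AP V\<^esub> b) F = a F - b F"
proof -
 interpret P: star_alg "AP V" by (rule AP_star_alg)
 assume "a : apc" "b : apc" "F : dual V"
 then show ?thesis using P.a_minus_smult[of a b] by simp
qed

theorem AP_cstar: "cstar (AP V) (apn)"
proof (intro cstar.intro cstar_axioms.intro AP_cstar_pre)
 interpret P: cstar_pre "AP V" "apn" by (rule AP_cstar_pre)
 fix s assume s: "s : cauchy_seqs (AP V) (apn)"
 have sin: "s n : apc" for n using P.cauchy_in[OF s] by simp
 have diff: "cmod (s m F - s n F) <= apn (s m \<ominus>\<^bsub>AP V\<^esub> s n)" if "F : dual V" for m n F
 proof -
  have "s m \<ominus>\<^bsub>AP V\<^esub> s n : apc" using P.minus_closed[of "s m" "s n"] sin by simp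
  from AP_norm_upper[OF this that] show ?thesis by (simp only: AP_minus[OF sin sin that])
 qed
 have conv: "convergent (%n. s n F)" if F: "F : dual V" for F
 proof (rule Cauchy_convergent, unfold Cauchy_def dist_norm, intro allI impI)
  fix e :: real assume "e > 0"
  then obtain N where N: "ALL m>=N. ALL n>=N. apn (s m \<ominus>\<^bsub>AP V\<^esub> s n) < e" using P.cauchyD[OF s] by blast
  then show "EX M. ALL m>=M. ALL n>=M. cmod (s m F - s n F) < e"
   using diff[OF F] by (intro exI[of _ N]) (meson order.strict_trans1)
 qed
 define a where "a = (\<lambda>F\<in>dual V. lim (%n. s n F))"
 have a_lim: "(%n. s n F) \<longlonglongrightarrow> a F" if "F : dual V" for F
  using conv[OF that] that by (simp add: a_def convergent_LIMSEQ_iff)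
 have unif: "EX N. ALL n>=N. ALL F:dual V. cmod (s n F - a F) <= e" if e: "e > 0" for e
 proof -
  obtain N where N: "ALL m>=N. ALL n>=N. apn (s m \<ominus>\<^bsub>AP V\<^esub> s n) < e" using P.cauchyD[OF s e] by blast
  have "cmod (s n F - a F) <= e" if "n >= N" "F : dual V" for n F
  proof (rule LIMSEQ_le_const2)
   show "(%m. cmod (s n F - s m F)) \<longlonglongrightarrow> cmod (s n F - a F)"
    by (intro tendsto_norm tendsto_diff tendsto_const a_lim that)
   show "EX M. ALL m>=M. cmod (s n F - s m F) <= e"
    using diff[OF that(2), of n] N that(1) by (intro exI[of _ N]) (meson less_imp_le order_trans)
  qed
  then show ?thesis by blast
 qed
 have a: "a : apc"
 proof (rule apc_uniform_limit)
  show "EX b:apc. ALL F:dual V. cmod (a F - b F) <= e" if "e > 0" for e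
   using unif[OF that] sin by (metis norm_minus_commute order_refl)
 qed (simp add: a_def)
 have "(%n. apn (s n \<ominus>\<^bsub>AP V\<^esub> a)) \<longlonglongrightarrow> 0"
 proof (rule LIMSEQ_I)
  fix e :: real assume e: "e > 0"
  obtain N where N: "ALL n>=N. ALL F:dual V. cmod (s n F - a F) <= e/2" using unif[of "e/2"] e by auto
  have "norm (apn (s n \<ominus>\<^bsub>AP V\<^esub> a) - 0) < e" if "n >= N" for n
  proof -
   have "apn (s n \<ominus>\<^bsub>AP V\<^esub> a) <= e/2"
    by (rule AP_norm_le) (simp only: AP_minus[OF sin a], use N that in blast)
   moreover have "0 <= apn (s n \<ominus>\<^bsub>AP V\<^esub> a)" using P.p_nonneg[OF P.minus_closed, of "s n" a] sin a by simp
   ultimately show ?thesis using e by (simp only: real_norm_def)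
  qed
  then show "EX N. ALL n>=N. norm (apn (s n \<ominus>\<^bsub>AP V\<^esub> a) - 0) < e" by blast
 qed
 then show "EX a:carrier (AP V). (%n. apn (s n \<ominus>\<^bsub>AP V\<^esub> a)) \<longlonglongrightarrow> 0" using a by auto
qed

end

section \<open>Density of trigonometric polynomials\<close>

context symp
begin

lemma dual_sum:
 assumes "finite B" "!!b. b : B ==> \<Phi> b : dual V"
 shows "(\<lambda>f\<in>carrier V. \<Sum>b\<in>B. c b * \<Phi> b f) : dual V"
 using assms
proof (induction B rule: finite_induct)
 case empty
 then show ?case using dual_zero by (simp only: sum.empty)
next
 case (insert b B)
 have eq: "(\<lambda>f\<in>carrier V. \<Sum>b\<in>insert b B. c b * \<Phi> b f) = (\<lambda>f\<in>carrier V. (\<lambda>f\<in>carrier V. \<Sum>b\<in>B. c b * \<Phi> b f) f + c b * \<Phi> b f)"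
  using insert.hyps by (intro restrict_ext) simp
 have "(\<lambda>f\<in>carrier V. \<Sum>b\<in>B. c b * \<Phi> b f) : dual V" using insert by blast
 moreover have "\<Phi> b : dual V" using insert.prems by blast
 ultimately show ?case unfolding eq by (rule dual_comb)
qed

text \<open>The restrictions of functionals to a finite set form a finite-dimensional space;
  \<open>B\<close> consists of interpolation points and \<Phi> of interpolating functionals. If the
  value at a new point \<open>s\<close> is not yet determined, some functional \<open>G\<close>
  vanishes on \<open>S\<close> but not at \<open>s\<close>, and it supplies the missing one.\<close>

lemma dual_basis:
 assumes "finite S" "S \<subseteq> carrier V"
 shows "EX B \<Phi>. B \<subseteq> S & (ALL b:B. \<Phi> b : dual V) & (ALL F:dual V. ALL s:S. F s = (\<Sum>b\<in>B. F b * \<Phi> b s))"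
 using assms
proof (induction S rule: finite_induct)
 case (insert s S)
 then obtain B \<Phi> where B: "B \<subseteq> S" and \<Phi>0: "ALL b:B. \<Phi> b : dual V"
  and eq0: "ALL F:dual V. ALL s:S. F s = (\<Sum>b\<in>B. F b * \<Phi> b s)" by auto
 have \<Phi>: "\<Phi> b : dual V" if "b : B" for b using \<Phi>0 that by blast
 have eq: "F u = (\<Sum>b\<in>B. F b * \<Phi> b u)" if "F : dual V" "u : S" for F u using eq0 that by blast
 have finB: "finite B" using B insert.hyps finite_subset by blast
 have sB: "s ~: B" using B insert.hyps by blast
 have s: "s : carrier V" using insert.prems by simp
 show ?case
 proof (cases "ALL F:dual V. F s = (\<Sum>b\<in>B. F b * \<Phi> b s)")
  case True
  then show ?thesis using B \<Phi> eq by (intro exI[of _ B] exI[of _ \<Phi>]) auto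
 next
  case False
  then obtain F0 where F0: "F0 : dual V" "F0 s ~= (\<Sum>b\<in>B. F0 b * \<Phi> b s)" by blast
  define P where "P = (\<lambda>f\<in>carrier V. \<Sum>b\<in>B. F0 b * \<Phi> b f)"
  have P: "P : dual V" unfolding P_def using finB \<Phi> by (rule dual_sum)
  define G where "G = (\<lambda>f\<in>carrier V. F0 f + (-1) * P f)"
  have G: "G : dual V" unfolding G_def by (rule dual_comb[OF F0(1) P])
  have Gs: "G s ~= 0" using F0(2) s by (simp add: G_def P_def)
  have G0: "G u = 0" if "u : S" for u
   using eq[OF F0(1) that] that insert.prems by (simp add: G_def P_def subset_iff)
  \<comment> \<open>The normalised \<open>G\<close> takes the value 1 at \<open>s\<close>. The old
    functionals are corrected by multiples of \<open>G\<close> so as to vanish at \<open>s\<close>,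
    which leaves them unchanged on \<open>S\<close>.\<close>
  define \<Psi> where "\<Psi> = (%b. if b = s then sc (1 / G s) G else (\<lambda>f\<in>carrier V. \<Phi> b f + (- (\<Phi> b s / G s)) * G f))"
  have "\<Psi> b : dual V" if "b : insert s B" for b
  proof (cases "b = s")
   case True
   then show ?thesis unfolding \<Psi>_def using sc_closed[OF G] by simp
  next
   case False
   then have "b : B" using that by blast
   then show ?thesis using False unfolding \<Psi>_def by (simp only: if_False dual_comb[OF \<Phi> G])
  qed
  moreover have "F u = (\<Sum>b\<in>insert s B. F b * \<Psi> b u)" if F: "F : dual V" and u: "u : insert s S" for F u
  proof -
   have uc: "u : carrier V" using u insert.prems by blast
   have "(\<Sum>b\<in>insert s B. F b * \<Psi> b u) = F s * \<Psi> s u + (\<Sum>b\<in>B. F b * \<Psi> b u)"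
    using finB sB by simp
   also have "F s * \<Psi> s u = F s * (G u / G s)" using uc by (simp add: \<Psi>_def sc_def)
   also have "(\<Sum>b\<in>B. F b * \<Psi> b u) = (\<Sum>b\<in>B. F b * \<Phi> b u - F b * \<Phi> b s * (G u / G s))"
   proof (rule sum.cong[OF refl])
    fix b assume "b : B"
    then have "b ~= s" using sB by blast
    then show "F b * \<Psi> b u = F b * \<Phi> b u - F b * \<Phi> b s * (G u / G s)"
     using uc by (simp add: \<Psi>_def algebra_simps)
   qed
   also have "... = (\<Sum>b\<in>B. F b * \<Phi> b u) - (\<Sum>b\<in>B. F b * \<Phi> b s) * (G u / G s)"
    by (simp only: sum_subtractf sum_distrib_right)
   finally have sum: "(\<Sum>b\<in>insert s B. F b * \<Psi> b u) = F s * (G u / G s) + ((\<Sum>b\<in>B. F b * \<Phi> b u) - (\<Sum>b\<in>B. F b * \<Phi> b s) * (G u / G s))" .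
   show ?thesis
   proof (cases "u : S")
    case True
    then show ?thesis unfolding sum using G0[OF True] eq[OF F True] by simp
   next
    case False
    then have "u = s" using u by blast
    then show ?thesis unfolding sum using Gs by simp
   qed
  qed
  ultimately show ?thesis using B by (intro exI[of _ "insert s B"] exI[of _ \<Psi>]) auto
 qed
qed simp

text \<open>Subadditive in \<open>F\<close>, as the supremum is invariant under translations; along
  a line it takes the place of \<open>q\<close> in \<open>bogolyubov_real\<close>.\<close>

definition osc :: "'v dual_fun => ('v => real) => real" where
 "osc a F = (SUP G\<in>dual V. cmod (a (dadd G F) - a G))"

lemma osc_le: "(!!G. G : dual V ==> cmod (a (dadd G F) - a G) <= C) ==> osc a F <= C"
 unfolding osc_def by (rule cSUP_least[OF dual_nonempty])

lemma osc_upper: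
 assumes a: "a : apc" and F: "F : dual V" and G: "G : dual V"
 shows "cmod (a (dadd G F) - a G) <= osc a F"
proof -
 obtain B where B: "!!F. F : dual V ==> cmod (a F) <= B" using apc_bounded[OF a] by metis
 have "bdd_above ((%G. cmod (a (dadd G F) - a G)) ` dual V)"
 proof (rule bdd_aboveI2)
  fix G assume G: "G : dual V"
  show "cmod (a (dadd G F) - a G) <= B + B"
   using norm_triangle_ineq4[of "a (dadd G F)" "a G"] B[OF G] B[OF dual_add_closed[OF G F]] by linarith
 qed
 then show ?thesis unfolding osc_def by (rule cSUP_upper[OF G])
qed

lemma osc_dadd:
 assumes a: "a : apc" and F: "F : dual V" and K: "K : dual V"
 shows "osc a (dadd F K) <= osc a F + osc a K"
proof (rule osc_le)
 fix G assume G: "G : dual V"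
 have GF: "dadd G F : dual V" using G F by (rule dual_add_closed)
 have "cmod (a (dadd G (dadd F K)) - a G) = cmod ((a (dadd (dadd G F) K) - a (dadd G F)) + (a (dadd G F) - a G))"
  by (simp add: dadd_assoc)
 also have "... <= osc a K + osc a F"
  by (intro norm_triangle_mono osc_upper a F K G GF)
 finally show "cmod (a (dadd G (dadd F K)) - a G) <= osc a F + osc a K" by simp
qed

lemma osc_diff:
 assumes a: "a : apc" and F: "F : dual V" and st: "trel a e (sc s F) (sc t F)"
 shows "osc a (sc (s - t) F) <= e"
proof (rule osc_le)
 fix G assume G: "G : dual V"
 let ?G = "dadd G (sc (- t) F)"
 have G': "?G : dual V" using G sc_closed[OF F] by (rule dual_add_closed)
 have "cmod (a (dadd ?G (sc s F)) - a (dadd ?G (sc t F))) <= e" using st G' by (simp add: trel_def)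
 then show "cmod (a (dadd G (sc (s - t) F)) - a G) <= e"
  by (simp add: dadd_assoc dadd_sc dadd_zero(1)[OF G])
qed

text \<open>A basic neighbourhood in the product topology constrains finitely many coordinates, and
  the intervals around the coordinates of \<open>K\<close> can be given a common radius.\<close>

lemma weak_nbhd:
 assumes a: "a : apc" and K: "K : dual V" and e: "e > 0"
 obtains S \<delta> where "finite S" "S \<subseteq> carrier V" "\<delta> > 0"
  "ALL F:dual V. (ALL f:S. \<bar>F f - K f\<bar> < \<delta>) --> cmod (a F - a K) < e"
proof -
 have "openin (dual_topology V) {F : topspace (dual_topology V). a F : ball (a K) e}"
  by (rule openin_continuous_map_preimage[OF apcD(2)[OF a]]) simp
 then have "openin (dual_topology V) {F : dual V. a F : ball (a K) e}" by (simp only: topspace_dual)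
 then obtain W where W: "openin (product_topology (%_. euclideanreal) (carrier V)) W"
  "{F : dual V. a F : ball (a K) e} = W \<inter> dual V"
  unfolding dual_topology_def openin_subtopology by blast
 have "K : {F : dual V. a F : ball (a K) e}" using K e by simp
 then have "K : W" using W(2) by blast
 then obtain U where U: "finite {i : carrier V. U i ~= topspace euclideanreal}" "ALL i:carrier V. openin euclideanreal (U i)"
  "K : Pi\<^sub>E (carrier V) U" "Pi\<^sub>E (carrier V) U \<subseteq> W"
  using W(1) unfolding openin_product_topology_alt by blast
 define S where "S = {i : carrier V. U i ~= UNIV}"
 have S: "finite S" "S \<subseteq> carrier V" using U(1) by (auto simp: S_def)
 have "ALL i:S. EX d>0. ALL y. \<bar>y - K i\<bar> < d --> y : U i"
 proof
  fix i assume i: "i : S"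
  then have "open (U i)" "K i : U i" using U(2,3) S(2) by (auto simp: PiE_iff)
  then obtain d where "d > 0" "ball (K i) d \<subseteq> U i" using open_contains_ball by blast
  then show "EX d>0. ALL y. \<bar>y - K i\<bar> < d --> y : U i"
   by (intro exI[of _ d]) (auto simp: subset_iff dist_real_def abs_minus_commute)
 qed
 then obtain d where d: "!!i. i : S ==> d i > 0" "!!i y. i : S ==> \<bar>y - K i\<bar> < d i ==> y : U i" by metis
 define \<delta> where "\<delta> = Min (insert 1 (d ` S))"
 have \<delta>: "\<delta> > 0" "!!i. i : S ==> \<delta> <= d i" using S(1) d(1) by (auto simp: \<delta>_def)
 have "cmod (a F - a K) < e" if F: "F : dual V" and near: "ALL f:S. \<bar>F f - K f\<bar> < \<delta>" for F
 proof -
  have "F i : U i" if i: "i : carrier V" for i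
  proof (cases "i : S")
   case True
   then have "\<bar>F i - K i\<bar> < d i" using near \<delta>(2) by force
   then show ?thesis by (rule d(2)[OF True])
  next
   case False
   then show ?thesis using i by (simp add: S_def)
  qed
  then have "F : Pi\<^sub>E (carrier V) U" using dualD(5)[OF F] by (auto simp: PiE_iff)
  then have "F : {F : dual V. a F : ball (a K) e}" using U(4) F W(2) by blast
  then show ?thesis by (simp add: dist_norm norm_minus_commute)
 qed
 then show thesis using that[OF S \<delta>(1)] by blast
qed

text \<open>Turns pointwise weak* continuity into a uniform estimate: continuity is used only at the
  finitely many points of a net, and almost periodicity moves every other point to one of
  these.\<close>

lemma osc_small:
 assumes a: "a : apc" and e: "e > 0"
 obtains S \<delta> where "finite S" "S \<subseteq> carrier V" "\<delta> > 0"
  "ALL F:dual V. (ALL f:S. \<bar>F f\<bar> < \<delta>) --> osc a F <= e"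
proof -
 obtain N where N: "finite N" "N \<subseteq> dual V" "!!F. F : dual V ==> EX K:N. trel a (e/3) F K"
  using tbd_net[OF apcD(3)[OF a, of "e/3"]] e by (metis zero_less_divide_iff zero_less_numeral)
 have "ALL K:N. EX S \<delta>. finite S & S \<subseteq> carrier V & \<delta> > 0 & (ALL F:dual V. (ALL f:S. \<bar>F f - K f\<bar> < \<delta>) --> cmod (a F - a K) < e/3)"
 proof
  fix K assume "K : N"
  then have "K : dual V" using N(2) by blast
  then obtain S \<delta> where "finite S" "S \<subseteq> carrier V" "\<delta> > 0"
   "ALL F:dual V. (ALL f:S. \<bar>F f - K f\<bar> < \<delta>) --> cmod (a F - a K) < e/3"
   using weak_nbhd[OF a, of K "e/3"] e by (metis zero_less_divide_iff zero_less_numeral)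
  then show "EX S \<delta>. finite S & S \<subseteq> carrier V & \<delta> > 0 & (ALL F:dual V. (ALL f:S. \<bar>F f - K f\<bar> < \<delta>) --> cmod (a F - a K) < e/3)" by blast
 qed
 then obtain S \<delta> where S: "!!K. K : N ==> finite (S K)" "!!K. K : N ==> S K \<subseteq> carrier V" "!!K. K : N ==> \<delta> K > 0"
  and near: "!!K F. K : N ==> F : dual V ==> ALL f:S K. \<bar>F f - K f\<bar> < \<delta> K ==> cmod (a F - a K) < e/3"
  by metis
 define S' where "S' = \<Union>(S ` N)"
 define \<delta>' where "\<delta>' = Min (insert 1 (\<delta> ` N))"
 have fin: "finite S'" "S' \<subseteq> carrier V" using S N(1) by (auto simp: S'_def)
 have \<delta>': "\<delta>' > 0" "!!K. K : N ==> \<delta>' <= \<delta> K" using S(3) N(1) by (auto simp: \<delta>'_def)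
 have "osc a F <= e" if F: "F : dual V" and sm: "ALL f:S'. \<bar>F f\<bar> < \<delta>'" for F
 proof (rule osc_le)
  fix G assume G: "G : dual V"
  obtain K where K: "K : N" "trel a (e/3) G K" using N(3)[OF G] by blast
  have KV: "K : dual V" using K N by blast
  have comm: "dadd F H = dadd H F" for H unfolding dual_add_def by (rule restrict_ext) simp
  have 1: "cmod (a (dadd F G) - a (dadd F K)) <= e/3" using K(2) F by (simp add: trel_def)
  have 2: "cmod (a G - a K) <= e/3"
  proof -
   have "cmod (a (dadd (sc 0 F) G) - a (dadd (sc 0 F) K)) <= e/3"
    using K(2) sc_closed[OF F, of 0] unfolding trel_def by blast
   then show ?thesis by (simp only: dadd_zero(2)[OF G] dadd_zero(2)[OF KV])
  qed
  have 3: "cmod (a (dadd K F) - a K) < e/3"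
  proof (rule near[OF K(1) dual_add_closed[OF KV F]], rule ballI)
   fix f assume f: "f : S K"
   then have "f : S'" using K(1) by (auto simp: S'_def)
   moreover have "f : carrier V" using f S(2)[OF K(1)] by blast
   ultimately have "\<bar>F f\<bar> < \<delta> K" "dadd K F f - K f = F f"
    using sm \<delta>'(2)[OF K(1)] by (auto simp: dual_add_def intro: less_le_trans)
   then show "\<bar>dadd K F f - K f\<bar> < \<delta> K" by simp
  qed
  have "cmod (a (dadd G F) - a G) = cmod ((a (dadd F G) - a (dadd F K)) + (a (dadd K F) - a K) - (a G - a K))"
   by (simp only: comm[of G] comm[of K]) simp
  also have "... <= cmod (a (dadd F G) - a (dadd F K)) + cmod (a (dadd K F) - a K) + cmod (a G - a K)"
   by (rule order_trans[OF norm_triangle_ineq4 add_right_mono[OF norm_triangle_ineq]])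
  also have "... <= e" using 1 2 3 by linarith
  finally show "cmod (a (dadd G F) - a G) <= e" .
 qed
 then show thesis using that[OF fin \<delta>'(1)] by blast
qed

text \<open>On the line spanned by \<Phi> the oscillation meets the assumptions of
  \<open>bogolyubov_real\<close>: the cover comes from almost periodicity, smallness near 0 from
  \<open>osc_small\<close>.\<close>

lemma osc_direction:
 assumes a: "a : apc" and \<Phi>: "\<Phi> : dual V" and e: "e > 0"
 obtains \<Theta> \<delta> where "finite \<Theta>" "\<delta> > 0" "ALL t. (ALL \<theta>:\<Theta>. cmod (cis (t * \<theta>) - 1) < \<delta>) --> osc a (sc t \<Phi>) <= 3 * e"
proof -
 obtain \<P> where P: "finite \<P>" "dual V \<subseteq> \<Union>\<P>" "ALL P:\<P>. ALL x:P \<inter> dual V. ALL y:P \<inter> dual V. trel a e x y"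
  using apcD(3)[OF a e] by (rule tbdE)
 obtain S d where S: "finite S" "S \<subseteq> carrier V" "d > 0" "ALL F:dual V. (ALL f:S. \<bar>F f\<bar> < d) --> osc a F <= e"
  using osc_small[OF a e] by metis
 \<comment> \<open>Chosen so that \<open>\<bar>t\<bar> <= d / M\<close> keeps
   \<open>t * \<Phi> f\<close> below \<open>d\<close> in modulus on all of \<open>S\<close>.\<close>
 define M where "M = 1 + (\<Sum>f\<in>S. \<bar>\<Phi> f\<bar>)"
 have M: "M > 0" "!!f. f : S ==> \<bar>\<Phi> f\<bar> < M"
 proof -
  show "M > 0" unfolding M_def by (rule add_pos_nonneg[OF zero_less_one sum_nonneg]) simp
  show "\<bar>\<Phi> f\<bar> < M" if "f : S" for f
   using member_le_sum[OF that, of "%f. \<bar>\<Phi> f\<bar>"] S(1) by (simp add: M_def)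
 qed
 let ?\<C> = "(%P. (%t. sc t \<Phi>) -` P) ` \<P>"
 obtain \<Theta> \<delta> where "finite \<Theta>" "\<delta> > 0" "!!t. (!!\<theta>. \<theta> : \<Theta> ==> cmod (cis (t * \<theta>) - 1) < \<delta>) ==> osc a (sc t \<Phi>) <= 3 * e"
 proof (rule bogolyubov_real[of ?\<C> "%t. osc a (sc t \<Phi>)" e "d / M"])
  show "finite ?\<C>" using P(1) by simp
  show "\<Union>?\<C> = UNIV" using P(2) sc_closed[OF \<Phi>] by blast
  show "osc a (sc (x - y) \<Phi>) <= e" if C: "C : ?\<C>" "x : C" "y : C" for C x y
  proof (rule osc_diff[OF a \<Phi>])
   obtain P' where "P' : \<P>" "sc x \<Phi> : P'" "sc y \<Phi> : P'" using C by auto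
   then show "trel a e (sc x \<Phi>) (sc y \<Phi>)" using P(3) sc_closed[OF \<Phi>] by blast
  qed
  show "osc a (sc (s + t) \<Phi>) <= osc a (sc s \<Phi>) + osc a (sc t \<Phi>)" for s t
   using osc_dadd[OF a sc_closed[OF \<Phi>, of s] sc_closed[OF \<Phi>, of t]] by (simp only: dadd_sc)
  show "d / M > 0" using S(3) M(1) by simp
  show "osc a (sc t \<Phi>) <= e" if t: "\<bar>t\<bar> <= d / M" for t
  proof -
   have "\<bar>sc t \<Phi> f\<bar> < d" if f: "f : S" for f
   proof -
    have "\<bar>sc t \<Phi> f\<bar> = \<bar>t\<bar> * \<bar>\<Phi> f\<bar>" using f S(2) by (auto simp: sc_def abs_mult)
    also have "... <= (d / M) * \<bar>\<Phi> f\<bar>" using t by (rule mult_right_mono) simp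
    also have "... < (d / M) * M" using M S(3) f by (intro mult_strict_left_mono) auto
    also have "... = d" using M(1) by simp
    finally show ?thesis .
   qed
   then show ?thesis using S(4) sc_closed[OF \<Phi>] by blast
  qed
 qed blast
 then show thesis using that[of \<Theta> \<delta>] by blast
qed

text \<open>The directions \<open>\<Phi> b\<close> can be treated one at a time because the oscillation is subadditive.\<close>
lemma osc_bohr:
 assumes a: "a : apc" and e: "e > 0"
 obtains C \<delta> where "finite C" "C \<subseteq> carrier V" "\<delta> > 0"
  "ALL F:dual V. (ALL f:C. cmod (cis (F f) - 1) < \<delta>) --> osc a F <= e"
proof -
 obtain S d where S: "finite S" "S \<subseteq> carrier V" "d > 0" "ALL F:dual V. (ALL f:S. \<bar>F f\<bar> < d) --> osc a F <= e/2"
  using osc_small[OF a, of "e/2"] e by (metis half_gt_zero)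
 obtain B \<Phi> where B: "B \<subseteq> S" and \<Phi>0: "ALL b:B. \<Phi> b : dual V"
  and eq0: "ALL F:dual V. ALL s:S. F s = (\<Sum>b\<in>B. F b * \<Phi> b s)"
  using dual_basis[OF S(1,2)] by (elim exE conjE)
 have \<Phi>: "\<Phi> b : dual V" if "b : B" for b using \<Phi>0 that by blast
 have eq: "F u = (\<Sum>b\<in>B. F b * \<Phi> b u)" if "F : dual V" "u : S" for F u using eq0 that by blast
 have finB: "finite B" using B S(1) finite_subset by blast
 have BV: "b : carrier V" if "b : B" for b using B S(2) that by blast
 \<comment> \<open>Each of the \<open>card B\<close> directions costs at most
   \<open>3 * \<epsilon>\<close>, so together they stay within \<open>e / 2\<close>; the other half
   is for the remainder, which vanishes on \<open>S\<close>.\<close>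
 define \<epsilon> where "\<epsilon> = e / (6 * (real (card B) + 1))"
 have \<epsilon>: "\<epsilon> > 0" using e by (simp add: \<epsilon>_def)
 have "ALL b:B. EX \<Theta> \<delta>. finite \<Theta> & \<delta> > 0 & (ALL t. (ALL \<theta>:\<Theta>. cmod (cis (t * \<theta>) - 1) < \<delta>) --> osc a (sc t (\<Phi> b)) <= 3 * \<epsilon>)"
  using osc_direction[OF a \<Phi> \<epsilon>] by metis
 then obtain \<Theta> \<delta> where \<Theta>: "!!b. b : B ==> finite (\<Theta> b)" "!!b. b : B ==> \<delta> b > (0::real)"
  "!!b t. b : B ==> ALL \<theta>:\<Theta> b. cmod (cis (t * \<theta>) - 1) < \<delta> b ==> osc a (sc t (\<Phi> b)) <= 3 * \<epsilon>" by metis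
 \<comment> \<open>A frequency \<theta> in the direction of \<open>b\<close> becomes the vector
   \<open>\<theta> \<odot> b\<close>, since
   \<open>F (\<theta> \<odot> b) = \<theta> * F b\<close>.\<close>
 define C where "C = (\<Union>b\<in>B. (%\<theta>. \<theta> \<odot> b) ` \<Theta> b)"
 define \<delta>' where "\<delta>' = Min (insert 1 (\<delta> ` B))"
 have C: "finite C" "C \<subseteq> carrier V" using \<Theta>(1) finB rsmult(1)[OF BV] by (auto simp: C_def)
 have \<delta>': "\<delta>' > 0" "!!b. b : B ==> \<delta>' <= \<delta> b" using \<Theta>(2) finB by (auto simp: \<delta>'_def)
 have "osc a F <= e" if F: "F : dual V" and near: "ALL f:C. cmod (cis (F f) - 1) < \<delta>'" for F
 proof -
  define H where "H A = (\<lambda>f\<in>carrier V. \<Sum>b\<in>A. F b * \<Phi> b f)" for A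
  have HV: "H A : dual V" if "A \<subseteq> B" for A
   unfolding H_def by (rule dual_sum) (use that finB finite_subset \<Phi> in blast)+
  have small: "osc a (sc (F b) (\<Phi> b)) <= 3 * \<epsilon>" if b: "b : B" for b
  proof (rule \<Theta>(3)[OF b], rule ballI)
   fix \<theta> assume "\<theta> : \<Theta> b"
   then have "\<theta> \<odot> b : C" using b by (auto simp: C_def)
   then have "cmod (cis (F (\<theta> \<odot> b)) - 1) < \<delta>'" using near by blast
   then show "cmod (cis (F b * \<theta>) - 1) < \<delta> b"
    using \<delta>'(2)[OF b] dualD(2)[OF F BV[OF b], of \<theta>] by (simp add: mult.commute)
  qed
  have H_le: "osc a (H A) <= real (card A) * (3 * \<epsilon>)" if "A \<subseteq> B" for A
   using finite_subset[OF that finB] that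
  proof (induction A rule: finite_induct)
   case empty
   have "H {} = sc 0 F" by (simp add: H_def sc_def)
   then have "osc a (H {}) <= 0" by (intro osc_le) (simp add: dadd_zero)
   then show ?case by simp
  next
   case (insert b A)
   have "H (insert b A) = dadd (sc (F b) (\<Phi> b)) (H A)"
    unfolding H_def dual_add_def sc_def using insert.hyps by (intro restrict_ext) simp
   moreover have "b : B" "A \<subseteq> B" using insert.prems by auto
   ultimately have "osc a (H (insert b A)) <= osc a (sc (F b) (\<Phi> b)) + osc a (H A)"
    using osc_dadd[OF a sc_closed[OF \<Phi>] HV] by simp
   also have "... <= 3 * \<epsilon> + real (card A) * (3 * \<epsilon>)"
    using small insert \<open>b : B\<close> \<open>A \<subseteq> B\<close> by (intro add_mono) auto
   also have "... = real (card (insert b A)) * (3 * \<epsilon>)" using insert.hyps by (simp add: algebra_simps)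
   finally show ?case .
  qed
  define R where "R = (\<lambda>f\<in>carrier V. F f + (-1) * H B f)"
  have RV: "R : dual V" unfolding R_def by (rule dual_comb[OF F HV[OF order_refl]])
  have "R s = 0" if "s : S" for s
   using eq[OF F that] that S(2) by (auto simp: R_def H_def)
  then have oR: "osc a R <= e/2" using S(3,4) RV by auto
  have FR: "F = dadd (H B) R"
   by (rule extensionalityI[OF dualD(5)[OF F] dualD(5)[OF dual_add_closed[OF HV[OF order_refl] RV]]])
    (simp add: dual_add_def R_def)
  have "osc a F <= osc a (H B) + osc a R"
   using osc_dadd[OF a HV[OF order_refl] RV] by (simp only: FR[symmetric])
  also have "... <= real (card B) * (3 * \<epsilon>) + e/2" using H_le[OF order_refl] oR by (rule add_mono)
  also have "real (card B) * (3 * \<epsilon>) <= (real (card B) + 1) * (3 * \<epsilon>)" using \<epsilon> by (intro mult_right_mono) auto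
  also have "(real (card B) + 1) * (3 * \<epsilon>) = e/2" by (simp add: \<epsilon>_def field_simps)
  finally show ?thesis by simp
 qed
 then show thesis using that[OF C \<delta>'(1)] by blast
qed

text \<open>Stone-Weierstrass needs a compact space, so trigonometric polynomials in the characters
  given by \<open>c i\<close> are read as functions on a torus, realised inside
  \<open>nat => complex\<close> by padding with zeros. Members are tied to polynomials only along
  the points \<open>Z F\<close>, where the approximations are evaluated.\<close>

lemma trig_ring:
 fixes c :: "nat => 'v" and k :: nat
 defines "Z \<equiv> %F i. if i < k then cis (F (c i)) else (0::complex)"
  and "S \<equiv> {z. (ALL i<k. cmod (z i) = 1) & (ALL i>=k. z i = (0::complex))}"
 assumes c: "!!i. i < k ==> c i : carrier V"
 shows "function_ring_on {r :: (nat => complex) => real. continuous_on S r \<and>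
  (EX b:FC. ALL F:dual V. cr (r (Z F)) = WC b F)} S"
proof
 let ?U = "%i::nat. if i < k then sphere (0::complex) 1 else {0}"
 have "z : S \<longleftrightarrow> (ALL i. z i : ?U i)" for z
 proof
  assume *: "ALL i. z i : ?U i"
  have "cmod (z i) = 1" if "i < k" for i using spec[OF *, of i] that by simp
  moreover have "z i = 0" if "i >= k" for i using spec[OF *, of i] that by simp
  ultimately show "z : S" by (simp add: S_def)
 qed (simp add: S_def)
 then have S_eq: "S = Pi\<^sub>E UNIV ?U" by (auto simp: PiE_iff)
 have "compactin (product_topology (%i. euclidean) UNIV) (Pi\<^sub>E UNIV ?U)"
  unfolding compactin_PiE by simp
 then show "compact S" unfolding S_eq by (simp add: euclidean_product_topology)
next
 fix f :: "(nat => complex) => real" and g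
 let ?R = "{r. continuous_on S r & (EX b:FC. ALL F:dual V. cr (r (Z F)) = WC b F)}"
 assume f: "f : ?R"
 then show "continuous_on S f" by simp
 assume g: "g : ?R"
 obtain b b' where b: "b : FC" "!!F. F : dual V ==> cr (f (Z F)) = WC b F"
  and b': "b' : FC" "!!F. F : dual V ==> cr (g (Z F)) = WC b' F"
  using f g by blast
 have cont: "continuous_on S f" "continuous_on S g" using f g by auto
 have "EX b:FC. ALL F:dual V. cr (f (Z F) + g (Z F)) = WC b F"
  by (rule bexI[of _ "%f. b f + b' f"]) (use b b' in \<open>simp_all add: W0_comb_linear(1)\<close>)
 then show "(%x. f x + g x) : ?R" using cont by (simp add: continuous_on_add)
 have "EX b:FC. ALL F:dual V. cr (f (Z F) * g (Z F)) = WC b F"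
  by (rule bexI[of _ "b \<star>[0] b'"]) (use b b' in \<open>simp_all add: W0_comb_star_mult(1)\<close>)
 then show "(%x. f x * g x) : ?R" using cont by (simp add: continuous_on_mult)
next
 let ?R = "{r. continuous_on S r & (EX b:FC. ALL F:dual V. cr (r (Z F)) = WC b F)}"
 have one: "WC (ws \<zero>) F = 1" if "F : dual V" for F
  using that by (simp add: W0_comb_symbol W0_eq dualD(3))
 fix u :: real
 have "EX b:FC. ALL F:dual V. cr u = WC b F"
 proof (rule bexI[of _ "%f. cr u * ws \<zero> f"])
  show "ALL F:dual V. cr u = WC (%f. cr u * ws \<zero> f) F"
  proof
   fix F assume F: "F : dual V"
   have s: "ws \<zero> : FC" by simp
   show "cr u = WC (%f. cr u * ws \<zero> f) F"
    using W0_comb_linear(2)[OF s s F, of "cr u"] one[OF F] by simp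
  qed
 qed simp
 then show "(%_. u) : ?R" by simp
next
 fix x y assume xy: "x : S" "y : S" "x ~= y"
 let ?R = "{r. continuous_on S r & (EX b:FC. ALL F:dual V. cr (r (Z F)) = WC b F)}"
 obtain i where "x i ~= y i" using xy(3) by auto
 moreover have "x i = 0" "y i = 0" if "i >= k" using xy(1,2) that by (simp_all add: S_def)
 ultimately have i: "i < k" using not_less by metis
 have co: "continuous_on S (%z::nat => complex. z i)"
  by (rule continuous_on_subset[OF continuous_on_product_coordinates subset_UNIV])
 have ci: "c i : carrier V" "\<ominus> c i : carrier V" using c[OF i] by auto
 have re: "(%z. Re (z i)) : ?R"
 proof -
  have "EX b:FC. ALL F:dual V. cr (Re (Z F i)) = WC b F"
  \<comment> \<open>The real part of \<open>cis\<close> is half the sum of the symbols at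
    \<open>c i\<close> and \<open>\<ominus> c i\<close>; the imaginary part below is treated
    alike.\<close>
  proof (rule bexI[of _ "%f. (1/2) * (%f. ws (c i) f + ws (\<ominus> c i) f) f"], rule ballI)
   fix F assume F: "F : dual V"
   have s: "ws (c i) : FC" "ws (\<ominus> c i) : FC" using ci by auto
   note s' = fin_closed(1)[OF s]
   show "cr (Re (Z F i)) = WC (%f. (1/2) * (%f. ws (c i) f + ws (\<ominus> c i) f) f) F"
    unfolding W0_comb_linear(2)[OF s' s' F] W0_comb_linear(1)[OF s F] W0_comb_symbol W0_eq[OF F]
    using i by (simp add: Z_def dualD(4)[OF F ci(1)] complex_eq_iff)
  qed (rule fin_closed(2)[OF fin_closed(1)], use ci in simp_all)
  then show ?thesis using co by (simp add: continuous_on_Re)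
 qed
 have im: "(%z. Im (z i)) : ?R"
 proof -
  have "EX b:FC. ALL F:dual V. cr (Im (Z F i)) = WC b F"
  proof (rule bexI[of _ "%f. (-\<i>/2) * (%f. ws (c i) f + (%f. (-1) * ws (\<ominus> c i) f) f) f"], rule ballI)
   fix F assume F: "F : dual V"
   have s: "ws (c i) : FC" "ws (\<ominus> c i) : FC" using ci by auto
   note s2 = fin_closed(2)[OF s(2), of "-1"]
   note s' = fin_closed(1)[OF s(1) s2]
   show "cr (Im (Z F i)) = WC (%f. (-\<i>/2) * (%f. ws (c i) f + (%f. (-1) * ws (\<ominus> c i) f) f) f) F"
    unfolding W0_comb_linear(2)[OF s' s' F] W0_comb_linear(1)[OF s(1) s2 F] W0_comb_linear(2)[OF s(2) s(2) F] W0_comb_symbol W0_eq[OF F]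
    using i by (simp add: Z_def dualD(4)[OF F ci(1)] complex_eq_iff)
  qed (rule fin_closed(2)[OF fin_closed(1)[OF _ fin_closed(2)]], use ci in simp_all)
  then show ?thesis using co by (simp add: continuous_on_Im)
 qed
 show "EX f:?R. f x ~= f y"
 proof (cases "Re (x i) = Re (y i)")
  case True
  then have "Im (x i) ~= Im (y i)" using \<open>x i ~= y i\<close> complex_eqI by blast
  then show ?thesis using im by (intro bexI[of _ "%z. Im (z i)"])
 next
  case False
  then show ?thesis using re by (intro bexI[of _ "%z. Re (z i)"])
 qed
qed

text \<open>Where finitely many characters nearly agree, \<open>a\<close> varies by at most
  \<open>e / 2\<close>. A partition of unity on the torus of these characters, subordinate to a
  finite net, blends the values \<open>a K\<close> into an approximation, and its members are
  replaced by trigonometric polynomials through Stone-Weierstrass at the cost of another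
  \<open>e / 2\<close>.\<close>

theorem AP_dense:
 assumes a: "a : apc" and e: "e > 0"
 shows "EX b:FC. ALL F:dual V. cmod (a F - WC b F) <= e"
proof -
 obtain C \<delta> where C: "finite C" "C \<subseteq> carrier V" and \<delta>: "\<delta> > 0"
  and bohr: "ALL F:dual V. (ALL f:C. cmod (cis (F f) - 1) < \<delta>) --> osc a F <= e/2"
  using osc_bohr[OF a, of "e/2"] e by (metis half_gt_zero)
 define k where "k = card C"
 obtain c where c: "bij_betw c {0..<k} C" using ex_bij_betw_nat_finite[OF C(1)] unfolding k_def by blast
 have cC: "C = c ` {..<k}" using c by (simp add: bij_betw_def lessThan_atLeast0)
 have cV: "c i : carrier V" if "i < k" for i using C(2) cC that by blast
 define Z where "Z F i = (if i < k then cis (F (c i)) else (0::complex))" for F :: "'v => real" and i :: nat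
 define S where "S = {z. (ALL i<k. cmod (z i) = 1) & (ALL i>=k. z i = (0::complex))}"
 interpret R: function_ring_on "{r :: (nat => complex) => real. continuous_on S r \<and>
  (EX b:FC. ALL F:dual V. cr (r (Z F)) = WC b F)}" S
  using trig_ring[of k c] cV unfolding Z_def[abs_def] S_def by simp
 have ZS: "Z F : S" for F by (simp add: Z_def S_def)
 have near: "cmod (a F - a K) <= e/2" if F: "F : dual V" and K: "K : dual V" and z: "ALL i<k. cmod (Z F i - Z K i) < \<delta>" for F K
 proof -
  define D where "D = dadd F (sc (-1) K)"
  have D: "D : dual V" unfolding D_def by (rule dual_add_closed[OF F sc_closed[OF K]])
  have "ALL f:C. cmod (cis (D f) - 1) < \<delta>"
  proof
   fix f assume "f : C"
   then obtain i where i: "i < k" "f = c i" using cC by blast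
   have "cis (F f) - cis (K f) = cis (K f) * (cis (D f) - 1)"
    using cV[OF i(1)] i(2) by (simp add: D_def dual_add_def sc_def algebra_simps cis_mult)
   then have "cmod (cis (D f) - 1) = cmod (cis (F f) - cis (K f))" by (simp add: norm_mult)
   also have "... < \<delta>" using z i by (simp add: Z_def)
   finally show "cmod (cis (D f) - 1) < \<delta>" .
  qed
  then have "osc a D <= e/2" using bohr D by blast
  moreover have "dadd K D = F"
   by (rule extensionalityI[OF dualD(5)[OF dual_add_closed[OF K D]] dualD(5)[OF F]])
    (simp add: D_def dual_add_def sc_def)
  ultimately show ?thesis using osc_upper[OF a D K] by simp
 qed
 \<comment> \<open>If all coordinates are within \<open>sqrt r\<close> of those of a net point, the
   sum of squares is at most \<open>k * r <= \<delta>\<^sup>2 / 2\<close>, so the bump of that point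
   has at least the height \<open>\<delta>\<^sup>2 / 2\<close>.\<close>
 define r where "r = \<delta>\<^sup>2 / (2 * (real k + 1))"
 have r: "r > 0" using \<delta> by (simp add: r_def)
 have tb: "tbd (dual V) (%F K. ALL i:{..<k}. cmod (Z F i - Z K i) <= sqrt r)"
  by (rule tbd_ball, simp, rule tbd_bounded[of _ _ 1]) (use r in \<open>auto simp: Z_def\<close>)
 obtain N where N: "finite N" "N \<subseteq> dual V" and net: "!!F. F : dual V ==> EX K:N. ALL i:{..<k}. cmod (Z F i - Z K i) <= sqrt r"
  using tbd_net[OF tb] by metis
 define q where "q K z = (\<Sum>i<k. (cmod (z i - Z K i))\<^sup>2)" for K and z :: "nat => complex"
 define \<psi> where "\<psi> K z = max 0 (\<delta>\<^sup>2 - q K z)" for K z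
 \<comment> \<open>The maximum keeps the denominator positive on the entire torus, also off the
   points \<open>Z F\<close>. At these points the sum is at least
   \<open>\<delta>\<^sup>2 / 2\<close> and equals the maximum, so the quotients add up to 1.\<close>
 define \<Psi> where "\<Psi> z = max (\<delta>\<^sup>2 / 2) (\<Sum>K\<in>N. \<psi> K z)" for z
 have \<Psi>pos: "\<Psi> z > 0" for z using \<delta> by (simp add: \<Psi>_def less_max_iff_disj)
 have co: "continuous_on S (%z::nat => complex. z i)" for i
  by (rule continuous_on_subset[OF continuous_on_product_coordinates subset_UNIV])
 have c\<psi>: "continuous_on S (\<psi> K)" for K
  unfolding \<psi>_def q_def
  by (intro continuous_on_max continuous_on_const continuous_on_diff continuous_on_sum continuous_on_power continuous_on_norm co)
 have c\<Psi>: "continuous_on S \<Psi>"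
  unfolding \<Psi>_def by (intro continuous_on_max continuous_on_const continuous_on_sum c\<psi>)
 define g where "g K z = \<psi> K z / \<Psi> z" for K z
 have cg: "continuous_on S (g K)" for K
  unfolding g_def by (rule continuous_on_divide[OF c\<psi> c\<Psi>]) (use \<Psi>pos less_irrefl in metis)
 have \<psi>0: "\<psi> K z >= 0" for K z by (simp add: \<psi>_def)
 have g0: "g K z >= 0" for K z unfolding g_def by (rule divide_nonneg_nonneg[OF \<psi>0 less_imp_le[OF \<Psi>pos]])
 have \<psi>near: "ALL i<k. cmod (Z F i - Z K i) < \<delta>" if "\<psi> K (Z F) > 0" for F K
 proof (intro allI impI)
  fix i assume i: "i < k"
  have "(cmod (Z F i - Z K i))\<^sup>2 <= q K (Z F)"
   unfolding q_def using i by (intro member_le_sum) auto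
  also have "... < \<delta>\<^sup>2" using that by (simp add: \<psi>_def less_max_iff_disj)
  finally show "cmod (Z F i - Z K i) < \<delta>" by (rule power_less_imp_less_base) (use \<delta> in simp)
 qed
 have sum1: "(\<Sum>K\<in>N. g K (Z F)) = 1" if F: "F : dual V" for F
 proof -
  from net[OF F] obtain K where K: "K : N" "ALL i:{..<k}. cmod (Z F i - Z K i) <= sqrt r" by (rule bexE)
  have "q K (Z F) <= (\<Sum>i<k. r)"
   unfolding q_def
  proof (rule sum_mono)
   fix i assume "i : {..<k}"
   then have "(cmod (Z F i - Z K i))\<^sup>2 <= (sqrt r)\<^sup>2" using K(2) by (intro power_mono) auto
   then show "(cmod (Z F i - Z K i))\<^sup>2 <= r" using r by simp
  qed
  also have "... = real k * r" by simp
  also have "... <= (real k + 1) * r" using r by (intro mult_right_mono) auto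
  also have "... = \<delta>\<^sup>2 / 2" by (simp add: r_def field_simps)
  finally have "\<delta>\<^sup>2 / 2 <= \<delta>\<^sup>2 - q K (Z F)" by linarith
  also have "... <= \<psi> K (Z F)" unfolding \<psi>_def by (rule max.cobounded2)
  finally have "\<psi> K (Z F) >= \<delta>\<^sup>2 / 2" .
  moreover have "\<psi> K (Z F) <= (\<Sum>K\<in>N. \<psi> K (Z F))" using K(1) N(1) \<psi>0 by (intro member_le_sum) auto
  ultimately have "\<Psi> (Z F) = (\<Sum>K\<in>N. \<psi> K (Z F))" by (simp add: \<Psi>_def)
  then show ?thesis unfolding g_def using \<Psi>pos[of "Z F"] by (simp add: sum_divide_distrib[symmetric])
 qed
 obtain A where A: "A >= 0" "!!F. F : dual V ==> cmod (a F) <= A" using apc_bounded[OF a] by metis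
 \<comment> \<open>Every \<open>a K\<close> is at most \<open>A\<close> in modulus, so
   \<open>card N\<close> errors of size \<eta> add up to no more than \<open>e / 2\<close>.\<close>
 define \<eta> where "\<eta> = e / (2 * (A + 1) * (real (card N) + 1))"
 have \<eta>: "\<eta> > 0" using e A by (simp add: \<eta>_def)
 have "ALL K. EX b:FC. ALL F:dual V. cmod (cr (g K (Z F)) - WC b F) <= \<eta>"
 proof
  fix K
  obtain u b where u: "ALL z:S. \<bar>g K z - u z\<bar> < \<eta>" "b : FC"
   "ALL F:dual V. cr (u (Z F)) = WC b F"
   using R.Stone_Weierstrass_basic[OF cg \<eta>, of K] by blast
  have "cmod (cr (g K (Z F)) - WC b F) <= \<eta>" if F: "F : dual V" for F
  proof -
   have "WC b F = cr (u (Z F))" using u(3) F by simp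
   then have "cmod (cr (g K (Z F)) - WC b F) = \<bar>g K (Z F) - u (Z F)\<bar>"
    by (simp only: of_real_diff[symmetric] norm_of_real)
   then show ?thesis using u(1) ZS[of F] by (simp add: less_imp_le)
  qed
  then show "EX b:FC. ALL F:dual V. cmod (cr (g K (Z F)) - WC b F) <= \<eta>" using u(2) by blast
 qed
 then obtain b where b: "!!K. b K : FC"
  "!!K F. F : dual V ==> cmod (cr (g K (Z F)) - WC (b K) F) <= \<eta>" by metis
 have comb: "EX b':FC. ALL F:dual V. WC b' F = (\<Sum>K\<in>M. a K * WC (b K) F)" if "finite M" for M
  using that
 proof (induction M rule: finite_induct)
  case empty
  show ?case by (rule bexI[of _ "%_. 0"]) (simp_all add: W0_combination_def)
 next
  case (insert K M)
  then obtain b' where b': "b' : FC" "ALL F:dual V. WC b' F = (\<Sum>K\<in>M. a K * WC (b K) F)" by blast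
  show ?case
  proof (rule bexI[of _ "%f. (%f. a K * b K f) f + b' f"], rule ballI)
   fix F assume F: "F : dual V"
   show "WC (%f. (%f. a K * b K f) f + b' f) F = (\<Sum>K\<in>insert K M. a K * WC (b K) F)"
    unfolding W0_comb_linear(1)[OF fin_closed(2)[OF b(1)] b'(1) F] W0_comb_linear(2)[OF b(1) b(1) F]
    using b'(2) F insert.hyps by simp
  qed (rule fin_closed(1)[OF fin_closed(2)[OF b(1)] b'(1)])
 qed
 obtain b' where b': "b' : FC" "ALL F:dual V. WC b' F = (\<Sum>K\<in>N. a K * WC (b K) F)"
  using comb[OF N(1)] by blast
 have "cmod (a F - WC b' F) <= e" if F: "F : dual V" for F
 proof -
  have 1: "a F - (\<Sum>K\<in>N. a K * cr (g K (Z F))) = (\<Sum>K\<in>N. (a F - a K) * cr (g K (Z F)))"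
  proof -
   have "a F = (\<Sum>K\<in>N. a F * cr (g K (Z F)))"
    using sum1[OF F] by (simp only: sum_distrib_left[symmetric] of_real_sum[symmetric]) simp
   then have "a F - (\<Sum>K\<in>N. a K * cr (g K (Z F))) =
    (\<Sum>K\<in>N. a F * cr (g K (Z F))) - (\<Sum>K\<in>N. a K * cr (g K (Z F)))" by simp
   then show ?thesis by (simp only: sum_subtractf[symmetric] left_diff_distrib)
  qed
  have "cmod (\<Sum>K\<in>N. (a F - a K) * cr (g K (Z F))) <= (\<Sum>K\<in>N. (e/2) * g K (Z F))"
  proof (rule order_trans[OF norm_sum], rule sum_mono)
   fix K assume K: "K : N"
   have "cmod (a F - a K) * g K (Z F) <= (e/2) * g K (Z F)"
   proof (cases "\<psi> K (Z F) > 0")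
    case True
    have KV: "K : dual V" using K N(2) by blast
    show ?thesis by (rule mult_right_mono[OF near[OF F KV \<psi>near[OF True]] g0])
   next
    case False
    then have "g K (Z F) = 0" using \<psi>0[of K "Z F"] by (simp add: g_def)
    then show ?thesis by simp
   qed
   then show "cmod ((a F - a K) * cr (g K (Z F))) <= (e/2) * g K (Z F)"
    using g0[of K "Z F"] by (simp add: norm_mult)
  qed
  also have "... = e/2" using sum1[OF F] by (simp only: sum_distrib_left[symmetric] mult_1_right)
  finally have part1: "cmod (a F - (\<Sum>K\<in>N. a K * cr (g K (Z F)))) <= e/2" unfolding 1 .
  have "cmod ((\<Sum>K\<in>N. a K * cr (g K (Z F))) - WC b' F) =
   cmod (\<Sum>K\<in>N. a K * (cr (g K (Z F)) - WC (b K) F))"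
   using b'(2) F by (simp only: right_diff_distrib sum_subtractf)
  also have "... <= (\<Sum>K\<in>N. A * \<eta>)"
  proof (rule order_trans[OF norm_sum], rule sum_mono)
   fix K assume "K : N"
   then show "cmod (a K * (cr (g K (Z F)) - WC (b K) F)) <= A * \<eta>"
    unfolding norm_mult using A b(2)[OF F] N(2) by (intro mult_mono) auto
  qed
  also have "... = real (card N) * (A * \<eta>)" by simp
  also have "... <= (real (card N) + 1) * ((A + 1) * \<eta>)" using A \<eta> by (intro mult_mono) auto
  also have "... = e/2"
  proof -
   have "A + 1 > 0" using A by simp
   then show ?thesis unfolding \<eta>_def by (simp add: divide_simps)
  qed
  finally have part2: "cmod ((\<Sum>K\<in>N. a K * cr (g K (Z F))) - WC b' F) <= e/2" .
  show ?thesis using norm_triangle_mono[OF part1 part2] by simp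
 qed
 then show ?thesis using b'(1) by blast
qed

end

section \<open>Quotients by the kernel of a surjective homomorphism\<close>

locale star_quotient = A: star_alg A + B: star_alg B
 for A :: "('a, 'x) star_algebra_scheme" and B :: "('b, 'y) star_algebra_scheme" +
 fixes l :: "'a => 'b"
 assumes hom: "l : star_hom A B" and onto: "l ` carrier A = carrier B"
begin

definition Ker :: "'a set" where "Ker = {a : carrier A. l a = \<zero>\<^bsub>B\<^esub>}"

abbreviation cos :: "'a => 'a set" where "cos a \<equiv> Ker +>\<^bsub>A\<^esub> a"

lemmas lD = star_homD[OF hom]

lemma l_minus: "a : carrier A ==> b : carrier A ==> l (a \<ominus>\<^bsub>A\<^esub> b) = l a \<ominus>\<^bsub>B\<^esub> l b"
 by (simp add: A.a_minus_smult B.a_minus_smult lD)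

lemma Ker_ideal: "ideal Ker A"
proof -
 have "ring_hom_ring A B l"
  by (rule ring_hom_ringI[OF A.ring_axioms B.ring_axioms]) (auto simp: lD)
 then have "ideal (a_kernel A B l) A" by (rule ring_hom_ring.kernel_is_ideal)
 then show ?thesis by (simp add: a_kernel_def' Ker_def)
qed

text \<open>Makes computations with classes computations with values of \<open>l\<close>; equality
  of classes becomes equality in \<open>B\<close>.\<close>

lemma coset: assumes a: "a : carrier A" shows "cos a = {x : carrier A. l x = l a}"
proof -
 interpret I: ideal Ker A by (rule Ker_ideal)
 have "x : cos a \<longleftrightarrow> x : carrier A & l x = l a" for x
 proof (cases "x : carrier A")
  case True
  have "x : cos a \<longleftrightarrow> x \<ominus>\<^bsub>A\<^esub> a : Ker"
   using I.a_rcos_module_minus[OF A.ring_axioms a True] .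
  also have "... \<longleftrightarrow> l x \<ominus>\<^bsub>B\<^esub> l a = \<zero>\<^bsub>B\<^esub>"
   unfolding Ker_def mem_Collect_eq l_minus[OF True a] using A.minus_closed[OF True a] by (simp only: simp_thms)
  also have "... \<longleftrightarrow> l x = l a" by (rule B.r_right_minus_eq[OF lD(1)[OF True] lD(1)[OF a]])
  finally show ?thesis using True by (simp only: simp_thms)
 next
  case False
  then show ?thesis using A.a_r_coset_subset_G[OF I.a_subset a] by blast
 qed
 then show ?thesis by blast
qed

lemma coset_eq_iff: "a : carrier A ==> b : carrier A ==> cos a = cos b \<longleftrightarrow> l a = l b"
 by (auto simp: coset)

abbreviation Q :: "'a set star_algebra" where "Q \<equiv> quotient_algebra A Ker"

lemma Q_carrier: "carrier Q = cos ` carrier A"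
 by (auto simp: quotient_algebra_def FactRing_def A_RCOSETS_def')

lemma Q_simps:
 assumes a: "a : carrier A" and b: "b : carrier A"
 shows "cos a \<oplus>\<^bsub>Q\<^esub> cos b = cos (a \<oplus>\<^bsub>A\<^esub> b)" "cos a \<otimes>\<^bsub>Q\<^esub> cos b = cos (a \<otimes>\<^bsub>A\<^esub> b)"
  "\<one>\<^bsub>Q\<^esub> = cos \<one>\<^bsub>A\<^esub>" "c \<odot>\<^bsub>Q\<^esub> cos a = cos (c \<odot>\<^bsub>A\<^esub> a)" "star Q (cos a) = cos (star A a)"
proof -
 interpret I: ideal Ker A by (rule Ker_ideal)
 show "cos a \<oplus>\<^bsub>Q\<^esub> cos b = cos (a \<oplus>\<^bsub>A\<^esub> b)"
  using I.a_rcos_sum[OF a b] by (simp add: quotient_algebra_def FactRing_def)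
 show "cos a \<otimes>\<^bsub>Q\<^esub> cos b = cos (a \<otimes>\<^bsub>A\<^esub> b)"
  using I.rcoset_mult_add[OF a b] by (simp add: quotient_algebra_def FactRing_def)
 show "\<one>\<^bsub>Q\<^esub> = cos \<one>\<^bsub>A\<^esub>" by (simp add: quotient_algebra_def FactRing_def)
 have self: "a : cos a" using a by (simp add: coset)
 \<comment> \<open>\<open>quotient_algebra\<close> forms scalar multiples and adjoints as unions of
   cosets over a class. Such a union collapses to one coset, since all members of the class have the
   same image under \<open>l\<close>.\<close>
 have un: "(\<Union>x\<in>cos a. cos (g x)) = cos (g a)"
  if "!!x. x : carrier A ==> g x : carrier A" "!!x. x : carrier A ==> l x = l a ==> l (g x) = l (g a)" for g
 proof -
  have "cos (g x) = cos (g a)" if "x : cos a" for x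
   using that a \<open>!!x. x : carrier A ==> g x : carrier A\<close>
    \<open>!!x. x : carrier A ==> l x = l a ==> l (g x) = l (g a)\<close>[of x]
   by (simp add: coset_eq_iff coset)
  then show ?thesis using self by blast
 qed
 show "c \<odot>\<^bsub>Q\<^esub> cos a = cos (c \<odot>\<^bsub>A\<^esub> a)"
  using un[of "%x. c \<odot>\<^bsub>A\<^esub> x"] a by (simp add: quotient_algebra_def lD)
 show "star Q (cos a) = cos (star A a)"
  using un[of "star A"] a by (simp add: quotient_algebra_def lD)
qed

lemma cos_closed: "a : carrier A ==> cos a : carrier Q"
 by (simp add: Q_carrier)

definition Phi :: "'a set => 'b" where "Phi = (\<lambda>P\<in>carrier Q. the_elem (l ` P))"

lemma Phi_coset: assumes a: "a : carrier A" shows "Phi (cos a) = l a"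
proof -
 have "l ` cos a = {l a}" using a by (auto simp: coset)
 then show ?thesis using cos_closed[OF a] by (simp add: Phi_def)
qed

lemma Phi_iso: "Phi : star_iso Q B"
proof -
 have "Phi : star_hom Q B"
 proof (rule star_homI)
  fix P assume "P : carrier Q"
  then obtain a where a: "a : carrier A" "P = cos a" by (auto simp: Q_carrier)
  show "Phi P : carrier B" using a by (simp add: Phi_coset lD)
  show "Phi (c \<odot>\<^bsub>Q\<^esub> P) = c \<odot>\<^bsub>B\<^esub> Phi P" for c using a by (simp add: Q_simps Phi_coset lD)
  show "Phi (star Q P) = star B (Phi P)" using a by (simp add: Q_simps Phi_coset lD)
  fix R assume "R : carrier Q"
  then obtain b where b: "b : carrier A" "R = cos b" by (auto simp: Q_carrier)
  show "Phi (P \<oplus>\<^bsub>Q\<^esub> R) = Phi P \<oplus>\<^bsub>B\<^esub> Phi R" using a b by (simp add: Q_simps Phi_coset lD)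
  show "Phi (P \<otimes>\<^bsub>Q\<^esub> R) = Phi P \<otimes>\<^bsub>B\<^esub> Phi R" using a b by (simp add: Q_simps Phi_coset lD)
 next
  show "Phi \<one>\<^bsub>Q\<^esub> = \<one>\<^bsub>B\<^esub>" using Q_simps(3)[OF A.one_closed A.one_closed] by (simp add: Phi_coset lD)
  show "Phi : extensional (carrier Q)" by (simp add: Phi_def)
 qed
 moreover have "bij_betw Phi (carrier Q) (carrier B)"
 proof (rule bij_betw_imageI)
  show "inj_on Phi (carrier Q)"
  proof (rule inj_onI)
   fix P R assume "P : carrier Q" "R : carrier Q" and e: "Phi P = Phi R"
   then obtain a b where ab: "a : carrier A" "b : carrier A" "P = cos a" "R = cos b" by (auto simp: Q_carrier)
   show "P = R" using e unfolding ab(3,4) Phi_coset[OF ab(1)] Phi_coset[OF ab(2)] coset_eq_iff[OF ab(1,2)] .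
  qed
  show "Phi ` carrier Q = carrier B"
   unfolding Q_carrier image_image using onto by (simp add: Phi_coset cong: image_cong)
 qed
 ultimately show ?thesis by (simp add: star_iso_def)
qed

text \<open>Two isomorphisms onto \<open>B\<close> differ by an automorphism of \<open>B\<close>, which is continuous.\<close>
lemma Phi_unique:
 assumes cs: "cstar B p" and D: "D \<subseteq> carrier B" "!!b e. b : carrier B ==> e > 0 ==> EX d:D. p (b \<ominus>\<^bsub>B\<^esub> d) < e"
  and \<Psi>: "\<Psi> : star_hom Q B" and agree: "!!a. a : carrier A ==> l a : D ==> \<Psi> (cos a) = l a"
 shows "\<Psi> = Phi"
proof -
 interpret Bc: cstar B p by fact
 define s where "s b = (SOME a. a : carrier A & l a = b)" for b
 have s: "s b : carrier A" "l (s b) = b" if "b : carrier B" for b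
 proof -
  have "EX a. a : carrier A & l a = b" using onto that by (metis imageE)
  then have "s b : carrier A & l (s b) = b" unfolding s_def by (rule someI_ex)
  then show "s b : carrier A" "l (s b) = b" by auto
 qed
 \<comment> \<open>The inverse of \<open>Phi\<close>. Followed by \<Psi> it gives an endomorphism of
   \<open>B\<close>, to which contractivity applies although the quotient carries no norm.\<close>
 define k where "k = (\<lambda>b\<in>carrier B. cos (s b))"
 have kl: "k (l a) = cos a" if "a : carrier A" for a
  using that s[of "l a"] lD(1)[OF that] by (simp add: k_def coset_eq_iff)
 have k: "k : star_hom B Q"
 proof (rule star_homI)
  fix b assume b: "b : carrier B"
  then obtain a where a: "a : carrier A" "b = l a" using onto by (metis imageE)
  show "k b : carrier Q" using a by (simp add: kl cos_closed)
  show "k (c \<odot>\<^bsub>B\<^esub> b) = c \<odot>\<^bsub>Q\<^esub> k b" for c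
   using a by (simp add: lD(5)[symmetric] kl Q_simps)
  show "k (star B b) = star Q (k b)" using a by (simp add: lD(6)[symmetric] kl Q_simps)
  fix b' assume b': "b' : carrier B"
  then obtain a' where a': "a' : carrier A" "b' = l a'" using onto by (metis imageE)
  show "k (b \<oplus>\<^bsub>B\<^esub> b') = k b \<oplus>\<^bsub>Q\<^esub> k b'" using a a' by (simp add: lD(2)[symmetric] kl Q_simps)
  show "k (b \<otimes>\<^bsub>B\<^esub> b') = k b \<otimes>\<^bsub>Q\<^esub> k b'" using a a' by (simp add: lD(3)[symmetric] kl Q_simps)
 next
  show "k \<one>\<^bsub>B\<^esub> = \<one>\<^bsub>Q\<^esub>"
   unfolding lD(4)[symmetric] Q_simps(3)[OF A.one_closed A.one_closed] by (rule kl[OF A.one_closed])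
  show "k : extensional (carrier B)" by (simp add: k_def)
 qed
 have "compose (carrier B) \<Psi> k = (\<lambda>b\<in>carrier B. b)"
 proof (rule star_hom_eq_on_dense[OF cs Bc.cstar_pre_axioms _ _ D])
  show "compose (carrier B) \<Psi> k : star_hom B B" by (rule star_hom_compose[OF B.star_alg_axioms k \<Psi>])
  show "(\<lambda>b\<in>carrier B. b) : star_hom B B" by (rule star_hom_id[OF B.star_alg_axioms])
  fix d assume d: "d : D"
  then have dB: "d : carrier B" using D(1) by blast
  then obtain a where a: "a : carrier A" "d = l a" using onto by (metis imageE)
  then show "compose (carrier B) \<Psi> k d = (\<lambda>b\<in>carrier B. b) d"
   using dB d agree[OF a(1)] kl[OF a(1)] by (simp add: compose_def)
 qed
 then have *: "\<Psi> (k b) = b" if "b : carrier B" for b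
  using that by (metis compose_eq restrict_apply')
 show ?thesis
 proof (rule extensionalityI)
  show "\<Psi> : extensional (carrier Q)" by (rule star_homD(7)[OF \<Psi>])
  show "Phi : extensional (carrier Q)" by (simp add: Phi_def)
  fix P assume "P : carrier Q"
  then obtain a where a: "a : carrier A" "P = cos a" by (auto simp: Q_carrier)
  then show "\<Psi> P = Phi P" using *[OF lD(1)[OF a(1)]] by (simp add: kl Phi_coset)
 qed
qed

end

lemma star_subalgebra_star_alg:
 assumes "star_alg A" "star_subalgebra A S" "\<one>\<^bsub>A\<^esub> : S"
 shows "star_alg (A\<lparr>carrier := S\<rparr>)"
proof -
 interpret star_alg A by fact
 let ?B = "A\<lparr>carrier := S\<rparr>"
 have S: "S \<subseteq> carrier A" "\<zero>\<^bsub>A\<^esub> : S" "!!a b. a : S ==> b : S ==> a \<oplus>\<^bsub>A\<^esub> b : S" "!!a b. a : S ==> b : S ==> a \<otimes>\<^bsub>A\<^esub> b : S"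
  "!!c a. a : S ==> c \<odot>\<^bsub>A\<^esub> a : S" "!!a. a : S ==> star A a : S"
  using assms(2) by (auto simp: star_subalgebra_def)
 have in_A: "a : carrier A" if "a : S" for a using S(1) that by blast
 have ag: "abelian_group ?B"
 proof (rule abelian_groupI)
  fix x assume x: "x : carrier ?B"
  then have "(-1) \<odot>\<^bsub>A\<^esub> x \<oplus>\<^bsub>A\<^esub> x = \<zero>\<^bsub>A\<^esub>" using in_A by (simp add: a_inv_smult[symmetric] l_neg)
  then show "EX y:carrier ?B. y \<oplus>\<^bsub>?B\<^esub> x = \<zero>\<^bsub>?B\<^esub>" using x S(5) by (intro bexI[of _ "(-1) \<odot>\<^bsub>A\<^esub> x"]) auto
 qed (simp_all add: S in_A a_ac)
 have mon: "Group.monoid ?B" by (rule monoidI) (simp_all add: S in_A m_assoc assms(3))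
 have "ring ?B" by (rule ringI[OF ag mon]) (simp_all add: in_A l_distr r_distr)
 then show ?thesis
 proof (rule star_alg.intro, intro star_alg_axioms.intro)
  fix a b c d assume "a : carrier ?B" "b : carrier ?B"
  then have ab: "a : S" "b : S" by simp_all
  note A = in_A[OF ab(1)] in_A[OF ab(2)]
  show "c \<odot>\<^bsub>?B\<^esub> a : carrier ?B" "star ?B a : carrier ?B" using S(5,6)[OF ab(1)] by simp_all
  show "(c + d) \<odot>\<^bsub>?B\<^esub> a = c \<odot>\<^bsub>?B\<^esub> a \<oplus>\<^bsub>?B\<^esub> d \<odot>\<^bsub>?B\<^esub> a"
   "c \<odot>\<^bsub>?B\<^esub> (a \<oplus>\<^bsub>?B\<^esub> b) = c \<odot>\<^bsub>?B\<^esub> a \<oplus>\<^bsub>?B\<^esub> c \<odot>\<^bsub>?B\<^esub> b"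
   "(c * d) \<odot>\<^bsub>?B\<^esub> a = c \<odot>\<^bsub>?B\<^esub> (d \<odot>\<^bsub>?B\<^esub> a)" "1 \<odot>\<^bsub>?B\<^esub> a = a"
   "c \<odot>\<^bsub>?B\<^esub> a \<otimes>\<^bsub>?B\<^esub> b = c \<odot>\<^bsub>?B\<^esub> (a \<otimes>\<^bsub>?B\<^esub> b)" "a \<otimes>\<^bsub>?B\<^esub> (c \<odot>\<^bsub>?B\<^esub> b) = c \<odot>\<^bsub>?B\<^esub> (a \<otimes>\<^bsub>?B\<^esub> b)"
   "star ?B (star ?B a) = a" "star ?B (a \<oplus>\<^bsub>?B\<^esub> b) = star ?B a \<oplus>\<^bsub>?B\<^esub> star ?B b"
   "star ?B (a \<otimes>\<^bsub>?B\<^esub> b) = star ?B b \<otimes>\<^bsub>?B\<^esub> star ?B a" "star ?B (c \<odot>\<^bsub>?B\<^esub> a) = cnj c \<odot>\<^bsub>?B\<^esub> star ?B a"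
   using smult_l_distr[OF A(1), of c d] smult_r_distr[OF A, of c] smult_smult[OF A(1), of c d] smult_one[OF A(1)]
    smult_mult_l[OF A, of c] smult_mult_r[OF A, of c] star_star[OF A(1)] star_add[OF A] star_mult[OF A]
    star_smult[OF A(1), of c]
   by simp_all
 qed
qed

section \<open>Bounded sections of the bundle of Weyl algebras\<close>

lemma tendsto_uc_at_0:
 fixes c :: "real => complex"
 assumes "uniformly_continuous_on {0<..1} c"
 obtains L where "(c \<longlongrightarrow> L) (at_right 0)"
proof -
 have "(0::real) : closure {0<..1}" by simp
 then obtain L where L: "(c \<longlongrightarrow> L) (at 0 within {0<..1})"
  using uniformly_continuous_on_extension_at_closure[OF assms] by metis
 have "at 0 within {0<..1} = at_right (0::real)"
  by (rule at_within_nhd[of _ "{..<1}"]) auto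
 then show thesis using L that by simp
qed

context symp
begin

abbreviation WA :: "real => 'v weyl_elem cstar_algebra" where "WA \<equiv> weyl_algebra V"
abbreviation nm :: "real => 'v weyl_elem => real" where "nm h \<equiv> cnorm (weyl_algebra V h)"
abbreviation Em :: "real => ('v => complex) => 'v weyl_elem" where "Em \<equiv> weyl_embed V"

lemma WA_cstar: "cstar (WA h) (nm h)"
 unfolding weyl_algebra_def by (rule cstar_pre.Compl_cstar[OF weyl_cstar_pre])

lemma WA_cstar_pre: "cstar_pre (WA h) (nm h)"
 using WA_cstar[of h] by (simp add: cstar_def)

lemma WA_star_alg: "star_alg (WA h)"
 using WA_cstar_pre[of h] by (simp add: cstar_pre_def)

text \<open>The adjoint is stated with a parameter \<open>k\<close> of its own, because the
  involution of polynomials does not depend on it and later occurs at parameter 0.\<close>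

lemma Em_simps:
 assumes a: "a : FC" and b: "b : FC"
 shows "Em h a : carrier (WA h)" "Em h (%f. a f + b f) = Em h a \<oplus>\<^bsub>WA h\<^esub> Em h b"
  "Em h (a \<star>[h] b) = Em h a \<otimes>\<^bsub>WA h\<^esub> Em h b"
  "Em h (%f. c * a f) = c \<odot>\<^bsub>WA h\<^esub> Em h a" "Em h (adj k a) = star (WA h) (Em h a)"
  "Em h (ws \<zero>) = \<one>\<^bsub>WA h\<^esub>" "Em h (%_. 0) = \<zero>\<^bsub>WA h\<^esub>" "nm h (Em h a) = mx h a"
proof -
 have ab: "a : carrier (weyl_poly V h)" "b : carrier (weyl_poly V h)" using a b by simp_all
 have st: "adj k a = adj h a" by (simp add: weyl_star)
 note E = cstar_pre.E_simps[OF weyl_cstar_pre ab, folded weyl_algebra_def]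
 show "Em h a : carrier (WA h)" "Em h (%f. a f + b f) = Em h a \<oplus>\<^bsub>WA h\<^esub> Em h b"
  "Em h (a \<star>[h] b) = Em h a \<otimes>\<^bsub>WA h\<^esub> Em h b"
  "Em h (%f. c * a f) = c \<odot>\<^bsub>WA h\<^esub> Em h a" "Em h (adj k a) = star (WA h) (Em h a)"
  "Em h (ws \<zero>) = \<one>\<^bsub>WA h\<^esub>" "Em h (%_. 0) = \<zero>\<^bsub>WA h\<^esub>" "nm h (Em h a) = mx h a"
  using E unfolding weyl_embed_def st by simp_all
qed

lemma Em_closed: "a : FC ==> Em h a : carrier (WA h)"
 by (rule Em_simps(1))

lemma Em_inj: "inj_on (Em h) (FC)"
 using cstar_pre.E_inj[OF weyl_cstar_pre, of h] by (simp add: weyl_embed_def)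

lemma Em_dense: "P : carrier (WA h) ==> e > 0 ==> EX d:Delta V h. nm h (P \<ominus>\<^bsub>WA h\<^esub> d) < e"
 using cstar_pre.E_dense[OF weyl_cstar_pre, of P h e] by (simp add: weyl_embed_def Delta_def weyl_algebra_def)

lemma Delta_sub: "Delta V h \<subseteq> carrier (WA h)"
 by (auto simp: Delta_def Em_closed)

lemma W_eq: "W V h f = Em h (ws f)" by (simp add: W_def)

lemma W_closed: "f : carrier V ==> W V h f : carrier (WA h)"
 by (simp add: W_eq Em_closed)

text \<open>Written with a sum and a scalar multiple so that the linearity rules for
  \<open>weyl_embed\<close> and \<open>W0_combination\<close> apply as they stand.\<close>

definition diffc :: "('v => complex) => ('v => complex) => 'v => complex" where
 "diffc a b = (%f. a f + (%f. (-1) * b f) f)"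

lemma diffc_closed: "a : FC ==> b : FC ==> diffc a b : FC"
 unfolding diffc_def by (intro fin_closed(1) fin_closed(2))

lemma Em_diffc:
 assumes a: "a : FC" and b: "b : FC"
 shows "Em h (diffc a b) = Em h a \<ominus>\<^bsub>WA h\<^esub> Em h b"
proof -
 interpret A: star_alg "WA h" by (rule WA_star_alg)
 show ?thesis unfolding diffc_def Em_simps(2)[OF a fin_closed(2)[OF b]] Em_simps(4)[OF b b]
  by (simp add: A.a_minus_smult Em_closed a b)
qed

lemma W0_diffc:
 assumes a: "a : FC" and b: "b : FC" and F: "F : dual V"
 shows "WC (diffc a b) F = WC a F - WC b F"
 unfolding diffc_def W0_comb_linear(1)[OF a fin_closed(2)[OF b] F] W0_comb_linear(2)[OF b b F] by simp

abbreviation BS :: "'v weyl_section cstar_algebra" where "BS \<equiv> bounded_sections V"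

lemma BS_simps:
 "a \<otimes>\<^bsub>BS\<^esub> b = (\<lambda>h\<in>{0<..1}. a h \<otimes>\<^bsub>WA h\<^esub> b h)" "\<one>\<^bsub>BS\<^esub> = (\<lambda>h\<in>{0<..1}. \<one>\<^bsub>WA h\<^esub>)"
 "\<zero>\<^bsub>BS\<^esub> = (\<lambda>h\<in>{0<..1}. \<zero>\<^bsub>WA h\<^esub>)" "a \<oplus>\<^bsub>BS\<^esub> b = (\<lambda>h\<in>{0<..1}. a h \<oplus>\<^bsub>WA h\<^esub> b h)"
 "c \<odot>\<^bsub>BS\<^esub> a = (\<lambda>h\<in>{0<..1}. c \<odot>\<^bsub>WA h\<^esub> a h)" "star BS a = (\<lambda>h\<in>{0<..1}. star (WA h) (a h))"
 "cnorm BS a = (SUP h\<in>{0<..1}. nm h (a h))"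
 by (simp_all add: bounded_sections_def)

lemma BSI:
 assumes "!!h. 0 < h ==> h <= 1 ==> a h : carrier (WA h)" "a : extensional {0<..1}"
  "!!h. 0 < h ==> h <= 1 ==> nm h (a h) <= B"
 shows "a : carrier BS"
 unfolding bounded_sections_def using assms by (auto simp: PiE_iff intro!: bdd_aboveI2[of _ _ B])

lemma BSD:
 assumes "a : carrier BS"
 shows "0 < h ==> h <= 1 ==> a h : carrier (WA h)" "a : extensional {0<..1}"
 using assms by (auto simp: bounded_sections_def PiE_iff)

lemma BS_norm_upper:
 assumes "a : carrier BS" "0 < h" "h <= 1" shows "nm h (a h) <= cnorm BS a"
 unfolding BS_simps by (rule cSUP_upper) (use assms in \<open>auto simp: bounded_sections_def\<close>)

lemma BS_norm_le: "(!!h. 0 < h ==> h <= 1 ==> nm h (a h) <= C) ==> cnorm BS a <= C"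
 unfolding BS_simps by (rule cSUP_least) auto

lemma BS_norm_nonneg: "a : carrier BS ==> 0 <= cnorm BS a"
proof -
 interpret A: cstar_pre "WA 1" "nm 1" by (rule WA_cstar_pre)
 assume a: "a : carrier BS"
 have "0 <= nm 1 (a 1)" by (rule A.p_nonneg[OF BSD(1)[OF a]]) auto
 also have "... <= cnorm BS a" by (rule BS_norm_upper[OF a]) auto
 finally show ?thesis .
qed

lemma BS_closed:
 assumes a: "a : carrier BS" and b: "b : carrier BS"
 shows "a \<oplus>\<^bsub>BS\<^esub> b : carrier BS" "a \<otimes>\<^bsub>BS\<^esub> b : carrier BS" "c \<odot>\<^bsub>BS\<^esub> a : carrier BS" "star BS a : carrier BS"
  "\<zero>\<^bsub>BS\<^esub> : carrier BS" "\<one>\<^bsub>BS\<^esub> : carrier BS"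
proof -
 note aD = BSD(1)[OF a] and bD = BSD(1)[OF b]
 note up = BS_norm_upper[OF a] and upb = BS_norm_upper[OF b]
 have pre: "cstar_pre (WA h) (nm h)" for h by (rule WA_cstar_pre)
 have alg: "star_alg (WA h)" for h by (rule WA_star_alg)
 have rg: "ring (WA h)" for h using alg[of h] by (simp add: star_alg_def)
 show "a \<oplus>\<^bsub>BS\<^esub> b : carrier BS"
 proof (rule BSI[of _ "cnorm BS a + cnorm BS b"])
  fix h :: real assume h: "0 < h" "h <= 1"
  interpret A: cstar_pre "WA h" "nm h" by (rule pre)
  show "(a \<oplus>\<^bsub>BS\<^esub> b) h : carrier (WA h)" using h aD[OF h] bD[OF h] by (simp add: BS_simps)
  show "nm h ((a \<oplus>\<^bsub>BS\<^esub> b) h) <= cnorm BS a + cnorm BS b"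
   using order_trans[OF A.p_add[OF aD[OF h] bD[OF h]] add_mono[OF up[OF h] upb[OF h]]] h by (simp only: BS_simps(4)) simp
 qed (simp add: BS_simps)
 show "a \<otimes>\<^bsub>BS\<^esub> b : carrier BS"
 proof (rule BSI[of _ "cnorm BS a * cnorm BS b"])
  fix h :: real assume h: "0 < h" "h <= 1"
  interpret A: cstar_pre "WA h" "nm h" by (rule pre)
  show "(a \<otimes>\<^bsub>BS\<^esub> b) h : carrier (WA h)" using h aD[OF h] bD[OF h] by (simp add: BS_simps)
  show "nm h ((a \<otimes>\<^bsub>BS\<^esub> b) h) <= cnorm BS a * cnorm BS b"
   using order_trans[OF A.p_mult[OF aD[OF h] bD[OF h]] mult_mono[OF up[OF h] upb[OF h] BS_norm_nonneg[OF a] A.p_nonneg[OF bD[OF h]]]] h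
   by (simp only: BS_simps(1)) simp
 qed (simp add: BS_simps)
 show "c \<odot>\<^bsub>BS\<^esub> a : carrier BS"
 proof (rule BSI[of _ "cmod c * cnorm BS a"])
  fix h :: real assume h: "0 < h" "h <= 1"
  interpret A: cstar_pre "WA h" "nm h" by (rule pre)
  show "(c \<odot>\<^bsub>BS\<^esub> a) h : carrier (WA h)" using h aD[OF h] by (simp add: BS_simps)
  have "nm h (c \<odot>\<^bsub>WA h\<^esub> a h) <= cmod c * cnorm BS a"
   unfolding A.p_smult[OF aD[OF h]] by (rule mult_left_mono[OF up[OF h]]) simp
  then show "nm h ((c \<odot>\<^bsub>BS\<^esub> a) h) <= cmod c * cnorm BS a" using h by (simp only: BS_simps(5)) simp
 qed (simp add: BS_simps)
 show "star BS a : carrier BS"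
 proof (rule BSI[of _ "cnorm BS a"])
  fix h :: real assume h: "0 < h" "h <= 1"
  interpret A: cstar_pre "WA h" "nm h" by (rule pre)
  show "(star BS a) h : carrier (WA h)" using h aD[OF h] by (simp add: BS_simps)
  have "nm h (star (WA h) (a h)) <= cnorm BS a" unfolding A.p_star[OF aD[OF h]] by (rule up[OF h])
  then show "nm h ((star BS a) h) <= cnorm BS a" using h by (simp only: BS_simps(6)) simp
 qed (simp add: BS_simps)
 show "\<zero>\<^bsub>BS\<^esub> : carrier BS"
 proof (rule BSI[of _ 0])
  fix h :: real assume h: "0 < h" "h <= 1"
  interpret A: cstar_pre "WA h" "nm h" by (rule pre)
  show "\<zero>\<^bsub>BS\<^esub> h : carrier (WA h)" "nm h (\<zero>\<^bsub>BS\<^esub> h) <= 0" using h by (simp_all add: BS_simps)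
 qed (simp add: BS_simps)
 show "\<one>\<^bsub>BS\<^esub> : carrier BS"
 proof (rule BSI[of _ 1])
  fix h :: real assume h: "0 < h" "h <= 1"
  interpret A: cstar_pre "WA h" "nm h" by (rule pre)
  show "\<one>\<^bsub>BS\<^esub> h : carrier (WA h)" "nm h (\<one>\<^bsub>BS\<^esub> h) <= 1" using h A.p_one_le by (simp_all add: BS_simps)
 qed (simp add: BS_simps)
qed

lemma BS_ext:
 assumes "a : carrier BS" "b : carrier BS" "!!h. 0 < h ==> h <= 1 ==> a h = b h" shows "a = b"
 by (rule extensionalityI[OF BSD(2)[OF assms(1)] BSD(2)[OF assms(2)]]) (use assms(3) in auto)

lemma BS_apply:
 assumes "0 < h" "h <= 1"
 shows "(a \<otimes>\<^bsub>BS\<^esub> b) h = a h \<otimes>\<^bsub>WA h\<^esub> b h" "\<one>\<^bsub>BS\<^esub> h = \<one>\<^bsub>WA h\<^esub>" "\<zero>\<^bsub>BS\<^esub> h = \<zero>\<^bsub>WA h\<^esub>"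
  "(a \<oplus>\<^bsub>BS\<^esub> b) h = a h \<oplus>\<^bsub>WA h\<^esub> b h" "(c \<odot>\<^bsub>BS\<^esub> a) h = c \<odot>\<^bsub>WA h\<^esub> a h" "star BS a h = star (WA h) (a h)"
 using assms by (simp_all add: BS_simps)

theorem BS_star_alg: "star_alg BS"
proof -
 have alg: "star_alg (WA h)" for h by (rule WA_star_alg)
 have rg: "ring (WA h)" for h using alg[of h] by (simp add: star_alg_def)
 have mon: "Group.monoid (WA h)" for h by (rule ring.is_monoid[OF rg])
 have semi: "semiring (WA h)" for h
 proof -
  interpret ring "WA h" by (rule rg)
  show ?thesis by (rule semiring_axioms)
 qed
 have "(\<lambda>h\<in>{0<..1}. \<zero>\<^bsub>WA h\<^esub>) : carrier BS"
 proof (rule BSI[of _ 0])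
  fix h :: real assume h: "0 < h" "h <= 1"
  interpret A: cstar_pre "WA h" "nm h" by (rule WA_cstar_pre)
  show "(\<lambda>h\<in>{0<..1}. \<zero>\<^bsub>WA h\<^esub>) h : carrier (WA h)" "nm h ((\<lambda>h\<in>{0<..1}. \<zero>\<^bsub>WA h\<^esub>) h) <= 0" using h by simp_all
 qed simp
 then have z: "\<zero>\<^bsub>BS\<^esub> : carrier BS" by (simp only: BS_simps)
 note o = BS_closed(6)[OF z z]
 note cl = BS_closed(1,2) BS_closed(3)[OF _ z] BS_closed(4)[OF _ z]
 note rs = ring.ring_simprules[OF rg]
 have ag: "abelian_group BS"
 proof (rule abelian_groupI)
  fix x y k assume x: "x : carrier BS" and y: "y : carrier BS" and k: "k : carrier BS"
  note D = BSD(1)[OF x] BSD(1)[OF y] BSD(1)[OF k]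
  show "x \<oplus>\<^bsub>BS\<^esub> y : carrier BS" by (intro cl x y)
  show "x \<oplus>\<^bsub>BS\<^esub> y \<oplus>\<^bsub>BS\<^esub> k = x \<oplus>\<^bsub>BS\<^esub> (y \<oplus>\<^bsub>BS\<^esub> k)"
   by (rule BS_ext, intro cl x y k, intro cl x y k) (simp only: BS_apply rs(7) D)
  show "x \<oplus>\<^bsub>BS\<^esub> y = y \<oplus>\<^bsub>BS\<^esub> x" by (rule BS_ext, intro cl x y, intro cl x y) (simp only: BS_apply rs(10) D)
  show "\<zero>\<^bsub>BS\<^esub> \<oplus>\<^bsub>BS\<^esub> x = x" by (rule BS_ext, intro cl x z, rule x) (simp only: BS_apply rs(8) D)
  show "EX y:carrier BS. y \<oplus>\<^bsub>BS\<^esub> x = \<zero>\<^bsub>BS\<^esub>"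
   by (rule bexI[OF _ cl(3)[OF x, of "-1"]], rule BS_ext, intro cl x, rule z)
    (simp only: BS_apply star_alg.a_inv_smult[OF alg, symmetric] rs(9) D)
 qed (rule z)
 have mo: "Group.monoid BS"
 proof (rule monoidI)
  fix x y k assume x: "x : carrier BS" and y: "y : carrier BS" and k: "k : carrier BS"
  note D = BSD(1)[OF x] BSD(1)[OF y] BSD(1)[OF k]
  show "x \<otimes>\<^bsub>BS\<^esub> y : carrier BS" by (intro cl x y)
  show "x \<otimes>\<^bsub>BS\<^esub> y \<otimes>\<^bsub>BS\<^esub> k = x \<otimes>\<^bsub>BS\<^esub> (y \<otimes>\<^bsub>BS\<^esub> k)"
   by (rule BS_ext, intro cl x y k, intro cl x y k) (simp only: BS_apply monoid.m_assoc[OF mon] D)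
  show "\<one>\<^bsub>BS\<^esub> \<otimes>\<^bsub>BS\<^esub> x = x" by (rule BS_ext, intro cl x o, rule x) (simp only: BS_apply monoid.l_one[OF mon] D)
  show "x \<otimes>\<^bsub>BS\<^esub> \<one>\<^bsub>BS\<^esub> = x" by (rule BS_ext, intro cl x o, rule x) (simp only: BS_apply monoid.r_one[OF mon] D)
 qed (rule o)
 have "ring BS"
 proof (rule ringI[OF ag mo])
  fix x y k assume x: "x : carrier BS" and y: "y : carrier BS" and k: "k : carrier BS"
  note D = BSD(1)[OF x] BSD(1)[OF y] BSD(1)[OF k]
  show "(x \<oplus>\<^bsub>BS\<^esub> y) \<otimes>\<^bsub>BS\<^esub> k = x \<otimes>\<^bsub>BS\<^esub> k \<oplus>\<^bsub>BS\<^esub> y \<otimes>\<^bsub>BS\<^esub> k"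
   by (rule BS_ext, intro cl x y k, intro cl x y k) (simp only: BS_apply semiring.l_distr[OF semi] D)
  show "k \<otimes>\<^bsub>BS\<^esub> (x \<oplus>\<^bsub>BS\<^esub> y) = k \<otimes>\<^bsub>BS\<^esub> x \<oplus>\<^bsub>BS\<^esub> k \<otimes>\<^bsub>BS\<^esub> y"
   by (rule BS_ext, intro cl x y k, intro cl x y k) (simp only: BS_apply semiring.r_distr[OF semi] D)
 qed
 then show ?thesis
 proof (intro star_alg.intro star_alg_axioms.intro)
  fix x y c d assume x: "x : carrier BS" and y: "y : carrier BS"
  note D = BSD(1)[OF x] BSD(1)[OF y]
  show "c \<odot>\<^bsub>BS\<^esub> x : carrier BS" "star BS x : carrier BS" by (intro cl x)+
  show "(c + d) \<odot>\<^bsub>BS\<^esub> x = c \<odot>\<^bsub>BS\<^esub> x \<oplus>\<^bsub>BS\<^esub> d \<odot>\<^bsub>BS\<^esub> x"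
   by (rule BS_ext, intro cl x, intro cl x) (simp only: BS_apply star_alg.smult_l_distr[OF alg] D)
  show "c \<odot>\<^bsub>BS\<^esub> (x \<oplus>\<^bsub>BS\<^esub> y) = c \<odot>\<^bsub>BS\<^esub> x \<oplus>\<^bsub>BS\<^esub> c \<odot>\<^bsub>BS\<^esub> y"
   by (rule BS_ext, intro cl x y, intro cl x y) (simp only: BS_apply star_alg.smult_r_distr[OF alg] D)
  show "(c * d) \<odot>\<^bsub>BS\<^esub> x = c \<odot>\<^bsub>BS\<^esub> (d \<odot>\<^bsub>BS\<^esub> x)"
   by (rule BS_ext, intro cl x, intro cl x) (simp only: BS_apply star_alg.smult_smult[OF alg] D)
  show "1 \<odot>\<^bsub>BS\<^esub> x = x"
   by (rule BS_ext, intro cl x, intro x) (simp only: BS_apply star_alg.smult_one[OF alg] D)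
  show "c \<odot>\<^bsub>BS\<^esub> x \<otimes>\<^bsub>BS\<^esub> y = c \<odot>\<^bsub>BS\<^esub> (x \<otimes>\<^bsub>BS\<^esub> y)"
   by (rule BS_ext, intro cl x y, intro cl x y) (simp only: BS_apply star_alg.smult_mult_l[OF alg] D)
  show "x \<otimes>\<^bsub>BS\<^esub> (c \<odot>\<^bsub>BS\<^esub> y) = c \<odot>\<^bsub>BS\<^esub> (x \<otimes>\<^bsub>BS\<^esub> y)"
   by (rule BS_ext, intro cl x y, intro cl x y) (simp only: BS_apply star_alg.smult_mult_r[OF alg] D)
  show "star BS (star BS x) = x"
   by (rule BS_ext, intro cl x, intro x) (simp only: BS_apply star_alg.star_star[OF alg] D)
  show "star BS (x \<oplus>\<^bsub>BS\<^esub> y) = star BS x \<oplus>\<^bsub>BS\<^esub> star BS y"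
   by (rule BS_ext, intro cl x y, intro cl x y) (simp only: BS_apply star_alg.star_add[OF alg] D)
  show "star BS (x \<otimes>\<^bsub>BS\<^esub> y) = star BS y \<otimes>\<^bsub>BS\<^esub> star BS x"
   by (rule BS_ext, intro cl x y, intro cl x y) (simp only: BS_apply star_alg.star_mult[OF alg] D)
  show "star BS (c \<odot>\<^bsub>BS\<^esub> x) = cnj c \<odot>\<^bsub>BS\<^esub> star BS x"
   by (rule BS_ext, intro cl x, intro cl x) (simp only: BS_apply star_alg.star_smult[OF alg] D)
 qed
qed

lemma BS_minus_apply:
 assumes a: "a : carrier BS" and b: "b : carrier BS" and h: "0 < h" "h <= 1"
 shows "(a \<ominus>\<^bsub>BS\<^esub> b) h = a h \<ominus>\<^bsub>WA h\<^esub> b h"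
proof -
 interpret B: star_alg BS by (rule BS_star_alg)
 interpret A: star_alg "WA h" by (rule WA_star_alg)
 show ?thesis
  unfolding B.a_minus_smult[OF a b] A.a_minus_smult[OF BSD(1)[OF a h] BSD(1)[OF b h]] BS_apply[OF h] ..
qed

end

section \<open>Limits of sections at parameter 0\<close>

context psymp
begin

abbreviation df :: "real => 'a weyl_elem => 'a weyl_elem => real" where
 "df h x y \<equiv> nm h (x \<ominus>\<^bsub>WA h\<^esub> y)"

abbreviation ev0 :: "(real => bool) => bool" where
 "ev0 P \<equiv> eventually P (at_right 0)"

lemma ev_unit: "ev0 (%h. 0 < h & h <= 1)"
 by (rule eventually_at_rightI[of 0 1]) auto

lemma df_tri:
 "x : carrier (WA h) ==> y : carrier (WA h) ==> z : carrier (WA h) ==> df h x z <= df h x y + df h y z"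
 by (rule cstar_pre.p_tri[OF WA_cstar_pre])

lemma df_comm: "x : carrier (WA h) ==> y : carrier (WA h) ==> df h x y = df h y x"
 by (rule cstar_pre.p_commute[OF WA_cstar_pre])

lemma nm_le: "x : carrier (WA h) ==> y : carrier (WA h) ==> nm h x <= df h x y + nm h y"
 by (rule cstar_pre.p_le_diff[OF WA_cstar_pre])

lemma df_Em: "a : FC ==> b : FC ==> df h (Em h a) (Em h b) = mx h (diffc a b)"
 using Em_diffc[of a b h] Em_simps(8)[OF diffc_closed diffc_closed, of a b a b h] by simp

text \<open>The fibres are compared through the sections with constant coefficients, along which the norms converge.\<close>

definition slim :: "'a weyl_section => 'a dual_fun => bool" where
 "slim a b \<longleftrightarrow> (ALL e>0. EX c:FC. ev0 (%h. df h (a h) (Em h c) <= e) \<and>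
  (ALL F:dual V. cmod (b F - WC c F) <= e))"

lemma slimE:
 assumes "slim a b" "e > 0"
 obtains c where "c : FC" "ev0 (%h. (0 < h & h <= 1) & df h (a h) (Em h c) <= e)"
  "!!F. F : dual V ==> cmod (b F - WC c F) <= e"
proof -
 obtain c where c: "c : FC" "ev0 (%h. df h (a h) (Em h c) <= e)"
   "ALL F:dual V. cmod (b F - WC c F) <= e"
  using assms unfolding slim_def by meson
 show thesis by (rule that[OF c(1) eventually_conj[OF ev_unit c(2)]]) (use c(3) in blast)
qed

text \<open>The factor \<open>K\<close> and the restriction to \<open>e <= 1\<close> absorb the
  bounds that arise for products and multiples, so that later proofs are free of rescaling.\<close>

lemma slimI:
 assumes "0 <= K" and "!!e. 0 < e ==> e <= 1 ==> EX c:FC. ev0 (%h. df h (a h) (Em h c) <= K * e) \<and>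
  (ALL F:dual V. cmod (b F - WC c F) <= K * e)"
 shows "slim a b"
 unfolding slim_def
proof (intro allI impI)
 fix e :: real assume e: "e > 0"
 define d where "d = min 1 (e / (K + 1))"
 have d: "0 < d" "d <= 1" using e assms(1) by (auto simp: d_def)
 have "K * d <= K * (e / (K + 1))" unfolding d_def by (rule mult_left_mono) (use assms(1) in auto)
 also have "... <= e" using e assms(1) by (simp add: field_simps)
 finally have le: "K * d <= e" .
 obtain c where c: "c : FC" "ev0 (%h. df h (a h) (Em h c) <= K * d)"
   "ALL F:dual V. cmod (b F - WC c F) <= K * d"
  using assms(2)[OF d] by meson
 show "EX c:FC. ev0 (%h. df h (a h) (Em h c) <= e) & (ALL F:dual V. cmod (b F - WC c F) <= e)"
 proof (intro bexI conjI ballI)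
  show "ev0 (%h. df h (a h) (Em h c) <= e)" using c(2) le by (auto elim: eventually_mono)
  show "cmod (b F - WC c F) <= e" if "F : dual V" for F using c(3) that le by force
 qed (rule c(1))
qed

text \<open>The comparison goes through one approximating polynomial: its fibre norms converge to
  its supremum norm by \<open>mx_tendsto_supn\<close>, which hands an eventual bound over to the
  limit.\<close>

lemma slim_le:
 assumes ab: "slim a b" and a: "a : carrier BS" and C: "ev0 (%h. nm h (a h) <= C)" and F: "F : dual V"
 shows "cmod (b F) <= C"
proof (rule field_le_epsilon)
 fix e :: real assume e: "e > 0"
 obtain c where c: "c : FC" "ev0 (%h. (0 < h & h <= 1) & df h (a h) (Em h c) <= e/2)"
  "!!F. F : dual V ==> cmod (b F - WC c F) <= e/2"
  using ab half_gt_zero[OF e] by (rule slimE) blast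
 have "ev0 (%h. mx h c <= C + e/2)" using c(2) C
 proof eventually_elim
  case (elim h)
  then have ah: "a h : carrier (WA h)" using BSD(1)[OF a] by simp
  have "nm h (Em h c) <= df h (Em h c) (a h) + nm h (a h)" by (rule nm_le[OF Em_closed[OF c(1)] ah])
  then show ?case using elim unfolding df_comm[OF Em_closed[OF c(1)] ah] Em_simps(8)[OF c(1) c(1)] by linarith
 qed
 then have "supn c <= C + e/2" by (rule tendsto_upperbound[OF mx_tendsto_supn[OF c(1)]]) simp
 then show "cmod (b F) <= C + e"
  using supn_upper[OF c(1) F] c(3)[OF F] norm_triangle_ineq2[of "b F" "WC c F"] by linarith
qed

text \<open>The converse transfer, at the price of \<open>e\<close>. Together with
  \<open>slim_le\<close> it identifies the sections that vanish at 0 with those whose limit function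
  is zero.\<close>

lemma slim_ge:
 assumes ab: "slim a b" and a: "a : carrier BS" and C: "!!F. F : dual V ==> cmod (b F) <= C" and e: "e > 0"
 shows "ev0 (%h. nm h (a h) <= C + e)"
proof -
 obtain c where c: "c : FC" "ev0 (%h. (0 < h & h <= 1) & df h (a h) (Em h c) <= e/3)"
  "!!F. F : dual V ==> cmod (b F - WC c F) <= e/3"
  using ab divide_pos_pos[OF e zero_less_numeral] by (rule slimE) blast
 have "supn c <= C + e/3"
 proof (rule supn_least)
  fix F assume F: "F : dual V"
  show "cmod (WC c F) <= C + e/3"
   using C[OF F] c(3)[OF F] norm_triangle_ineq2[of "WC c F" "b F"]
    norm_minus_commute[of "b F" "WC c F"] by linarith
 qed
 then have "ev0 (%h. mx h c < C + 2 * e/3)" using e by (intro order_tendstoD(2)[OF mx_tendsto_supn[OF c(1)]]) auto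
 with c(2) show ?thesis
 proof eventually_elim
  case (elim h)
  then have ah: "a h : carrier (WA h)" using BSD(1)[OF a] by simp
  show ?case using nm_le[OF ah Em_closed[OF c(1)]] elim unfolding Em_simps(8)[OF c(1) c(1)] by linarith
 qed
qed

lemma slim_add:
 assumes ab: "slim a b" "slim a' b'" and a: "a : carrier BS" "a' : carrier BS"
 shows "slim (a \<oplus>\<^bsub>BS\<^esub> a') (\<lambda>F\<in>dual V. b F + b' F)"
proof (rule slimI[of 2])
 fix e :: real assume e: "0 < e"
 obtain c where c: "c : FC" "ev0 (%h. (0 < h & h <= 1) & df h (a h) (Em h c) <= e)"
  "!!F. F : dual V ==> cmod (b F - WC c F) <= e" using ab(1) e by (rule slimE) blast
 obtain c' where c': "c' : FC" "ev0 (%h. (0 < h & h <= 1) & df h (a' h) (Em h c') <= e)"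
  "!!F. F : dual V ==> cmod (b' F - WC c' F) <= e" using ab(2) e by (rule slimE) blast
 show "EX c:FC. ev0 (%h. df h ((a \<oplus>\<^bsub>BS\<^esub> a') h) (Em h c) <= 2 * e) \<and>
  (ALL F:dual V. cmod ((\<lambda>F\<in>dual V. b F + b' F) F - WC c F) <= 2 * e)"
 proof (intro bexI conjI ballI)
  show "(%f. c f + c' f) : FC" by (rule fin_closed(1)[OF c(1) c'(1)])
  show "ev0 (%h. df h ((a \<oplus>\<^bsub>BS\<^esub> a') h) (Em h (%f. c f + c' f)) <= 2 * e)" using c(2) c'(2)
  proof eventually_elim
   case (elim h)
   then have h: "0 < h" "h <= 1" by auto
   interpret A: cstar_pre "WA h" "nm h" by (rule WA_cstar_pre)
   note [simp] = BSD(1)[OF a(1) h] BSD(1)[OF a(2) h] Em_closed[OF c(1), of h] Em_closed[OF c'(1), of h]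
   have "(a h \<oplus>\<^bsub>WA h\<^esub> a' h) \<ominus>\<^bsub>WA h\<^esub> (Em h c \<oplus>\<^bsub>WA h\<^esub> Em h c') = (a h \<ominus>\<^bsub>WA h\<^esub> Em h c) \<oplus>\<^bsub>WA h\<^esub> (a' h \<ominus>\<^bsub>WA h\<^esub> Em h c')"
    by (simp add: A.a_minus_smult A.smult_r_distr A.a_ac)
   then have "df h (a h \<oplus>\<^bsub>WA h\<^esub> a' h) (Em h c \<oplus>\<^bsub>WA h\<^esub> Em h c') <= df h (a h) (Em h c) + df h (a' h) (Em h c')"
    using A.p_add[of "a h \<ominus>\<^bsub>WA h\<^esub> Em h c" "a' h \<ominus>\<^bsub>WA h\<^esub> Em h c'"] by simp
   then show ?case using elim unfolding BS_apply[OF h] Em_simps(2)[OF c(1) c'(1)] by linarith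
  qed
  fix F assume F: "F : dual V"
  show "cmod ((\<lambda>F\<in>dual V. b F + b' F) F - WC (%f. c f + c' f) F) <= 2 * e"
   unfolding W0_comb_linear(1)[OF c(1) c'(1) F] restrict_apply'[OF F]
   using c(3)[OF F] c'(3)[OF F] norm_diff_triangle_ineq[of "b F" "b' F" "WC c F" "WC c' F"]
   by linarith
 qed
qed simp

lemma slim_star:
 assumes ab: "slim a b" and a: "a : carrier BS"
 shows "slim (star BS a) (\<lambda>F\<in>dual V. cnj (b F))"
proof (rule slimI[of 1])
 fix e :: real assume e: "0 < e"
 obtain c where c: "c : FC" "ev0 (%h. (0 < h & h <= 1) & df h (a h) (Em h c) <= e)"
  "!!F. F : dual V ==> cmod (b F - WC c F) <= e" using ab e by (rule slimE) blast
 show "EX c:FC. ev0 (%h. df h (star BS a h) (Em h c) <= 1 * e) \<and>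
  (ALL F:dual V. cmod ((\<lambda>F\<in>dual V. cnj (b F)) F - WC c F) <= 1 * e)"
 proof (intro bexI conjI ballI)
  show "adj 0 c : FC" by (rule fin_closed(5)[OF c(1)])
  show "ev0 (%h. df h (star BS a h) (Em h (adj 0 c)) <= 1 * e)" using c(2)
  proof eventually_elim
   case (elim h)
   then have h: "0 < h" "h <= 1" by auto
   interpret A: cstar_pre "WA h" "nm h" by (rule WA_cstar_pre)
   note D = BSD(1)[OF a h] Em_closed[OF c(1), of h]
   show ?case using elim
    unfolding BS_apply[OF h] Em_simps(5)[OF c(1) c(1)] A.star_minus[OF D, symmetric] A.p_star[OF A.minus_closed[OF D]] by simp
  qed
  fix F assume F: "F : dual V"
  show "cmod ((\<lambda>F\<in>dual V. cnj (b F)) F - WC (adj 0 c) F) <= 1 * e"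
   unfolding W0_comb_star_mult(2)[OF c(1) c(1) F] restrict_apply'[OF F]
   unfolding complex_cnj_diff[symmetric] complex_mod_cnj using c(3)[OF F] by simp
 qed
qed simp

text \<open>A multiplier enters only through its limit at 0, supplied for uniformly continuous ones
  by \<open>tendsto_uc_at_0\<close>; scalar multiples are the constant case.\<close>

lemma slim_uc:
 assumes ab: "slim a b" and a: "a : carrier BS" and u: "(u \<longlongrightarrow> L) (at_right 0)"
 shows "slim (\<lambda>h\<in>{0<..1}. u h \<odot>\<^bsub>WA h\<^esub> a h) (\<lambda>F\<in>dual V. L * b F)"
proof (rule slimI[of "cnorm BS a + cmod L"])
 show "0 <= cnorm BS a + cmod L" using BS_norm_nonneg[OF a] by simp
 fix e :: real assume e: "0 < e"
 obtain c where c: "c : FC" "ev0 (%h. (0 < h & h <= 1) & df h (a h) (Em h c) <= e)"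
  "!!F. F : dual V ==> cmod (b F - WC c F) <= e" using ab e by (rule slimE) blast
 have u: "ev0 (%h. cmod (u h - L) <= e)"
  using tendstoD[OF u e] by (auto simp: dist_norm elim: eventually_mono)
 show "EX c:FC. ev0 (%h. df h ((\<lambda>h\<in>{0<..1}. u h \<odot>\<^bsub>WA h\<^esub> a h) h) (Em h c) <= (cnorm BS a + cmod L) * e) \<and>
  (ALL F:dual V. cmod ((\<lambda>F\<in>dual V. L * b F) F - WC c F) <= (cnorm BS a + cmod L) * e)"
 proof (intro bexI conjI ballI)
  show "(%f. L * c f) : FC" by (rule fin_closed(2)[OF c(1)])
  show "ev0 (%h. df h ((\<lambda>h\<in>{0<..1}. u h \<odot>\<^bsub>WA h\<^esub> a h) h) (Em h (%f. L * c f)) <= (cnorm BS a + cmod L) * e)" using c(2) u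
  proof eventually_elim
   case (elim h)
   then have h: "0 < h" "h <= 1" "h : {0<..1}" by auto
   interpret A: cstar_pre "WA h" "nm h" by (rule WA_cstar_pre)
   note D = BSD(1)[OF a h(1,2)] Em_closed[OF c(1), of h]
   have "u h \<odot>\<^bsub>WA h\<^esub> a h \<ominus>\<^bsub>WA h\<^esub> L \<odot>\<^bsub>WA h\<^esub> a h = (u h - L) \<odot>\<^bsub>WA h\<^esub> a h"
    using A.smult_l_distr[OF D(1), of "u h" "- L"] A.smult_smult[OF D(1), of "-1" L] D(1) by (simp add: A.a_minus_smult)
   then have 1: "df h (u h \<odot>\<^bsub>WA h\<^esub> a h) (L \<odot>\<^bsub>WA h\<^esub> a h) = cmod (u h - L) * nm h (a h)"
    by (simp only: A.p_smult[OF D(1)])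
   have 2: "df h (L \<odot>\<^bsub>WA h\<^esub> a h) (L \<odot>\<^bsub>WA h\<^esub> Em h c) = cmod L * df h (a h) (Em h c)"
    unfolding A.smult_minus[OF D, symmetric] by (rule A.p_smult[OF A.minus_closed[OF D]])
   have 3: "cmod (u h - L) * nm h (a h) <= e * cnorm BS a"
    using elim BS_norm_upper[OF a h(1,2)] A.p_nonneg[OF D(1)] e by (intro mult_mono) auto
   have 4: "cmod L * df h (a h) (Em h c) <= cmod L * e" using elim by (intro mult_left_mono) auto
   show ?case
    unfolding restrict_apply'[OF h(3)] Em_simps(4)[OF c(1) c(1)]
    using df_tri[OF A.smult_closed[OF D(1)] A.smult_closed[OF D(1)] A.smult_closed[OF D(2)], of "u h" L L] 3 4 unfolding 1 2
    by (simp add: algebra_simps)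
  qed
  fix F assume F: "F : dual V"
  have "cmod L * cmod (b F - WC c F) <= cmod L * e" using c(3)[OF F] by (rule mult_left_mono) simp
  also have "... <= (cnorm BS a + cmod L) * e" using e BS_norm_nonneg[OF a] by (simp add: algebra_simps)
  finally show "cmod ((\<lambda>F\<in>dual V. L * b F) F - WC (%f. L * c f) F) <= (cnorm BS a + cmod L) * e"
   unfolding W0_comb_linear(2)[OF c(1) c(1) F] restrict_apply'[OF F] norm_mult[symmetric] right_diff_distrib .
 qed
qed

text \<open>A product of two sections with constant coefficients has coefficients that depend on
  \<open>h\<close> through the phases. Since \<open>l1\<close> dominates all fibre norms, this
  allows the product to be replaced by the one at parameter 0.\<close>

lemma mult_coeffs_tendsto:
 assumes c: "c : FC" and c': "c' : FC"
 shows "((%h. l1 (diffc (c \<star>[h] c') (c \<star>[0] c'))) \<longlongrightarrow> 0) (at_right 0)"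
proof -
 let ?S = "(%(f, g). f \<oplus> g) ` (supp c \<times> supp c')"
 have S: "finite ?S" using finC(1)[OF c] finC(1)[OF c'] by simp
 have co: "((%h. (c \<star>[h] c') k) \<longlongrightarrow> (c \<star>[0] c') k) (at_right 0)" for k
  unfolding weyl_mult[OF finC(1)[OF c] finC(1)[OF c'] order_refl order_refl]
 proof (intro tendsto_sum)
  fix f g
  have "((%h. ph h f g) \<longlongrightarrow> ph 0 f g) (at_right 0)" unfolding ph_def by (intro tendsto_intros)
  then show "((%h. if f \<oplus> g = k then c f * c' g * ph h f g else 0) \<longlongrightarrow> (if f \<oplus> g = k then c f * c' g * ph 0 f g else 0)) (at_right 0)"
   by (cases "f \<oplus> g = k") (simp_all only: simp_thms if_True if_False tendsto_mult_left tendsto_const)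
 qed
 have "supp (diffc (c \<star>[h] c') (c \<star>[0] c')) \<subseteq> ?S" for h
  using supp_mult[of h c c'] supp_mult[of 0 c c'] unfolding diffc_def supp_def subset_iff mem_Collect_eq
  by (metis add_cancel_right_right mult_zero_right)
 then have "l1 (diffc (c \<star>[h] c') (c \<star>[0] c')) =
  (\<Sum>k\<in>?S. cmod ((c \<star>[h] c') k - (c \<star>[0] c') k))" for h
  using l1_superset[OF S] unfolding diffc_def by simp
 moreover have "((%h. \<Sum>k\<in>?S. cmod ((c \<star>[h] c') k - (c \<star>[0] c') k)) \<longlongrightarrow> (\<Sum>k\<in>?S. 0)) (at_right 0)"
  by (intro tendsto_sum tendsto_norm_zero LIM_zero co)
 ultimately show ?thesis by simp
qed

lemma slim_mult:
 assumes ab: "slim a b" "slim a' b'" and a: "a : carrier BS" "a' : carrier BS" and b: "b : apc" "b' : apc"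
 shows "slim (a \<otimes>\<^bsub>BS\<^esub> a') (\<lambda>F\<in>dual V. b F * b' F)"
proof -
 let ?K = "cnorm BS a + cnorm BS a' + apn b + apn b' + 2"
 have K: "0 <= cnorm BS a" "0 <= cnorm BS a'" "0 <= apn b" "0 <= apn b'"
  by (intro BS_norm_nonneg AP_norm_nonneg a b)+
 show ?thesis
 proof (rule slimI[of ?K])
  show "0 <= ?K" using K by simp
  fix e :: real assume e: "0 < e" "e <= 1"
  obtain c where c: "c : FC" "ev0 (%h. (0 < h & h <= 1) & df h (a h) (Em h c) <= e)"
   "!!F. F : dual V ==> cmod (b F - WC c F) <= e" using ab(1) e(1) by (rule slimE) blast
  obtain c' where c': "c' : FC" "ev0 (%h. (0 < h & h <= 1) & df h (a' h) (Em h c') <= e)"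
   "!!F. F : dual V ==> cmod (b' F - WC c' F) <= e" using ab(2) e(1) by (rule slimE) blast
  define p where "p h = c \<star>[h] c'" for h
  have p: "p h : FC" for h unfolding p_def by (rule fin_closed(4)[OF c(1) c'(1)])
  have pe: "ev0 (%h. l1 (diffc (p h) (p 0)) < e)"
   unfolding p_def by (rule order_tendstoD(2)[OF mult_coeffs_tendsto[OF c(1) c'(1)] e(1)])
  show "EX c:FC. ev0 (%h. df h ((a \<otimes>\<^bsub>BS\<^esub> a') h) (Em h c) <= ?K * e) \<and>
   (ALL F:dual V. cmod ((\<lambda>F\<in>dual V. b F * b' F) F - WC c F) <= ?K * e)"
  proof (intro bexI conjI ballI)
   show "p 0 : FC" by (rule p)
   show "ev0 (%h. df h ((a \<otimes>\<^bsub>BS\<^esub> a') h) (Em h (p 0)) <= ?K * e)" using c(2) c'(2) pe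
   proof eventually_elim
    case (elim h)
    then have h: "0 < h" "h <= 1" by auto
    interpret A: cstar_pre "WA h" "nm h" by (rule WA_cstar_pre)
    note D = BSD(1)[OF a(1) h] BSD(1)[OF a(2) h] Em_closed[OF c(1), of h] Em_closed[OF c'(1), of h]
    note up = BS_norm_upper[OF a(1) h] BS_norm_upper[OF a(2) h]
    have 1: "df h (a h \<otimes>\<^bsub>WA h\<^esub> a' h) (Em h c \<otimes>\<^bsub>WA h\<^esub> Em h c') \<le>
      nm h (a h) * df h (a' h) (Em h c') + df h (a h) (Em h c) * nm h (Em h c')"
     by (rule A.p_mult_diff[OF D])
    have 2: "nm h (a h) * df h (a' h) (Em h c') <= cnorm BS a * e"
     using elim up K A.p_nonneg[OF A.minus_closed[OF D(2,4)]] by (intro mult_mono) auto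
    have "nm h (Em h c') <= cnorm BS a' + 1"
     using nm_le[OF D(4,2)] df_comm[OF D(2,4)] elim up(2) e(2) by linarith
    then have 3: "df h (a h) (Em h c) * nm h (Em h c') <= e * (cnorm BS a' + 1)"
     using elim A.p_nonneg[OF D(4)] e by (intro mult_mono) auto
    have 4: "df h (Em h (p h)) (Em h (p 0)) <= e"
     unfolding df_Em[OF p p] using mx_le_l1[OF diffc_closed[OF p p], of h h 0] elim by linarith
    have "df h (a h \<otimes>\<^bsub>WA h\<^esub> a' h) (Em h (p 0)) <= df h (a h \<otimes>\<^bsub>WA h\<^esub> a' h) (Em h (p h)) + df h (Em h (p h)) (Em h (p 0))"
     by (rule df_tri[OF A.m_closed[OF D(1,2)] Em_closed[OF p] Em_closed[OF p]])
    moreover have "Em h (p h) = Em h c \<otimes>\<^bsub>WA h\<^esub> Em h c'" unfolding p_def by (rule Em_simps(3)[OF c(1) c'(1)])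
    ultimately have "df h (a h \<otimes>\<^bsub>WA h\<^esub> a' h) (Em h (p 0)) <= cnorm BS a * e + e * (cnorm BS a' + 1) + e"
     using 1 2 3 4 by simp
    also have "... <= ?K * e" using K e by (simp add: algebra_simps)
    finally show ?case unfolding BS_apply[OF h] .
   qed
   fix F assume F: "F : dual V"
   let ?w = "WC c F" and ?w' = "WC c' F"
   have "b F * b' F - ?w * ?w' = b F * (b' F - ?w') + (b F - ?w) * ?w'" by (simp add: algebra_simps)
   then have "cmod (b F * b' F - ?w * ?w') <= cmod (b F) * cmod (b' F - ?w') + cmod (b F - ?w) * cmod ?w'"
    using norm_triangle_ineq[of "b F * (b' F - ?w')" "(b F - ?w) * ?w'"] by (simp add: norm_mult)
   moreover have "cmod (b F) * cmod (b' F - ?w') <= apn b * e"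
    using AP_norm_upper[OF b(1) F] c'(3)[OF F] K by (intro mult_mono) auto
   moreover have "cmod (b F - ?w) * cmod ?w' <= e * (apn b' + 1)"
   proof (rule mult_mono)
    show "cmod ?w' <= apn b' + 1"
     using AP_norm_upper[OF b(2) F] c'(3)[OF F] e(2) norm_triangle_ineq2[of ?w' "b' F"] norm_minus_commute[of "b' F" ?w']
     by linarith
   qed (use c(3)[OF F] e in auto)
   moreover have "apn b * e + e * (apn b' + 1) <= ?K * e" using K e by (simp add: algebra_simps del: AP_simps)
   ultimately show "cmod ((\<lambda>F\<in>dual V. b F * b' F) F - WC (p 0) F) <= ?K * e"
    unfolding restrict_apply'[OF F] p_def W0_comb_star_mult(1)[OF c(1) c'(1) F] by linarith
  qed
 qed
qed

definition sec :: "('a => complex) => 'a weyl_section" where "sec c = (\<lambda>h\<in>{0<..1}. Em h c)"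

lemma sec_BS: "c : FC ==> sec c : carrier BS"
 by (rule BSI[of _ "l1 c"]) (auto simp: sec_def Em_closed Em_simps(8) mx_le_l1)

lemma slim_sec: "c : FC ==> slim (sec c) (WC c)"
proof (rule slimI[of 0])
 fix e assume c: "c : FC"
 have "ev0 (%h. df h (sec c h) (Em h c) <= 0 * e)" using ev_unit
 proof eventually_elim
  case (elim h)
  interpret A: cstar_pre "WA h" "nm h" by (rule WA_cstar_pre)
  show ?case using elim Em_closed[OF c, of h] by (simp add: sec_def a_minus_def A.r_neg)
 qed
 then show "EX d:FC. ev0 (%h. df h (sec c h) (Em h d) <= 0 * e) \<and>
  (ALL F:dual V. cmod (WC c F - WC d F) <= 0 * e)" using c by (intro bexI[of _ c]) auto
qed simp

lemma slim_minus:
 assumes ab: "slim a b" "slim a' b'" and a: "a : carrier BS" "a' : carrier BS" and b: "b : apc" "b' : apc"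
 shows "slim (a \<ominus>\<^bsub>BS\<^esub> a') (b \<ominus>\<^bsub>AP V\<^esub> b')"
proof -
 interpret B: star_alg BS by (rule BS_star_alg)
 interpret P: star_alg "AP V" by (rule AP_star_alg)
 have "slim ((-1) \<odot>\<^bsub>BS\<^esub> a') (\<lambda>F\<in>dual V. (-1) * b' F)"
  unfolding BS_simps by (rule slim_uc[OF ab(2) a(2) tendsto_const])
 then have "slim ((-1) \<odot>\<^bsub>BS\<^esub> a') ((-1) \<odot>\<^bsub>AP V\<^esub> b')" unfolding AP_simps .
 from slim_add[OF ab(1) this a(1) B.smult_closed[OF a(2)]] show ?thesis
  using P.a_minus_smult[of b b'] b unfolding B.a_minus_smult[OF a] by (simp only: AP_simps)
qed

lemma slim_unique:
 assumes ab: "slim a b" "slim a b'" and a: "a : carrier BS" and b: "b : apc" "b' : apc"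
 shows "b = b'"
proof (rule extensionalityI[OF apcD(1)[OF b(1)] apcD(1)[OF b(2)]])
 fix F assume F: "F : dual V"
 have "ev0 (%h. nm h ((a \<ominus>\<^bsub>BS\<^esub> a) h) <= 0)" using ev_unit
 proof eventually_elim
  case (elim h)
  interpret A: cstar_pre "WA h" "nm h" by (rule WA_cstar_pre)
  show ?case using elim BSD(1)[OF a, of h] unfolding BS_minus_apply[OF a a, OF elim[THEN conjunct1] elim[THEN conjunct2]] by (simp add: a_minus_def A.r_neg)
 qed
 moreover have "a \<ominus>\<^bsub>BS\<^esub> a : carrier BS"
 proof -
  interpret B: star_alg BS by (rule BS_star_alg)
  show ?thesis by (rule B.minus_closed[OF a a])
 qed
 ultimately have "cmod ((b \<ominus>\<^bsub>AP V\<^esub> b') F) <= 0" using slim_le[OF slim_minus[OF ab a a b]] F by blast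
 then show "b F = b' F" by (simp add: AP_minus[OF b F])
qed

end

section \<open>Continuous sections and the limit homomorphism\<close>

context psymp
begin

abbreviation CS :: "'a weyl_section cstar_algebra" where "CS \<equiv> continuous_sections V"

lemma CS_simps [simp]:
 "a \<otimes>\<^bsub>CS\<^esub> b = a \<otimes>\<^bsub>BS\<^esub> b" "\<one>\<^bsub>CS\<^esub> = \<one>\<^bsub>BS\<^esub>" "\<zero>\<^bsub>CS\<^esub> = \<zero>\<^bsub>BS\<^esub>"
 "a \<oplus>\<^bsub>CS\<^esub> b = a \<oplus>\<^bsub>BS\<^esub> b" "c \<odot>\<^bsub>CS\<^esub> a = c \<odot>\<^bsub>BS\<^esub> a" "star CS a = star BS a"
 by (simp_all add: continuous_sections_def)

text \<open>The closure conditions whose least solution is the carrier of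
  \<open>continuous_sections V\<close>. A property of all continuous sections is proved by checking
  that the sections having it form such a family.\<close>

definition section_family :: "'a weyl_section set => bool" where
 "section_family S \<longleftrightarrow> star_subalgebra BS S & norm_closed BS S & closed_under_uc_functions V S & W_section V ` carrier V \<subseteq> S"

lemma CS_carrier: "carrier CS = \<Inter>{S. section_family S}"
 by (simp add: continuous_sections_def section_family_def)

lemma star_subalgebraD:
 assumes "star_subalgebra A S"
 shows "S \<subseteq> carrier A" "\<zero>\<^bsub>A\<^esub> : S" "x : S ==> y : S ==> x \<oplus>\<^bsub>A\<^esub> y : S" "x : S ==> y : S ==> x \<otimes>\<^bsub>A\<^esub> y : S"
  "x : S ==> z \<odot>\<^bsub>A\<^esub> x : S" "x : S ==> star A x : S"
 using assms unfolding star_subalgebra_def by (simp_all only: simp_thms Ball_def)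

lemma star_subalgebraI:
 assumes "S \<subseteq> carrier A" "\<zero>\<^bsub>A\<^esub> : S" "!!x y. x : S ==> y : S ==> x \<oplus>\<^bsub>A\<^esub> y : S" "!!x y. x : S ==> y : S ==> x \<otimes>\<^bsub>A\<^esub> y : S"
  "!!x z. x : S ==> z \<odot>\<^bsub>A\<^esub> x : S" "!!x. x : S ==> star A x : S"
 shows "star_subalgebra A S"
 unfolding star_subalgebra_def by (intro conjI allI ballI assms)

lemma sec_in_subalgebra:
 assumes S: "star_subalgebra BS S" "W_section V ` carrier V \<subseteq> S" and c: "c : FC"
 shows "sec c : S"
 using c
proof (induction rule: fin_coeffs_induct)
 case zero
 have "sec (%_. 0) = \<zero>\<^bsub>BS\<^esub>"
  unfolding sec_def BS_simps by (rule restrict_ext) (rule Em_simps(7)[OF fin_closed(3) fin_closed(3)])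
 then show ?case using star_subalgebraD(2)[OF S(1)] by simp
next
 case (add c f r)
 have W: "sec (ws f) : S"
  using S(2) add(1) by (auto simp: sec_def W_section_def W_eq)
 have "sec (%g. c * ws f g + r g) = c \<odot>\<^bsub>BS\<^esub> sec (ws f) \<oplus>\<^bsub>BS\<^esub> sec r"
  unfolding sec_def BS_simps
  by (rule restrict_ext) (simp add: Em_simps(2)[OF fin_closed(2)[OF ws_fin[OF add(1)]] add(3)]
   Em_simps(4)[OF ws_fin[OF add(1)] ws_fin[OF add(1)]])
 then show ?case using star_subalgebraD(3)[OF S(1) star_subalgebraD(5)[OF S(1) W, of c] add(5)] by simp
qed

text \<open>Shown below to be a \<open>section_family\<close>, so that every continuous section has
  an almost periodic limit.\<close>

definition limitable :: "'a weyl_section set" where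
 "limitable = {a : carrier BS. EX b:apc. slim a b}"

lemma limitableE: assumes "a : limitable" obtains b where "a : carrier BS" "b : apc" "slim a b"
 using assms unfolding limitable_def by blast

lemma limitableI: "a : carrier BS ==> b : apc ==> slim a b ==> a : limitable"
 unfolding limitable_def by blast

lemma slim_smult: "slim a b ==> a : carrier BS ==> slim (c \<odot>\<^bsub>BS\<^esub> a) (\<lambda>F\<in>dual V. c * b F)"
 unfolding BS_simps by (rule slim_uc) auto

text \<open>By \<open>slim_le\<close> the mutual distances of the sections \<open>s n\<close> bound
  those of the limits \<open>b n\<close>, so these converge in the complete algebra of almost
  periodic functions, and their limit is the one sought for \<open>a\<close>.\<close>

lemma limitable_closed: "norm_closed BS limitable"
 unfolding norm_closed_def
proof (intro allI impI, elim conjE)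
 fix s a assume s: "ALL n. s n : limitable" and a: "a : carrier BS" and lim: "(%n. cnorm BS (s n \<ominus>\<^bsub>BS\<^esub> a)) \<longlonglongrightarrow> 0"
 interpret B: star_alg BS by (rule BS_star_alg)
 interpret P: cstar "AP V" "apn" by (rule AP_cstar)
 have "ALL n. EX b. s n : carrier BS & b : apc & slim (s n) b" using s by (meson limitableE)
 then obtain b where b: "!!n. s n : carrier BS" "!!n. b n : apc" "!!n. slim (s n) (b n)" by metis
 define t where "t n = cnorm BS (s n \<ominus>\<^bsub>BS\<^esub> a)" for n
 have sa: "df h (s n h) (a h) <= t n" if h: "0 < h" "h <= 1" for n h
  unfolding t_def BS_minus_apply[OF b(1) a h, symmetric] by (rule BS_norm_upper[OF B.minus_closed[OF b(1) a] h])
 have bb: "apn (b m \<ominus>\<^bsub>AP V\<^esub> b n) <= t m + t n" for m n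
 proof (rule AP_norm_le, rule slim_le[OF slim_minus[OF b(3) b(3) b(1) b(1) b(2) b(2)] B.minus_closed[OF b(1) b(1)]])
  show "ev0 (%h. nm h ((s m \<ominus>\<^bsub>BS\<^esub> s n) h) <= t m + t n)" using ev_unit
  proof eventually_elim
   case (elim h)
   then have h: "0 < h" "h <= 1" by auto
   note D = BSD(1)[OF b(1) h] BSD(1)[OF a h]
   show ?case unfolding BS_minus_apply[OF b(1) b(1) h]
    using df_tri[OF D(1) D(2) D(1), of m n] sa[OF h, of m] sa[OF h, of n] df_comm[OF D(1) D(2), of n] by linarith
  qed
 qed
 have t: "t \<longlonglongrightarrow> 0" unfolding t_def by (rule lim)
 have "b : cauchy_seqs (AP V) (apn)"
  unfolding cauchy_seqs_def mem_Collect_eq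
 proof (intro conjI allI impI)
  show "b n : carrier (AP V)" for n using b(2) by simp
  fix e :: real assume "e > 0"
  then obtain N where N: "!!n. n >= N ==> t n < e/2"
   using order_tendstoD(2)[OF t, of "e/2"] unfolding eventually_sequentially by (metis half_gt_zero)
  show "EX N. ALL m>=N. ALL n>=N. apn (b m \<ominus>\<^bsub>AP V\<^esub> b n) < e"
  proof (intro exI[of _ N] allI impI)
   fix m n assume "m >= N" "n >= N"
   then show "apn (b m \<ominus>\<^bsub>AP V\<^esub> b n) < e" using bb[of m n] N[of m] N[of n] by linarith
  qed
 qed
 then obtain d where d: "P.conv b d" using P.complete' by metis
 then have dapc: "d : apc" using P.convD(2) by simp
 have "slim a d"
 proof (rule slimI[of 2])
  fix e :: real assume e: "0 < e"
  have "eventually (%n. t n < e & apn (b n \<ominus>\<^bsub>AP V\<^esub> d) < e) sequentially"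
   by (intro eventually_conj order_tendstoD(2)[OF t e] order_tendstoD(2)[OF P.convD(3)[OF d] e])
  then obtain n where n: "t n < e" "apn (b n \<ominus>\<^bsub>AP V\<^esub> d) < e" using eventually_sequentially by fastforce
  obtain c where c: "c : FC" "ev0 (%h. (0 < h & h <= 1) & df h (s n h) (Em h c) <= e)"
   "!!F. F : dual V ==> cmod (b n F - WC c F) <= e" using b(3) e by (rule slimE) blast
  show "EX c:FC. ev0 (%h. df h (a h) (Em h c) <= 2 * e) & (ALL F:dual V. cmod (d F - WC c F) <= 2 * e)"
  proof (intro bexI[OF _ c(1)] conjI ballI)
   show "ev0 (%h. df h (a h) (Em h c) <= 2 * e)" using c(2)
   proof eventually_elim
    case (elim h)
    then have h: "0 < h" "h <= 1" by auto
    note D = BSD(1)[OF a h] BSD(1)[OF b(1) h]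
    show ?case using df_tri[OF D Em_closed[OF c(1)], of n] df_comm[OF D(2) D(1), of n] sa[OF h, of n] n(1) elim by linarith
   qed
   fix F assume F: "F : dual V"
   have "P.conv b d" by (rule d)
   have "cmod (b n F - d F) < e"
    using AP_norm_upper[OF _ F, of "b n \<ominus>\<^bsub>AP V\<^esub> d"] P.minus_closed[of "b n" d] b(2) dapc n(2)
    unfolding AP_minus[OF b(2) dapc F] AP_simps(1) by fastforce
   then show "cmod (d F - WC c F) <= 2 * e"
    using c(3)[OF F] norm_triangle_ineq[of "d F - b n F" "b n F - WC c F"] norm_minus_commute[of "b n F" "d F"]
    by simp
  qed
 qed simp
 then show "a : limitable" by (rule limitableI[OF a dapc])
qed

lemma limitable_family: "section_family limitable"
 unfolding section_family_def
proof (intro conjI limitable_closed star_subalgebraI)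
 interpret B: star_alg BS by (rule BS_star_alg)
 show "limitable \<subseteq> carrier BS" by (auto simp: limitable_def)
 have sl: "sec c : limitable" if "c : FC" for c
  by (rule limitableI[OF sec_BS[OF that] apc_W0_comb[OF that] slim_sec[OF that]])
 have W: "W_section V f = sec (ws f)" for f by (simp add: W_section_def sec_def W_eq)
 show "W_section V ` carrier V \<subseteq> limitable" unfolding W using sl by auto
 have "sec (%_. 0) = \<zero>\<^bsub>BS\<^esub>"
  unfolding sec_def BS_simps by (rule restrict_ext) (rule Em_simps(7)[OF fin_closed(3) fin_closed(3)])
 then show "\<zero>\<^bsub>BS\<^esub> : limitable" using sl[OF fin_closed(3)] by simp
 fix a assume "a : limitable"
 then obtain b where a: "a : carrier BS" "b : apc" "slim a b" by (rule limitableE)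
 show "z \<odot>\<^bsub>BS\<^esub> a : limitable" for z
  by (rule limitableI[OF B.smult_closed[OF a(1)] apc_smult[OF a(2)] slim_smult[OF a(3,1)]])
 show "star BS a : limitable"
  by (rule limitableI[OF B.star_closed[OF a(1)] apc_cnj[OF a(2)] slim_star[OF a(3,1)]])
 fix a' assume "a' : limitable"
 then obtain b' where a': "a' : carrier BS" "b' : apc" "slim a' b'" by (rule limitableE)
 show "a \<oplus>\<^bsub>BS\<^esub> a' : limitable"
  by (rule limitableI[OF B.a_closed[OF a(1) a'(1)] apc_add[OF a(2) a'(2)] slim_add[OF a(3) a'(3) a(1) a'(1)]])
 show "a \<otimes>\<^bsub>BS\<^esub> a' : limitable"
  by (rule limitableI[OF B.m_closed[OF a(1) a'(1)] apc_mult[OF a(2) a'(2)] slim_mult[OF a(3) a'(3) a(1) a'(1) a(2) a'(2)]])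
next
 show "closed_under_uc_functions V limitable"
  unfolding closed_under_uc_functions_def
 proof (intro allI impI ballI, elim conjE)
  fix u :: "real => complex" and a
  assume u: "uniformly_continuous_on {0<..1} u" "bounded (u ` {0<..1})" and "a : limitable"
  then obtain b where a: "a : carrier BS" "b : apc" "slim a b" by (elim limitableE)
  obtain L where L: "(u \<longlongrightarrow> L) (at_right 0)" using u(1) by (rule tendsto_uc_at_0)
  obtain K where "ALL h:{0<..1}. cmod (u h) <= K" using u(2) unfolding bounded_iff by auto
  then have K: "cmod (u h) <= K" if "0 < h" "h <= 1" for h using that by simp
  have "(\<lambda>h\<in>{0<..1}. u h \<odot>\<^bsub>WA h\<^esub> a h) : carrier BS"
  proof (rule BSI[of _ "K * cnorm BS a"])
   fix h :: real assume h: "0 < h" "h <= 1"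
   interpret A: cstar_pre "WA h" "nm h" by (rule WA_cstar_pre)
   note D = BSD(1)[OF a(1) h]
   show "(\<lambda>h\<in>{0<..1}. u h \<odot>\<^bsub>WA h\<^esub> a h) h : carrier (WA h)" using h D by simp
   have "cmod (u h) * nm h (a h) <= K * cnorm BS a"
    using K[OF h] BS_norm_upper[OF a(1) h] A.p_nonneg[OF D] order_trans[OF norm_ge_zero K[OF h]] by (intro mult_mono) auto
   then show "nm h ((\<lambda>h\<in>{0<..1}. u h \<odot>\<^bsub>WA h\<^esub> a h) h) <= K * cnorm BS a"
    using h by (simp add: A.p_smult[OF D])
  qed simp
  then show "(\<lambda>h\<in>{0<..1}. u h \<odot>\<^bsub>WA h\<^esub> a h) : limitable" by (rule limitableI[OF _ apc_smult[OF a(2)] slim_uc[OF a(3,1) L]])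
 qed
qed

lemma CS_sub: "carrier CS \<subseteq> limitable"
 unfolding CS_carrier by (rule Inter_lower) (simp add: limitable_family)

lemma CS_family: "section_family (carrier CS)"
proof -
 have sub: "carrier CS \<subseteq> carrier BS" using CS_sub by (auto simp: limitable_def)
 have I: "a : carrier CS" if "!!S. section_family S ==> a : S" for a using that unfolding CS_carrier by (rule InterI) simp
 have D: "a : S" if "a : carrier CS" "section_family S" for a S using that unfolding CS_carrier by (auto)
 have fam: "star_subalgebra BS S" "norm_closed BS S" "closed_under_uc_functions V S" "W_section V ` carrier V \<subseteq> S"
  if "section_family S" for S using that unfolding section_family_def by simp_all
 show ?thesis
  unfolding section_family_def
 proof (intro conjI star_subalgebraI sub I)
  show "\<zero>\<^bsub>BS\<^esub> : S" if "section_family S" for S by (rule star_subalgebraD(2)[OF fam(1)[OF that]])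
  show "x \<oplus>\<^bsub>BS\<^esub> y : S" "x \<otimes>\<^bsub>BS\<^esub> y : S" if "x : carrier CS" "y : carrier CS" "section_family S" for x y S
   using star_subalgebraD(3,4)[OF fam(1)[OF that(3)] D[OF that(1,3)] D[OF that(2,3)]] by simp_all
  show "z \<odot>\<^bsub>BS\<^esub> x : S" "star BS x : S" if "x : carrier CS" "section_family S" for x z S
   using star_subalgebraD(5,6)[OF fam(1)[OF that(2)] D[OF that]] by simp_all
  show "norm_closed BS (carrier CS)"
   unfolding norm_closed_def
  proof (intro allI impI I)
   fix s a S assume s: "(ALL n. s n : carrier CS) & a : carrier BS & (%n. cnorm BS (s n \<ominus>\<^bsub>BS\<^esub> a)) \<longlonglongrightarrow> 0" and S: "section_family S"
   have "ALL n. s n : S" using D[OF _ S] s by simp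
   then show "a : S" using fam(2)[OF S] s unfolding norm_closed_def by blast
  qed
  show "closed_under_uc_functions V (carrier CS)"
   unfolding closed_under_uc_functions_def
  proof (intro allI impI ballI I)
   fix u :: "real => complex" and a S assume u: "uniformly_continuous_on {0<..1} u & bounded (u ` {0<..1})"
    and a: "a : carrier CS" and S: "section_family S"
   show "(\<lambda>h\<in>{0<..1}. u h \<odot>\<^bsub>WA h\<^esub> a h) : S"
    using fam(3)[OF S] u D[OF a S] unfolding closed_under_uc_functions_def by simp
  qed
  show "W_section V ` carrier V \<subseteq> carrier CS"
   unfolding CS_carrier by (rule Inter_greatest) (simp add: fam(4))
 qed
qed

lemma CS_props: "star_subalgebra BS (carrier CS)" "norm_closed BS (carrier CS)"
  "closed_under_uc_functions V (carrier CS)" "W_section V ` carrier V \<subseteq> carrier CS"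
 using CS_family unfolding section_family_def by simp_all

lemma CS_BS: "a : carrier CS ==> a : carrier BS"
 using star_subalgebraD(1)[OF CS_props(1)] by blast

lemma sec_CS: "c : FC ==> sec c : carrier CS"
 by (rule sec_in_subalgebra[OF CS_props(1,4)])

lemma sec_one: "sec (ws \<zero>) = \<one>\<^bsub>BS\<^esub>"
 unfolding sec_def BS_simps by (rule restrict_ext) (rule Em_simps(6)[OF fin_closed(3) fin_closed(3)])

theorem CS_star_alg: "star_alg CS"
proof -
 have "star_alg (BS\<lparr>carrier := carrier CS\<rparr>)"
  by (rule star_subalgebra_star_alg[OF BS_star_alg CS_props(1)])
   (use sec_CS[OF ws_fin[OF V.zero_closed]] in \<open>simp add: sec_one\<close>)
 moreover have "BS\<lparr>carrier := carrier CS\<rparr> = CS" by (simp add: continuous_sections_def)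
 ultimately show ?thesis by simp
qed

text \<open>The classical limit on the level of sections. Its kernel is \<open>K0 V\<close> and it
  is onto \<open>AP V\<close>, so the quotient and its identification with \<open>AP V\<close> are
  instances of \<open>star_quotient\<close>.\<close>

definition lam :: "'a weyl_section => 'a dual_fun" where
 "lam = (\<lambda>a\<in>carrier CS. THE b. b : apc & slim a b)"

lemma lam:
 assumes "a : carrier CS" shows "lam a : apc" "slim a (lam a)"
proof -
 obtain b where b: "a : carrier BS" "b : apc" "slim a b" using CS_sub assms by (meson limitableE subsetD)
 have "(THE b. b : apc & slim a b) = b"
  by (rule the_equality) (use b slim_unique[OF _ b(3) b(1) _ b(2)] in blast)+
 then show "lam a : apc" "slim a (lam a)" using b assms by (simp_all add: lam_def)
qed

lemma lam_eq: "a : carrier CS ==> b : apc ==> slim a b ==> lam a = b"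
 by (rule slim_unique[OF lam(2) _ CS_BS lam(1)])

lemma lam_sec: "c : FC ==> lam (sec c) = WC c"
 by (rule lam_eq[OF sec_CS apc_W0_comb slim_sec])

theorem lam_hom: "lam : star_hom CS (AP V)"
proof (rule star_homI)
 interpret C: star_alg CS by (rule CS_star_alg)
 fix a assume a: "a : carrier CS"
 show "lam a : carrier (AP V)" using lam(1)[OF a] by simp
 note la = lam[OF a] CS_BS[OF a]
 show "lam (c \<odot>\<^bsub>CS\<^esub> a) = c \<odot>\<^bsub>AP V\<^esub> lam a" for c
  unfolding AP_simps by (rule lam_eq[OF C.smult_closed[OF a] apc_smult[OF la(1)]]) (simp add: slim_smult la)
 show "lam (star CS a) = star (AP V) (lam a)"
  unfolding AP_simps by (rule lam_eq[OF C.star_closed[OF a] apc_cnj[OF la(1)]]) (simp add: slim_star la)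
 fix b assume b: "b : carrier CS"
 note lb = lam[OF b] CS_BS[OF b]
 show "lam (a \<oplus>\<^bsub>CS\<^esub> b) = lam a \<oplus>\<^bsub>AP V\<^esub> lam b"
  unfolding AP_simps by (rule lam_eq[OF C.a_closed[OF a b] apc_add[OF la(1) lb(1)]]) (simp add: slim_add la lb)
 show "lam (a \<otimes>\<^bsub>CS\<^esub> b) = lam a \<otimes>\<^bsub>AP V\<^esub> lam b"
  unfolding AP_simps by (rule lam_eq[OF C.m_closed[OF a b] apc_mult[OF la(1) lb(1)]]) (simp add: slim_mult la lb)
next
 have "WC (ws \<zero>) = \<one>\<^bsub>AP V\<^esub>"
  unfolding W0_comb_symbol W0_def AP_simps by (rule restrict_ext) (simp add: dualD(3))
 then show "lam \<one>\<^bsub>CS\<^esub> = \<one>\<^bsub>AP V\<^esub>" using lam_sec[OF ws_fin[OF V.zero_closed]] by (simp add: sec_one)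
 show "lam : extensional (carrier CS)" by (simp add: lam_def)
qed

text \<open>\<open>slim_le\<close> and \<open>slim_ge\<close> translate vanishing of the fibre norms
  at 0 into vanishing of the limit function. Hence \<open>K0 V\<close> is a kernel and in particular
  an ideal.\<close>

lemma K0_eq: "K0 V = {a : carrier CS. lam a = \<zero>\<^bsub>AP V\<^esub>}"
proof -
 have "((%h. nm h (a h)) \<longlongrightarrow> 0) (at_right 0) \<longleftrightarrow> lam a = \<zero>\<^bsub>AP V\<^esub>" if a: "a : carrier CS" for a
 proof
  assume l: "((%h. nm h (a h)) \<longlongrightarrow> 0) (at_right 0)"
  show "lam a = \<zero>\<^bsub>AP V\<^esub>"
  proof (rule extensionalityI[OF apcD(1)[OF lam(1)[OF a]]])
   fix F assume F: "F : dual V"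
   have "cmod (lam a F) <= 0"
   proof (rule field_le_epsilon)
    fix e :: real assume "e > 0"
    then have "ev0 (%h. nm h (a h) <= 0 + e)" using order_tendstoD(2)[OF l, of e] by (auto elim: eventually_mono)
    then show "cmod (lam a F) <= 0 + e" by (rule slim_le[OF lam(2)[OF a] CS_BS[OF a] _ F])
   qed
   then show "lam a F = \<zero>\<^bsub>AP V\<^esub> F" using F by simp
  qed simp
 next
  assume z: "lam a = \<zero>\<^bsub>AP V\<^esub>"
  show "((%h. nm h (a h)) \<longlongrightarrow> 0) (at_right 0)"
  proof (rule tendstoI)
   fix e :: real assume e: "e > 0"
   have "ev0 (%h. nm h (a h) <= 0 + e/2)"
    by (rule slim_ge[OF lam(2)[OF a] CS_BS[OF a]]) (use e in \<open>auto simp: z\<close>)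
   with ev_unit show "ev0 (%h. dist (nm h (a h)) 0 < e)"
   proof eventually_elim
    case (elim h)
    interpret A: cstar_pre "WA h" "nm h" by (rule WA_cstar_pre)
    show ?case using elim e A.p_nonneg[OF BSD(1)[OF CS_BS[OF a]]] by simp
   qed
  qed
 qed
 then show ?thesis unfolding K0_def by blast
qed

end

section \<open>Surjectivity of the limit and the classical limit object\<close>

context psymp
begin

lemma cutoff_uc:
 fixes \<delta> :: real
 shows "uniformly_continuous_on {0<..1} (%h. cr (max 0 (min 1 (2 - 2 * h / \<delta>))))"
proof -
 have "uniformly_continuous_on {0..1} (%h. cr (max 0 (min 1 (2 - 2 * h / \<delta>))))"
 proof (rule compact_uniformly_continuous)
  have "continuous_on {0..1} (%h. max 0 (min 1 (2 - 2 * h * inverse \<delta>)))" by (intro continuous_intros)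
  then show "continuous_on {0..1} (%h. cr (max 0 (min 1 (2 - 2 * h / \<delta>))))"
   by (intro continuous_on_of_real) (simp add: divide_inverse)
 qed simp
 then show ?thesis unfolding uniformly_continuous_on_def by (meson greaterThanAtMost_subseteq_atLeastAtMost_iff order_refl subsetD)
qed

text \<open>A given almost periodic function is a uniform limit of trigonometric polynomials. The increments of
 the corresponding constant-coefficient sections are small only near 0 and have to be cut off there.\<close>

theorem lam_onto: "lam ` carrier CS = apc"
proof
 show "lam ` carrier CS \<subseteq> apc" using lam(1) by blast
 show "apc \<subseteq> lam ` carrier CS"
 proof
  fix b assume b: "b : apc"
  interpret B: star_alg BS by (rule BS_star_alg)
  \<comment> \<open>The constant 8 bounds the increments by \<open>(1/2)^n / 4\<close> in supremum
    norm, strictly less than \<open>(1/2)^n\<close>; this gap allows the passage to the fibre norms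
    for small \<open>h\<close>.\<close>
  have "ALL n. EX c:FC. ALL F:dual V. cmod (b F - WC c F) <= (1/2)^n / 8"
   by (intro allI AP_dense[OF b]) simp
  then obtain c where c: "!!n. c n : FC"
   "!!n F. F : dual V ==> cmod (b F - WC (c n) F) <= (1/2)^n / 8" by metis
  define d where "d n = diffc (c (Suc n)) (c n)" for n
  have d: "d n : FC" for n unfolding d_def by (rule diffc_closed[OF c(1) c(1)])
  \<comment> \<open>The bound by \<open>1 / (n + 1)\<close> lets only finitely many increments
    survive at a fixed \<open>h\<close>, so that the sum over \<open>n\<close> is finite in each
    fibre.\<close>
  have "EX \<delta>>0. \<delta> <= 1 / (real n + 1) & (ALL h. 0 < h & h < \<delta> --> mx h (d n) <= (1/2)^n)" for n
  proof -
   have "supn (d n) <= (1/2)^n / 4"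
   proof (rule supn_least)
    fix F assume F: "F : dual V"
    have "(1/2::real) ^ Suc n / 8 <= (1/2)^n / 8" by simp
    moreover have "cmod (WC (c (Suc n)) F - WC (c n) F) \<le>
      cmod (b F - WC (c n) F) + cmod (b F - WC (c (Suc n)) F)"
     using norm_triangle_ineq4[of "b F - WC (c n) F" "b F - WC (c (Suc n)) F"] by simp
    ultimately show "cmod (WC (d n) F) <= (1/2)^n / 4"
     unfolding d_def W0_diffc[OF c(1) c(1) F] using c(2)[OF F, of n] c(2)[OF F, of "Suc n"] by linarith
   qed
   then have "supn (d n) < (1/2)^n" by (rule order_le_less_trans) simp
   then have "ev0 (%h. mx h (d n) < (1/2)^n)" by (rule order_tendstoD(2)[OF mx_tendsto_supn[OF d]])
   then obtain e where e: "e > 0" "ALL h>0. h < e --> mx h (d n) < (1/2)^n"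
    using eventually_at_right[of 0 "1::real"] by auto
   show ?thesis by (rule exI[of _ "min e (1 / (real n + 1))"]) (use e in \<open>auto simp: less_imp_le\<close>)
  qed
  then obtain \<delta> where \<delta>: "!!n. \<delta> n > 0" "!!n. \<delta> n <= 1 / (real n + 1)"
   "!!n h. 0 < h ==> h < \<delta> n ==> mx h (d n) <= (1/2)^n" by metis
  \<comment> \<open>A continuous cutoff: 1 up to \<open>\<delta> n / 2\<close>, 0 from
    \<open>\<delta> n\<close> on, and linear in between.\<close>
  define g where "g n h = max 0 (min 1 (2 - 2 * h / \<delta> n))" for n and h :: real
  have g01: "0 <= g n h" "g n h <= 1" for n h by (auto simp: g_def)
  have g0: "g n h = 0" if "\<delta> n <= h" for n h using that \<delta>(1)[of n] by (simp add: g_def field_simps)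
  have g1: "g n h = 1" if "0 < h" "h < \<delta> n / 2" for n h using that \<delta>(1)[of n] by (simp add: g_def field_simps)
  define Y where "Y n = (\<lambda>h\<in>{0<..1}. cr (g n h) \<odot>\<^bsub>WA h\<^esub> sec (d n) h)" for n
  define S where "S = rec_nat (sec (c 0)) (%n s. s \<oplus>\<^bsub>BS\<^esub> Y n)"
  have S0: "S 0 = sec (c 0)" and SS: "S (Suc n) = S n \<oplus>\<^bsub>BS\<^esub> Y n" for n by (simp_all add: S_def)
  have "Y n : carrier CS" for n
   using CS_props(3) sec_CS[OF d, of n] cutoff_uc[of "\<delta> n"] g01
   unfolding closed_under_uc_functions_def Y_def g_def[symmetric]
   by (auto simp: bounded_iff intro!: exI[of _ 1] image_eqI)
  then have SC: "S n : carrier CS" for n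
   by (induction n) (simp_all add: S0 SS sec_CS[OF c(1)] star_subalgebraD(3)[OF CS_props(1)])
  have SB: "S n : carrier BS" for n by (rule CS_BS[OF SC])
  have Sh: "S (Suc n) h = S n h \<oplus>\<^bsub>WA h\<^esub> cr (g n h) \<odot>\<^bsub>WA h\<^esub> Em h (d n)" if h: "0 < h" "h <= 1" for n h
   unfolding SS BS_apply[OF h] Y_def sec_def using h by simp
  have step: "df h (S (Suc n) h) (S n h) <= (1/2)^n" if h: "0 < h" "h <= 1" for n h
  proof -
   interpret A: cstar_pre "WA h" "nm h" by (rule WA_cstar_pre)
   note D = BSD(1)[OF SB h, of n] Em_closed[OF d, of h n]
   let ?y = "cr (g n h) \<odot>\<^bsub>WA h\<^esub> Em h (d n)"
   have y: "?y : carrier (WA h)" by (rule A.smult_closed[OF D(2)])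
   have "S (Suc n) h \<ominus>\<^bsub>WA h\<^esub> S n h = ?y" unfolding Sh[OF h] using D(1) y by algebra
   then have "df h (S (Suc n) h) (S n h) = g n h * mx h (d n)"
    using A.p_smult[OF D(2), of "cr (g n h)"] g01(1)[of n h] by (simp add: Em_simps(8)[OF d d])
   also have "... <= (1/2)^n"
   proof (cases "\<delta> n <= h")
    case False
    have "g n h * mx h (d n) <= 1 * (1/2)^n"
     using g01[of n h] \<delta>(3)[OF h(1), of n] False A.p_nonneg[OF D(2)] unfolding Em_simps(8)[OF d d] by (intro mult_mono) auto
    then show ?thesis by simp
   qed (simp add: g0)
   finally show ?thesis .
  qed
  have tail: "df h (S (M + k) h) (S M h) <= 2 * (1/2)^M - 2 * (1/2)^(M+k)" if h: "0 < h" "h <= 1" for h M k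
  proof (induction k)
   case 0
   interpret A: cstar_pre "WA h" "nm h" by (rule WA_cstar_pre)
   show ?case using BSD(1)[OF SB h, of M] by (simp add: a_minus_def A.r_neg)
  next
   case (Suc k)
   show ?case
    using df_tri[OF BSD(1)[OF SB h] BSD(1)[OF SB h] BSD(1)[OF SB h], of "Suc (M+k)" M "M+k"] step[OF h, of "M+k"] Suc.IH by simp
  qed
  \<comment> \<open>From index \<open>N h\<close> on every cutoff vanishes at \<open>h\<close>,
    because \<open>\<delta> n <= 1 / (n + 1) <= h\<close>.\<close>
  define N where "N h = nat \<lceil>1/h\<rceil>" for h :: real
  have const: "S (N h + k) h = S (N h) h" if h: "0 < h" "h <= 1" for h k
  proof (induction k)
   case (Suc k)
   interpret A: cstar_pre "WA h" "nm h" by (rule WA_cstar_pre)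
   have "1 / h <= real (N h + k) + 1" unfolding N_def using real_nat_ceiling_ge[of "1/h"] by linarith
   then have "1 / (real (N h + k) + 1) <= h" using h by (simp add: field_simps)
   then have "g (N h + k) h = 0" using \<delta>(2)[of "N h + k"] by (intro g0) linarith
   then have "S (Suc (N h + k)) h = S (N h + k) h"
    unfolding Sh[OF h] using BSD(1)[OF SB h] Em_closed[OF d] by simp
   then show ?case using Suc.IH by simp
  qed simp
  define a where "a = (\<lambda>h\<in>{0<..1}. S (N h) h)"
  have aD: "a h : carrier (WA h)" if "0 < h" "h <= 1" for h using that BSD(1)[OF SB that] by (simp add: a_def)
  have aS: "df h (a h) (S M h) <= 2 * (1/2)^M" if h: "0 < h" "h <= 1" for h M
  proof (cases "M <= N h")
   case True
   have "df h (S (N h) h) (S M h) <= 2 * (1/2) ^ M - 2 * (1/2) ^ N h" using tail[OF h, of M "N h - M"] True by simp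
   also have "... <= 2 * (1/2) ^ M" by simp
   finally show ?thesis using h by (simp add: a_def)
  next
   case False
   interpret A: cstar_pre "WA h" "nm h" by (rule WA_cstar_pre)
   have "S M h = a h" using const[OF h, of "M - N h"] False h by (simp add: a_def)
   then show ?thesis using aD[OF h] by (simp add: a_minus_def A.r_neg)
  qed
  have aB: "a : carrier BS"
  proof (rule BSI[OF aD])
   show "a : extensional {0<..1}" by (simp add: a_def)
   show "nm h (a h) <= 2 + cnorm BS (S 0)" if h: "0 < h" "h <= 1" for h
    using nm_le[OF aD[OF h] BSD(1)[OF SB h], of 0] aS[OF h, of 0] BS_norm_upper[OF SB h, of 0] by simp
  qed
  have half: "(%n. 2 * (1/2::real)^n) \<longlonglongrightarrow> 0"
   using tendsto_mult_left[OF LIMSEQ_realpow_zero[of "1/2::real"], of 2] by simp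
  have "(%n. cnorm BS (S n \<ominus>\<^bsub>BS\<^esub> a)) \<longlonglongrightarrow> 0"
  proof (rule tendsto_sandwich[OF _ _ tendsto_const half])
   have "cnorm BS (S n \<ominus>\<^bsub>BS\<^esub> a) <= 2 * (1/2)^n" for n
   proof (rule BS_norm_le)
    fix h :: real assume h: "0 < h" "h <= 1"
    show "nm h ((S n \<ominus>\<^bsub>BS\<^esub> a) h) <= 2 * (1/2)^n"
     unfolding BS_minus_apply[OF SB aB h] df_comm[OF BSD(1)[OF SB h] aD[OF h]] by (rule aS[OF h])
   qed
   then show "\<forall>\<^sub>F n in sequentially. cnorm BS (S n \<ominus>\<^bsub>BS\<^esub> a) <= 2 * (1/2)^n" by simp
   have "0 <= cnorm BS (S n \<ominus>\<^bsub>BS\<^esub> a)" for n by (rule BS_norm_nonneg[OF B.minus_closed[OF SB aB]])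
   then show "\<forall>\<^sub>F n in sequentially. 0 <= cnorm BS (S n \<ominus>\<^bsub>BS\<^esub> a)" by simp
  qed
  then have aC: "a : carrier CS" using CS_props(2) SC aB unfolding norm_closed_def by blast
  \<comment> \<open>Close enough to 0 the first \<open>M\<close> cutoffs are all 1, and the
    increments telescope.\<close>
  have near: "ev0 (%h. S M h = Em h (c M))" for M
  proof (induction M)
   case 0
   show ?case using ev_unit by eventually_elim (simp add: S0 sec_def)
  next
   case (Suc M)
   have "ev0 (%h. h < \<delta> M / 2)" using \<delta>(1)[of M] by (intro eventually_at_rightI[of 0 "\<delta> M / 2"]) auto
   with Suc ev_unit show ?case
   proof eventually_elim
    case (elim h)
    interpret A: cstar_pre "WA h" "nm h" by (rule WA_cstar_pre)
    note D = Em_closed[OF c(1), of h M] Em_closed[OF c(1), of h "Suc M"]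
    have "g M h = 1" using elim by (intro g1) auto
    then have "S (Suc M) h = Em h (c M) \<oplus>\<^bsub>WA h\<^esub> (Em h (c (Suc M)) \<ominus>\<^bsub>WA h\<^esub> Em h (c M))"
     using Sh[of h M] elim A.smult_one[OF A.minus_closed[OF D(2) D(1)]] Em_diffc[OF c(1) c(1), of h "Suc M" M] by (simp add: d_def)
    also have "... = Em h (c (Suc M))" using D by algebra
    finally show ?case .
   qed
  qed
  have "slim a b"
  proof (rule slimI[of 1])
   fix e :: real assume e: "0 < e"
   obtain M where M: "2 * (1/2::real)^M < e" using order_tendstoD(2)[OF half e] eventually_sequentially by auto
   show "EX c:FC. ev0 (%h. df h (a h) (Em h c) <= 1 * e) & (ALL F:dual V. cmod (b F - WC c F) <= 1 * e)"
   proof (intro bexI[OF _ c(1)[of M]] conjI ballI)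
    show "ev0 (%h. df h (a h) (Em h (c M)) <= 1 * e)" using ev_unit near[of M]
    proof eventually_elim
     case (elim h)
     then show ?case using aS[of h M] M by simp
    qed
    have "(1/2::real)^M / 8 <= 2 * (1/2)^M" by simp
    then show "cmod (b F - WC (c M) F) <= 1 * e" if "F : dual V" for F
     using c(2)[OF that, of M] M by linarith
   qed
  qed simp
  then have "lam a = b" by (rule lam_eq[OF aC b])
  then show "b : lam ` carrier CS" using aC by blast
 qed
qed

lemma quotient: "star_quotient CS (AP V) lam"
 by (intro star_quotient.intro star_quotient_axioms.intro CS_star_alg AP_star_alg lam_hom) (simp add: lam_onto)

lemma K0_Ker: "K0 V = star_quotient.Ker CS (AP V) lam"
 unfolding K0_eq star_quotient.Ker_def[OF quotient] ..

lemma limit_algebra_eq: "limit_algebra V = quotient_algebra CS (star_quotient.Ker CS (AP V) lam)"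
 unfolding limit_algebra_def K0_Ker ..

lemma AP_norm_dense: "b : apc ==> e > 0 ==> EX d:Delta0 V. apn (b \<ominus>\<^bsub>AP V\<^esub> d) < e"
proof -
 assume b: "b : apc" and e: "e > 0"
 obtain c where c: "c : FC" "ALL F:dual V. cmod (b F - WC c F) <= e/2" using AP_dense[OF b half_gt_zero[OF e]] by blast
 have "apn (b \<ominus>\<^bsub>AP V\<^esub> WC c) <= e/2"
  by (rule AP_norm_le) (use c in \<open>simp only: AP_minus[OF b apc_W0_comb[OF c(1)]]\<close>)
 also have "... < e" using e by simp
 finally show ?thesis using c(1) unfolding Delta0_def by blast
qed

lemma Delta0_apc: "Delta0 V \<subseteq> apc"
 unfolding Delta0_def using apc_W0_comb by blast

lemma W_section_eq: "W_section V f = sec (ws f)"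
 by (simp add: W_section_def sec_def W_eq)

lemma W0_comb_step:
 assumes "f : carrier V" "r : FC"
 shows "WC (%g. c * ws f g + r g) = c \<odot>\<^bsub>AP V\<^esub> W0 V f \<oplus>\<^bsub>AP V\<^esub> WC r"
proof (rule extensionalityI[of _ "dual V"])
 fix F assume F: "F : dual V"
 show "WC (%g. c * ws f g + r g) F = (c \<odot>\<^bsub>AP V\<^esub> W0 V f \<oplus>\<^bsub>AP V\<^esub> WC r) F"
  using F by (simp add: W0_comb_linear(1)[OF fin_closed(2)[OF ws_fin[OF assms(1)]] assms(2) F]
   W0_comb_linear(2)[OF ws_fin[OF assms(1)] ws_fin[OF assms(1)] F] W0_comb_symbol)
qed (simp_all add: W0_combination_def)

lemma W0_comb_zero: "WC (%_. 0) = \<zero>\<^bsub>AP V\<^esub>"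
 by (simp add: W0_combination_def)

text \<open>Induction along the support. The two maps are treated through membership in
  \<open>{p, q}\<close> so that each linearity assumption is stated once.\<close>

lemma Delta0_linear_eq:
 assumes "abelian_group B" "p \<zero>\<^bsub>AP V\<^esub> = \<zero>\<^bsub>B\<^esub>" "q \<zero>\<^bsub>AP V\<^esub> = \<zero>\<^bsub>B\<^esub>"
  and add: "!!r a b. r : {p, q} ==> a : Delta0 V ==> b : Delta0 V ==> r (a \<oplus>\<^bsub>AP V\<^esub> b) = r a \<oplus>\<^bsub>B\<^esub> r b"
  and smult: "!!r a c. r : {p, q} ==> a : Delta0 V ==> r (c \<odot>\<^bsub>AP V\<^esub> a) = c \<odot>\<^bsub>B\<^esub> r a"
  and W: "!!f. f : carrier V ==> p (W0 V f) = q (W0 V f)" and c: "c : FC"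
 shows "p (WC c) = q (WC c)"
 using c
proof (induction rule: fin_coeffs_induct)
 case (add c f r)
 have 1: "W0 V f : Delta0 V" "WC r : Delta0 V"
  unfolding Delta0_def using add(3) ws_fin[OF add(1)] W0_comb_symbol[of f] by (metis imageI)+
 have "c \<odot>\<^bsub>AP V\<^esub> W0 V f = WC (%g. c * ws f g + 0)"
  using W0_comb_step[OF add(1) fin_closed(3), of c] apc_smult[OF apc_W0[OF add(1)], of c] apcD(1)
  unfolding W0_comb_zero AP_simps by (auto simp: fun_eq_iff extensional_def)
 then have 2: "c \<odot>\<^bsub>AP V\<^esub> W0 V f : Delta0 V"
  unfolding Delta0_def using fin_closed(1)[OF fin_closed(2)[OF ws_fin[OF add(1)]] fin_closed(3), of c] by (metis imageI)
 show ?case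
  unfolding W0_comb_step[OF add(1,3)] assms(4)[OF insertI1 2 1(2)] assms(4)[OF insertI2[OF insertI1] 2 1(2)]
   assms(5)[OF insertI1 1(1)] assms(5)[OF insertI2[OF insertI1] 1(1)] W[OF add(1)] add(5) ..
qed (simp only: W0_comb_zero assms(2,3))

text \<open>Prescribed values on the sections \<open>W_section V f\<close> propagate by linearity to
  all constant coefficients, that is, to all classes with limit in \<open>Delta0 V\<close>. Density
  of the latter and \<open>Phi_unique\<close> leave the description no choice.\<close>

theorem limit_iso_eq: "limit_iso V = star_quotient.Phi CS (AP V) lam"
proof -
 interpret L: star_quotient CS "AP V" lam by (rule quotient)
 have W: "W_section V f : carrier CS" if "f : carrier V" for f using CS_props(4) that by blast
 show ?thesis
  unfolding limit_iso_def limit_algebra_eq K0_Ker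
 proof (rule the_equality, intro conjI ballI)
  show "L.Phi : star_iso L.Q (AP V)" by (rule L.Phi_iso)
  show "L.Phi (L.cos (W_section V f)) = W0 V f" if "f : carrier V" for f
   using L.Phi_coset[OF W[OF that]] unfolding W_section_eq lam_sec[OF ws_fin[OF that]] W0_comb_symbol .
  fix \<Psi> assume \<Psi>: "\<Psi> : star_iso L.Q (AP V) & (ALL f:carrier V. \<Psi> (L.cos (W_section V f)) = W0 V f)"
  then have h: "\<Psi> : star_hom L.Q (AP V)" by (simp add: star_iso_def)
  have sec: "\<Psi> (L.cos (sec c)) = WC c" if "c : FC" for c
   using that
  proof (induction rule: fin_coeffs_induct)
   case zero
   have z: "sec (%_. 0) : carrier CS" by (rule sec_CS[OF fin_closed(3)])
   have "sec (%_. 0) = 0 \<odot>\<^bsub>CS\<^esub> sec (%_. 0)"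
    unfolding CS_simps BS_simps sec_def
    by (rule restrict_ext) (use Em_simps(4)[OF fin_closed(3) fin_closed(3), where c=0] in simp)
   then have "\<Psi> (L.cos (sec (%_. 0))) = 0 \<odot>\<^bsub>AP V\<^esub> \<Psi> (L.cos (sec (%_. 0)))"
    using L.Q_simps(4)[OF z z, of 0] star_homD(5)[OF h L.cos_closed[OF z], of 0] by simp
   then show ?case unfolding W0_comb_zero by (simp cong: restrict_cong)
  next
   case (add c f r)
   note s = sec_CS[OF ws_fin[OF add(1)]] sec_CS[OF add(3)]
   have eq: "sec (%g. c * ws f g + r g) = c \<odot>\<^bsub>CS\<^esub> sec (ws f) \<oplus>\<^bsub>CS\<^esub> sec r"
    unfolding sec_def CS_simps BS_simps
    by (rule restrict_ext) (simp add: Em_simps(2)[OF fin_closed(2)[OF ws_fin[OF add(1)]] add(3)]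
     Em_simps(4)[OF ws_fin[OF add(1)] ws_fin[OF add(1)]])
   have "\<Psi> (L.cos (sec (%g. c * ws f g + r g))) = c \<odot>\<^bsub>AP V\<^esub> \<Psi> (L.cos (sec (ws f))) \<oplus>\<^bsub>AP V\<^esub> \<Psi> (L.cos (sec r))"
    unfolding eq L.Q_simps(1)[OF L.A.smult_closed[OF s(1)] s(2), symmetric]
    unfolding star_homD(2)[OF h L.cos_closed[OF L.A.smult_closed[OF s(1)]] L.cos_closed[OF s(2)]]
    unfolding L.Q_simps(4)[OF s(1) s(1), symmetric] star_homD(5)[OF h L.cos_closed[OF s(1)]] ..
   then show ?case unfolding add(5) W0_comb_step[OF add(1,3)] using \<Psi> add(1) by (simp only: W_section_eq)
  qed
  show "\<Psi> = L.Phi"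
  proof (rule L.Phi_unique[OF AP_cstar _ _ h])
   show "Delta0 V \<subseteq> carrier (AP V)" using Delta0_apc by simp
   show "EX d:Delta0 V. apn (b \<ominus>\<^bsub>AP V\<^esub> d) < e" if "b : carrier (AP V)" "e > 0" for b e
    by (rule AP_norm_dense) (use that in simp_all)
   fix a assume a: "a : carrier CS" and "lam a : Delta0 V"
   then obtain c where c: "c : FC" "lam a = WC c" unfolding Delta0_def by blast
   have "L.cos a = L.cos (sec c)" unfolding L.coset_eq_iff[OF a sec_CS[OF c(1)]] lam_sec[OF c(1)] by (rule c(2))
   then show "\<Psi> (L.cos a) = lam a" using sec[OF c(1)] c(2) by simp
  qed
 qed
qed

lemma limit_iso_coset: "a : carrier CS ==> limit_iso V (K0 V +>\<^bsub>CS\<^esub> a) = lam a"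
 unfolding limit_iso_eq K0_Ker by (rule star_quotient.Phi_coset[OF quotient])

lemma limit_carrier: "carrier (limit_algebra V) = (%a. K0 V +>\<^bsub>CS\<^esub> a) ` carrier CS"
 unfolding limit_algebra_eq K0_Ker by (rule star_quotient.Q_carrier[OF quotient])

lemma limit_iso_image: "limit_iso V ` carrier (limit_algebra V) = apc"
 unfolding limit_carrier image_image using lam_onto by (simp add: limit_iso_coset cong: image_cong)

text \<open>Supplies a member of the intersection that defines \<open>smooth_sections V\<close>;
  hence limits of smooth sections lie in \<open>Delta0 V\<close>.\<close>

lemma Delta0_sub_star: "star_subalgebra BS {a : carrier CS. lam a : Delta0 V}"
proof (rule star_subalgebraI)
 note s = star_subalgebraD[OF CS_props(1)] and l = star_homD[OF lam_hom, unfolded CS_simps]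
 show "{a : carrier CS. lam a : Delta0 V} \<subseteq> carrier BS" using CS_BS by blast
 have W: "WC c : Delta0 V" if "c : FC" for c unfolding Delta0_def by (rule imageI[OF that])
 have z: "\<zero>\<^bsub>BS\<^esub> : K0 V"
 proof -
  interpret L: star_quotient CS "AP V" lam by (rule quotient)
  interpret I: ideal L.Ker CS by (rule L.Ker_ideal)
  show ?thesis unfolding K0_Ker using I.zero_closed by simp
 qed
 then show "\<zero>\<^bsub>BS\<^esub> : {a : carrier CS. lam a : Delta0 V}"
  unfolding K0_eq using W[OF fin_closed(3)] unfolding W0_comb_zero by simp
 fix x assume "x : {a : carrier CS. lam a : Delta0 V}"
 then obtain c where x: "x : carrier CS" and c: "c : FC" "lam x = WC c" unfolding Delta0_def by blast
 have res: "WC c = (\<lambda>F\<in>dual V. WC c F)" for c by (simp add: W0_combination_def cong: restrict_cong)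
 have "z \<odot>\<^bsub>AP V\<^esub> lam x = WC (%f. z * c f)" for z
  unfolding AP_simps c(2) by (subst (2) res, rule restrict_ext) (simp only: W0_comb_linear(2)[OF c(1) c(1)])
 then show "z \<odot>\<^bsub>BS\<^esub> x : {a : carrier CS. lam a : Delta0 V}" for z
  using s(5)[OF x] l(5)[OF x] W[OF fin_closed(2)[OF c(1)]] by simp
 have "star (AP V) (lam x) = WC (adj 0 c)"
  unfolding AP_simps c(2) by (subst (2) res, rule restrict_ext) (simp only: W0_comb_star_mult(2)[OF c(1) c(1)])
 then show "star BS x : {a : carrier CS. lam a : Delta0 V}"
  using s(6)[OF x] l(6)[OF x] W[OF fin_closed(5)[OF c(1)]] by simp
 fix y assume "y : {a : carrier CS. lam a : Delta0 V}"
 then obtain d where y: "y : carrier CS" and d: "d : FC" "lam y = WC d" unfolding Delta0_def by blast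
 have "lam x \<oplus>\<^bsub>AP V\<^esub> lam y = WC (%f. c f + d f)"
  unfolding AP_simps c(2) d(2) by (subst (3) res, rule restrict_ext) (simp only: W0_comb_linear(1)[OF c(1) d(1)])
 then show "x \<oplus>\<^bsub>BS\<^esub> y : {a : carrier CS. lam a : Delta0 V}"
  using s(3)[OF x y] l(2)[OF x y] W[OF fin_closed(1)[OF c(1) d(1)]] by simp
 have "lam x \<otimes>\<^bsub>AP V\<^esub> lam y = WC (c \<star>[0] d)"
  unfolding AP_simps c(2) d(2) by (subst (3) res, rule restrict_ext) (simp only: W0_comb_star_mult(1)[OF c(1) d(1)])
 then show "x \<otimes>\<^bsub>BS\<^esub> y : {a : carrier CS. lam a : Delta0 V}"
  using s(4)[OF x y] l(3)[OF x y] W[OF fin_closed(4)[OF c(1) d(1)]] by simp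
qed

lemma limit_smooth_image: "limit_iso V ` limit_smooth V = Delta0 V"
proof -
 have W: "W_section V ` carrier V \<subseteq> {a : carrier CS. lam a : Delta0 V}"
  unfolding Delta0_def using sec_CS[OF ws_fin] lam_sec[OF ws_fin] ws_fin
  by (fastforce simp: W_section_eq)
 have sub: "smooth_sections V \<subseteq> {a : carrier CS. lam a : Delta0 V}"
  unfolding smooth_sections_def by (rule Inter_lower) (simp only: mem_Collect_eq Delta0_sub_star W simp_thms)
 have sec: "sec c : smooth_sections V" if "c : FC" for c
  unfolding smooth_sections_def by (rule InterI) (use sec_in_subalgebra that in blast)
 have "limit_iso V ` limit_smooth V = lam ` smooth_sections V"
  unfolding limit_smooth_def image_image by (rule image_cong[OF refl]) (rule limit_iso_coset, use sub in blast)
 also have "... = Delta0 V"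
 proof
  show "lam ` smooth_sections V \<subseteq> Delta0 V" using sub by blast
  show "Delta0 V \<subseteq> lam ` smooth_sections V"
  proof
   fix b assume "b : Delta0 V"
   then obtain c where c: "c : FC" "b = WC c" unfolding Delta0_def by blast
   show "b : lam ` smooth_sections V" unfolding c(2) lam_sec[OF c(1), symmetric] by (rule imageI[OF sec[OF c(1)]])
  qed
 qed
 finally show ?thesis .
qed

text \<open>An equality and not just an isomorphism, since \<open>limit_iso V\<close> transports the
  quotient to functions on the dual, where its carrier and smooth part are the expected
  ones.\<close>

theorem classical_limit_obj_eq: "classical_limit_obj V = cs V"
 unfolding classical_limit_obj_def classical_system_def limit_iso_image limit_smooth_image AP_eq ..

end

section \<open>The Poisson bracket and the quantization maps\<close>

context psymp
begin

definition lin_on :: "('b, 'y) star_algebra_scheme => ('a dual_fun => 'b) => bool" where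
 "lin_on B p \<longleftrightarrow> (ALL a:Delta0 V. p a : carrier B & (ALL c. p (c \<odot>\<^bsub>AP V\<^esub> a) = c \<odot>\<^bsub>B\<^esub> p a) \<and>
  (ALL b:Delta0 V. p (a \<oplus>\<^bsub>AP V\<^esub> b) = p a \<oplus>\<^bsub>B\<^esub> p b))"

lemma Delta0I: "c : FC ==> WC c : Delta0 V"
 unfolding Delta0_def by (rule imageI)

lemma W0_Delta0: "f : carrier V ==> W0 V f : Delta0 V"
 using Delta0I[OF ws_fin[of f V]] unfolding W0_comb_symbol .

lemma W0_comb_smult: "c : FC ==> z \<odot>\<^bsub>AP V\<^esub> WC c = WC (%f. z * c f)"
proof (rule extensionalityI[of _ "dual V"])
 fix F assume c: "c : FC" and F: "F : dual V"
 show "(z \<odot>\<^bsub>AP V\<^esub> WC c) F = WC (%f. z * c f) F"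
  unfolding AP_simps restrict_apply'[OF F] W0_comb_linear(2)[OF c c F] ..
qed (simp_all add: W0_combination_def)

lemma lin_on_eq:
 assumes "star_alg B" and p: "lin_on B p" and q: "lin_on B q"
  and W: "!!f. f : carrier V ==> p (W0 V f) = q (W0 V f)" and a: "a : Delta0 V"
 shows "p a = q a"
proof -
 interpret B: star_alg B by fact
 have z: "\<zero>\<^bsub>AP V\<^esub> = 0 \<odot>\<^bsub>AP V\<^esub> \<zero>\<^bsub>AP V\<^esub>" "\<zero>\<^bsub>AP V\<^esub> : Delta0 V"
  using Delta0I[OF fin_closed(3)] unfolding W0_comb_zero by (simp_all cong: restrict_cong)
 have z0: "r \<zero>\<^bsub>AP V\<^esub> = \<zero>\<^bsub>B\<^esub>" if r: "lin_on B r" for r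
 proof -
  have "r \<zero>\<^bsub>AP V\<^esub> = 0 \<odot>\<^bsub>B\<^esub> r \<zero>\<^bsub>AP V\<^esub>" using r z(2) unfolding lin_on_def by (subst z(1)) blast
  also have "... = \<zero>\<^bsub>B\<^esub>" by (rule B.smult_0_left) (use r z(2) in \<open>simp only: lin_on_def\<close>)
  finally show ?thesis .
 qed
 obtain c where c: "c : FC" "a = WC c" using a unfolding Delta0_def by blast
 show ?thesis
  unfolding c(2)
  by (rule Delta0_linear_eq[OF B.abelian_group_axioms z0[OF p] z0[OF q] _ _ W c(1)])
   (use p q in \<open>unfold lin_on_def insert_iff empty_iff, blast\<close>)+
qed

text \<open>Linear extension in each argument separately. It gives uniqueness of the bracket and
  reduces the Poisson property of a map to symbols.\<close>

lemma bilinear_eq: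
 assumes B: "star_alg B"
  and lin: "!!r a. r : {p, q} ==> a : Delta0 V ==> lin_on B (r a) & lin_on B (%b. r b a)"
  and W: "!!f g. f : carrier V ==> g : carrier V ==> p (W0 V f) (W0 V g) = q (W0 V f) (W0 V g)"
  and ab: "a : Delta0 V" "b : Delta0 V"
 shows "p a b = q a b"
proof (rule lin_on_eq[OF B, of "%a. p a b" "%a. q a b"])
 show "lin_on B (%a. p a b)" "lin_on B (%a. q a b)" using lin[of p b] lin[of q b] ab(2) by simp_all
 fix f assume f: "f : carrier V"
 show "p (W0 V f) b = q (W0 V f) b"
  by (rule lin_on_eq[where p="p (W0 V f)" and q="q (W0 V f)", OF B _ _ W[OF f] ab(2)]) (use lin W0_Delta0[OF f] in simp_all)
qed (rule ab(1))

lemma bracket_lin: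
 assumes "is_poisson_bracket V B" "a : Delta0 V" shows "lin_on (AP V) (B a)" "lin_on (AP V) (%b. B b a)"
proof -
 note P = assms(1)[unfolded is_poisson_bracket_def]
 note B = P[THEN conjunct1] P[THEN conjunct2, THEN conjunct1] P[THEN conjunct2, THEN conjunct2, THEN conjunct1]
 have cl: "B a b : carrier (AP V)" if "a : Delta0 V" "b : Delta0 V" for a b
  unfolding AP_simps(1) by (rule subsetD[OF Delta0_apc PiE_mem[OF PiE_mem[OF B(1) that(1)] that(2)]])
 show "lin_on (AP V) (B a)" "lin_on (AP V) (%b. B b a)"
  unfolding lin_on_def
  by (intro ballI conjI allI cl assms(2); (assumption | (use B(2,3) assms(2) in blast)))+
qed

text \<open>Existence is the assumption on \<open>V\<close>; bilinearity and the values on symbols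
  determine the bracket, and extensionality in both arguments turns this into equality of
  functions.\<close>

lemma poisson_bracket: "is_poisson_bracket V (poisson_bracket V)"
proof -
 obtain B where B: "is_poisson_bracket V B" using has_bracket unfolding has_poisson_bracket_def by blast
 show ?thesis
  unfolding poisson_bracket_def
 proof (rule theI[of "is_poisson_bracket V", OF B])
  fix B' assume B': "is_poisson_bracket V B'"
  have E: "P : Delta0 V \<rightarrow>\<^sub>E (Delta0 V \<rightarrow>\<^sub>E Delta0 V)" if "is_poisson_bracket V P" for P
   using that unfolding is_poisson_bracket_def by (rule conjunct1)
  show "B' = B"
  proof (rule PiE_ext[OF E[OF B'] E[OF B]])
   fix a assume a: "a : Delta0 V"
   show "B' a = B a"
   proof (rule PiE_ext[OF PiE_mem[OF E[OF B'] a] PiE_mem[OF E[OF B] a]])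
    fix b assume b: "b : Delta0 V"
    show "B' a b = B a b"
    proof (rule bilinear_eq[OF AP_star_alg _ _ a b])
     show "lin_on (AP V) (r a) & lin_on (AP V) (%b. r b a)" if "r : {B', B}" "a : Delta0 V" for r a
      using that bracket_lin[OF B that(2)] bracket_lin[OF B' that(2)] by auto
     show "B' (W0 V f) (W0 V g) = B (W0 V f) (W0 V g)" if "f : carrier V" "g : carrier V" for f g
      using B B' that unfolding is_poisson_bracket_def by simp
    qed
   qed
  qed
 qed
qed

lemma bracket_W0: "f : carrier V ==> g : carrier V ==>
  poisson_bracket V (W0 V f) (W0 V g) = cr (sform V f g) \<odot>\<^bsub>AP V\<^esub> W0 V (f \<oplus> g)"
 using poisson_bracket unfolding is_poisson_bracket_def by blast

text \<open>By the Parseval bound \<open>l2_le_supn\<close> a combination that vanishes on the dual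
  has zero coefficients; the quantization maps depend on this uniqueness.\<close>

lemma W0_comb_inj: "inj_on (WC) (FC)"
proof (rule inj_onI)
 fix a b assume a: "a : FC" and b: "b : FC" and eq: "WC a = WC b"
 have "supn (diffc a b) <= 0" by (rule supn_least) (simp add: W0_diffc[OF a b] eq)
 then have "l2 (diffc a b) = 0" using l2_le_supn[OF diffc_closed[OF a b]] l2_nonneg[of "diffc a b"] by linarith
 then have "diffc a b = (%_. 0)" by (rule l2_eq_0D[OF finC(1)[OF diffc_closed[OF a b]]])
 then show "a = b" by (simp add: diffc_def fun_eq_iff)
qed

lemma quantization_map_eq: "c : FC ==> quantization_map V h (WC c) = Em h c"
 unfolding quantization_map_def by (simp add: Delta0I inv_into_f_f[OF W0_comb_inj])

lemma quantization_map_inv: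
 assumes c: "c : FC" shows "inv_into (Delta0 V) (quantization_map V h) (Em h c) = WC c"
 unfolding quantization_map_eq[OF c, of h, symmetric]
proof (rule inv_into_f_f[OF _ Delta0I[OF c]])
 show "inj_on (quantization_map V h) (Delta0 V)"
 proof (rule inj_onI)
  fix a b assume "a : Delta0 V" "b : Delta0 V" and e: "quantization_map V h a = quantization_map V h b"
  then obtain x y where x: "x : FC" "a = WC x" and y: "y : FC" "b = WC y"
   unfolding Delta0_def by blast
  show "a = b"
   using e inj_onD[OF Em_inj _ x(1) y(1), of h] unfolding x(2) y(2) quantization_map_eq[OF x(1)] quantization_map_eq[OF y(1)] by simp
 qed
qed

end

section \<open>Quantum and classical arrows with given parameters\<close>

lemma qs_simps [simp]:
 "qspace (qs V) = V" "0 < h ==> h <= 1 ==> qalg (qs V) h = weyl_algebra V h"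
 "0 < h ==> h <= 1 ==> qsmooth (qs V) h = Delta V h"
 "0 < h ==> h <= 1 ==> qmap (qs V) h = quantization_map V h"
 by (simp_all add: quantum_system_def)

lemma cs_simps [simp]:
 "cspace (cs V) = V" "calg (cs V) = AP V"
 "csmooth (cs V) = Delta0 V" "cbracket (cs V) = poisson_bracket V"
 by (simp_all add: classical_system_def)

text \<open>In terms of coefficients the quantization maps are identities, so conjugating with them
  carries the coefficients found at parameter 1 unchanged to \<open>h\<close>.\<close>

lemma rescaled_map_eq:
 assumes "psymp V" "psymp U" "0 < h" "h <= 1" "c : fin_coeffs V" "d : fin_coeffs U"
  and "\<alpha> (weyl_embed V 1 c) = weyl_embed U 1 d"
 shows "rescaled_map (qs V) (qs U) \<alpha> h (weyl_embed V h c) = weyl_embed U h d"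
 unfolding rescaled_map_def using assms
 by (simp add: psymp.quantization_map_inv psymp.quantization_map_eq)

locale psymp_hom = symp_hom V U \<omega> T + V: psymp V + U: psymp U for V U :: "'v symplectic_tvs" and \<omega> T
begin

abbreviation "qV \<equiv> qs V"
abbreviation "qU \<equiv> qs U"

definition bt :: "real => 'v quantum_map" where
 "bt h = (SOME \<beta>. \<beta> : star_hom (V.WA h) (U.WA h) \<and>
  (ALL a:fin_coeffs V. \<beta> (weyl_embed V h a) = weyl_embed U h (push a)))"

lemma bt: "bt h : star_hom (V.WA h) (U.WA h)"
  "a : fin_coeffs V ==> bt h (weyl_embed V h a) = weyl_embed U h (push a)"
proof -
 obtain \<beta> where b: "\<beta> : star_hom (V.WA h) (U.WA h)"
  "ALL a:fin_coeffs V. \<beta> (weyl_embed V h a) = weyl_embed U h (push a)" by (rule weyl_hom_exists[of h]) blast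
 have "bt h : star_hom (V.WA h) (U.WA h) & (ALL a:fin_coeffs V. bt h (weyl_embed V h a) = weyl_embed U h (push a))"
  unfolding bt_def by (rule someI[of _ \<beta>]) (use b in simp)
 then show "bt h : star_hom (V.WA h) (U.WA h)"
  "a : fin_coeffs V ==> bt h (weyl_embed V h a) = weyl_embed U h (push a)" by simp_all
qed

lemma bt_cont: "bt h : cont_linear (V.WA h) (U.WA h)"
 by (rule star_hom_cont_linear[OF V.WA_cstar U.WA_cstar_pre bt(1)])

lemma bt_unique_embed:
 assumes g: "\<gamma> : cont_linear (V.WA h) (U.WA h)"
  and e: "!!a. a : fin_coeffs V ==> \<gamma> (weyl_embed V h a) = weyl_embed U h (push a)"
 shows "\<gamma> = bt h"
proof (rule cont_linear_eq_on_dense[OF V.WA_cstar_pre U.WA_cstar_pre g bt_cont V.Delta_sub V.Em_dense])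
 show "\<gamma> d = bt h d" if "d : Delta V h" for d using that e bt(2) unfolding Delta_def by auto
qed

lemma bt_unique:
 assumes g: "\<gamma> : cont_linear (V.WA h) (U.WA h)"
  and W: "!!f. f : carrier V ==> \<gamma> (W V h f) = \<omega> f \<odot>\<^bsub>U.WA h\<^esub> W U h (T f)"
 shows "\<gamma> = bt h"
proof (rule bt_unique_embed[OF g])
 interpret A: star_alg "weyl_algebra V h" by (rule V.WA_star_alg)
 interpret B: star_alg "weyl_algebra U h" by (rule U.WA_star_alg)
 have lin: "\<gamma> (x \<oplus>\<^bsub>V.WA h\<^esub> y) = \<gamma> x \<oplus>\<^bsub>U.WA h\<^esub> \<gamma> y" "\<gamma> (c \<odot>\<^bsub>V.WA h\<^esub> x) = c \<odot>\<^bsub>U.WA h\<^esub> \<gamma> x"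
   "\<gamma> x : carrier (U.WA h)"
  if "x : carrier (V.WA h)" "y : carrier (V.WA h)" for x y c
  using g that unfolding cont_linear_def by (auto dest: PiE_mem)
 fix a assume "a : fin_coeffs V"
 then show "\<gamma> (weyl_embed V h a) = weyl_embed U h (push a)"
 proof (induction rule: fin_coeffs_induct)
  case zero
  have z: "\<zero>\<^bsub>V.WA h\<^esub> = 0 \<odot>\<^bsub>V.WA h\<^esub> \<zero>\<^bsub>V.WA h\<^esub>" by simp
  show ?case
   unfolding push_zero V.Em_simps(7)[OF V.fin_closed(3) V.fin_closed(3)] U.Em_simps(7)[OF U.fin_closed(3) U.fin_closed(3)]
   by (subst z, subst lin(2)[OF A.zero_closed A.zero_closed], rule B.smult_0_left, rule lin(3)[OF A.zero_closed A.zero_closed])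
 next
  case (add c f r)
  note s = ws_fin[OF add(1)] and s' = ws_fin[OF T(1)[OF add(1)]]
  note cs = V.fin_closed(2)[OF s, of c]
  have "\<gamma> (weyl_embed V h (%g. c * ws f g + r g)) = c \<odot>\<^bsub>U.WA h\<^esub> (\<omega> f \<odot>\<^bsub>U.WA h\<^esub> W U h (T f)) \<oplus>\<^bsub>U.WA h\<^esub> weyl_embed U h (push r)"
   unfolding V.Em_simps(2)[OF cs add(3)] lin(1)[OF V.Em_closed[OF cs] V.Em_closed[OF add(3)]] add(5)
   unfolding V.Em_simps(4)[OF s s] lin(2)[OF V.Em_closed[OF s] V.Em_closed[OF s]] W[OF add(1), unfolded V.W_eq] ..
  also have "... = weyl_embed U h (push (%g. c * ws f g + r g))"
   unfolding push_linear(1)[OF cs add(3)] push_linear(2)[OF s s] push_symbol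
    U.Em_simps(2)[OF U.fin_closed(2)[OF U.fin_closed(2)[OF s']] push_closed[OF add(3)]]
    U.Em_simps(4)[OF U.fin_closed(2)[OF s'] U.fin_closed(2)[OF s']] U.Em_simps(4)[OF s' s'] U.W_eq ..
  finally show ?case .
 qed
qed

lemma bt_W: "f : carrier V ==> bt h (W V h f) = \<omega> f \<odot>\<^bsub>U.WA h\<^esub> W U h (T f)"
 unfolding V.W_eq U.W_eq bt(2)[OF ws_fin] push_symbol
 by (rule U.Em_simps(4)) (rule ws_fin, rule T(1), assumption)+

lemma bt_contractive: "x : carrier (V.WA h) ==> U.nm h (bt h x) <= V.nm h x"
 by (rule star_hom_contractive[OF V.WA_cstar U.WA_cstar_pre bt(1)])

lemma bt_extension:
 assumes h: "0 < h" "h <= 1" shows "rescaled_extension qV qU (bt 1) h (bt h)"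
 unfolding rescaled_extension_def qs_simps(2-4)[OF h]
proof (intro conjI IntI ballI bt(1) bt_cont)
 fix a assume "a : Delta V h"
 then obtain c where c: "c : fin_coeffs V" "a = weyl_embed V h c" unfolding Delta_def by blast
 show "bt h a = rescaled_map qV qU (bt 1) h a"
  unfolding c(2) bt(2)[OF c(1)]
  by (rule rescaled_map_eq[where \<alpha>="bt 1", OF V.psymp_axioms U.psymp_axioms h c(1) push_closed[OF c(1)] bt(2)[OF c(1)], symmetric])
qed

lemma rescaled_arrow_eq:
 assumes h: "0 < h" "h <= 1" shows "rescaled_arrow qV qU (bt 1) h = bt h"
 unfolding rescaled_arrow_def
proof (rule the_equality[of "rescaled_extension qV qU (bt 1) h", OF bt_extension[OF h]])
 fix \<beta> assume b: "rescaled_extension qV qU (bt 1) h \<beta>"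
 show "\<beta> = bt h"
 proof (rule bt_unique_embed)
  show "\<beta> : cont_linear (V.WA h) (U.WA h)" using b h by (simp add: rescaled_extension_def)
  fix a assume a: "a : fin_coeffs V"
  have "weyl_embed V h a : Delta V h" unfolding Delta_def by (rule imageI[OF a])
  then have "\<beta> (weyl_embed V h a) = rescaled_map qV qU (bt 1) h (weyl_embed V h a)" using b h by (simp add: rescaled_extension_def)
  also have "... = weyl_embed U h (push a)"
   by (rule rescaled_map_eq[where \<alpha>="bt 1", OF V.psymp_axioms U.psymp_axioms h a push_closed[OF a] bt(2)[OF a]])
  finally show "\<beta> (weyl_embed V h a) = weyl_embed U h (push a)" .
 qed
qed

definition lf :: "'v weyl_section => 'v weyl_section" where "lf a = (\<lambda>h\<in>{0<..1}. bt h (a h))"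

lemma lifted_arrow_eq: "a : carrier V.CS ==> lifted_arrow qV qU (bt 1) a = lf a"
 unfolding lifted_arrow_def lf_def qs_simps(1) by (simp add: rescaled_arrow_eq cong: restrict_cong)

lemma lf_simps:
 assumes a: "a : carrier V.BS" and b: "b : carrier V.BS"
 shows "lf (a \<oplus>\<^bsub>V.BS\<^esub> b) = lf a \<oplus>\<^bsub>U.BS\<^esub> lf b" "lf (a \<otimes>\<^bsub>V.BS\<^esub> b) = lf a \<otimes>\<^bsub>U.BS\<^esub> lf b"
  "lf (c \<odot>\<^bsub>V.BS\<^esub> a) = c \<odot>\<^bsub>U.BS\<^esub> lf a" "lf (star V.BS a) = star U.BS (lf a)"
  "lf (\<lambda>h\<in>{0<..1}. u h \<odot>\<^bsub>V.WA h\<^esub> a h) = (\<lambda>h\<in>{0<..1}. u h \<odot>\<^bsub>U.WA h\<^esub> lf a h)"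
 unfolding lf_def V.BS_simps U.BS_simps
 by (rule restrict_ext; simp add: star_homD[OF bt(1)] V.BSD(1)[OF a] V.BSD(1)[OF b])+

lemma lf_BS: "a : carrier V.BS ==> lf a : carrier U.BS"
proof (rule U.BSI[of _ "cnorm V.BS a"])
 fix h :: real assume a: "a : carrier V.BS" and h: "0 < h" "h <= 1"
 show "lf a h : carrier (U.WA h)" using h star_homD(1)[OF bt(1) V.BSD(1)[OF a h]] by (simp add: lf_def)
 show "U.nm h (lf a h) <= cnorm V.BS a"
  using h order_trans[OF bt_contractive[OF V.BSD(1)[OF a h]] V.BS_norm_upper[OF a h]] by (simp add: lf_def)
qed (simp add: lf_def)

lemma lf_sec: "c : fin_coeffs V ==> lf (V.sec c) = U.sec (push c)"
 unfolding lf_def V.sec_def U.sec_def by (rule restrict_ext) (simp add: bt(2))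

text \<open>Minimality of the continuous sections: those over \<open>V\<close> with continuous image
  form a \<open>section_family\<close>. Norm closedness uses that every \<open>bt h\<close> is
  contractive, hence \<open>lf\<close> is so for the supremum over \<open>h\<close>.\<close>

lemma lf_CS: "a : carrier V.CS ==> lf a : carrier U.CS"
proof -
 let ?S = "{a : carrier V.CS. lf a : carrier U.CS}"
 note v = V.star_subalgebraD[OF V.CS_props(1)] and u = U.star_subalgebraD[OF U.CS_props(1)]
 interpret VB: star_alg V.BS by (rule V.BS_star_alg)
 have "V.section_family ?S"
  unfolding V.section_family_def
 proof (intro conjI V.star_subalgebraI)
  show "?S \<subseteq> carrier V.BS" using V.CS_BS by blast
  have z: "\<zero>\<^bsub>V.BS\<^esub> = V.sec (%_. 0)"
   unfolding V.sec_def V.BS_simps by (rule restrict_ext) (rule V.Em_simps(7)[OF V.fin_closed(3) V.fin_closed(3), symmetric])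
  show "\<zero>\<^bsub>V.BS\<^esub> : ?S"
   unfolding z using V.sec_CS[OF V.fin_closed(3)] lf_sec[OF V.fin_closed(3)] U.sec_CS[OF push_closed[OF V.fin_closed(3)]] by simp
  show "W_section V ` carrier V \<subseteq> ?S"
   unfolding V.W_section_eq using V.sec_CS lf_sec U.sec_CS push_closed by (auto)
  fix x assume "x : ?S"
  then have x: "x : carrier V.CS" "lf x : carrier U.CS" by simp_all
  note xB = V.CS_BS[OF x(1)]
  show "z \<odot>\<^bsub>V.BS\<^esub> x : ?S" for z
   using v(5)[OF x(1)] u(5)[OF x(2)] unfolding mem_Collect_eq lf_simps(3)[OF xB xB] by simp
  show "star V.BS x : ?S"
   using v(6)[OF x(1)] u(6)[OF x(2)] unfolding mem_Collect_eq lf_simps(4)[OF xB xB] by simp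
  fix y assume "y : ?S"
  then have y: "y : carrier V.CS" "lf y : carrier U.CS" by simp_all
  note yB = V.CS_BS[OF y(1)]
  show "x \<oplus>\<^bsub>V.BS\<^esub> y : ?S"
   using v(3)[OF x(1) y(1)] u(3)[OF x(2) y(2)] unfolding mem_Collect_eq lf_simps(1)[OF xB yB] by simp
  show "x \<otimes>\<^bsub>V.BS\<^esub> y : ?S"
   using v(4)[OF x(1) y(1)] u(4)[OF x(2) y(2)] unfolding mem_Collect_eq lf_simps(2)[OF xB yB] by simp
 next
  show "closed_under_uc_functions V ?S"
   unfolding closed_under_uc_functions_def
  proof (intro allI impI ballI)
   fix k :: "real => complex" and a
   assume k: "uniformly_continuous_on {0<..1} k & bounded (k ` {0<..1})" and "a : ?S"
   then have a: "a : carrier V.CS" "lf a : carrier U.CS" by simp_all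
   show "(\<lambda>h\<in>{0<..1}. k h \<odot>\<^bsub>V.WA h\<^esub> a h) : ?S"
    unfolding mem_Collect_eq lf_simps(5)[OF V.CS_BS[OF a(1)] V.CS_BS[OF a(1)]]
    using V.CS_props(3) U.CS_props(3) a k unfolding closed_under_uc_functions_def by simp
  qed
  show "norm_closed V.BS ?S"
   unfolding norm_closed_def
  proof (intro allI impI, elim conjE)
   fix s a assume s: "ALL n. s n : ?S" and a: "a : carrier V.BS"
    and lim: "(%n. cnorm V.BS (s n \<ominus>\<^bsub>V.BS\<^esub> a)) \<longlonglongrightarrow> 0"
   have s': "s n : carrier V.CS" "lf (s n) : carrier U.CS" for n using s by simp_all
   note sB = V.CS_BS[OF s'(1)]
   have aC: "a : carrier V.CS" using V.CS_props(2) s' a lim unfolding norm_closed_def by blast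
   interpret UB: star_alg U.BS by (rule U.BS_star_alg)
   have d: "lf (s n) \<ominus>\<^bsub>U.BS\<^esub> lf a = lf (s n \<ominus>\<^bsub>V.BS\<^esub> a)" for n
    unfolding UB.a_minus_smult[OF lf_BS[OF sB] lf_BS[OF a]] VB.a_minus_smult[OF sB a]
     lf_simps(1)[OF sB VB.smult_closed[OF a]] lf_simps(3)[OF a a] ..
   have le: "cnorm U.BS (lf x) <= cnorm V.BS x" if x: "x : carrier V.BS" for x
   proof (rule U.BS_norm_le)
    fix h :: real assume h: "0 < h" "h <= 1"
    show "U.nm h (lf x h) <= cnorm V.BS x"
     using h order_trans[OF bt_contractive[OF V.BSD(1)[OF x h]] V.BS_norm_upper[OF x h]] by (simp add: lf_def)
   qed
   have "(%n. cnorm U.BS (lf (s n) \<ominus>\<^bsub>U.BS\<^esub> lf a)) \<longlonglongrightarrow> 0"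
   proof (rule tendsto_sandwich[OF _ _ tendsto_const lim])
    show "\<forall>\<^sub>F n in sequentially. 0 <= cnorm U.BS (lf (s n) \<ominus>\<^bsub>U.BS\<^esub> lf a)"
     by (rule always_eventually) (intro allI U.BS_norm_nonneg UB.minus_closed lf_BS sB a)
    show "\<forall>\<^sub>F n in sequentially. cnorm U.BS (lf (s n) \<ominus>\<^bsub>U.BS\<^esub> lf a) <= cnorm V.BS (s n \<ominus>\<^bsub>V.BS\<^esub> a)"
     unfolding d by (rule always_eventually) (intro allI le VB.minus_closed sB a)
   qed
   then have "(ALL n. lf (s n) : carrier U.CS) & lf a : carrier U.BS & (%n. cnorm U.BS (lf (s n) \<ominus>\<^bsub>U.BS\<^esub> lf a)) \<longlonglongrightarrow> 0"
    by (intro conjI allI s'(2) lf_BS[OF a])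
   then have "lf a : carrier U.CS" by (rule U.CS_props(2)[unfolded norm_closed_def, rule_format])
   then show "a : ?S" using aC by simp
  qed
 qed
 then have "carrier V.CS \<subseteq> ?S" unfolding V.CS_carrier by (intro Inter_lower) simp
 then show "a : carrier V.CS ==> lf a : carrier U.CS" by blast
qed

lemma lf_hom: "restrict lf (carrier V.CS) : star_hom V.CS U.CS"
proof (rule star_homI)
 interpret C: star_alg V.CS by (rule V.CS_star_alg)
 have "U.sec (push (ws \<zero>\<^bsub>V\<^esub>)) = U.sec (ws \<zero>\<^bsub>U\<^esub>)" unfolding push_symbol by (simp add: T(4))
 then have "lf \<one>\<^bsub>V.BS\<^esub> = \<one>\<^bsub>U.BS\<^esub>" unfolding V.sec_one[symmetric] U.sec_one[symmetric] lf_sec[OF ws_fin[OF V.V.zero_closed]] .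
 then show "restrict lf (carrier V.CS) \<one>\<^bsub>V.CS\<^esub> = \<one>\<^bsub>U.CS\<^esub>" using C.one_closed by simp
 fix a assume a: "a : carrier V.CS"
 note aB = V.CS_BS[OF a]
 show "restrict lf (carrier V.CS) a : carrier U.CS" using lf_CS[OF a] a by simp
 show "restrict lf (carrier V.CS) (c \<odot>\<^bsub>V.CS\<^esub> a) = c \<odot>\<^bsub>U.CS\<^esub> restrict lf (carrier V.CS) a" for c
  using C.smult_closed[OF a] a lf_simps(3)[OF aB aB] by simp
 show "restrict lf (carrier V.CS) (star V.CS a) = star U.CS (restrict lf (carrier V.CS) a)"
  using C.star_closed[OF a] a lf_simps(4)[OF aB aB] by simp
 fix b assume b: "b : carrier V.CS"
 note bB = V.CS_BS[OF b]
 show "restrict lf (carrier V.CS) (a \<oplus>\<^bsub>V.CS\<^esub> b) = restrict lf (carrier V.CS) a \<oplus>\<^bsub>U.CS\<^esub> restrict lf (carrier V.CS) b"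
  using C.a_closed[OF a b] a b lf_simps(1)[OF aB bB] by simp
 show "restrict lf (carrier V.CS) (a \<otimes>\<^bsub>V.CS\<^esub> b) = restrict lf (carrier V.CS) a \<otimes>\<^bsub>U.CS\<^esub> restrict lf (carrier V.CS) b"
  using C.m_closed[OF a b] a b lf_simps(2)[OF aB bB] by simp
qed simp

text \<open>Contractivity of each \<open>bt h\<close> carries sections vanishing at 0 to sections
  vanishing at 0, so \<open>lf\<close> descends to the quotients.\<close>

lemma lam_lf:
 assumes a: "a : carrier V.CS" and b: "b : carrier V.CS" and eq: "V.lam a = V.lam b"
 shows "U.lam (lf a) = U.lam (lf b)"
proof -
 interpret LV: star_quotient V.CS "AP V" V.lam by (rule V.quotient)
 interpret LU: star_quotient U.CS "AP U" U.lam by (rule U.quotient)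
 have ab: "a \<ominus>\<^bsub>V.CS\<^esub> b : carrier V.CS" by (rule LV.A.minus_closed[OF a b])
 have "V.lam (a \<ominus>\<^bsub>V.CS\<^esub> b) = \<zero>\<^bsub>AP V\<^esub>"
  unfolding LV.l_minus[OF a b] eq by (rule LV.B.r_right_minus_eq[THEN iffD2, OF LV.lD(1)[OF b] LV.lD(1)[OF b] refl])
 then have "a \<ominus>\<^bsub>V.CS\<^esub> b : K0 V" unfolding V.K0_eq using ab by simp
 then have lim: "((%h. V.nm h ((a \<ominus>\<^bsub>V.CS\<^esub> b) h)) \<longlongrightarrow> 0) (at_right 0)" by (simp add: K0_def)
 have "((%h. U.nm h (lf (a \<ominus>\<^bsub>V.CS\<^esub> b) h)) \<longlongrightarrow> 0) (at_right 0)"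
 proof (rule tendsto_sandwich[OF _ _ tendsto_const lim])
  show "\<forall>\<^sub>F h in at_right 0. 0 <= U.nm h (lf (a \<ominus>\<^bsub>V.CS\<^esub> b) h)" using V.ev_unit
  proof eventually_elim
   case (elim h)
   then show ?case using cstar_pre.p_nonneg[OF U.WA_cstar_pre U.BSD(1)[OF U.CS_BS[OF lf_CS[OF ab]]], of h] by simp
  qed
  show "\<forall>\<^sub>F h in at_right 0. U.nm h (lf (a \<ominus>\<^bsub>V.CS\<^esub> b) h) <= V.nm h ((a \<ominus>\<^bsub>V.CS\<^esub> b) h)" using V.ev_unit
  proof eventually_elim
   case (elim h)
   then have h: "0 < h" "h <= 1" by auto
   show ?case using h bt_contractive[OF V.BSD(1)[OF V.CS_BS[OF ab] h]] by (simp add: lf_def)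
  qed
 qed
 then have "lf (a \<ominus>\<^bsub>V.CS\<^esub> b) : K0 U" using lf_CS[OF ab] by (simp add: K0_def)
 then have z: "U.lam (lf (a \<ominus>\<^bsub>V.CS\<^esub> b)) = \<zero>\<^bsub>AP U\<^esub>" unfolding U.K0_eq by simp
 note r = star_homD[OF lf_hom]
 have "lf (a \<ominus>\<^bsub>V.CS\<^esub> b) = lf a \<ominus>\<^bsub>U.CS\<^esub> lf b"
  using r(2)[OF a LV.A.smult_closed[OF b, of "-1"]] r(5)[OF b, of "-1"] a b LV.A.smult_closed[OF b, of "-1"] LV.A.a_closed[OF a LV.A.smult_closed[OF b, of "-1"]]
  unfolding LV.A.a_minus_smult[OF a b] LU.A.a_minus_smult[OF lf_CS[OF a] lf_CS[OF b]] by (simp only: restrict_apply')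
 then have "U.lam (lf a) \<ominus>\<^bsub>AP U\<^esub> U.lam (lf b) = \<zero>\<^bsub>AP U\<^esub>"
  using z unfolding LU.l_minus[OF lf_CS[OF a] lf_CS[OF b], symmetric] by simp
 then show ?thesis by (rule LU.B.r_right_minus_eq[THEN iffD1, OF LU.lD(1)[OF lf_CS[OF a]] LU.lD(1)[OF lf_CS[OF b]]])
qed

abbreviation ca :: "'v classical_map" where "ca \<equiv> classical_limit_arrow qV qU (bt 1)"

text \<open>The class chosen by \<open>inv_into\<close> is the fibre of \<open>V.lam\<close> through
  \<open>a\<close>. The images of its members lie in one coset by \<open>lam_lf\<close>, so the
  union in \<open>quotient_arrow\<close> collapses to the coset of \<open>lf a\<close>.\<close>

lemma ca_lam:
 assumes a: "a : carrier V.CS" shows "ca (V.lam a) = U.lam (lf a)"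
proof -
 interpret LV: star_quotient V.CS "AP V" V.lam by (rule V.quotient)
 let ?P = "inv_into (carrier (limit_algebra V)) (limit_iso V) (V.lam a)"
 have m: "V.lam a : limit_iso V ` carrier (limit_algebra V)" unfolding V.limit_iso_image by (rule V.lam(1)[OF a])
 have "?P : carrier (limit_algebra V)" by (rule inv_into_into[OF m])
 then obtain b where b: "b : carrier V.CS" "?P = K0 V +>\<^bsub>V.CS\<^esub> b" unfolding V.limit_carrier by blast
 have "V.lam b = V.lam a" using f_inv_into_f[OF m] unfolding b(2) V.limit_iso_coset[OF b(1)] .
 then have P: "?P = {x : carrier V.CS. V.lam x = V.lam a}" unfolding b(2) V.K0_Ker LV.coset[OF b(1)] by simp
 have "K0 U +>\<^bsub>U.CS\<^esub> lifted_arrow qV qU (bt 1) x = K0 U +>\<^bsub>U.CS\<^esub> lf a" if "x : ?P" for x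
 proof -
  have x: "x : carrier V.CS" "V.lam x = V.lam a" using that unfolding P by simp_all
  show ?thesis
   unfolding lifted_arrow_eq[OF x(1)] U.K0_Ker star_quotient.coset_eq_iff[OF U.quotient lf_CS[OF x(1)] lf_CS[OF a]]
   by (rule lam_lf[OF x(1) a x(2)])
 qed
 moreover have "a : ?P" unfolding P using a by simp
 ultimately have "quotient_arrow qV qU (bt 1) ?P = K0 U +>\<^bsub>U.CS\<^esub> lf a"
  unfolding quotient_arrow_def qs_simps(1) by blast
 then show ?thesis
  unfolding classical_limit_arrow_def qs_simps(1) restrict_apply'[OF m] by (simp only: U.limit_iso_coset[OF lf_CS[OF a]])
qed

lemma ca_hom: "ca : star_hom (AP V) (AP U)"
proof -
 interpret C: star_alg V.CS by (rule V.CS_star_alg)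
 note l = star_homD[OF V.lam_hom] and u = star_homD[OF U.lam_hom] and r = star_homD[OF lf_hom]
 have pre: "EX a:carrier V.CS. b = V.lam a" if "b : carrier (AP V)" for b
  using that V.lam_onto unfolding V.AP_simps(1) by blast
 have rl: "restrict lf (carrier V.CS) a = lf a" if "a : carrier V.CS" for a using that by (rule restrict_apply')
 show ?thesis
 proof (rule star_homI)
  fix x assume "x : carrier (AP V)"
  then obtain a where a: "a : carrier V.CS" "x = V.lam a" using pre by blast
  show "ca x : carrier (AP U)" unfolding a(2) ca_lam[OF a(1)] by (rule u(1)[OF lf_CS[OF a(1)]])
  show "ca (c \<odot>\<^bsub>AP V\<^esub> x) = c \<odot>\<^bsub>AP U\<^esub> ca x" for c
   unfolding a(2) ca_lam[OF a(1)] l(5)[OF a(1), symmetric] ca_lam[OF C.smult_closed[OF a(1)]] u(5)[OF lf_CS[OF a(1)], symmetric]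
   using r(5)[OF a(1), of c] unfolding rl[OF a(1)] rl[OF C.smult_closed[OF a(1)]] by simp
  show "ca (star (AP V) x) = star (AP U) (ca x)"
   unfolding a(2) ca_lam[OF a(1)] l(6)[OF a(1), symmetric] ca_lam[OF C.star_closed[OF a(1)]] u(6)[OF lf_CS[OF a(1)], symmetric]
   using r(6)[OF a(1)] unfolding rl[OF a(1)] rl[OF C.star_closed[OF a(1)]] by simp
  fix y assume "y : carrier (AP V)"
  then obtain b where b: "b : carrier V.CS" "y = V.lam b" using pre by blast
  show "ca (x \<oplus>\<^bsub>AP V\<^esub> y) = ca x \<oplus>\<^bsub>AP U\<^esub> ca y"
   unfolding a(2) b(2) ca_lam[OF a(1)] ca_lam[OF b(1)] l(2)[OF a(1) b(1), symmetric] ca_lam[OF C.a_closed[OF a(1) b(1)]]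
    u(2)[OF lf_CS[OF a(1)] lf_CS[OF b(1)], symmetric]
   using r(2)[OF a(1) b(1)] unfolding rl[OF a(1)] rl[OF b(1)] rl[OF C.a_closed[OF a(1) b(1)]] by simp
  show "ca (x \<otimes>\<^bsub>AP V\<^esub> y) = ca x \<otimes>\<^bsub>AP U\<^esub> ca y"
   unfolding a(2) b(2) ca_lam[OF a(1)] ca_lam[OF b(1)] l(3)[OF a(1) b(1), symmetric] ca_lam[OF C.m_closed[OF a(1) b(1)]]
    u(3)[OF lf_CS[OF a(1)] lf_CS[OF b(1)], symmetric]
   using r(3)[OF a(1) b(1)] unfolding rl[OF a(1)] rl[OF b(1)] rl[OF C.m_closed[OF a(1) b(1)]] by simp
 next
  show "ca \<one>\<^bsub>AP V\<^esub> = \<one>\<^bsub>AP U\<^esub>"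
   unfolding l(4)[symmetric] ca_lam[OF C.one_closed] u(4)[symmetric] using r(4) unfolding rl[OF C.one_closed] by simp
  show "ca : extensional (carrier (AP V))"
   unfolding classical_limit_arrow_def qs_simps(1) V.limit_iso_image V.AP_simps(1) by (rule restrict_extensional)
 qed
qed

lemma ca_comb: "c : fin_coeffs V ==> ca (W0_combination V c) = W0_combination U (push c)"
 using ca_lam[OF V.sec_CS, of c] unfolding lf_sec[of c] by (simp only: V.lam_sec lf_sec U.lam_sec push_closed)

lemma ca_W0: "f : carrier V ==> ca (W0 V f) = \<omega> f \<odot>\<^bsub>AP U\<^esub> W0 U (T f)"
 unfolding V.W0_comb_symbol[symmetric] ca_comb[OF ws_fin] push_symbol U.W0_comb_symbol[symmetric]
 by (rule U.W0_comb_smult[symmetric]) (rule ws_fin, rule T(1))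

text \<open>Density of \<open>Delta0 V\<close> allows \<open>ca\<close> to be recognised by its
  values on symbols, without reference to sections. Classification and composition of classical
  arrows rely on this.\<close>

lemma ca_unique:
 assumes g: "\<alpha> : star_hom (AP V) (AP U)" and W: "!!f. f : carrier V ==> \<alpha> (W0 V f) = \<omega> f \<odot>\<^bsub>AP U\<^esub> W0 U (T f)"
 shows "\<alpha> = ca"
proof (rule star_hom_eq_on_dense[OF V.AP_cstar U.AP_cstar_pre g ca_hom])
 show "Delta0 V \<subseteq> carrier (AP V)" using V.Delta0_apc by simp
 show "EX d:Delta0 V. cnorm (AP V) (b \<ominus>\<^bsub>AP V\<^esub> d) < e" if "b : carrier (AP V)" "e > 0" for b e
  by (rule V.AP_norm_dense) (use that in simp_all)
 have lin: "V.lin_on (AP U) r" if "r : star_hom (AP V) (AP U)" for r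
  unfolding V.lin_on_def using star_homD(1,2,5)[OF that] V.Delta0_apc unfolding V.AP_simps(1) by (meson subsetD)
 show "\<alpha> d = ca d" if "d : Delta0 V" for d
  by (rule V.lin_on_eq[OF U.AP_star_alg lin[OF g] lin[OF ca_hom] _ that]) (simp only: W ca_W0)
qed

lemma ca_smooth: "ca ` Delta0 V \<subseteq> Delta0 U"
 unfolding Delta0_def using ca_comb push_closed by auto

text \<open>By \<open>bilinear_eq\<close> symbols suffice, and there both sides agree since \<omega>
  is multiplicative and \<open>T\<close> is additive and preserves the form.\<close>

lemma ca_poisson:
 assumes ab: "a : Delta0 V" "b : Delta0 V"
 shows "ca (poisson_bracket V a b) = poisson_bracket U (ca a) (ca b)"
proof (rule V.bilinear_eq[OF U.AP_star_alg _ _ ab])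
 note c = star_homD[OF ca_hom]
 have D: "x : carrier (AP V)" if "x : Delta0 V" for x using that V.Delta0_apc by auto
 have S: "ca x : Delta0 U" if "x : Delta0 V" for x using that ca_smooth by blast
 have L: "V.lin_on (AP U) (%x. ca (p x))" if "V.lin_on (AP V) p" for p
  using that unfolding V.lin_on_def by (simp add: c del: V.AP_simps U.AP_simps)
 have R: "V.lin_on (AP U) (%x. p (ca x))" if "U.lin_on (AP U) p" for p
  using that unfolding V.lin_on_def U.lin_on_def by (simp add: c D S del: V.AP_simps U.AP_simps)
 show "V.lin_on (AP U) (r a) & V.lin_on (AP U) (%b. r b a)"
  if "r : {%a b. ca (poisson_bracket V a b), %a b. poisson_bracket U (ca a) (ca b)}" "a : Delta0 V" for r a
  using that L[OF V.bracket_lin(1)[OF V.poisson_bracket that(2)]] L[OF V.bracket_lin(2)[OF V.poisson_bracket that(2)]]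
   R[OF U.bracket_lin(1)[OF U.poisson_bracket S[OF that(2)]]] R[OF U.bracket_lin(2)[OF U.poisson_bracket S[OF that(2)]]] by auto
 fix f g assume f: "f : carrier V" and g: "g : carrier V"
 have fg: "f \<oplus>\<^bsub>V\<^esub> g : carrier V" by (rule V.V.a_closed[OF f g])
 interpret A: star_alg "AP U" by (rule U.AP_star_alg)
 note W = V.W0_Delta0[OF f] V.W0_Delta0[OF g]
 have TU: "W0 U (T x) : Delta0 U" if "x : carrier V" for x by (rule U.W0_Delta0[OF T(1)[OF that]])
 note BU = U.bracket_lin[OF U.poisson_bracket, unfolded U.lin_on_def]
 have sm: "poisson_bracket U (x \<odot>\<^bsub>AP U\<^esub> a) b = x \<odot>\<^bsub>AP U\<^esub> poisson_bracket U a b"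
   "poisson_bracket U a (x \<odot>\<^bsub>AP U\<^esub> b) = x \<odot>\<^bsub>AP U\<^esub> poisson_bracket U a b"
  if "a : Delta0 U" "b : Delta0 U" for a b x using U.poisson_bracket that unfolding is_poisson_bracket_def by meson+
 have S': "y \<odot>\<^bsub>AP U\<^esub> W0 U (T x) : Delta0 U" if "x : carrier V" for x y
  unfolding U.W0_comb_symbol[symmetric] U.W0_comb_smult[OF ws_fin[OF T(1)[OF that]]]
  by (rule U.Delta0I[OF U.fin_closed(2)[OF ws_fin[OF T(1)[OF that]]]])
 have WU: "W0 U (T f \<oplus>\<^bsub>U\<^esub> T g) : carrier (AP U)" using U.apc_W0[OF U.V.a_closed[OF T(1)[OF f] T(1)[OF g]]] by simp
 have "poisson_bracket U (ca (W0 V f)) (ca (W0 V g)) =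
   \<omega> f \<odot>\<^bsub>AP U\<^esub> (\<omega> g \<odot>\<^bsub>AP U\<^esub> (cr (sform U (T f) (T g)) \<odot>\<^bsub>AP U\<^esub> W0 U (T f \<oplus>\<^bsub>U\<^esub> T g)))"
  unfolding ca_W0[OF f] ca_W0[OF g] sm(1)[OF TU[OF f] S'[OF g]] sm(2)[OF TU[OF f] TU[OF g]] U.bracket_W0[OF T(1)[OF f] T(1)[OF g]] ..
 also have "... = cr (sform V f g) \<odot>\<^bsub>AP U\<^esub> (\<omega> (f \<oplus>\<^bsub>V\<^esub> g) \<odot>\<^bsub>AP U\<^esub> W0 U (T (f \<oplus>\<^bsub>V\<^esub> g)))"
  unfolding A.smult_smult[OF WU, symmetric] T(2)[OF f g] A.smult_smult[OF A.smult_closed[OF WU], symmetric] T(3)[OF f g] \<omega>(2)[OF f g]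
  by (simp only: mult_ac)
 also have "... = ca (poisson_bracket V (W0 V f) (W0 V g))"
  unfolding V.bracket_W0[OF f g] c(5)[OF D[OF V.W0_Delta0[OF fg]]] ca_W0[OF fg] ..
 finally show "ca (poisson_bracket V (W0 V f) (W0 V g)) = poisson_bracket U (ca (W0 V f)) (ca (W0 V g))" by simp
qed

end

section \<open>Classification of the arrows\<close>

lemma symbol_cancel:
 assumes "(%k. x * ws g k) = (%k. y * ws g' k)" "x ~= 0"
 shows "g = g'" "x = y"
 using fun_cong[OF assms(1), of g] assms(2) by (auto simp: weyl_symbol_def split: if_splits)

text \<open>For \<open>h = 1 / (\<bar>d\<bar> + 1)\<close> the phase angle is at most
  \<open>1/2\<close> in modulus, too small for a nonzero multiple of \<open>2 * pi\<close>. A single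
  fixed \<open>h\<close> would determine the numbers only modulo \<open>4 * pi / h\<close>.\<close>

lemma phase_determines:
 fixes s t :: real
 assumes "!!h. 0 < h ==> h <= 1 ==> exp (- (\<i> / 2) * cr (h * s)) = exp (- (\<i> / 2) * cr (h * t))"
 shows "s = t"
proof -
 define d where "d = s - t"
 define h where "h = 1 / (\<bar>d\<bar> + 1)"
 have h: "0 < h" "h <= 1" by (simp_all add: h_def)
 have "- (\<i> / 2) * cr (h * d) = - (\<i> / 2) * cr (h * s) - (- (\<i> / 2) * cr (h * t))"
  by (simp add: d_def algebra_simps)
 then have "exp (- (\<i> / 2) * cr (h * d)) = 1"
  by (simp only: exp_diff assms[OF h]) simp
 then obtain n :: int where n: "- (h * d) / 2 = of_int (2 * n) * pi" unfolding exp_eq_1 by auto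
 have "\<bar>h * d\<bar> <= 1" by (simp add: h_def abs_mult field_simps)
 then have "\<bar>of_int (2 * n) * pi\<bar> <= 1/2" unfolding n[symmetric] by simp
 moreover have "2 * pi <= \<bar>of_int (2 * n) * pi\<bar>" if "n ~= 0"
 proof -
  have "1 <= \<bar>real_of_int n\<bar>" using that by linarith
  then have "1 * (2 * pi) <= \<bar>real_of_int n\<bar> * (2 * pi)" by (rule mult_right_mono) simp
  then show ?thesis by (simp add: abs_mult)
 qed
 ultimately have "n = 0" using pi_gt3 by linarith
 then have "d = 0" using n h by simp
 then show ?thesis by (simp add: d_def)
qed

context psymp
begin

lemma smult_W0: "g : carrier V ==> z \<odot>\<^bsub>AP V\<^esub> W0 V g = WC (%k. z * ws g k)"
 unfolding W0_comb_symbol[symmetric] by (rule W0_comb_smult[OF ws_fin])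

lemma smult_W0_cancel:
 assumes g: "g : carrier V" "g' : carrier V" and e: "x \<odot>\<^bsub>AP V\<^esub> W0 V g = y \<odot>\<^bsub>AP V\<^esub> W0 V g'" "x ~= 0"
 shows "g = g'" "x = y"
 using symbol_cancel[OF inj_onD[OF W0_comb_inj e(1)[unfolded smult_W0[OF g(1)] smult_W0[OF g(2)]]
  fin_closed(2)[OF ws_fin[OF g(1)]] fin_closed(2)[OF ws_fin[OF g(2)]]] e(2)] by simp_all

lemma W0_mult:
 assumes "f : carrier V" "g : carrier V"
 shows "(x \<odot>\<^bsub>AP V\<^esub> W0 V f) \<otimes>\<^bsub>AP V\<^esub> (y \<odot>\<^bsub>AP V\<^esub> W0 V g) = (x * y) \<odot>\<^bsub>AP V\<^esub> W0 V (f \<oplus> g)"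
 unfolding AP_simps by (rule restrict_ext) (simp add: W0_eq dualD(1)[OF _ assms] cis_mult[symmetric])

lemma one_smult_W0: "f : carrier V ==> 1 \<odot>\<^bsub>AP V\<^esub> W0 V f = W0 V f"
 using apc_restrict[OF apc_W0] by simp

lemma W0_unitary: "star (AP V) (W0 V f) \<otimes>\<^bsub>AP V\<^esub> W0 V f = \<one>\<^bsub>AP V\<^esub>"
 unfolding AP_simps by (rule restrict_ext) (simp add: W0_eq cis_cnj cis_mult)

text \<open>The equation of functions is pulled back to coefficients by \<open>W0_comb_inj\<close>,
  where \<open>weyl_unitary_trivial\<close> applies at parameter 0.\<close>

lemma unitary_combination:
 assumes a: "a : FC" and u: "star (AP V) (WC a) \<otimes>\<^bsub>AP V\<^esub> WC a = \<one>\<^bsub>AP V\<^esub>"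
 shows "EX c g. cmod c = 1 & g : carrier V & a = (%k. c * ws g k)"
proof -
 let ?p = "adj 0 a \<star>[0] a"
 have p: "?p : FC" by (rule fin_closed(4)[OF fin_closed(5)[OF a] a])
 have "WC ?p = WC (ws \<zero>)"
 proof (rule extensionalityI[OF apcD(1)[OF apc_W0_comb[OF p]] apcD(1)[OF apc_W0_comb[OF ws_fin[OF V.zero_closed]]]])
  fix F assume F: "F : dual V"
  show "WC ?p F = WC (ws \<zero>) F"
   using fun_cong[OF u, of F] F
   unfolding W0_comb_star_mult(1)[OF fin_closed(5)[OF a] a F] W0_comb_star_mult(2)[OF a a F] W0_comb_symbol W0_eq[OF F] dualD(3)[OF F] by simp
 qed
 then have "?p = ws \<zero>" by (rule inj_onD[OF W0_comb_inj _ p ws_fin[OF V.zero_closed]])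
 then show ?thesis by (rule weyl_unitary_trivial[OF a]) blast
qed

lemma unitary_embed:
 assumes a: "a : FC" and u: "star (WA h) (Em h a) \<otimes>\<^bsub>WA h\<^esub> Em h a = \<one>\<^bsub>WA h\<^esub>"
 shows "EX c g. cmod c = 1 & g : carrier V & a = (%k. c * ws g k)"
proof -
 note s = fin_closed(5)[OF a, where h=h]
 have "Em h (adj h a \<star>[h] a) = Em h (ws \<zero>)"
  unfolding Em_simps(3)[OF s a] Em_simps(5)[OF a a] Em_simps(6)[OF a a] by (rule u)
 then have "adj h a \<star>[h] a = ws \<zero>"
  by (rule inj_onD[OF Em_inj _ fin_closed(4)[OF s a] ws_fin[OF V.zero_closed]])
 then show ?thesis by (rule weyl_unitary_trivial[OF a]) blast
qed

lemma W_mult: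
 assumes f: "f : carrier V" and g: "g : carrier V"
 shows "Em h (%k. x * ws f k) \<otimes>\<^bsub>WA h\<^esub> Em h (%k. y * ws g k) = Em h (%k. (x * y * ph h f g) * ws (f \<oplus> g) k)"
proof -
 note s = ws_fin[OF f] ws_fin[OF g]
 have "(%k. x * ws f k) \<star>[h] (%k. y * ws g k) = (%k. (x * y * ph h f g) * ws (f \<oplus> g) k)"
  unfolding weyl_smult(1)[OF s(1) fin_closed(2)[OF s(2)]] weyl_smult(2)[OF s] symbol_mult[OF f g] by (simp only: mult_ac)
 then show ?thesis unfolding Em_simps(3)[OF fin_closed(2)[OF s(1)] fin_closed(2)[OF s(2)], symmetric] by simp
qed

lemma Em_symbol_cancel:
 assumes g: "g : carrier V" "g' : carrier V" and e: "Em h (%k. x * ws g k) = Em h (%k. y * ws g' k)" "x ~= 0"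
 shows "g = g'" "x = y"
 using symbol_cancel[OF inj_onD[OF Em_inj e(1) fin_closed(2)[OF ws_fin[OF g(1)]] fin_closed(2)[OF ws_fin[OF g(2)]]] e(2)]
 by simp_all

end

definition BT :: "'v symplectic_tvs => 'v symplectic_tvs => ('v => complex) => ('v => 'v) => 'v quantum_map" where
 "BT V U \<omega> T = psymp_hom.bt V U \<omega> T 1"

definition CA :: "'v symplectic_tvs => 'v symplectic_tvs => ('v => complex) => ('v => 'v) => 'v classical_map" where
 "CA V U \<omega> T = classical_limit_arrow (qs V) (qs U) (BT V U \<omega> T)"

lemma psymp_homI:
 assumes "psymp V" "psymp U" and \<omega>: "!!f. f : carrier V ==> cmod (\<omega> f) = 1"
  "!!f g. f : carrier V ==> g : carrier V ==> \<omega> (f \<oplus>\<^bsub>V\<^esub> g) = \<omega> f * \<omega> g"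
  and T: "!!f. f : carrier V ==> T f : carrier U"
  "!!f g. f : carrier V ==> g : carrier V ==> T (f \<oplus>\<^bsub>V\<^esub> g) = T f \<oplus>\<^bsub>U\<^esub> T g"
  "!!f g. f : carrier V ==> g : carrier V ==> sform U (T f) (T g) = sform V f g"
 shows "psymp_hom V U \<omega> T"
proof -
 interpret V: psymp V by fact
 interpret U: psymp U by fact
 have z: "T \<zero>\<^bsub>V\<^esub> : carrier U" by (rule T(1)[OF V.V.zero_closed])
 have "T \<zero>\<^bsub>V\<^esub> \<oplus>\<^bsub>U\<^esub> T \<zero>\<^bsub>V\<^esub> = T \<zero>\<^bsub>V\<^esub>" using T(2)[OF V.V.zero_closed V.V.zero_closed] by simp
 then have "T \<zero>\<^bsub>V\<^esub> = \<zero>\<^bsub>U\<^esub>" using U.V.add.l_cancel_one[OF z z] by simp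
 then have "additive_symplectic V U T" unfolding additive_symplectic_def using T by (simp add: Pi_iff)
 moreover have "additive_character V \<omega>" unfolding additive_character_def using \<omega> by simp
 ultimately show ?thesis
  by (intro psymp_hom.intro symp_hom.intro symp_hom_axioms.intro assms(1,2) V.symp_axioms U.symp_axioms)
qed

text \<open>Comparing the images of \<open>W0 V f\<close>, \<open>W0 V g\<close> and their product
  gives additivity of \<open>T\<close> and the character law together, because a nonzero multiple of
  a symbol determines both the symbol and the factor. The bracket yields the form.\<close>

lemma class_arrow_form:
 assumes "psymp V" "psymp U" and hom: "\<alpha> : Hom LinClass (cs V) (cs U)"
 shows "EX \<omega> T. psymp_hom V U \<omega> T & \<alpha> = CA V U \<omega> T"
proof -
 interpret V: psymp V by fact
 interpret U: psymp U by fact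
 have al: "\<alpha> : star_hom (AP V) (AP U)" and sm: "\<alpha> ` Delta0 V \<subseteq> Delta0 U"
  and po: "ALL a:Delta0 V. ALL b:Delta0 V. \<alpha> (poisson_bracket V a b) = poisson_bracket U (\<alpha> a) (\<alpha> b)"
  using hom by (simp_all add: LinClass_def)
 note h = star_homD[OF al]
 have W: "W0 V f : carrier (AP V)" if "f : carrier V" for f using V.apc_W0[OF that] by simp
 have "EX c g. cmod c = 1 & g : carrier U & \<alpha> (W0 V f) = c \<odot>\<^bsub>AP U\<^esub> W0 U g" if f: "f : carrier V" for f
 proof -
  have "\<alpha> (W0 V f) : Delta0 U" using sm V.W0_Delta0[OF f] by blast
  then obtain a where a: "a : fin_coeffs U" "\<alpha> (W0 V f) = W0_combination U a" unfolding Delta0_def by blast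
  interpret A: star_alg "AP V" by (rule V.AP_star_alg)
  have "star (AP U) (W0_combination U a) \<otimes>\<^bsub>AP U\<^esub> W0_combination U a = \<one>\<^bsub>AP U\<^esub>"
   unfolding a(2)[symmetric] h(6)[OF W[OF f], symmetric] h(3)[OF A.star_closed[OF W[OF f]] W[OF f], symmetric] V.W0_unitary by (rule h(4))
  then obtain c g where "cmod c = 1" "g : carrier U" "a = (%k. c * ws g k)" using U.unitary_combination[OF a(1)] by blast
  then show ?thesis using a(2) U.smult_W0[of g c, symmetric] by (intro exI[of _ c] exI[of _ g] conjI) (simp_all only:)
 qed
 then obtain \<omega> T where cT: "ALL f:carrier V. cmod (\<omega> f) = 1 & T f : carrier U & \<alpha> (W0 V f) = \<omega> f \<odot>\<^bsub>AP U\<^esub> W0 U (T f)" by metis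
 then have c: "cmod (\<omega> f) = 1" and T: "T f : carrier U" and aW: "\<alpha> (W0 V f) = \<omega> f \<odot>\<^bsub>AP U\<^esub> W0 U (T f)"
  if "f : carrier V" for f using that by simp_all
 have nz: "\<omega> f ~= 0" if "f : carrier V" for f using c[OF that] by auto
 have add: "T (f \<oplus>\<^bsub>V\<^esub> g) = T f \<oplus>\<^bsub>U\<^esub> T g" "\<omega> (f \<oplus>\<^bsub>V\<^esub> g) = \<omega> f * \<omega> g"
  if f: "f : carrier V" and g: "g : carrier V" for f g
 proof -
  note fg = V.V.a_closed[OF f g]
  have "W0 V f \<otimes>\<^bsub>AP V\<^esub> W0 V g = W0 V (f \<oplus>\<^bsub>V\<^esub> g)"
   using V.W0_mult[OF f g, of 1 1] unfolding V.one_smult_W0[OF f] V.one_smult_W0[OF g] mult_1 V.one_smult_W0[OF fg] .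
  then have "\<omega> (f \<oplus>\<^bsub>V\<^esub> g) \<odot>\<^bsub>AP U\<^esub> W0 U (T (f \<oplus>\<^bsub>V\<^esub> g)) = (\<omega> f * \<omega> g) \<odot>\<^bsub>AP U\<^esub> W0 U (T f \<oplus>\<^bsub>U\<^esub> T g)"
   using h(3)[OF W[OF f] W[OF g]] unfolding aW[OF f] aW[OF g] U.W0_mult[OF T[OF f] T[OF g]] aW[OF fg, symmetric] by (simp only:)
  then show "T (f \<oplus>\<^bsub>V\<^esub> g) = T f \<oplus>\<^bsub>U\<^esub> T g" "\<omega> (f \<oplus>\<^bsub>V\<^esub> g) = \<omega> f * \<omega> g"
   using U.smult_W0_cancel[OF T[OF fg] U.V.a_closed[OF T[OF f] T[OF g]] _ nz[OF fg]] by blast+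
 qed
 have sy: "sform U (T f) (T g) = sform V f g" if f: "f : carrier V" and g: "g : carrier V" for f g
 proof -
  note fg = V.V.a_closed[OF f g]
  note Tf = T[OF f] and Tg = T[OF g]
  have sm: "poisson_bracket U (x \<odot>\<^bsub>AP U\<^esub> a) b = x \<odot>\<^bsub>AP U\<^esub> poisson_bracket U a b"
    "poisson_bracket U a (x \<odot>\<^bsub>AP U\<^esub> b) = x \<odot>\<^bsub>AP U\<^esub> poisson_bracket U a b"
   if "a : Delta0 U" "b : Delta0 U" for a b x
   using U.bracket_lin[OF U.poisson_bracket that(1)] U.bracket_lin[OF U.poisson_bracket that(2)] that unfolding U.lin_on_def by blast+
  have S': "\<omega> g \<odot>\<^bsub>AP U\<^esub> W0 U (T g) : Delta0 U"
   unfolding U.smult_W0[OF Tg] by (rule U.Delta0I[OF U.fin_closed(2)[OF ws_fin[OF Tg]]])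
  have "\<alpha> (poisson_bracket V (W0 V f) (W0 V g)) = poisson_bracket U (\<alpha> (W0 V f)) (\<alpha> (W0 V g))"
   using po V.W0_Delta0[OF f] V.W0_Delta0[OF g] by blast
  then have e: "cr (sform V f g) \<odot>\<^bsub>AP U\<^esub> (\<omega> (f \<oplus>\<^bsub>V\<^esub> g) \<odot>\<^bsub>AP U\<^esub> W0 U (T (f \<oplus>\<^bsub>V\<^esub> g))) =
    \<omega> f \<odot>\<^bsub>AP U\<^esub> (\<omega> g \<odot>\<^bsub>AP U\<^esub> (cr (sform U (T f) (T g)) \<odot>\<^bsub>AP U\<^esub> W0 U (T f \<oplus>\<^bsub>U\<^esub> T g)))"
   unfolding V.bracket_W0[OF f g] h(5)[OF W[OF fg]] aW[OF fg] aW[OF f] aW[OF g]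
    sm(1)[OF U.W0_Delta0[OF Tf] S'] sm(2)[OF U.W0_Delta0[OF Tf] U.W0_Delta0[OF Tg]] U.bracket_W0[OF Tf Tg] .
  \<comment> \<open>At the zero functional all symbols have the value 1, which turns the bracket
    identity into one of numbers.\<close>
  have "sform V f g * \<omega> (f \<oplus>\<^bsub>V\<^esub> g) = \<omega> f * (\<omega> g * sform U (T f) (T g))"
   using fun_cong[OF e, of "\<lambda>f\<in>carrier U. 0"] U.dual_zero T[OF fg] U.V.a_closed[OF Tf Tg] by (simp add: U.W0_eq)
  then have "cr (sform V f g) * (\<omega> f * \<omega> g) = cr (sform U (T f) (T g)) * (\<omega> f * \<omega> g)"
   unfolding add(2)[OF f g] by (simp only: mult_ac)
  then show ?thesis using nz[OF f] nz[OF g] by simp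
 qed
 have hom: "psymp_hom V U \<omega> T" by (rule psymp_homI[OF assms(1,2) c add(2) T add(1) sy])
 interpret H: psymp_hom V U \<omega> T by (rule hom)
 have "\<alpha> = CA V U \<omega> T" unfolding CA_def BT_def by (rule H.ca_unique[OF al aW])
 then show ?thesis using hom by blast
qed

text \<open>The extension at every parameter \<open>k\<close> is again multiplicative and has the
  same \<omega> and \<open>T\<close>, so \<open>key\<close> compares the phases for all
  \<open>k\<close>. At the single value 1 the character law and the form would stay
  entangled.\<close>

lemma quant_arrow_form:
 assumes "psymp V" "psymp U" and hom: "\<alpha> : Hom LinQuant (qs V) (qs U)"
 shows "EX \<omega> T. psymp_hom V U \<omega> T & \<alpha> = BT V U \<omega> T"
proof -
 interpret V: psymp V by fact
 interpret U: psymp U by fact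
 have al: "\<alpha> : star_hom (V.WA 1) (U.WA 1)" and sm: "\<alpha> ` Delta V 1 \<subseteq> Delta U 1"
  and sc: "ALL h:{0<..1}. EX \<beta>. rescaled_extension (qs V) (qs U) \<alpha> h \<beta>"
  using hom by (simp_all add: LinQuant_def smooth_map_def scaling_map_def)
 note h = star_homD[OF al]
 have "EX c g. cmod c = 1 & g : carrier U & \<alpha> (W V 1 f) = U.Em 1 (%k. c * ws g k)" if f: "f : carrier V" for f
 proof -
  note s = ws_fin[OF f]
  have "W V 1 f : Delta V 1" unfolding V.W_eq Delta_def by (rule imageI[OF s])
  then have "\<alpha> (W V 1 f) : Delta U 1" using sm by blast
  then obtain a where a: "a : fin_coeffs U" "\<alpha> (W V 1 f) = U.Em 1 a" unfolding Delta_def by blast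
  interpret A: star_alg "V.WA 1" by (rule V.WA_star_alg)
  note Wf = V.W_closed[OF f, of 1]
  have "star (V.WA 1) (W V 1 f) \<otimes>\<^bsub>V.WA 1\<^esub> W V 1 f = \<one>\<^bsub>V.WA 1\<^esub>"
   unfolding V.W_eq V.Em_simps(5)[OF s s, where k=1, symmetric] V.Em_simps(3)[OF V.fin_closed(5)[OF s] s, symmetric] V.symbol_unitary[OF f]
   by (rule V.Em_simps(6)[OF s s])
  then have "star (U.WA 1) (U.Em 1 a) \<otimes>\<^bsub>U.WA 1\<^esub> U.Em 1 a = \<one>\<^bsub>U.WA 1\<^esub>"
   unfolding a(2)[symmetric] h(6)[OF Wf, symmetric] h(3)[OF A.star_closed[OF Wf] Wf, symmetric] by (simp only: h(4))
  then show ?thesis using U.unitary_embed[OF a(1)] a(2) by blast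
 qed
 then obtain \<omega> T where "ALL f:carrier V. cmod (\<omega> f) = 1 & T f : carrier U & \<alpha> (W V 1 f) = U.Em 1 (%k. \<omega> f * ws (T f) k)" by metis
 then have c: "cmod (\<omega> f) = 1" and T: "T f : carrier U" and aW: "\<alpha> (W V 1 f) = U.Em 1 (%k. \<omega> f * ws (T f) k)"
  if "f : carrier V" for f using that by simp_all
 have nz: "\<omega> f ~= 0" if "f : carrier V" for f using c[OF that] by auto
 have key: "T f \<oplus>\<^bsub>U\<^esub> T g = T (f \<oplus>\<^bsub>V\<^esub> g) & \<omega> f * \<omega> g * U.ph k (T f) (T g) = V.ph k f g * \<omega> (f \<oplus>\<^bsub>V\<^esub> g)"
  if k: "0 < k" "k <= 1" and f: "f : carrier V" and g: "g : carrier V" for k f g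
 proof -
  note fg = V.V.a_closed[OF f g] and s = ws_fin[OF f] ws_fin[OF g]
  obtain \<beta> where \<beta>: "rescaled_extension (qs V) (qs U) \<alpha> k \<beta>" using sc k by force
  then have bh: "\<beta> : star_hom (V.WA k) (U.WA k)" using k by (simp add: rescaled_extension_def)
  have bW: "\<beta> (W V k x) = U.Em k (%k. \<omega> x * ws (T x) k)" if x: "x : carrier V" for x
  proof -
   have "V.Em k (ws x) : Delta V k" unfolding Delta_def by (rule imageI[OF ws_fin[OF x]])
   then have "\<beta> (V.Em k (ws x)) = rescaled_map (qs V) (qs U) \<alpha> k (V.Em k (ws x))"
    using \<beta> k by (simp add: rescaled_extension_def)
   also have "... = U.Em k (%k. \<omega> x * ws (T x) k)"
    by (rule rescaled_map_eq[where \<alpha>=\<alpha>, OF assms(1,2) k ws_fin[OF x] U.fin_closed(2)[OF ws_fin[OF T[OF x]]] aW[OF x, unfolded V.W_eq]])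
   finally show ?thesis unfolding V.W_eq .
  qed
  have "W V k f \<otimes>\<^bsub>V.WA k\<^esub> W V k g = V.ph k f g \<odot>\<^bsub>V.WA k\<^esub> W V k (f \<oplus>\<^bsub>V\<^esub> g)"
   using V.W_mult[OF f g, of k 1 1] unfolding V.W_eq V.Em_simps(4)[OF ws_fin[OF fg] ws_fin[OF fg], symmetric] by simp
  then have "\<beta> (W V k f) \<otimes>\<^bsub>U.WA k\<^esub> \<beta> (W V k g) = V.ph k f g \<odot>\<^bsub>U.WA k\<^esub> \<beta> (W V k (f \<oplus>\<^bsub>V\<^esub> g))"
   using star_homD(3)[OF bh V.W_closed[OF f] V.W_closed[OF g]] star_homD(5)[OF bh V.W_closed[OF fg], of "V.ph k f g"] by simp
  then have "U.Em k (%j. (\<omega> f * \<omega> g * U.ph k (T f) (T g)) * ws (T f \<oplus>\<^bsub>U\<^esub> T g) j) =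
    U.Em k (%j. V.ph k f g * (\<omega> (f \<oplus>\<^bsub>V\<^esub> g) * ws (T (f \<oplus>\<^bsub>V\<^esub> g)) j))"
   unfolding bW[OF f] bW[OF g] bW[OF fg] U.W_mult[OF T[OF f] T[OF g]]
    U.Em_simps(4)[OF U.fin_closed(2)[OF ws_fin[OF T[OF fg]]] U.fin_closed(2)[OF ws_fin[OF T[OF fg]]], symmetric] .
  then have "U.Em k (%j. (\<omega> f * \<omega> g * U.ph k (T f) (T g)) * ws (T f \<oplus>\<^bsub>U\<^esub> T g) j) =
    U.Em k (%j. (V.ph k f g * \<omega> (f \<oplus>\<^bsub>V\<^esub> g)) * ws (T (f \<oplus>\<^bsub>V\<^esub> g)) j)" by (simp only: mult.assoc)
  moreover have "\<omega> f * \<omega> g * U.ph k (T f) (T g) ~= 0" using nz[OF f] nz[OF g] by simp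
  ultimately show ?thesis using U.Em_symbol_cancel[OF U.V.a_closed[OF T[OF f] T[OF g]] T[OF fg]] by blast
 qed
 have add: "T (f \<oplus>\<^bsub>V\<^esub> g) = T f \<oplus>\<^bsub>U\<^esub> T g" if f: "f : carrier V" and g: "g : carrier V" for f g
  using key[OF zero_less_one order_refl f g] by simp
 \<comment> \<open>The identity \<open>key\<close> mixes the character with the phases; as
   \<open>k\<close> tends to 0 the phases tend to 1 and leave the character law.\<close>
 have mult: "\<omega> (f \<oplus>\<^bsub>V\<^esub> g) = \<omega> f * \<omega> g" if f: "f : carrier V" and g: "g : carrier V" for f g
 proof -
  have l: "((%k. \<omega> f * \<omega> g * U.ph k (T f) (T g)) \<longlongrightarrow> \<omega> f * \<omega> g * U.ph 0 (T f) (T g)) (at_right 0)"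
   unfolding U.ph_def by (intro tendsto_intros)
  have r: "((%k. V.ph k f g * \<omega> (f \<oplus>\<^bsub>V\<^esub> g)) \<longlongrightarrow> V.ph 0 f g * \<omega> (f \<oplus>\<^bsub>V\<^esub> g)) (at_right 0)"
   unfolding V.ph_def by (intro tendsto_intros)
  have "((%k. \<omega> f * \<omega> g * U.ph k (T f) (T g)) \<longlongrightarrow> V.ph 0 f g * \<omega> (f \<oplus>\<^bsub>V\<^esub> g)) (at_right 0)"
   by (rule Lim_transform_eventually[OF r]) (use V.ev_unit in \<open>eventually_elim, use key[OF _ _ f g] in simp\<close>)
  from tendsto_unique[OF _ l this] show ?thesis by simp
 qed
 have sy: "sform U (T f) (T g) = sform V f g" if f: "f : carrier V" and g: "g : carrier V" for f g
 proof (rule phase_determines)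
  fix k :: real assume k: "0 < k" "k <= 1"
  have "(\<omega> f * \<omega> g) * U.ph k (T f) (T g) = (\<omega> f * \<omega> g) * V.ph k f g" using key[OF k f g] unfolding mult[OF f g] by (simp add: mult.commute)
  then have "U.ph k (T f) (T g) = V.ph k f g" using nz[OF f] nz[OF g] by simp
  then show "exp (- (\<i> / 2) * cr (k * sform U (T f) (T g))) = exp (- (\<i> / 2) * cr (k * sform V f g))"
   unfolding U.ph_def V.ph_def .
 qed
 have hom: "psymp_hom V U \<omega> T" by (rule psymp_homI[OF assms(1,2) c mult T add sy])
 interpret H: psymp_hom V U \<omega> T by (rule hom)
 have "\<alpha> = BT V U \<omega> T"
  unfolding BT_def
 proof (rule H.bt_unique[OF star_hom_cont_linear[OF V.WA_cstar U.WA_cstar_pre al]])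
  fix f assume f: "f : carrier V"
  show "\<alpha> (W V 1 f) = \<omega> f \<odot>\<^bsub>U.WA 1\<^esub> W U 1 (T f)"
   unfolding aW[OF f] U.W_eq by (rule U.Em_simps(4)[OF ws_fin[OF T[OF f]] ws_fin[OF T[OF f]]])
 qed
 then show ?thesis using hom by blast
qed

lemma CA_hom: "psymp_hom V U \<omega> T ==> CA V U \<omega> T : Hom LinClass (cs V) (cs U)"
proof -
 assume "psymp_hom V U \<omega> T"
 then interpret psymp_hom V U \<omega> T .
 show ?thesis unfolding CA_def BT_def using ca_hom ca_smooth ca_poisson by (simp add: LinClass_def)
qed

lemma BT_hom: "psymp_hom V U \<omega> T ==> BT V U \<omega> T : Hom LinQuant (qs V) (qs U)"
proof -
 assume "psymp_hom V U \<omega> T"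
 then interpret psymp_hom V U \<omega> T .
 have "bt 1 ` Delta V 1 \<subseteq> Delta U 1" unfolding Delta_def using bt(2) push_closed by auto
 moreover have "scaling_map qV qU (bt 1)" unfolding scaling_map_def
 proof
  fix h :: real assume "h : {0<..1}"
  then show "EX \<beta>. rescaled_extension qV qU (bt 1) h \<beta>" by (intro exI[of _ "bt h"] bt_extension) simp_all
 qed
 ultimately show ?thesis unfolding BT_def using bt(1)[of 1] by (simp add: LinQuant_def smooth_map_def)
qed

text \<open>The parameters in the description are read off from the classical arrow uniquely by
  \<open>smult_W0_cancel\<close>, and \<open>bt_unique\<close> shows that they determine the
  continuous linear map.\<close>

lemma quantized_arrow_CA:
 assumes "psymp_hom V U \<omega> T" shows "quantized_arrow V U (CA V U \<omega> T) = BT V U \<omega> T"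
proof -
 interpret psymp_hom V U \<omega> T by fact
 have C: "CA V U \<omega> T (W0 V f) = \<omega> f \<odot>\<^bsub>AP U\<^esub> W0 U (T f)" if "f : carrier V" for f
  unfolding CA_def BT_def by (rule ca_W0[OF that])
 show ?thesis
  unfolding quantized_arrow_def
 proof (rule the_equality)
  show "BT V U \<omega> T : cont_linear (weyl_algebra V 1) (weyl_algebra U 1) \<and>
    (EX \<omega>' T'. additive_character V \<omega>' & additive_symplectic V U T' \<and>
     (ALL f:carrier V. CA V U \<omega> T (W0 V f) = \<omega>' f \<odot>\<^bsub>AP U\<^esub> W0 U (T' f)) \<and>
     (ALL f:carrier V. BT V U \<omega> T (W V 1 f) = \<omega>' f \<odot>\<^bsub>weyl_algebra U 1\<^esub> W U 1 (T' f)))"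
   unfolding BT_def by (intro conjI exI[of _ \<omega>] exI[of _ T] bt_cont char sympl ballI C[unfolded BT_def] bt_W)
  fix \<beta> assume "\<beta> : cont_linear (weyl_algebra V 1) (weyl_algebra U 1) \<and>
    (EX \<omega>' T'. additive_character V \<omega>' & additive_symplectic V U T' \<and>
     (ALL f:carrier V. CA V U \<omega> T (W0 V f) = \<omega>' f \<odot>\<^bsub>AP U\<^esub> W0 U (T' f)) \<and>
     (ALL f:carrier V. \<beta> (W V 1 f) = \<omega>' f \<odot>\<^bsub>weyl_algebra U 1\<^esub> W U 1 (T' f)))"
  then obtain \<omega>' T' where b: "\<beta> : cont_linear (weyl_algebra V 1) (weyl_algebra U 1)" and T': "additive_symplectic V U T'"
   and C': "!!f. f : carrier V ==> CA V U \<omega> T (W0 V f) = \<omega>' f \<odot>\<^bsub>AP U\<^esub> W0 U (T' f)"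
   and B': "!!f. f : carrier V ==> \<beta> (W V 1 f) = \<omega>' f \<odot>\<^bsub>weyl_algebra U 1\<^esub> W U 1 (T' f)" by blast
  show "\<beta> = BT V U \<omega> T"
   unfolding BT_def
  proof (rule bt_unique[OF b])
   fix f assume f: "f : carrier V"
   have "T' f : carrier U" using T' f unfolding additive_symplectic_def by blast
   moreover have "\<omega> f ~= 0" using \<omega>(1)[OF f] by auto
   ultimately have "T f = T' f" "\<omega> f = \<omega>' f"
    using U.smult_W0_cancel[OF T(1)[OF f], of "T' f" "\<omega> f" "\<omega>' f"] C[OF f] C'[OF f] by simp_all
   then show "\<beta> (W V 1 f) = \<omega> f \<odot>\<^bsub>weyl_algebra U 1\<^esub> W U 1 (T f)" using B'[OF f] by simp
  qed
 qed
qed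

lemma arrow_id:
 assumes "psymp V"
 shows "psymp_hom V V (%_. 1) (%f. f)" "(\<lambda>a\<in>carrier (AP V). a) = CA V V (%_. 1) (%f. f)"
  "(\<lambda>a\<in>carrier (weyl_algebra V 1). a) = BT V V (%_. 1) (%f. f)"
proof -
 show hom: "psymp_hom V V (%_. 1) (%f. f)" by (rule psymp_homI[OF assms assms]) simp_all
 interpret psymp_hom V V "%_. 1" "%f. f" by (rule hom)
 interpret A: star_alg "weyl_algebra V 1" by (rule V.WA_star_alg)
 show "(\<lambda>a\<in>carrier (AP V). a) = CA V V (%_. 1) (%f. f)"
  unfolding CA_def BT_def
 proof (rule ca_unique[OF star_hom_id[OF V.AP_star_alg]])
  show "(\<lambda>a\<in>carrier (AP V). a) (W0 V f) = 1 \<odot>\<^bsub>AP V\<^esub> W0 V f" if "f : carrier V" for f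
   unfolding V.one_smult_W0[OF that] using V.apc_W0[OF that] by simp
 qed
 show "(\<lambda>a\<in>carrier (weyl_algebra V 1). a) = BT V V (%_. 1) (%f. f)"
  unfolding BT_def
 proof (rule bt_unique[OF star_hom_cont_linear[OF V.WA_cstar V.WA_cstar_pre star_hom_id[OF V.WA_star_alg]]])
  show "(\<lambda>a\<in>carrier (weyl_algebra V 1). a) (W V 1 f) = 1 \<odot>\<^bsub>weyl_algebra V 1\<^esub> W V 1 f" if "f : carrier V" for f
   unfolding restrict_apply'[OF V.W_closed[OF that]] by (rule A.smult_one[OF V.W_closed[OF that], symmetric])
 qed
qed

text \<open>Composites are homomorphisms, so \<open>ca_unique\<close> and \<open>bt_unique\<close>
  reduce both equations to symbols, where the factors multiply to
  \<open>\<omega> f * \<omega>' (T f)\<close>.\<close>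

lemma arrow_compose:
 assumes "psymp_hom V U \<omega> T" "psymp_hom U Y \<omega>' T'"
 defines "\<omega>'' \<equiv> %f. \<omega> f * \<omega>' (T f)" and "T'' \<equiv> %f. T' (T f)"
 shows "psymp_hom V Y \<omega>'' T''"
  "compose (carrier (AP V)) (CA U Y \<omega>' T') (CA V U \<omega> T) = CA V Y \<omega>'' T''"
  "compose (carrier (weyl_algebra V 1)) (BT U Y \<omega>' T') (BT V U \<omega> T) = BT V Y \<omega>'' T''"
proof -
 interpret F: psymp_hom V U \<omega> T by fact
 interpret G: psymp_hom U Y \<omega>' T' by fact
 show hom: "psymp_hom V Y \<omega>'' T''"
 proof (rule psymp_homI[OF F.V.psymp_axioms G.U.psymp_axioms])
  fix f assume f: "f : carrier V"
  note Tf = F.T(1)[OF f]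
  show "cmod (\<omega>'' f) = 1" unfolding \<omega>''_def norm_mult F.\<omega>(1)[OF f] G.\<omega>(1)[OF Tf] by (rule mult_1)
  show "T'' f : carrier Y" unfolding T''_def by (rule G.T(1)[OF Tf])
  fix g assume g: "g : carrier V"
  note Tg = F.T(1)[OF g]
  show "\<omega>'' (f \<oplus>\<^bsub>V\<^esub> g) = \<omega>'' f * \<omega>'' g"
   unfolding \<omega>''_def F.T(2)[OF f g] F.\<omega>(2)[OF f g] G.\<omega>(2)[OF Tf Tg] by (simp only: mult_ac)
  show "T'' (f \<oplus>\<^bsub>V\<^esub> g) = T'' f \<oplus>\<^bsub>Y\<^esub> T'' g" unfolding T''_def F.T(2)[OF f g] by (rule G.T(2)[OF Tf Tg])
  show "sform Y (T'' f) (T'' g) = sform V f g" unfolding T''_def G.T(3)[OF Tf Tg] by (rule F.T(3)[OF f g])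
 qed
 interpret H: psymp_hom V Y \<omega>'' T'' by (rule hom)
 interpret AY: star_alg "AP Y" by (rule G.U.AP_star_alg)
 interpret BY: star_alg "weyl_algebra Y 1" by (rule G.U.WA_star_alg)
 show "compose (carrier (AP V)) (CA U Y \<omega>' T') (CA V U \<omega> T) = CA V Y \<omega>'' T''"
  unfolding CA_def BT_def
 proof (rule H.ca_unique[OF star_hom_compose[OF F.V.AP_star_alg F.ca_hom G.ca_hom]])
  fix f assume f: "f : carrier V"
  note Tf = F.T(1)[OF f]
  have c: "W0 V f : carrier (AP V)" "W0 U (T f) : carrier (AP U)" "W0 Y (T' (T f)) : carrier (AP Y)"
   using F.V.apc_W0[OF f] F.U.apc_W0[OF Tf] G.U.apc_W0[OF G.T(1)[OF Tf]] by simp_all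
  show "compose (carrier (AP V)) G.ca F.ca (W0 V f) = \<omega>'' f \<odot>\<^bsub>AP Y\<^esub> W0 Y (T'' f)"
   unfolding compose_eq[OF c(1)] F.ca_W0[OF f] star_homD(5)[OF G.ca_hom c(2)] G.ca_W0[OF Tf] \<omega>''_def T''_def
   by (rule AY.smult_smult[OF c(3), symmetric])
 qed
 show "compose (carrier (weyl_algebra V 1)) (BT U Y \<omega>' T') (BT V U \<omega> T) = BT V Y \<omega>'' T''"
  unfolding BT_def
 proof (rule H.bt_unique[OF star_hom_cont_linear[OF F.V.WA_cstar G.U.WA_cstar_pre star_hom_compose[OF F.V.WA_star_alg F.bt(1) G.bt(1)]]])
  fix f assume f: "f : carrier V"
  note Tf = F.T(1)[OF f]
  show "compose (carrier (weyl_algebra V 1)) (G.bt 1) (F.bt 1) (W V 1 f) = \<omega>'' f \<odot>\<^bsub>weyl_algebra Y 1\<^esub> W Y 1 (T'' f)"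
   unfolding compose_eq[OF F.V.W_closed[OF f]] F.bt_W[OF f] star_homD(5)[OF G.bt(1) F.U.W_closed[OF Tf]] G.bt_W[OF Tf] \<omega>''_def T''_def
   by (rule BY.smult_smult[OF G.U.W_closed[OF G.T(1)[OF Tf]], symmetric])
 qed
qed

section \<open>Categories, functors and natural isomorphisms\<close>

text \<open>For extensional maps with restricted composition the unit and associativity laws are
  automatic; what remains is that identities and composites are arrows.\<close>

lemma concrete_category:
 assumes "!!x y f. x : Obj C ==> y : Obj C ==> f : Hom C x y ==> f : K x \<rightarrow>\<^sub>E K y"
  and "!!x. Id C x = (\<lambda>a\<in>K x. a)" "!!x y z g f. Comp C x y z g f = compose (K x) g f"
  and "!!x. x : Obj C ==> Id C x : Hom C x x"
  and "!!x y z f g. x : Obj C ==> y : Obj C ==> z : Obj C ==> f : Hom C x y ==> g : Hom C y z ==> Comp C x y z g f : Hom C x z"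
 shows "is_category C"
 unfolding is_category_def
proof (intro conjI ballI)
 fix x y f assume xy: "x : Obj C" "y : Obj C" and "f : Hom C x y"
 then have f: "f : K x \<rightarrow> K y" "f : extensional (K x)" using assms(1)[OF xy] by (auto simp: PiE_def)
 show "Comp C x x y f (Id C x) = f" "Comp C x y y (Id C y) f = f"
  unfolding assms(2,3) by (rule compose_Id[OF f], rule Id_compose[OF f])
next
 fix w x y z f g h assume "w : Obj C" "x : Obj C" "f : Hom C w x"
 then have "f : K w \<rightarrow> K x" using assms(1)[of w x f] by (simp add: PiE_def)
 then show "Comp C w y z h (Comp C w x y g f) = Comp C w x z (Comp C x y z h g) f" unfolding assms(3) by (rule compose_assoc)
qed (rule assms, assumption+)+

text \<open>With \<open>F\<close> fixing the objects and arrows of \<open>C\<close>, naturality of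
  the identity arrows is the unit law, and each of them is its own inverse.\<close>

lemma identity_natural_isomorphism:
 assumes "is_category C" "!!x. x : Obj C ==> omap F x = x"
  "!!x y f. x : Obj C ==> y : Obj C ==> f : Hom C x y ==> amap F x y f = f"
 shows "natural_isomorphism C C id_functor F (Id C)"
proof -
 have C: "Id C x : Hom C x x" "f : Hom C x y ==> Comp C x x y f (Id C x) = f" "f : Hom C x y ==> Comp C x y y (Id C y) f = f"
  if "x : Obj C" "y : Obj C" for x y f using assms(1) that unfolding is_category_def by blast+
 show ?thesis
  unfolding natural_isomorphism_def natural_transformation_def is_iso_arrow_def id_functor_def
  using C assms(2,3) by (auto intro!: bexI[of _ "Id C _"])
qed

lemma PiE_star_hom: "f : star_hom A B ==> f : carrier A \<rightarrow>\<^sub>E carrier B"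
 using star_homD(1,7)[of f A B] by (simp add: PiE_def Pi_iff)

lemma Obj_iff: "x : Obj LinClass \<longleftrightarrow> (EX V. psymp V & x = cs V)"
  "u : Obj LinQuant \<longleftrightarrow> (EX V. psymp V & u = qs V)"
 by (auto simp: LinClass_def LinQuant_def psymp_def psymp_axioms_def symp_def)

lemma Id_Comp [simp]:
 "Id LinClass (cs V) = (\<lambda>a\<in>carrier (AP V). a)" "Id LinQuant (qs V) = (\<lambda>a\<in>carrier (weyl_algebra V 1). a)"
 "Comp LinClass (cs V) y z \<beta> \<alpha> = compose (carrier (AP V)) \<beta> \<alpha>"
 "Comp LinQuant (qs V) y' z' \<delta> \<gamma> = compose (carrier (weyl_algebra V 1)) \<delta> \<gamma>"
 by (simp_all add: LinClass_def LinQuant_def)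

lemma LinClass_category: "is_category LinClass"
proof (rule concrete_category[where K="%x. carrier (calg x)"])
 show "f : carrier (calg x) \<rightarrow>\<^sub>E carrier (calg y)" if "f : Hom LinClass x y" for x y :: "'a classical_obj" and f
  using that by (intro PiE_star_hom) (simp add: LinClass_def)
next
 fix x :: "'a classical_obj" assume "x : Obj LinClass"
 then obtain V where V: "psymp V" "x = cs V" unfolding Obj_iff by blast
 show "Id LinClass x : Hom LinClass x x" unfolding V(2) Id_Comp arrow_id(2)[OF V(1)] by (rule CA_hom[OF arrow_id(1)[OF V(1)]])
next
 fix x y z :: "'a classical_obj" and f g
 assume "x : Obj LinClass" "y : Obj LinClass" "z : Obj LinClass" and f: "f : Hom LinClass x y" and g: "g : Hom LinClass y z"
 then obtain V U Y where V: "psymp V" "x = cs V" and U: "psymp U" "y = cs U"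
  and Y: "psymp Y" "z = cs Y" unfolding Obj_iff by blast
 obtain \<omega> T where F: "psymp_hom V U \<omega> T" "f = CA V U \<omega> T" using class_arrow_form[OF V(1) U(1)] f unfolding V U by blast
 obtain \<omega>' T' where G: "psymp_hom U Y \<omega>' T'" "g = CA U Y \<omega>' T'" using class_arrow_form[OF U(1) Y(1)] g unfolding U Y by blast
 show "Comp LinClass x y z g f : Hom LinClass x z"
  unfolding V(2) Y(2) Id_Comp F(2) G(2) arrow_compose(2)[OF F(1) G(1)] by (rule CA_hom[OF arrow_compose(1)[OF F(1) G(1)]])
qed (simp_all add: LinClass_def)

lemma LinQuant_category: "is_category LinQuant"
proof (rule concrete_category[where K="%x. carrier (qalg x 1)"])
 show "f : carrier (qalg x 1) \<rightarrow>\<^sub>E carrier (qalg y 1)" if "f : Hom LinQuant x y" for x y :: "'a quantum_obj" and f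
  using that by (intro PiE_star_hom) (simp add: LinQuant_def)
next
 fix x :: "'a quantum_obj" assume "x : Obj LinQuant"
 then obtain V where V: "psymp V" "x = qs V" unfolding Obj_iff by blast
 show "Id LinQuant x : Hom LinQuant x x" unfolding V(2) Id_Comp arrow_id(3)[OF V(1)] by (rule BT_hom[OF arrow_id(1)[OF V(1)]])
next
 fix x y z :: "'a quantum_obj" and f g
 assume "x : Obj LinQuant" "y : Obj LinQuant" "z : Obj LinQuant" and f: "f : Hom LinQuant x y" and g: "g : Hom LinQuant y z"
 then obtain V U Y where V: "psymp V" "x = qs V" and U: "psymp U" "y = qs U"
  and Y: "psymp Y" "z = qs Y" unfolding Obj_iff by blast
 obtain \<omega> T where F: "psymp_hom V U \<omega> T" "f = BT V U \<omega> T" using quant_arrow_form[OF V(1) U(1)] f unfolding V U by blast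
 obtain \<omega>' T' where G: "psymp_hom U Y \<omega>' T'" "g = BT U Y \<omega>' T'" using quant_arrow_form[OF U(1) Y(1)] g unfolding U Y by blast
 show "Comp LinQuant x y z g f : Hom LinQuant x z"
  unfolding V(2) Y(2) Id_Comp F(2) G(2) arrow_compose(3)[OF F(1) G(1)] by (rule BT_hom[OF arrow_compose(1)[OF F(1) G(1)]])
qed (simp_all add: LinQuant_def)

text \<open>The second equation is the definition of \<open>CA\<close>. So both functors merely
  exchange the classical and the quantum arrow with the same parameters.\<close>

lemma Q_W_CA:
 assumes "psymp_hom V U \<omega> T"
 shows "amap Q_W (cs V) (cs U) (CA V U \<omega> T) = BT V U \<omega> T"
  "amap L_W (qs V) (qs U) (BT V U \<omega> T) = CA V U \<omega> T"
 using quantized_arrow_CA[OF assms] by (simp_all add: Q_W_def L_W_def CA_def)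

lemma omap_eq: "omap Q_W (cs V) = qs V" "psymp V ==> omap L_W (qs V) = cs V"
 by (simp_all add: Q_W_def L_W_def psymp.classical_limit_obj_eq)

lemma Q_W_functor: "is_functor LinClass LinQuant Q_W"
 unfolding is_functor_def
proof (intro conjI ballI)
 fix x :: "'a classical_obj" assume "x : Obj LinClass"
 then obtain V where V: "psymp V" "x = cs V" unfolding Obj_iff by blast
 show "omap Q_W x : Obj LinQuant" unfolding Obj_iff V(2) omap_eq(1) using V(1) by blast
 show "amap Q_W x x (Id LinClass x) = Id LinQuant (omap Q_W x)"
  unfolding V(2) omap_eq(1) Id_Comp arrow_id(2,3)[OF V(1)] by (rule Q_W_CA(1)[OF arrow_id(1)[OF V(1)]])
 fix y :: "'a classical_obj" and f assume "y : Obj LinClass" and f: "f : Hom LinClass x y"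
 then obtain U where U: "psymp U" "y = cs U" unfolding Obj_iff by blast
 obtain \<omega> T where F: "psymp_hom V U \<omega> T" "f = CA V U \<omega> T" using class_arrow_form[OF V(1) U(1)] f unfolding V U by blast
 show "amap Q_W x y f : Hom LinQuant (omap Q_W x) (omap Q_W y)"
  unfolding V(2) U(2) omap_eq(1) F(2) Q_W_CA(1)[OF F(1)] by (rule BT_hom[OF F(1)])
 fix z :: "'a classical_obj" and g assume "z : Obj LinClass" and g: "g : Hom LinClass y z"
 then obtain Y where Y: "psymp Y" "z = cs Y" unfolding Obj_iff by blast
 obtain \<omega>' T' where G: "psymp_hom U Y \<omega>' T'" "g = CA U Y \<omega>' T'" using class_arrow_form[OF U(1) Y(1)] g unfolding U Y by blast
 note FG = arrow_compose[OF F(1) G(1)]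
 show "amap Q_W x z (Comp LinClass x y z g f) = Comp LinQuant (omap Q_W x) (omap Q_W y) (omap Q_W z) (amap Q_W y z g) (amap Q_W x y f)"
  unfolding V(2) U(2) Y(2) omap_eq(1) Id_Comp F(2) G(2) FG(2) Q_W_CA(1)[OF F(1)] Q_W_CA(1)[OF G(1)] FG(3) by (rule Q_W_CA(1)[OF FG(1)])
qed

lemma L_W_functor: "is_functor LinQuant LinClass L_W"
 unfolding is_functor_def
proof (intro conjI ballI)
 fix x :: "'a quantum_obj" assume "x : Obj LinQuant"
 then obtain V where V: "psymp V" "x = qs V" unfolding Obj_iff by blast
 show "omap L_W x : Obj LinClass" unfolding Obj_iff V(2) omap_eq(2)[OF V(1)] using V(1) by blast
 show "amap L_W x x (Id LinQuant x) = Id LinClass (omap L_W x)"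
  unfolding V(2) omap_eq(2)[OF V(1)] Id_Comp arrow_id(2,3)[OF V(1)] by (rule Q_W_CA(2)[OF arrow_id(1)[OF V(1)]])
 fix y :: "'a quantum_obj" and f assume "y : Obj LinQuant" and f: "f : Hom LinQuant x y"
 then obtain U where U: "psymp U" "y = qs U" unfolding Obj_iff by blast
 obtain \<omega> T where F: "psymp_hom V U \<omega> T" "f = BT V U \<omega> T" using quant_arrow_form[OF V(1) U(1)] f unfolding V U by blast
 show "amap L_W x y f : Hom LinClass (omap L_W x) (omap L_W y)"
  unfolding V(2) U(2) omap_eq(2)[OF V(1)] omap_eq(2)[OF U(1)] F(2) Q_W_CA(2)[OF F(1)] by (rule CA_hom[OF F(1)])
 fix z :: "'a quantum_obj" and g assume "z : Obj LinQuant" and g: "g : Hom LinQuant y z"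
 then obtain Y where Y: "psymp Y" "z = qs Y" unfolding Obj_iff by blast
 obtain \<omega>' T' where G: "psymp_hom U Y \<omega>' T'" "g = BT U Y \<omega>' T'" using quant_arrow_form[OF U(1) Y(1)] g unfolding U Y by blast
 note FG = arrow_compose[OF F(1) G(1)]
 show "amap L_W x z (Comp LinQuant x y z g f) = Comp LinClass (omap L_W x) (omap L_W y) (omap L_W z) (amap L_W y z g) (amap L_W x y f)"
  unfolding V(2) U(2) Y(2) omap_eq(2)[OF V(1)] omap_eq(2)[OF U(1)] omap_eq(2)[OF Y(1)] Id_Comp F(2) G(2) FG(3)
   Q_W_CA(2)[OF F(1)] Q_W_CA(2)[OF G(1)] FG(2) by (rule Q_W_CA(2)[OF FG(1)])
qed

lemma L_Q_identity: "natural_isomorphism LinClass LinClass id_functor (comp_functor L_W Q_W) (Id LinClass)"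
proof (rule identity_natural_isomorphism[OF LinClass_category])
 fix x :: "'a classical_obj" assume "x : Obj LinClass"
 then obtain V where V: "psymp V" "x = cs V" unfolding Obj_iff by blast
 show "omap (comp_functor L_W Q_W) x = x" by (simp add: comp_functor_def V(2) omap_eq(1) omap_eq(2)[OF V(1)])
 fix y :: "'a classical_obj" and f assume "y : Obj LinClass" and f: "f : Hom LinClass x y"
 then obtain U where U: "psymp U" "y = cs U" unfolding Obj_iff by blast
 obtain \<omega> T where F: "psymp_hom V U \<omega> T" "f = CA V U \<omega> T" using class_arrow_form[OF V(1) U(1)] f unfolding V U by blast
 show "amap (comp_functor L_W Q_W) x y f = f"
  by (simp add: comp_functor_def V(2) U(2) omap_eq(1) F(2) Q_W_CA[OF F(1)])
qed

lemma Q_L_identity: "natural_isomorphism LinQuant LinQuant id_functor (comp_functor Q_W L_W) (Id LinQuant)"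
proof (rule identity_natural_isomorphism[OF LinQuant_category])
 fix x :: "'a quantum_obj" assume "x : Obj LinQuant"
 then obtain V where V: "psymp V" "x = qs V" unfolding Obj_iff by blast
 show "omap (comp_functor Q_W L_W) x = x" by (simp add: comp_functor_def V(2) omap_eq(1) omap_eq(2)[OF V(1)])
 fix y :: "'a quantum_obj" and f assume "y : Obj LinQuant" and f: "f : Hom LinQuant x y"
 then obtain U where U: "psymp U" "y = qs U" unfolding Obj_iff by blast
 obtain \<omega> T where F: "psymp_hom V U \<omega> T" "f = BT V U \<omega> T" using quant_arrow_form[OF V(1) U(1)] f unfolding V U by blast
 show "amap (comp_functor Q_W L_W) x y f = f"
  by (simp add: comp_functor_def V(2) U(2) omap_eq(2)[OF V(1)] omap_eq(2)[OF U(1)] F(2) Q_W_CA[OF F(1)])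
qed

theorem theorem1:
  shows "is_category (LinClass :: ('v classical_obj, 'v classical_map) category) \<and>
    is_category (LinQuant :: ('v quantum_obj, 'v quantum_map) category) \<and>
    is_functor (LinClass :: ('v classical_obj, 'v classical_map) category) LinQuant Q_W \<and>
    is_functor (LinQuant :: ('v quantum_obj, 'v quantum_map) category) LinClass L_W \<and>
    (\<exists>\<eta>. natural_isomorphism (LinClass :: ('v classical_obj, 'v classical_map) category) LinClass
       id_functor (comp_functor L_W Q_W) \<eta>) \<and>
    (\<exists>\<epsilon>. natural_isomorphism (LinQuant :: ('v quantum_obj, 'v quantum_map) category) LinQuant
       id_functor (comp_functor Q_W L_W) \<epsilon>)"
    using LinClass_category LinQuant_category Q_W_functor L_W_functor L_Q_identity Q_L_identity by blast

end
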